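(* For a fixed $m\in\mathbb{N}$ with $m\ge m_0=[\frac n2+2]$, let $u$ be a local solution on $[0,T]$ of the problem $$u_{tt}-c^2\Delta u=\alpha\varepsilon u_tu_{tt}+\beta\varepsilon\nabla u\cdot\nabla u_t,\quad x\in\mathbb{R}^n,\qquad u(x,0)=u_0(x),\quad u_t(x,0)=u_1(x),$$ satisfying $$u\in C^r([0,T];H^{m+1-r}(\mathbb{R}^n))\ \text{ for } 0\le r\le m,$$ $$\forall t\in[0,T],\quad\|u_t(t)\|_{L^\infty(\mathbb{R}^n)}<\tfrac1{2\alpha\varepsilon},\quad\|u\|_{L^\infty(\mathbb{R}^n)}<M_1,\quad\|\nabla u\|_{L^\infty(\mathbb{R}^n)}<M_2.$$ Then for $t\in[0,T]$ $$E_m[u](t)\le B\,E_m[u](0)+C_m\max(\alpha,\beta)\varepsilon\int_0^tE_m[u](\tau)^{\frac32}\,d\tau,$$ with constants $B=\frac{3+2c^2}{\min(1/2,c^2)}>0$, depending only on $c$, and $C_m>0$, depending only on $m$, on the dimension $n$ and on $c$ (on $c$ only if $\min(1/2,c^2)=c^2$).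
   Context: $\alpha,\beta,c,\varepsilon,M_1,M_2$ are positive constants, $n\in\mathbb{N}^*$, $[\cdot]$ is the integer part, and $$E_m[u](t)=\|\nabla u(t)\|_{H^m(\mathbb{R}^n)}^2+\sum_{i=1}^{m+1}\|\partial_t^iu(t)\|_{H^{m+1-i}(\mathbb{R}^n)}^2.$$ *)

theory Defs
  imports "HOL-Analysis.Analysis" "HOL-Probability.Essential_Supremum"
begin

text \<open>
  Elements of the Lebesgue and Sobolev spaces are represented by Borel measurable functions
  on \<open>real ^ 'n\<close>; operators that are determined only up to null sets (weak derivatives and
  time derivatives) choose a representative, and every notion below is insensitive to that choice.
\<close>

definition L2 :: "(real ^ 'n \<Rightarrow> real) set" where
  "L2 = {f. f \<in> borel_measurable lborel \<and> integrable lborel (\<lambda>x. (f x)\<^sup>2)}"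

definition L2_norm :: "(real ^ 'n \<Rightarrow> real) \<Rightarrow> real" where
  "L2_norm f = sqrt (integral\<^sup>L lborel (\<lambda>x. (f x)\<^sup>2))"

definition Linf_norm :: "(real ^ 'n \<Rightarrow> 'b::real_normed_vector) \<Rightarrow> ereal" where
  "Linf_norm f = esssup lborel (\<lambda>x. ereal (norm (f x)))"

definition locally_integrable :: "(real ^ 'n \<Rightarrow> real) \<Rightarrow> bool" where
  "locally_integrable f \<longleftrightarrow> (\<forall>K. compact K \<longrightarrow> set_integrable lborel K f)"

definition partial_deriv :: "'n::finite \<Rightarrow> (real ^ 'n \<Rightarrow> real) \<Rightarrow> real ^ 'n \<Rightarrow> real" where
  "partial_deriv i f x = frechet_derivative f (at x) (axis i 1)"

abbreviation iterated_partial :: "'n::finite list \<Rightarrow> (real ^ 'n \<Rightarrow> real) \<Rightarrow> real ^ 'n \<Rightarrow> real" where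
  "iterated_partial is f \<equiv> foldr partial_deriv is f"

text \<open>Infinitely differentiable: all iterated partial derivatives exist and are themselves
  (Frechet) differentiable, hence continuous.\<close>

definition test_function :: "(real ^ 'n \<Rightarrow> real) \<Rightarrow> bool" where
  "test_function \<phi> \<longleftrightarrow>
     (\<forall>is x. iterated_partial is \<phi> differentiable (at x)) \<and> compact (closure {x. \<phi> x \<noteq> 0})"

type_synonym 'n multi_index = "'n \<Rightarrow> nat"

definition mi_size :: "'n::finite multi_index \<Rightarrow> nat" where
  "mi_size a = (\<Sum>i\<in>UNIV. a i)"

text \<open>The classical derivative of multi-index \<open>a\<close> of a test function is the iterated partial
  derivative along any list in which each direction \<open>i\<close> occurs \<open>a i\<close> times; the order of the
  list is immaterial since test functions are smooth.\<close>

definition has_weak_deriv ::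
    "'n::finite multi_index \<Rightarrow> (real ^ 'n \<Rightarrow> real) \<Rightarrow> (real ^ 'n \<Rightarrow> real) \<Rightarrow> bool" where
  "has_weak_deriv a f g \<longleftrightarrow> locally_integrable f \<and> locally_integrable g \<and>
     (\<forall>\<phi> is. test_function \<phi> \<longrightarrow> (\<forall>i. count_list is i = a i) \<longrightarrow>
        integral\<^sup>L lborel (\<lambda>x. f x * iterated_partial is \<phi> x) =
        (-1) ^ mi_size a * integral\<^sup>L lborel (\<lambda>x. g x * \<phi> x))"

definition weak_deriv :: "'n::finite multi_index \<Rightarrow> (real ^ 'n \<Rightarrow> real) \<Rightarrow> real ^ 'n \<Rightarrow> real" where
  "weak_deriv a f = (SOME g. has_weak_deriv a f g)"

definition weak_partial :: "'n::finite \<Rightarrow> (real ^ 'n \<Rightarrow> real) \<Rightarrow> real ^ 'n \<Rightarrow> real" where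
  "weak_partial i f = weak_deriv ((\<lambda>_. 0)(i := 1)) f"

definition grad :: "(real ^ 'n::finite \<Rightarrow> real) \<Rightarrow> real ^ 'n \<Rightarrow> real ^ 'n" where
  "grad f x = (\<chi> i. weak_partial i f x)"

definition laplacian :: "(real ^ 'n::finite \<Rightarrow> real) \<Rightarrow> real ^ 'n \<Rightarrow> real" where
  "laplacian f x = (\<Sum>i\<in>UNIV. weak_deriv ((\<lambda>_. 0)(i := 2)) f x)"

definition sobolev :: "nat \<Rightarrow> (real ^ 'n::finite \<Rightarrow> real) set" where
  "sobolev s = {f \<in> L2. \<forall>a. mi_size a \<le> s \<longrightarrow> (\<exists>g\<in>L2. has_weak_deriv a f g)}"

definition sobolev_norm :: "nat \<Rightarrow> (real ^ 'n::finite \<Rightarrow> real) \<Rightarrow> real" where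
  "sobolev_norm s f = sqrt (\<Sum>a | mi_size a \<le> s. (L2_norm (weak_deriv a f))\<^sup>2)"

text \<open>Derivatives at the endpoints of a time interval \<open>S\<close> are one-sided, because limits are
  taken within \<open>S\<close>.\<close>

definition has_time_deriv_at :: "nat \<Rightarrow> real set \<Rightarrow> (real \<Rightarrow> real ^ 'n::finite \<Rightarrow> real) \<Rightarrow>
    (real ^ 'n \<Rightarrow> real) \<Rightarrow> real \<Rightarrow> bool" where
  "has_time_deriv_at s S u v t \<longleftrightarrow> (\<forall>\<tau>\<in>S. u \<tau> \<in> sobolev s) \<and> v \<in> sobolev s \<and>
     ((\<lambda>\<tau>. sobolev_norm s (\<lambda>x. (u \<tau> x - u t x) / (\<tau> - t) - v x)) \<longlongrightarrow> 0) (at t within S)"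

text \<open>\<open>C_sobolev r s S\<close> is \<open>C\<^sup>r(S; H\<^sup>s)\<close>; the function \<open>U i\<close> is the \<open>i\<close>-th time derivative.\<close>

definition C_sobolev :: "nat \<Rightarrow> nat \<Rightarrow> real set \<Rightarrow> (real \<Rightarrow> real ^ 'n::finite \<Rightarrow> real) set" where
  "C_sobolev r s S = {u. \<exists>U. U 0 = u \<and>
     (\<forall>i\<le>r. \<forall>t\<in>S. U i t \<in> sobolev s \<and>
        ((\<lambda>\<tau>. sobolev_norm s (\<lambda>x. U i \<tau> x - U i t x)) \<longlongrightarrow> 0) (at t within S)) \<and>
     (\<forall>i<r. \<forall>t\<in>S. has_time_deriv_at s S (U i) (U (Suc i) t) t)}"

text \<open>The time derivative is taken in \<open>L\<^sup>2 = H\<^sup>0\<close>. Since \<open>H\<^sup>s\<close> is continuously embedded in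
  \<open>L\<^sup>2\<close>, it agrees with the derivative in \<open>H\<^sup>s\<close> whenever the latter exists.\<close>

definition time_deriv ::
    "real set \<Rightarrow> (real \<Rightarrow> real ^ 'n::finite \<Rightarrow> real) \<Rightarrow> real \<Rightarrow> real ^ 'n \<Rightarrow> real" where
  "time_deriv S u t = (SOME v. has_time_deriv_at 0 S u v t)"

text \<open>The highest time derivative, of order \<open>m + 1\<close>, is not part of the assumption
  \<open>u \<in> C\<^sup>r(S; H\<^sup>m\<^sup>+\<^sup>1\<^sup>-\<^sup>r)\<close>, \<open>r \<le> m\<close>; for the solutions considered it exists in \<open>L\<^sup>2\<close> because
  the equation expresses the second time derivative through lower-order ones.\<close>

definition energy :: "nat \<Rightarrow> real set \<Rightarrow> (real \<Rightarrow> real ^ 'n::finite \<Rightarrow> real) \<Rightarrow> real \<Rightarrow> real" where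
  "energy m S u t =
     (\<Sum>j\<in>UNIV. (sobolev_norm m (weak_partial j (u t)))\<^sup>2) +
     (\<Sum>i=1..m+1. (sobolev_norm (m + 1 - i) ((time_deriv S ^^ i) u t))\<^sup>2)"

text \<open>Kuznetsov equation with initial data \<open>u0\<close>, \<open>u1\<close>, as an identity in \<open>L\<^sup>2\<close> at every time in \<open>S\<close>.\<close>

definition kuznetsov_solution :: "real \<Rightarrow> real \<Rightarrow> real \<Rightarrow> real \<Rightarrow> real set \<Rightarrow>
    (real ^ 'n::finite \<Rightarrow> real) \<Rightarrow> (real ^ 'n \<Rightarrow> real) \<Rightarrow> (real \<Rightarrow> real ^ 'n \<Rightarrow> real) \<Rightarrow> bool" where
  "kuznetsov_solution c \<alpha> \<beta> \<epsilon> S u0 u1 u \<longleftrightarrow>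
     (\<forall>t\<in>S. AE x in lborel.
        (time_deriv S ^^ 2) u t x - c\<^sup>2 * laplacian (u t) x =
        \<alpha> * \<epsilon> * time_deriv S u t x * (time_deriv S ^^ 2) u t x +
        \<beta> * \<epsilon> * (grad (u t) x \<bullet> grad (time_deriv S u t) x)) \<and>
     (AE x in lborel. u 0 x = u0 x) \<and>
     (AE x in lborel. time_deriv S u 0 x = u1 x)"

end

theory Submission
  imports Defs "HOL-Probability.Probability_Measure"
begin

text \<open>
  For a space-time multi-index \<open>A\<close> with \<open>|A| \<le> m\<close>, pairing the \<open>A\<close>-th derivative of the equation with
  \<open>\<partial>\<^sub>t \<partial>\<^sup>A u\<close> shows that \<open>\<integral> (1 - \<alpha>\<epsilon>u\<^sub>t) (\<partial>\<^sub>t \<partial>\<^sup>A u)\<^sup>2 + c\<^sup>2 |\<nabla> \<partial>\<^sup>A u|\<^sup>2\<close> grows at a rate of at most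
  \<open>const max(\<alpha>, \<beta>) \<epsilon> E\<^sup>3\<^sup>/\<^sup>2\<close>, because all quadratic remainders are products of factors in \<open>H\<^sup>s\<close> and
  \<open>H\<^sup>r\<close> with \<open>2(s + r) > n\<close>. The smallness of \<open>u\<^sub>t\<close> makes this functional comparable with the
  squared norms, and summing over \<open>A\<close> with suitable weights yields \<open>E\<^sub>m\<close>.

  For \<open>|A| = m\<close> the solution is not regular enough to differentiate the functional. One derivative
  in \<open>A\<close> is therefore replaced by a forward difference quotient in time or space, and the step tends
  to \<open>0\<close> in the integrated inequality. The derivative of order \<open>m + 1\<close> in time exists because the
  equation, differentiated \<open>m - 2\<close> times in time, can be solved for the top order term: its coefficient
  \<open>1 - \<alpha>\<epsilon>u\<^sub>t\<close> is at least \<open>1/2\<close>.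

  The product estimate \<open>\<parallel>fg\<parallel>\<^sub>2 \<le> K \<parallel>f\<parallel>\<^sub>H\<^sub>s \<parallel>g\<parallel>\<^sub>H\<^sub>r\<close> is obtained without Fourier analysis: repeatedly subtracting
  averages over cubes of side \<open>2\<^sup>-\<^sup>i\<close> splits \<open>f\<close> into pieces whose \<open>L\<^sup>2\<close>-norms decay like \<open>2\<^sup>-\<^sup>s\<^sup>i\<close> and
  whose sup-norms exceed the \<open>L\<^sup>2\<close>-norms by at most \<open>2\<^sup>n\<^sup>i\<^sup>/\<^sup>2\<close>, and the product is summed by telescoping.
\<close>

section \<open>Square integrable functions\<close>

text \<open>The hypothesis on \<open>m\<close> amounts to \<open>n + 3 \<le> 2 * m\<close> and
  enters the analysis in one form. Differentiated \<open>m\<close> times, the equation contains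
  products of two derivatives of \<open>u\<close> whose orders add up to \<open>m + 3\<close>; their
  regularities then add up to at least \<open>m - 1\<close>, and \<open>2 * (m - 1) > n\<close>. So
  the worst products just stay in L^2. A difference quotient obeys the same bounds as a derivative,
  by the mean value inequality, and its product rule leaves the top order quotient multiplied by the
  unshifted coefficient; the energy identity survives with a remainder of the same kind. This has
  two costs. A forward quotient in time needs \<open>t + h \<le> T\<close>, so the estimate is
  obtained for \<open>t < T\<close> and extended by continuity. And the remainder at time
  \<open>t\<close> involves the energy on all of \<open>[t, t + h]\<close>, which uniform continuity
  of the energy repairs. The calculus of products is needed once to construct the top time
  derivative and again after that derivative is available, so the same locale is instantiated twice.
  The product constant \<open>K\<close> is fixed before the solution, which makes the final constant
  independent of the solution.\<close>

definition L2_inner :: "(real ^ 'n \<Rightarrow> real) \<Rightarrow> (real ^ 'n \<Rightarrow> real) \<Rightarrow> real" where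
  "L2_inner f g = (\<integral>x. f x * g x \<partial>lborel)"

lemma L2_measurable [measurable_dest]: "f \<in> L2 \<Longrightarrow> f \<in> borel_measurable borel"
  by (simp add: L2_def)

lemma L2_integrable_square: "f \<in> L2 \<Longrightarrow> integrable lborel (\<lambda>x. (f x)\<^sup>2)"
  by (simp add: L2_def)

lemma L2I: "f \<in> borel_measurable borel \<Longrightarrow> integrable lborel (\<lambda>x. (f x)\<^sup>2) \<Longrightarrow> f \<in> L2"
  by (simp add: L2_def)

lemma abs_mult_le_squares: "\<bar>a * b\<bar> \<le> a\<^sup>2 + (b::real)\<^sup>2"
  using sum_squares_bound[of "\<bar>a\<bar>" "\<bar>b\<bar>"] zero_le_power2[of a] zero_le_power2[of b]
  unfolding abs_mult power2_abs by linarith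

lemma L2_integrable_mult:
  assumes [measurable]: "f \<in> L2" "g \<in> L2"
  shows "integrable lborel (\<lambda>x. f x * g x)"
proof (rule Bochner_Integration.integrable_bound)
  show "integrable lborel (\<lambda>x. (f x)\<^sup>2 + (g x)\<^sup>2)"
    using assms by (intro Bochner_Integration.integrable_add L2_integrable_square)
  have "f \<in> borel_measurable borel" "g \<in> borel_measurable borel" by measurable
  then show "(\<lambda>x. f x * g x) \<in> borel_measurable lborel" by simp
  show "AE x in lborel. norm (f x * g x) \<le> norm ((f x)\<^sup>2 + (g x)\<^sup>2)"
    using abs_mult_le_squares by (auto simp: abs_mult intro!: AE_I2)
qed

lemma L2_zero [simp]: "(\<lambda>x. 0) \<in> L2"
  by (simp add: L2_def)

lemma L2_cmult [simp, intro]: "f \<in> L2 \<Longrightarrow> (\<lambda>x. c * f x) \<in> L2"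
  by (auto simp: L2_def power_mult_distrib)

lemma L2_add [simp, intro]:
  assumes "f \<in> L2" "g \<in> L2"
  shows "(\<lambda>x. f x + g x) \<in> L2"
proof (rule L2I)
  show "(\<lambda>x. f x + g x) \<in> borel_measurable borel"
    using assms[THEN L2_measurable] by simp
  have "integrable lborel (\<lambda>x. (f x)\<^sup>2 + (g x)\<^sup>2 + 2 * (f x * g x))"
    using assms by (intro Bochner_Integration.integrable_add integrable_mult_right
        L2_integrable_square L2_integrable_mult)
  then show "integrable lborel (\<lambda>x. (f x + g x)\<^sup>2)"
    by (simp add: power2_sum mult.assoc)
qed

lemma L2_uminus [simp, intro]: "f \<in> L2 \<Longrightarrow> (\<lambda>x. - f x) \<in> L2"
  using L2_cmult[of f "-1"] by simp

lemma L2_diff [simp, intro]: "f \<in> L2 \<Longrightarrow> g \<in> L2 \<Longrightarrow> (\<lambda>x. f x - g x) \<in> L2"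
  using L2_add[of f "\<lambda>x. - g x"] by simp

lemma L2_divide [simp, intro]: "f \<in> L2 \<Longrightarrow> (\<lambda>x. f x / c) \<in> L2"
  using L2_cmult[of f "inverse c"] by (simp add: divide_inverse mult.commute)

lemma L2_sum [simp, intro]: "(\<And>i. i \<in> I \<Longrightarrow> f i \<in> L2) \<Longrightarrow> (\<lambda>x. \<Sum>i\<in>I. f i x) \<in> L2"
  by (induction I rule: infinite_finite_induct) auto

lemma L2_bounded_mult:
  assumes "f \<in> L2" and [measurable]: "a \<in> borel_measurable borel"
    and ab: "AE x in lborel. \<bar>a x\<bar> \<le> M"
  shows "(\<lambda>x. a x * f x) \<in> L2"
proof (rule L2I)
  have [measurable]: "f \<in> borel_measurable borel" using assms by (simp add: L2_measurable)
  show "(\<lambda>x. a x * f x) \<in> borel_measurable borel" by measurable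
  show "integrable lborel (\<lambda>x. (a x * f x)\<^sup>2)"
  proof (rule Bochner_Integration.integrable_bound)
    show "integrable lborel (\<lambda>x. M\<^sup>2 * (f x)\<^sup>2)"
      using assms by (intro integrable_mult_right L2_integrable_square)
    show "AE x in lborel. norm ((a x * f x)\<^sup>2) \<le> norm (M\<^sup>2 * (f x)\<^sup>2)"
      using ab
    proof eventually_elim
      case (elim x)
      have "(a x)\<^sup>2 \<le> M\<^sup>2" using elim by (metis abs_ge_zero power2_abs power_mono)
      then show ?case by (simp add: power_mult_distrib mult_right_mono)
    qed
  qed simp
qed

lemma L2_cong_AE:
  assumes "f \<in> L2" "g \<in> borel_measurable borel" "AE x in lborel. f x = g x"
  shows "g \<in> L2"
proof (rule L2I)
  have [measurable]: "f \<in> borel_measurable borel" "g \<in> borel_measurable borel"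
    using assms by (simp_all add: L2_measurable)
  have "integrable lborel (\<lambda>x. (f x)\<^sup>2) = integrable lborel (\<lambda>x. (g x)\<^sup>2)"
    by (rule integrable_cong_AE) (use assms in auto)
  then show "integrable lborel (\<lambda>x. (g x)\<^sup>2)"
    using assms by (simp add: L2_integrable_square)
qed fact

lemma L2_inner_commute: "L2_inner f g = L2_inner g f"
  by (simp add: L2_inner_def mult.commute)

lemma L2_inner_add_left: "f \<in> L2 \<Longrightarrow> g \<in> L2 \<Longrightarrow> h \<in> L2 \<Longrightarrow>
    L2_inner (\<lambda>x. f x + g x) h = L2_inner f h + L2_inner g h"
  by (simp add: L2_inner_def distrib_right L2_integrable_mult)

lemma L2_inner_diff_left: "f \<in> L2 \<Longrightarrow> g \<in> L2 \<Longrightarrow> h \<in> L2 \<Longrightarrow>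
    L2_inner (\<lambda>x. f x - g x) h = L2_inner f h - L2_inner g h"
  by (simp add: L2_inner_def left_diff_distrib L2_integrable_mult)

lemma L2_inner_cmult_left [simp]: "L2_inner (\<lambda>x. c * f x) g = c * L2_inner f g"
  by (simp add: L2_inner_def mult.assoc)

lemma L2_inner_cmult_right [simp]: "L2_inner f (\<lambda>x. c * g x) = c * L2_inner f g"
  by (subst (1 2) L2_inner_commute) simp

lemma L2_inner_divide_left [simp]: "L2_inner (\<lambda>x. f x / c) g = L2_inner f g / c"
  using L2_inner_cmult_left[of "inverse c" f g] by (simp add: divide_inverse mult.commute)

lemma L2_inner_zero_left [simp]: "L2_inner (\<lambda>x. 0) g = 0"
  by (simp add: L2_inner_def)

lemma L2_inner_add_right: "f \<in> L2 \<Longrightarrow> g \<in> L2 \<Longrightarrow> h \<in> L2 \<Longrightarrow>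
    L2_inner h (\<lambda>x. f x + g x) = L2_inner h f + L2_inner h g"
  by (subst (1 2 3) L2_inner_commute) (rule L2_inner_add_left)

lemma L2_inner_diff_right: "f \<in> L2 \<Longrightarrow> g \<in> L2 \<Longrightarrow> h \<in> L2 \<Longrightarrow>
    L2_inner h (\<lambda>x. f x - g x) = L2_inner h f - L2_inner h g"
  by (subst (1 2 3) L2_inner_commute) (rule L2_inner_diff_left)

lemma L2_inner_sum_left: "(\<And>i. i \<in> I \<Longrightarrow> f i \<in> L2) \<Longrightarrow> g \<in> L2 \<Longrightarrow>
    L2_inner (\<lambda>x. \<Sum>i\<in>I. f i x) g = (\<Sum>i\<in>I. L2_inner (f i) g)"
  by (induction I rule: infinite_finite_induct) (auto simp: L2_inner_add_left)

lemma L2_inner_cong_AE: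
  assumes "AE x in lborel. f x = f' x" "AE x in lborel. g x = g' x"
    "f \<in> borel_measurable borel" "f' \<in> borel_measurable borel"
    "g \<in> borel_measurable borel" "g' \<in> borel_measurable borel"
  shows "L2_inner f g = L2_inner f' g'"
  unfolding L2_inner_def by (rule integral_cong_AE) (use assms in auto)

lemma L2_norm_nonneg [simp]: "0 \<le> L2_norm f"
  by (simp add: L2_norm_def)

lemma L2_norm_zero [simp]: "L2_norm (\<lambda>x. 0) = 0"
  by (simp add: L2_norm_def)

lemma L2_norm_square: "(L2_norm f)\<^sup>2 = L2_inner f f"
  by (simp add: L2_norm_def L2_inner_def power2_eq_square)

lemma L2_norm_cmult [simp]: "L2_norm (\<lambda>x. c * f x) = \<bar>c\<bar> * L2_norm f"
  by (simp add: L2_norm_def power_mult_distrib real_sqrt_mult)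

lemma L2_norm_divide [simp]: "L2_norm (\<lambda>x. f x / c) = L2_norm f / \<bar>c\<bar>"
  using L2_norm_cmult[of "inverse c" f] by (simp add: divide_inverse mult.commute)

lemma L2_norm_uminus [simp]: "L2_norm (\<lambda>x. - f x) = L2_norm f"
  by (simp add: L2_norm_def)

lemma L2_norm_minus_commute: "L2_norm (\<lambda>x. f x - g x) = L2_norm (\<lambda>x. g x - f x)"
  by (simp add: L2_norm_def power2_commute)

lemma L2_norm_cong_AE:
  assumes "AE x in lborel. f x = f' x"
    "f \<in> borel_measurable borel" "f' \<in> borel_measurable borel"
  shows "L2_norm f = L2_norm f'"
  unfolding L2_norm_def by (rule arg_cong[where f = sqrt], rule integral_cong_AE) (use assms in auto)

lemma L2_Cauchy_Schwarz:
  assumes f: "f \<in> L2" and g: "g \<in> L2"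
  shows "\<bar>L2_inner f g\<bar> \<le> L2_norm f * L2_norm g"
proof -
  have nn: "0 \<le> (L2_norm f)\<^sup>2 + 2 * t * L2_inner f g + t\<^sup>2 * (L2_norm g)\<^sup>2" for t
  proof -
    have "0 \<le> (L2_norm (\<lambda>x. f x + t * g x))\<^sup>2" by simp
    also have "\<dots> = L2_inner f f + 2 * t * L2_inner f g + t\<^sup>2 * L2_inner g g"
      unfolding L2_norm_square using f g
      by (simp add: L2_inner_add_left L2_inner_add_right L2_inner_commute[of g f] algebra_simps
          power2_eq_square)
    finally show ?thesis by (simp add: L2_norm_square)
  qed
  show ?thesis
  proof (cases "L2_norm g = 0")
    case True
    then have *: "0 \<le> (L2_norm f)\<^sup>2 + 2 * t * L2_inner f g" for t using nn[of t] by simp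
    have "L2_inner f g = 0"
    proof (rule ccontr)
      assume nz: "L2_inner f g \<noteq> 0"
      \<comment> \<open>At this \<open>t\<close> the affine expression
        \<open>(L2_norm f)^2 + 2 * t * L2_inner f g\<close> takes the value -1.\<close>
      show False
        using *[of "- ((L2_norm f)\<^sup>2 + 1) / (2 * L2_inner f g)"] nz by (simp add: field_simps)
    qed
    then show ?thesis by simp
  next
    case False
    then have pos: "0 < (L2_norm g)\<^sup>2" by simp
    \<comment> \<open>The quadratic in \<open>t\<close> is minimal at
      \<open>- L2_inner f g / p\<close>; nonnegativity of the minimum is the squared
      inequality.\<close>
    define p where "p = (L2_norm g)\<^sup>2"
    have "(- L2_inner f g / p)\<^sup>2 * p = (L2_inner f g)\<^sup>2 / p"
      using pos unfolding p_def[symmetric] by (simp add: power2_eq_square)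
    then have "0 \<le> (L2_norm f)\<^sup>2 - (L2_inner f g)\<^sup>2 / p"
      using nn[of "- L2_inner f g / p"] unfolding p_def[symmetric] by (simp add: power2_eq_square)
    then have "(L2_inner f g)\<^sup>2 \<le> (L2_norm f * L2_norm g)\<^sup>2"
      using pos unfolding power_mult_distrib p_def[symmetric] by (simp add: field_simps)
    then show ?thesis by (simp add: abs_le_square_iff[symmetric] abs_mult)
  qed
qed

lemma L2_norm_triangle:
  assumes f: "f \<in> L2" and g: "g \<in> L2"
  shows "L2_norm (\<lambda>x. f x + g x) \<le> L2_norm f + L2_norm g"
proof (rule power2_le_imp_le)
  have "(L2_norm (\<lambda>x. f x + g x))\<^sup>2 = (L2_norm f)\<^sup>2 + 2 * L2_inner f g + (L2_norm g)\<^sup>2"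
    unfolding L2_norm_square using f g
    by (simp add: L2_inner_add_left L2_inner_add_right L2_inner_commute[of g f])
  also have "\<dots> \<le> (L2_norm f + L2_norm g)\<^sup>2"
    using L2_Cauchy_Schwarz[OF f g] by (simp add: power2_sum)
  finally show "(L2_norm (\<lambda>x. f x + g x))\<^sup>2 \<le> (L2_norm f + L2_norm g)\<^sup>2" .
qed simp

lemma L2_norm_triangle_ineq2:
  assumes "f \<in> L2" "g \<in> L2"
  shows "\<bar>L2_norm f - L2_norm g\<bar> \<le> L2_norm (\<lambda>x. f x - g x)"
  using L2_norm_triangle[of "\<lambda>x. f x - g x" g] L2_norm_triangle[of "\<lambda>x. g x - f x" f] assms
    L2_norm_minus_commute[of f g] by (simp add: abs_le_iff)

lemma L2_norm_sum_le:
  "(\<And>i. i \<in> I \<Longrightarrow> f i \<in> L2) \<Longrightarrow> L2_norm (\<lambda>x. \<Sum>i\<in>I. f i x) \<le> (\<Sum>i\<in>I. L2_norm (f i))"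
proof (induction I rule: infinite_finite_induct)
  case (insert i I)
  then show ?case using L2_norm_triangle[of "f i" "\<lambda>x. \<Sum>i\<in>I. f i x"] by fastforce
qed auto

lemma L2_norm_zero_AE:
  assumes "f \<in> L2" "L2_norm f = 0"
  shows "AE x in lborel. f x = 0"
proof -
  have "(\<integral>x. (f x)\<^sup>2 \<partial>lborel) = 0" using assms(2) by (simp add: L2_norm_def)
  then have "AE x in lborel. (f x)\<^sup>2 = 0"
    using L2_integrable_square[OF assms(1)]
    by (subst (asm) integral_nonneg_eq_0_iff_AE) auto
  then show ?thesis by simp
qed

lemma L2_norm_mono_AE:
  assumes "g \<in> L2" "f \<in> borel_measurable borel" "AE x in lborel. \<bar>f x\<bar> \<le> \<bar>g x\<bar>"
  shows "f \<in> L2" "L2_norm f \<le> L2_norm g"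
proof -
  have [measurable]: "g \<in> borel_measurable borel" "f \<in> borel_measurable borel"
    using assms by (simp_all add: L2_measurable)
  have le: "AE x in lborel. (f x)\<^sup>2 \<le> (g x)\<^sup>2"
    using assms(3) by (auto simp: abs_le_square_iff)
  have "integrable lborel (\<lambda>x. (f x)\<^sup>2)"
    by (rule Bochner_Integration.integrable_bound[OF L2_integrable_square[OF assms(1)]]) (use le in auto)
  then show "f \<in> L2" by (intro L2I) auto
  then show "L2_norm f \<le> L2_norm g"
    unfolding L2_norm_def
    by (intro real_sqrt_le_mono integral_mono_AE L2_integrable_square le assms)
qed

lemma L2_norm_bounded_mult:
  assumes "f \<in> L2" "a \<in> borel_measurable borel" "AE x in lborel. \<bar>a x\<bar> \<le> M"
  shows "(\<lambda>x. a x * f x) \<in> L2" "L2_norm (\<lambda>x. a x * f x) \<le> \<bar>M\<bar> * L2_norm f"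
proof -
  have 1: "(\<lambda>x. M * f x) \<in> L2" using assms by simp
  have 2: "(\<lambda>x. a x * f x) \<in> borel_measurable borel"
    using assms by (simp add: L2_measurable)
  have 3: "AE x in lborel. \<bar>a x * f x\<bar> \<le> \<bar>M * f x\<bar>"
    using assms(3) by eventually_elim (auto simp: abs_mult intro: mult_right_mono)
  show "(\<lambda>x. a x * f x) \<in> L2" by (rule L2_norm_mono_AE(1)[OF 1 2 3])
  show "L2_norm (\<lambda>x. a x * f x) \<le> \<bar>M\<bar> * L2_norm f"
    using L2_norm_mono_AE(2)[OF 1 2 3] by simp
qed

text \<open>L^1 convergence yields a subsequence converging almost everywhere, and Fatou's lemma
  carries the L^2 bound over to the limit. It serves for products: factors converging in L^2 make
  the product converge only in L^1, while the bound is known in L^2.\<close>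

lemma L2_norm_le_of_L1_limit:
  fixes h :: "nat \<Rightarrow> real ^ 'n \<Rightarrow> real"
  assumes hk: "\<And>k. h k \<in> L2" "\<And>k. L2_norm (h k) \<le> M"
    and [measurable]: "g \<in> borel_measurable borel"
    and int: "\<And>k. integrable lborel (\<lambda>x. h k x - g x)"
    and lim: "(\<lambda>k. \<integral>x. \<bar>h k x - g x\<bar> \<partial>lborel) \<longlonglongrightarrow> 0"
  shows "g \<in> L2" "L2_norm g \<le> M"
proof -
  have M: "0 \<le> M" using hk(2)[of 0] L2_norm_nonneg[of "h 0"] by linarith
  have [measurable]: "h k \<in> borel_measurable borel" for k using hk(1) by (rule L2_measurable)
  obtain r where r: "strict_mono r" "AE x in lborel. (\<lambda>k. h (r k) x - g x) \<longlonglongrightarrow> 0"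
    using tendsto_L1_AE_subseq[of lborel "\<lambda>k x. h k x - g x"] int lim by auto
  have lims: "AE x in lborel. liminf (\<lambda>k. ennreal ((h (r k) x)\<^sup>2)) = ennreal ((g x)\<^sup>2)"
    using r(2)
  proof eventually_elim
    case (elim x)
    then have "(\<lambda>k. h (r k) x) \<longlonglongrightarrow> g x" by (simp add: LIM_zero_iff)
    then have "(\<lambda>k. ennreal ((h (r k) x)\<^sup>2)) \<longlonglongrightarrow> ennreal ((g x)\<^sup>2)"
      by (intro tendsto_ennrealI tendsto_power)
    then show ?case by (simp add: lim_imp_Liminf)
  qed
  have "(\<integral>\<^sup>+x. ennreal ((g x)\<^sup>2) \<partial>lborel) = (\<integral>\<^sup>+x. liminf (\<lambda>k. ennreal ((h (r k) x)\<^sup>2)) \<partial>lborel)"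
    by (rule nn_integral_cong_AE) (use lims in auto)
  also have "\<dots> \<le> liminf (\<lambda>k. \<integral>\<^sup>+x. ennreal ((h (r k) x)\<^sup>2) \<partial>lborel)"
    by (rule nn_integral_liminf) simp
  also have "\<dots> \<le> ennreal (M\<^sup>2)"
  proof (rule order_trans[OF Liminf_mono[where g="\<lambda>_. ennreal (M\<^sup>2)"]])
    show "\<forall>\<^sub>F k in sequentially. (\<integral>\<^sup>+x. ennreal ((h (r k) x)\<^sup>2) \<partial>lborel) \<le> ennreal (M\<^sup>2)"
    proof (intro always_eventually allI)
      fix k
      have "(\<integral>\<^sup>+x. ennreal ((h (r k) x)\<^sup>2) \<partial>lborel) = ennreal ((L2_norm (h (r k)))\<^sup>2)"
        using L2_integrable_square[OF hk(1)] by (simp add: nn_integral_eq_integral L2_norm_def)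
      then show "(\<integral>\<^sup>+x. ennreal ((h (r k) x)\<^sup>2) \<partial>lborel) \<le> ennreal (M\<^sup>2)"
        using hk(2)[of "r k"] by (simp add: ennreal_leI power_mono)
    qed
  qed (simp add: Liminf_const)
  finally have le: "(\<integral>\<^sup>+x. ennreal ((g x)\<^sup>2) \<partial>lborel) \<le> ennreal (M\<^sup>2)" .
  have i: "integrable lborel (\<lambda>x. (g x)\<^sup>2)"
    by (rule integrableI_nonneg) (use le in \<open>auto simp: less_top[symmetric] top_unique\<close>)
  then show "g \<in> L2" by (intro L2I) auto
  have "ennreal (\<integral>x. (g x)\<^sup>2 \<partial>lborel) \<le> ennreal (M\<^sup>2)"
    using le nn_integral_eq_integral[OF i] by simp
  then have "(\<integral>x. (g x)\<^sup>2 \<partial>lborel) \<le> M\<^sup>2" by simp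
  then show "L2_norm g \<le> M" unfolding L2_norm_def using M by (simp add: real_le_lsqrt)
qed

section \<open>Test functions and uniqueness of weak derivatives\<close>

primrec times_differentiable :: "nat \<Rightarrow> (real \<Rightarrow> real) \<Rightarrow> bool" where
  "times_differentiable 0 h \<longleftrightarrow> True"
| "times_differentiable (Suc k) h \<longleftrightarrow>
     (\<exists>h'. (\<forall>x. (h has_real_derivative h' x) (at x)) \<and> times_differentiable k h')"

lemma times_differentiable_SucD: "times_differentiable (Suc k) h \<Longrightarrow> times_differentiable k h"
  by (induction k arbitrary: h) auto

lemma times_differentiable_add:
  "times_differentiable k f \<Longrightarrow> times_differentiable k g \<Longrightarrow> times_differentiable k (\<lambda>x. f x + g x)"
proof (induction k arbitrary: f g)
  case (Suc k)
  then obtain f' g' where "\<And>x. (f has_real_derivative f' x) (at x)" "times_differentiable k f'"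
    "\<And>x. (g has_real_derivative g' x) (at x)" "times_differentiable k g'" by auto
  then show ?case using Suc.IH[of f' g']
    by (auto intro!: exI[of _ "\<lambda>x. f' x + g' x"] DERIV_add)
qed simp

lemma times_differentiable_cmult:
  "times_differentiable k f \<Longrightarrow> times_differentiable k (\<lambda>x. c * f x)"
proof (induction k arbitrary: f)
  case (Suc k)
  then obtain f' where "\<And>x. (f has_real_derivative f' x) (at x)" "times_differentiable k f'" by auto
  then show ?case using Suc.IH[of f'] by (auto intro!: exI[of _ "\<lambda>x. c * f' x"] DERIV_cmult)
qed simp

lemma times_differentiable_mult:
  "times_differentiable k f \<Longrightarrow> times_differentiable k g \<Longrightarrow> times_differentiable k (\<lambda>x. f x * g x)"
proof (induction k arbitrary: f g)
  case (Suc k)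
  then obtain f' g' where d: "\<And>x. (f has_real_derivative f' x) (at x)" "times_differentiable k f'"
    "\<And>x. (g has_real_derivative g' x) (at x)" "times_differentiable k g'" by auto
  have "times_differentiable k f" "times_differentiable k g"
    using Suc.prems by (blast dest: times_differentiable_SucD)+
  then have "times_differentiable k (\<lambda>x. f' x * g x + g' x * f x)"
    using d by (intro times_differentiable_add Suc.IH)
  then show ?case using d
    by (auto intro!: exI[of _ "\<lambda>x. f' x * g x + g' x * f x"] DERIV_mult)
qed simp

lemma times_differentiable_affine:
  "times_differentiable k f \<Longrightarrow> times_differentiable k (\<lambda>x. f (a * x + b))"
proof (induction k arbitrary: f)
  case (Suc k)
  then obtain f' where d: "\<And>x. (f has_real_derivative f' x) (at x)" "times_differentiable k f'" by auto
  have "((\<lambda>x. f (a * x + b)) has_real_derivative a * f' (a * x + b)) (at x)" for x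
  proof -
    have "((\<lambda>x. a * x + b) has_real_derivative a) (at x)"
      by (auto intro!: derivative_eq_intros)
    from DERIV_chain2[OF d(1) this] show ?thesis by (simp only: mult.commute[of a "f' _"])
  qed
  moreover have "times_differentiable k (\<lambda>x. a * f' (a * x + b))"
    using d(2) Suc.IH by (intro times_differentiable_cmult) auto
  ultimately show ?case by (auto intro!: exI[of _ "\<lambda>x. a * f' (a * x + b)"])
qed simp

text \<open>The functions \<open>t^(-k) * exp (- 1/t)\<close>, extended by 0 to the left. As a
  family in \<open>k\<close> they are closed under differentiation up to linear combinations, which
  makes the classical flat function \<open>flat_exp 0\<close> smooth.\<close>

definition flat_exp :: "nat \<Rightarrow> real \<Rightarrow> real" where
  "flat_exp k t = (if t \<le> 0 then 0 else (1 / t) ^ k * exp (- (1 / t)))"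

lemma flat_exp_nonneg: "0 \<le> flat_exp k t"
  by (simp add: flat_exp_def)

lemma flat_exp_0_le_1: "flat_exp 0 t \<le> 1"
  by (simp add: flat_exp_def)

lemma flat_exp_tendsto_0: "(flat_exp k \<longlongrightarrow> 0) (at 0)"
proof -
  have "((\<lambda>t::real. inverse t ^ k / exp (inverse t)) \<longlongrightarrow> 0) (at_right 0)"
    by (rule filterlim_compose[OF tendsto_power_div_exp_0 filterlim_inverse_at_top_right])
  then have "(flat_exp k \<longlongrightarrow> 0) (at_right 0)"
    by (rule Lim_transform_eventually)
      (auto simp: eventually_at_right_field flat_exp_def exp_minus divide_inverse intro!: exI[of _ 1])
  moreover have "(flat_exp k \<longlongrightarrow> 0) (at_left 0)"
    by (rule Lim_transform_eventually[OF tendsto_const])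
      (auto simp: eventually_at_left_field flat_exp_def intro!: exI[of _ "-1"])
  ultimately show ?thesis by (simp add: filterlim_split_at)
qed

lemma flat_exp_DERIV:
  "(flat_exp k has_real_derivative (- real k * flat_exp (Suc k) t + flat_exp (Suc (Suc k)) t)) (at t)"
proof (cases t "0::real" rule: linorder_cases)
  case less
  have "((\<lambda>_. 0) has_real_derivative 0) (at t)" by simp
  then have "(flat_exp k has_real_derivative 0) (at t)"
    by (rule has_field_derivative_transform_within_open[of _ _ _ "{..<0}"])
      (use less in \<open>auto simp: flat_exp_def\<close>)
  then show ?thesis using less by (simp add: flat_exp_def)
next
  case equal
  have "((\<lambda>h. flat_exp (Suc k) h) \<longlongrightarrow> 0) (at 0)" by (rule flat_exp_tendsto_0)
  \<comment> \<open>At the origin the difference quotient of one member of the family is the next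
    member itself.\<close>
  moreover have "flat_exp (Suc k) h = (flat_exp k (0 + h) - flat_exp k 0) / h" for h
    by (simp add: flat_exp_def field_simps)
  ultimately have "((\<lambda>h. (flat_exp k (0 + h) - flat_exp k 0) / h) \<longlongrightarrow> 0) (at 0)" by simp
  then show ?thesis using equal by (simp add: DERIV_def flat_exp_def)
next
  case greater
  have u: "((\<lambda>t. 1 / t) has_real_derivative - ((1 / t) * (1 / t))) (at t)"
    using greater by (auto intro!: derivative_eq_intros simp: divide_inverse)
  have p: "((\<lambda>t. (1 / t) ^ k) has_real_derivative - real k * (1 / t) ^ Suc k) (at t)"
  proof (cases k)
    case (Suc n)
    then show ?thesis using DERIV_power_Suc[OF u, of n]
      by (simp add: algebra_simps minus_divide_left[symmetric] diff_divide_distrib add_divide_distrib)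
  qed simp
  have e: "((\<lambda>t. exp (- (1 / t))) has_real_derivative exp (- (1 / t)) * ((1 / t) * (1 / t))) (at t)"
    using DERIV_chain2[OF DERIV_exp DERIV_minus[OF u]] by simp
  have "((\<lambda>t. (1 / t) ^ k * exp (- (1 / t))) has_real_derivative
      (- real k * flat_exp (Suc k) t + flat_exp (Suc (Suc k)) t)) (at t)"
    using DERIV_mult[OF p e] greater by (simp add: flat_exp_def algebra_simps)
  then show ?thesis
    by (rule has_field_derivative_transform_within_open[of _ _ _ "{0<..}"])
      (use greater in \<open>auto simp: flat_exp_def\<close>)
qed

text \<open>The induction is for all \<open>k\<close> at once, since a derivative brings in the
  members \<open>k + 1\<close> and \<open>k + 2\<close>.\<close>

lemma times_differentiable_flat_exp: "times_differentiable n (flat_exp k)"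
proof (induction n arbitrary: k)
  case (Suc n)
  then show ?case
    using flat_exp_DERIV[of k]
    by (auto intro!: exI[of _ "\<lambda>t. - real k * flat_exp (Suc k) t + flat_exp (Suc (Suc k)) t"]
        times_differentiable_add times_differentiable_cmult[where c="- real k", simplified] times_differentiable_cmult)
qed simp

definition smooth_real :: "(real \<Rightarrow> real) \<Rightarrow> bool" where
  "smooth_real h \<longleftrightarrow> (\<forall>k. times_differentiable k h)"

text \<open>Each order of differentiability comes with its own witness for the first derivative;
  uniqueness of derivatives identifies all these witnesses.\<close>

lemma smooth_real_derivative:
  assumes "smooth_real h"
  obtains h' where "smooth_real h'" "\<And>x. (h has_real_derivative h' x) (at x)"
proof -
  have "\<forall>k. \<exists>h'. (\<forall>x. (h has_real_derivative h' x) (at x)) \<and> times_differentiable k h'"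
    using assms unfolding smooth_real_def by (metis times_differentiable.simps(2))
  then obtain D where D: "\<And>k x. (h has_real_derivative D k x) (at x)"
    "\<And>k. times_differentiable k (D k)" by metis
  have "D k = D 0" for k by (rule ext) (rule DERIV_unique[OF D(1) D(1)])
  then show ?thesis using D that[of "D 0"] by (metis smooth_real_def)
qed

text \<open>For products of functions of one coordinate a partial derivative acts on a single factor
  and stays inside the class, so smoothness in several variables reduces to one variable.\<close>

definition product_function :: "('n \<Rightarrow> real \<Rightarrow> real) \<Rightarrow> real ^ 'n::finite \<Rightarrow> real" where
  "product_function h x = (\<Prod>i\<in>UNIV. h i (x $ i))"

lemma product_function_has_derivative:
  fixes h :: "'n::finite \<Rightarrow> real \<Rightarrow> real"
  assumes "\<And>i y. (h i has_real_derivative h' i y) (at y)"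
  shows "(product_function h has_derivative
    (\<lambda>v. \<Sum>i\<in>UNIV. h' i (x $ i) * v $ i * (\<Prod>j\<in>UNIV - {i}. h j (x $ j)))) (at x)"
proof -
  have "((\<lambda>x. h i (x $ i)) has_derivative (\<lambda>v. h' i (x $ i) * v $ i)) (at x)" for i
    using has_derivative_compose[OF bounded_linear_imp_has_derivative[OF bounded_linear_vec_nth[of i]]
        assms[of i "x $ i", unfolded has_field_derivative_def]] .
  then show ?thesis unfolding product_function_def[abs_def] by (rule has_derivative_prod)
qed

lemma partial_deriv_product_function:
  fixes h :: "'n::finite \<Rightarrow> real \<Rightarrow> real"
  assumes "\<And>i y. (h i has_real_derivative h' i y) (at y)"
  shows "partial_deriv j (product_function h) = product_function (h(j := h' j))"
proof
  fix x :: "real ^ 'n"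
  have "partial_deriv j (product_function h) x =
      (\<Sum>i\<in>UNIV. h' i (x $ i) * axis j 1 $ i * (\<Prod>k\<in>UNIV - {i}. h k (x $ k)))"
    unfolding partial_deriv_def
    using frechet_derivative_at[OF product_function_has_derivative[of h h', OF assms], of x, symmetric] by simp
  also have "\<dots> = h' j (x $ j) * (\<Prod>k\<in>UNIV - {j}. h k (x $ k))"
    by (subst sum.remove[of _ j]) (auto simp: axis_def intro!: sum.neutral)
  also have "\<dots> = product_function (h(j := h' j)) x"
    unfolding product_function_def by (subst prod.remove[of _ j]) (auto intro!: prod.cong)
  finally show "partial_deriv j (product_function h) x = product_function (h(j := h' j)) x" .
qed

lemma iterated_partial_product_function:
  fixes h :: "'n::finite \<Rightarrow> real \<Rightarrow> real"
  assumes "\<And>i. smooth_real (h i)"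
  shows "\<exists>h'. (\<forall>i. smooth_real (h' i)) \<and> iterated_partial is (product_function h) = product_function h'"
proof (induction "is")
  case Nil
  then show ?case using assms by auto
next
  case (Cons j js)
  then obtain g where g: "\<And>i. smooth_real (g i)"
    "iterated_partial js (product_function h) = product_function g" by auto
  have "\<forall>i. \<exists>g'. smooth_real g' \<and> (\<forall>x. (g i has_real_derivative g' x) (at x))"
    using g(1) smooth_real_derivative by metis
  then obtain g' where "\<And>i. smooth_real (g' i)" "\<And>i x. (g i has_real_derivative g' i x) (at x)"
    by metis
  then show ?case using g partial_deriv_product_function[of g g' j]
    by (auto intro!: exI[of _ "g(j := g' j)"])
qed

lemma test_function_product_function:
  fixes h :: "'n::finite \<Rightarrow> real \<Rightarrow> real"
  assumes "\<And>i. smooth_real (h i)" "\<And>i y. y \<notin> {a $ i .. b $ i} \<Longrightarrow> h i y = 0"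
  shows "test_function (product_function h)"
proof -
  have "iterated_partial is (product_function h) differentiable (at x)" for "is" x
  proof -
    obtain g where g: "\<And>i. smooth_real (g i)"
      "iterated_partial is (product_function h) = product_function g"
      using iterated_partial_product_function[of h "is"] assms(1) by blast
    have "\<forall>i. \<exists>g'. smooth_real g' \<and> (\<forall>x. (g i has_real_derivative g' x) (at x))"
      using g(1) smooth_real_derivative by metis
    then obtain g' where "\<And>i x. (g i has_real_derivative g' i x) (at x)" by metis
    then show ?thesis using product_function_has_derivative[of g g' x] g(2)
      by (auto simp: differentiable_def)
  qed
  moreover have "{x. product_function h x \<noteq> 0} \<subseteq> cbox a b"
    unfolding product_function_def
  proof safe
    fix x assume "(\<Prod>i\<in>UNIV. h i (x $ i)) \<noteq> 0"
    then have "\<And>i. h i (x $ i) \<noteq> 0" by simp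
    then have "\<And>i. x $ i \<in> {a $ i .. b $ i}" using assms(2) by metis
    then show "x \<in> cbox a b" by (auto simp: mem_box_cart)
  qed
  then have "compact (closure {x. product_function h x \<noteq> 0})"
    by (meson bounded_cbox bounded_subset compact_closure)
  ultimately show ?thesis by (auto simp: test_function_def)
qed

lemma flat_exp_scaled_tendsto:
  assumes "t > 0" shows "(\<lambda>k. flat_exp 0 (real k * t)) \<longlonglongrightarrow> 1"
proof -
  have "filterlim (\<lambda>k. real k * t) at_top sequentially"
    using assms by (intro filterlim_at_top_mult_tendsto_pos[OF tendsto_const] filterlim_real_sequentially)
  then have "(\<lambda>k. exp (- inverse (real k * t))) \<longlonglongrightarrow> exp (- 0)"
    by (intro tendsto_exp tendsto_minus tendsto_inverse_0_at_top)
  moreover have "\<forall>\<^sub>F k in sequentially. exp (- inverse (real k * t)) = flat_exp 0 (real k * t)"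
    using eventually_gt_at_top[of 0] by eventually_elim (use assms in \<open>auto simp: flat_exp_def divide_inverse mult_le_0_iff\<close>)
  ultimately show ?thesis by (simp add: Lim_transform_eventually)
qed

text \<open>In each coordinate \<open>exp (- 1 / (k * t))\<close> tends to 1 for
  \<open>t > 0\<close>, and the flat function vanishes for \<open>t \<le> 0\<close>. Hence the
  dilated bumps live inside the open box, are bounded by 1 and increase their plateau to the whole
  box.\<close>

lemma test_function_box_approximation:
  fixes a b :: "real ^ 'n::finite"
  obtains \<phi> where "\<And>k::nat. test_function (\<phi> k)" "\<And>k x. \<bar>\<phi> k x\<bar> \<le> indicator (box a b) x"
    "\<And>x. (\<lambda>k. \<phi> k x) \<longlonglongrightarrow> indicator (box a b) x"
proof -
  define h where "h k i t = flat_exp 0 (real k * (t - a $ i)) * flat_exp 0 (real k * (b $ i - t))"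
    for k :: nat and i t
  define \<phi> where "\<phi> k = product_function (h k)" for k
  have sm: "smooth_real (h k i)" for k i
  proof -
    have "times_differentiable n (\<lambda>t. flat_exp 0 (real k * t + (- real k * a $ i)) *
        flat_exp 0 ((- real k) * t + real k * b $ i))" for n
      by (intro times_differentiable_mult times_differentiable_affine times_differentiable_flat_exp)
    then show ?thesis by (simp add: smooth_real_def h_def[abs_def] algebra_simps)
  qed
  have h0: "h k i t = 0" if "t \<notin> {a $ i <..< b $ i}" for k i t
    using that by (auto simp: h_def flat_exp_def mult_le_0_iff mult_nonneg_nonpos)
  have h1: "0 \<le> h k i t" "h k i t \<le> 1" for k i t
    by (auto simp: h_def flat_exp_nonneg flat_exp_0_le_1 intro: mult_le_one)
  have z: "\<phi> k x = 0" if x: "x \<notin> box a b" for k x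
  proof -
    obtain i where "x $ i \<notin> {a $ i <..< b $ i}" using x by (auto simp: mem_box_cart)
    then have "h k i (x $ i) = 0" by (rule h0)
    then show ?thesis unfolding \<phi>_def product_function_def by (auto intro: prod_zero)
  qed
  show thesis
  proof (rule that[of \<phi>])
    show "test_function (\<phi> k)" for k
      unfolding \<phi>_def by (rule test_function_product_function[of _ a b]) (use sm h0 in auto)
    show "\<bar>\<phi> k x\<bar> \<le> indicator (box a b) x" for k x
    proof (cases "x \<in> box a b")
      case True
      have "\<bar>\<phi> k x\<bar> = \<phi> k x" unfolding \<phi>_def product_function_def using h1 by (simp add: prod_nonneg)
      also have "\<dots> \<le> 1" unfolding \<phi>_def product_function_def using h1 by (intro prod_le_1) auto
      finally show ?thesis using True by simp
    qed (simp add: z)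
    show "(\<lambda>k. \<phi> k x) \<longlonglongrightarrow> indicator (box a b) x" for x
    proof (cases "x \<in> box a b")
      case True
      have "(\<lambda>k. h k i (x $ i)) \<longlonglongrightarrow> 1 * 1" for i
        unfolding h_def using True by (intro tendsto_mult flat_exp_scaled_tendsto) (auto simp: mem_box_cart)
      then have "(\<lambda>k. \<phi> k x) \<longlonglongrightarrow> (\<Prod>i\<in>(UNIV::'n set). 1)"
        unfolding \<phi>_def product_function_def by (intro tendsto_prod) auto
      then show ?thesis using True by simp
    qed (simp add: z)
  qed
qed

section \<open>Locally integrable functions and the fundamental lemma of the calculus of
  variations\<close>

lemma locally_integrable_cbox:
  "locally_integrable f \<Longrightarrow> integrable lborel (\<lambda>x. indicator (cbox a b) x * f x)"
  unfolding locally_integrable_def using compact_cbox by (auto simp: set_integrable_def)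

lemma locally_integrable_measurable:
  fixes f :: "real ^ 'n::finite \<Rightarrow> real"
  assumes "locally_integrable f" shows "f \<in> borel_measurable borel"
proof -
  let ?C = "\<lambda>k. cbox (- (real k *\<^sub>R 1)) (real k *\<^sub>R 1) :: (real ^ 'n) set"
  have m: "(\<lambda>x. indicator (?C k) x * f x) \<in> borel_measurable borel" for k
    using borel_measurable_integrable[OF locally_integrable_cbox[OF assms]] by simp
  show ?thesis
  proof (rule borel_measurable_LIMSEQ_real[OF _ m])
    fix x :: "real ^ 'n"
    obtain k0 :: nat where k0: "norm x \<le> real k0" using real_arch_simple by blast
    have "x \<in> ?C k" if "k \<ge> k0" for k
    proof -
      have "\<bar>x $ i\<bar> \<le> real k" for i using component_le_norm_cart[of x i] k0 that by linarith
      then show ?thesis by (auto simp: mem_box_cart abs_le_iff) (smt (verit))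
    qed
    then have "\<forall>\<^sub>F k in sequentially. f x = indicator (?C k) x * f x"
      by (intro eventually_sequentiallyI[of k0]) simp
    then show "(\<lambda>k. indicator (?C k) x * f x) \<longlonglongrightarrow> f x"
      by (rule Lim_transform_eventually[OF tendsto_const])
  qed
qed

text \<open>Boxes form an intersection-stable generator of the Borel sets, so vanishing integrals
  over boxes spread to all Borel sets by a Dynkin argument. Cutting \<open>f\<close> off to a
  bounded cube first makes it integrable, as complements require.\<close>

lemma integral_box_zero_imp_AE_zero:
  fixes f :: "real ^ 'n::finite \<Rightarrow> real"
  assumes f: "locally_integrable f"
    and box: "\<And>a b. (\<integral>x. indicator (box a b) x * f x \<partial>lborel) = 0"
  shows "AE x in lborel. f x = 0"
proof -
  let ?C = "\<lambda>k. box (- (real k *\<^sub>R 1)) (real k *\<^sub>R 1) :: (real ^ 'n) set"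
  have [measurable]: "f \<in> borel_measurable borel" using f by (rule locally_integrable_measurable)
  have int: "integrable lborel (\<lambda>x. indicator (?C k) x * f x)" for k
    by (rule Bochner_Integration.integrable_bound[OF locally_integrable_cbox[OF f, of "- (real k *\<^sub>R 1)" "real k *\<^sub>R 1"]])
      (auto split: split_indicator simp: mem_box_cart less_imp_le)
  have "AE x in lborel. indicator (?C k) x * f x = 0" for k
  proof (rule sigma_finite_measure.density_zero[OF sigma_finite_lborel int])
    fix A :: "(real ^ 'n) set" assume A: "A \<in> sets lborel"
    have "A \<in> sigma_sets UNIV (range (\<lambda>(a, b). box a b :: (real ^ 'n) set))"
      using A by (simp add: borel_eq_box)
    have st: "Int_stable (range (\<lambda>(a, b). box a b :: (real ^ 'n) set))"
      by (auto simp: Int_stable_def box_Int_box)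
    have pw: "range (\<lambda>(a, b). box a b :: (real ^ 'n) set) \<subseteq> Pow UNIV" by simp
    from st pw \<open>A \<in> sigma_sets _ _\<close>
    have "(\<integral>x. indicator A x * (indicator (?C k) x * f x) \<partial>lborel) = 0"
    proof (induction A rule: sigma_sets_induct_disjoint)
      case (basic A)
      then obtain a b where A: "A = box a b" by auto
      obtain c d where "box a b \<inter> ?C k = box c d" by (auto simp: box_Int_box)
      then have "indicator A x * (indicator (?C k) x * f x) = indicator (box c d) x * f x" for x
        unfolding A by (metis (no_types, lifting) indicator_inter_arith mult.assoc)
      then show "(\<integral>x. indicator A x * (indicator (?C k) x * f x) \<partial>lborel) = 0"
        using box by (simp only:)
    next
      case (compl A)
      note A = compl.hyps and IH = compl.IH
      have [measurable]: "A \<in> sets borel" using A by (simp add: borel_eq_box)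
      have "(\<integral>x. indicator (UNIV - A) x * (indicator (?C k) x * f x) \<partial>lborel) =
          (\<integral>x. indicator (?C k) x * f x - indicator A x * (indicator (?C k) x * f x) \<partial>lborel)"
        by (intro Bochner_Integration.integral_cong) (auto split: split_indicator)
      also have "\<dots> = (\<integral>x. indicator (?C k) x * f x \<partial>lborel) -
          (\<integral>x. indicator A x * (indicator (?C k) x * f x) \<partial>lborel)"
        using integrable_mult_indicator[OF _ int[of k], of A]
        by (intro Bochner_Integration.integral_diff int) simp_all
      finally show "(\<integral>x. indicator (UNIV - A) x * (indicator (?C k) x * f x) \<partial>lborel) = 0"
        using IH box by simp
    next
      case (union A)
      note dj = union.hyps(1) and A = union.hyps(2) and IH = union.IH
      have "A i \<in> sets lborel" for i using A by (auto simp: borel_eq_box)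
      moreover have "set_integrable lborel (\<Union>i. A i) (\<lambda>x. indicator (?C k) x * f x)"
        unfolding set_integrable_def using calculation by (intro integrable_mult_indicator int) auto
      ultimately have "(LINT x:(\<Union>i. A i)|lborel. indicator (?C k) x * f x) =
          (\<Sum>i. LINT x:A i|lborel. indicator (?C k) x * f x)"
        using dj by (intro lebesgue_integral_countable_add) (auto simp: disjoint_family_on_def)
      then show "(\<integral>x. indicator (\<Union>i. A i) x * (indicator (?C k) x * f x) \<partial>lborel) = 0"
        using IH by (simp add: set_lebesgue_integral_def)
    qed (auto)
    then show "(LINT x:A|lborel. indicator (?C k) x * f x) = 0"
      by (simp add: set_lebesgue_integral_def)
  qed
  then have "AE x in lborel. \<forall>k. indicator (?C k) x * f x = 0"
    by (subst AE_all_countable) blast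
  then show ?thesis
  proof eventually_elim
    case (elim x)
    obtain k :: nat where k: "norm x < real k" using reals_Archimedean2 by blast
    have "\<bar>x $ i\<bar> < real k" for i using component_le_norm_cart[of x i] k by linarith
    then have "x \<in> ?C k" by (auto simp: mem_box_cart abs_less_iff) (smt (verit))
    then show ?case using elim[rule_format, of k] by simp
  qed
qed

text \<open>Indicators of boxes are dominated limits of test functions, so orthogonality to test
  functions gives vanishing integrals over boxes.\<close>

theorem fundamental_lemma_variations:
  fixes f :: "real ^ 'n::finite \<Rightarrow> real"
  assumes f: "locally_integrable f"
    and orth: "\<And>\<phi>. test_function \<phi> \<Longrightarrow> (\<integral>x. f x * \<phi> x \<partial>lborel) = 0"
  shows "AE x in lborel. f x = 0"
proof (rule integral_box_zero_imp_AE_zero[OF f])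
  fix a b :: "real ^ 'n"
  obtain \<phi> where \<phi>: "\<And>k::nat. test_function (\<phi> k)" "\<And>k x. \<bar>\<phi> k x\<bar> \<le> indicator (box a b) x"
    "\<And>x. (\<lambda>k. \<phi> k x) \<longlonglongrightarrow> indicator (box a b) x"
    using test_function_box_approximation by blast
  have [measurable]: "f \<in> borel_measurable borel" using f by (rule locally_integrable_measurable)
  have [measurable]: "\<phi> k \<in> borel_measurable borel" for k
  proof -
    have "\<phi> k differentiable (at x)" for x
      using \<phi>(1)[of k] unfolding test_function_def by (metis foldr_Nil id_apply)
    then have "continuous_on UNIV (\<phi> k)"
      by (simp add: continuous_at_imp_continuous_on differentiable_imp_continuous_within)
    then show ?thesis by (rule borel_measurable_continuous_onI)
  qed
  have "(\<lambda>k. \<integral>x. f x * \<phi> k x \<partial>lborel) \<longlonglongrightarrow> (\<integral>x. f x * indicator (box a b) x \<partial>lborel)"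
  proof (rule integral_dominated_convergence)
    show "integrable lborel (\<lambda>x. norm (indicator (cbox a b) x * f x))"
      by (intro integrable_norm locally_integrable_cbox f)
    show "AE x in lborel. (\<lambda>k. f x * \<phi> k x) \<longlonglongrightarrow> f x * indicator (box a b) x"
      by (intro AE_I2 tendsto_mult tendsto_const \<phi>)
    show "AE x in lborel. norm (f x * \<phi> k x) \<le> norm (indicator (cbox a b) x * f x)" for k
    proof (rule AE_I2)
      fix x
      have "\<bar>\<phi> k x\<bar> \<le> indicator (cbox a b) x"
        using \<phi>(2)[of k x] by (auto split: split_indicator_asm split_indicator simp: mem_box_cart less_imp_le)
      then show "norm (f x * \<phi> k x) \<le> norm (indicator (cbox a b) x * f x)"
        by (simp add: abs_mult mult.commute[of "indicator _ _"] mult_left_mono)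
    qed
  qed simp_all
  then show "(\<integral>x. indicator (box a b) x * f x \<partial>lborel) = 0"
    using orth[OF \<phi>(1)] by (simp add: LIMSEQ_const_iff mult.commute)
qed

section \<open>Translations and averages in the space of square integrable functions\<close>

lemma integral_translate:
  fixes f :: "real ^ 'n \<Rightarrow> real"
  assumes "f \<in> borel_measurable borel"
  shows "(\<integral>x. f (x + y) \<partial>lborel) = (\<integral>x. f x \<partial>lborel)"
proof -
  have "(\<integral>x. f x \<partial>lborel) = (\<integral>x. f x \<partial>distr lborel borel ((+) y))" by (simp add: lborel_distr_plus)
  also have "\<dots> = (\<integral>x. f (y + x) \<partial>lborel)" by (subst integral_distr) (use assms in auto)
  finally show ?thesis by (simp add: add.commute)
qed

lemma integrable_translate:
  fixes f :: "real ^ 'n \<Rightarrow> real"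
  assumes "integrable lborel f"
  shows "integrable lborel (\<lambda>x. f (x + y))"
proof -
  have "integrable (distr lborel borel ((+) y)) f" using assms by (simp add: lborel_distr_plus)
  then have "integrable lborel (\<lambda>x. f (y + x))"
    by (subst (asm) integrable_distr_eq) (use borel_measurable_integrable[OF assms] in auto)
  then show ?thesis by (simp add: add.commute)
qed

lemma AE_translate:
  fixes P :: "real ^ 'n \<Rightarrow> bool"
  assumes "AE x in lborel. P x"
  shows "AE x in lborel. P (x + y)"
proof -
  have "AE x in distr lborel borel ((+) y). P x" unfolding lborel_distr_plus by (rule assms)
  then have "AE x in lborel. P (y + x)" by (rule AE_distrD[rotated]) simp
  then show ?thesis by (simp add: add.commute)
qed

lemma L2_translate [simp, intro]: "f \<in> L2 \<Longrightarrow> (\<lambda>x. f (x + y)) \<in> L2"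
  using integrable_translate[of "\<lambda>x. (f x)\<^sup>2" y] by (auto simp: L2_def)

lemma L2_inner_translate:
  assumes "f \<in> L2" "g \<in> L2"
  shows "L2_inner (\<lambda>x. f (x + y)) g = L2_inner f (\<lambda>x. g (x - y))"
proof -
  have "(\<lambda>x. f x * g (x - y)) \<in> borel_measurable borel"
    using assms[THEN L2_measurable] by (auto intro!: borel_measurable_times measurable_compose[of "\<lambda>x. x - y" _ _ g])
  from integral_translate[OF this, of y] show ?thesis by (simp add: L2_inner_def)
qed

lemma L2_norm_translate [simp]:
  assumes "f \<in> L2" shows "L2_norm (\<lambda>x. f (x + y)) = L2_norm f"
  unfolding L2_norm_def using integral_translate[of "\<lambda>x. (f x)\<^sup>2" y] L2_measurable[OF assms] by simp

text \<open>Jensen's inequality for the square, read off from nonnegativity of the variance.\<close>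

lemma (in prob_space) expectation_square_le:
  fixes X :: "'a \<Rightarrow> real"
  assumes "X \<in> borel_measurable M" "integrable M (\<lambda>y. (X y)\<^sup>2)"
  shows "integrable M X" "(\<integral>y. X y \<partial>M)\<^sup>2 \<le> (\<integral>y. (X y)\<^sup>2 \<partial>M)"
proof -
  show i: "integrable M X" by (rule square_integrable_imp_integrable[OF assms])
  show "(\<integral>y. X y \<partial>M)\<^sup>2 \<le> (\<integral>y. (X y)\<^sup>2 \<partial>M)"
    using variance_positive[of X] variance_eq[OF i assms(2)] by simp
qed

text \<open>An average of L^2 functions over a probability space is no larger in norm than its
  members: Jensen's inequality pointwise in \<open>x\<close>, then Tonelli. The pairing formula is
  Fubini. Averages along segments and over cubes are both instances.\<close>

lemma L2_average:
  fixes F :: "'b \<Rightarrow> real ^ 'n \<Rightarrow> real"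
  assumes "prob_space \<mu>"
    and [measurable]: "(\<lambda>(x, y). F y x) \<in> borel_measurable (lborel \<Otimes>\<^sub>M \<mu>)"
    and F: "\<And>y. y \<in> space \<mu> \<Longrightarrow> F y \<in> L2" and M: "AE y in \<mu>. L2_norm (F y) \<le> M"
  shows "AE x in lborel. integrable \<mu> (\<lambda>y. F y x)"
    and "(\<lambda>x. \<integral>y. F y x \<partial>\<mu>) \<in> L2" and "L2_norm (\<lambda>x. \<integral>y. F y x \<partial>\<mu>) \<le> M"
    and "\<psi> \<in> L2 \<Longrightarrow> L2_inner (\<lambda>x. \<integral>y. F y x \<partial>\<mu>) \<psi> = (\<integral>y. L2_inner (F y) \<psi> \<partial>\<mu>)"
proof -
  interpret prob_space \<mu> by fact
  interpret pair_sigma_finite lborel \<mu> by standard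
  have M0: "0 \<le> M"
  proof -
    have "\<not> (AE y in \<mu>. False)" by simp
    moreover have "AE y in \<mu>. False" if "M < 0"
      using M
    proof eventually_elim
      case (elim y)
      then show ?case using that L2_norm_nonneg[of "F y"] by linarith
    qed
    ultimately show ?thesis by (metis not_le)
  qed
  have sq: "(\<integral>\<^sup>+x. ennreal ((F y x)\<^sup>2) \<partial>lborel) = ennreal ((L2_norm (F y))\<^sup>2)" if "y \<in> space \<mu>" for y
    using L2_integrable_square[OF F[OF that]] by (simp add: nn_integral_eq_integral L2_norm_def)
  have "(\<integral>\<^sup>+x. \<integral>\<^sup>+y. ennreal ((F y x)\<^sup>2) \<partial>\<mu> \<partial>lborel) = (\<integral>\<^sup>+y. \<integral>\<^sup>+x. ennreal ((F y x)\<^sup>2) \<partial>lborel \<partial>\<mu>)"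
    using Fubini[of "\<lambda>(x, y). ennreal ((F y x)\<^sup>2)"] by (simp add: split_beta')
  also have "\<dots> = (\<integral>\<^sup>+y. ennreal ((L2_norm (F y))\<^sup>2) \<partial>\<mu>)"
    by (rule nn_integral_cong) (rule sq)
  also have "\<dots> \<le> (\<integral>\<^sup>+y. ennreal (M\<^sup>2) \<partial>\<mu>)"
    by (rule nn_integral_mono_AE) (use M in \<open>auto intro!: ennreal_leI power_mono\<close>)
  also have "\<dots> = ennreal (M\<^sup>2)" by (simp add: emeasure_space_1)
  finally have le: "(\<integral>\<^sup>+x. \<integral>\<^sup>+y. ennreal ((F y x)\<^sup>2) \<partial>\<mu> \<partial>lborel) \<le> ennreal (M\<^sup>2)" .
  have le': "(\<integral>\<^sup>+p. ennreal ((case p of (x, y) \<Rightarrow> F y x)\<^sup>2) \<partial>(lborel \<Otimes>\<^sub>M \<mu>)) \<le> ennreal (M\<^sup>2)"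
    using le sigma_finite_measure.nn_integral_fst[OF prob_space_imp_sigma_finite[OF assms(1)], of "\<lambda>p. ennreal ((case p of (x, y) \<Rightarrow> F y x)\<^sup>2)" lborel] by simp
  have int2: "integrable (lborel \<Otimes>\<^sub>M \<mu>) (\<lambda>p. (case p of (x, y) \<Rightarrow> F y x)\<^sup>2)"
    by (rule integrableI_nonneg) (use le' in \<open>auto simp: less_top[symmetric] top_unique\<close>)
  have ae2: "AE x in lborel. integrable \<mu> (\<lambda>y. (F y x)\<^sup>2)"
    using AE_integrable_fst'[OF int2] by simp
  have meas: "(\<lambda>y. F y x) \<in> borel_measurable \<mu>" for x
    using measurable_Pair2[of "\<lambda>(x, y). F y x" lborel \<mu> borel x] by simp
  show ae: "AE x in lborel. integrable \<mu> (\<lambda>y. F y x)"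
    using ae2 by eventually_elim (rule expectation_square_le(1)[OF meas])
  have [measurable]: "(\<lambda>x. \<integral>y. F y x \<partial>\<mu>) \<in> borel_measurable borel"
    using sigma_finite_measure.borel_measurable_lebesgue_integral[OF prob_space_imp_sigma_finite[OF assms(1)], of "\<lambda>x y. F y x" lborel] by simp
  have jen: "AE x in lborel. (\<integral>y. F y x \<partial>\<mu>)\<^sup>2 \<le> (\<integral>y. (F y x)\<^sup>2 \<partial>\<mu>)"
    using ae2 by eventually_elim (rule expectation_square_le(2)[OF meas])
  have intx: "integrable lborel (\<lambda>x. \<integral>y. (F y x)\<^sup>2 \<partial>\<mu>)"
    using integrable_fst'[OF int2] by simp
  show L: "(\<lambda>x. \<integral>y. F y x \<partial>\<mu>) \<in> L2"
  proof (rule L2I)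
    show "integrable lborel (\<lambda>x. (\<integral>y. F y x \<partial>\<mu>)\<^sup>2)"
      by (rule Bochner_Integration.integrable_bound[OF intx])
        (use jen in \<open>auto elim!: eventually_mono intro: order_trans[OF _ abs_ge_self]\<close>)
  qed simp
  have "(\<integral>x. (\<integral>y. F y x \<partial>\<mu>)\<^sup>2 \<partial>lborel) \<le> (\<integral>x. (\<integral>y. (F y x)\<^sup>2 \<partial>\<mu>) \<partial>lborel)"
    using jen by (intro integral_mono_AE L2_integrable_square L intx)
  also have "\<dots> \<le> M\<^sup>2"
  proof -
    have "ennreal (\<integral>x. (\<integral>y. (F y x)\<^sup>2 \<partial>\<mu>) \<partial>lborel) = (\<integral>\<^sup>+x. ennreal (\<integral>y. (F y x)\<^sup>2 \<partial>\<mu>) \<partial>lborel)"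
      by (rule nn_integral_eq_integral[symmetric, OF intx]) auto
    also have "\<dots> = (\<integral>\<^sup>+x. \<integral>\<^sup>+y. ennreal ((F y x)\<^sup>2) \<partial>\<mu> \<partial>lborel)"
      by (rule nn_integral_cong_AE) (use ae2 in eventually_elim, simp add: nn_integral_eq_integral)
    also note le
    finally show ?thesis by (subst (asm) ennreal_le_iff) auto
  qed
  finally show "L2_norm (\<lambda>x. \<integral>y. F y x \<partial>\<mu>) \<le> M"
    unfolding L2_norm_def using M0 by (simp add: real_le_lsqrt)
  assume \<psi>: "\<psi> \<in> L2"
  have [measurable]: "\<psi> \<in> borel_measurable borel" using \<psi> by (rule L2_measurable)
  have int\<psi>: "integrable (lborel \<Otimes>\<^sub>M \<mu>) (\<lambda>p. (\<psi> (fst p))\<^sup>2)"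
  proof (rule integrableI_nonneg)
    have "(\<integral>\<^sup>+p. ennreal ((\<psi> (fst p))\<^sup>2) \<partial>(lborel \<Otimes>\<^sub>M \<mu>)) = (\<integral>\<^sup>+x. ennreal ((\<psi> x)\<^sup>2) \<partial>lborel)"
      using sigma_finite_measure.nn_integral_fst[OF prob_space_imp_sigma_finite[OF assms(1)], of "\<lambda>p. ennreal ((\<psi> (fst p))\<^sup>2)" lborel] by (simp add: emeasure_space_1)
    also have "\<dots> < \<infinity>"
      using L2_integrable_square[OF \<psi>] by (simp add: nn_integral_eq_integral)
    finally show "(\<integral>\<^sup>+p. ennreal ((\<psi> (fst p))\<^sup>2) \<partial>(lborel \<Otimes>\<^sub>M \<mu>)) < \<infinity>" .
  qed auto
  have int: "integrable (lborel \<Otimes>\<^sub>M \<mu>) (\<lambda>(x, y). F y x * \<psi> x)"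
  proof (rule Bochner_Integration.integrable_bound[OF Bochner_Integration.integrable_add[OF int2 int\<psi>]])
    show "AE p in lborel \<Otimes>\<^sub>M \<mu>. norm (case p of (x, y) \<Rightarrow> F y x * \<psi> x) \<le>
        norm ((case p of (x, y) \<Rightarrow> F y x)\<^sup>2 + (\<psi> (fst p))\<^sup>2)"
      by (intro AE_I2) (auto simp: split_beta' abs_mult_le_squares)
  qed simp
  have "L2_inner (\<lambda>x. \<integral>y. F y x \<partial>\<mu>) \<psi> = (\<integral>x. \<integral>y. F y x * \<psi> x \<partial>\<mu> \<partial>lborel)"
    unfolding L2_inner_def by simp
  also have "\<dots> = (\<integral>y. \<integral>x. F y x * \<psi> x \<partial>lborel \<partial>\<mu>)"
    by (rule Fubini_integral[symmetric]) (use int in simp)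
  finally show "L2_inner (\<lambda>x. \<integral>y. F y x \<partial>\<mu>) \<psi> = (\<integral>y. L2_inner (F y) \<psi> \<partial>\<mu>)"
    by (simp add: L2_inner_def)
qed

section \<open>Continuity of translations in the mean\<close>

lemma tendsto_zero_le:
  fixes f g :: "'b \<Rightarrow> real"
  assumes "(g \<longlongrightarrow> 0) F" "\<forall>\<^sub>F y in F. \<bar>f y\<bar> \<le> g y"
  shows "(f \<longlongrightarrow> 0) F"
  by (rule Lim_null_comparison[OF _ assms(1)]) (use assms(2) in simp)

text \<open>Induction over integrable functions leaves the indicator of a set of finite measure.
  Outer regularity replaces that set by an open set, whose indicator is recovered pointwise on the
  set itself by small translations.\<close>

lemma integrable_translate_continuous:
  fixes f :: "real ^ 'n::finite \<Rightarrow> real"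
  assumes "integrable lborel f"
  shows "((\<lambda>y. \<integral>x. \<bar>f (x + y) - f x\<bar> \<partial>lborel) \<longlongrightarrow> 0) (at 0)"
  using assms
proof (induction rule: integrable_induct)
  case (base A c)
  have A [measurable]: "A \<in> sets borel" and Af: "emeasure lborel A < \<infinity>" using base by auto
  show ?case
  proof (rule tendstoI)
    fix e :: real assume e: "e > 0"
    \<comment> \<open>The error consists of the open set's own contribution and twice the measure of
      \<open>U - A\<close>, altogether at most \<open>3 * \<delta> * \<bar>c\<bar>\<close>; the
      denominator keeps this below \<open>e\<close>, also for \<open>c = 0\<close>.\<close>
    define \<delta> where "\<delta> = e / (4 * (\<bar>c\<bar> + 1))"
    have \<delta>: "\<delta> > 0" using e by (simp add: \<delta>_def)
    have "A \<in> sets lebesgue" by simp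
    then obtain U where U: "open U" "A \<subseteq> U" "U - A \<in> lmeasurable" "emeasure lebesgue (U - A) < ennreal \<delta>"
      by (rule sets_lebesgue_outer_open[OF _ \<delta>])
    have [measurable]: "U \<in> sets borel" using U by simp
    have UA: "emeasure lborel (U - A) < ennreal \<delta>" using U(4) by simp
    have iUA: "integrable lborel (\<lambda>x. indicat_real (U - A) x)"
      using UA by (intro integrable_real_indicator) (auto simp: order_less_trans[OF _ ennreal_less_top])
    have iA: "integrable lborel (\<lambda>x. indicat_real A x)"
      using Af by (intro integrable_real_indicator) auto
    have split: "indicat_real U x = indicat_real A x + indicat_real (U - A) x" for x
      using U(2) by (auto split: split_indicator)
    have iU: "integrable lborel (\<lambda>x. indicat_real U x)"
      unfolding split by (intro Bochner_Integration.integrable_add iA iUA)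
    have "(\<integral>x. indicat_real (U - A) x \<partial>lborel) < \<delta>"
      using UA \<delta> by (simp add: measure_def enn2real_less_iff[OF order_less_trans[OF UA ennreal_less_top]])
    have "((\<lambda>y. \<integral>x. \<bar>indicat_real U (x + y) - indicat_real U x\<bar> \<partial>lborel) \<longlongrightarrow> 0) (at 0)"
    proof (rule iffD2[OF tendsto_at_iff_sequentially], intro allI impI)
      fix X :: "nat \<Rightarrow> real ^ 'n" assume X: "\<forall>i. X i \<in> UNIV - {0}" "X \<longlonglongrightarrow> 0"
      have i: "integrable lborel (\<lambda>x. indicat_real U x * indicat_real U (x + X k))" for k
        by (rule Bochner_Integration.integrable_bound[OF iU]) (auto split: split_indicator)
      have iX: "integrable lborel (\<lambda>x. indicat_real U (x + X k))" for k
        by (rule integrable_translate[OF iU])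
      \<comment> \<open>For values 0 and 1 the identity
        \<open>\<bar>p - q\<bar> = p + q - 2 * p * q\<close> holds. The product is dominated by the
        fixed indicator of \<open>U\<close>, while the translated indicators have no evident common
        majorant.\<close>
      have eq: "(\<integral>x. \<bar>indicat_real U (x + X k) - indicat_real U x\<bar> \<partial>lborel) =
          2 * ((\<integral>x. indicat_real U x \<partial>lborel) - (\<integral>x. indicat_real U x * indicat_real U (x + X k) \<partial>lborel))" for k
      proof -
        have "(\<integral>x. \<bar>indicat_real U (x + X k) - indicat_real U x\<bar> \<partial>lborel) =
          (\<integral>x. indicat_real U (x + X k) + indicat_real U x - 2 * (indicat_real U x * indicat_real U (x + X k)) \<partial>lborel)"
          by (intro Bochner_Integration.integral_cong) (auto split: split_indicator)
        also have "\<dots> = (\<integral>x. indicat_real U (x + X k) \<partial>lborel) + (\<integral>x. indicat_real U x \<partial>lborel)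
            - 2 * (\<integral>x. indicat_real U x * indicat_real U (x + X k) \<partial>lborel)"
          using i iX iU by simp
        finally show ?thesis using integral_translate[of "indicat_real U" "X k"] by simp
      qed
      have "(\<lambda>k. \<integral>x. indicat_real U x * indicat_real U (x + X k) \<partial>lborel) \<longlonglongrightarrow> (\<integral>x. indicat_real U x \<partial>lborel)"
      proof (rule integral_dominated_convergence[OF _ _ iU])
        show "AE x in lborel. (\<lambda>k. indicat_real U x * indicat_real U (x + X k)) \<longlonglongrightarrow> indicat_real U x"
        proof (rule AE_I2)
          fix x
          show "(\<lambda>k. indicat_real U x * indicat_real U (x + X k)) \<longlonglongrightarrow> indicat_real U x"
          proof (cases "x \<in> U")
            case True
            have "(\<lambda>k. x + X k) \<longlonglongrightarrow> x + 0" by (intro tendsto_intros X)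
            then have "\<forall>\<^sub>F k in sequentially. x + X k \<in> U"
              using topological_tendstoD[OF _ U(1)] True by auto
            then have "\<forall>\<^sub>F k in sequentially. 1 = indicat_real U x * indicat_real U (x + X k)"
              by eventually_elim (use True in simp)
            then show ?thesis using True by (simp add: Lim_transform_eventually[OF tendsto_const])
          qed simp
        qed
      qed (auto split: split_indicator)
      then have "(\<lambda>k. 2 * ((\<integral>x. indicat_real U x \<partial>lborel) - (\<integral>x. indicat_real U x * indicat_real U (x + X k) \<partial>lborel)))
          \<longlonglongrightarrow> 2 * ((\<integral>x. indicat_real U x \<partial>lborel) - (\<integral>x. indicat_real U x \<partial>lborel))"
        by (intro tendsto_intros)
      then show "((\<lambda>y. \<integral>x. \<bar>indicat_real U (x + y) - indicat_real U x\<bar> \<partial>lborel) \<circ> X) \<longlonglongrightarrow> 0"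
        by (simp add: eq o_def)
    qed
    from tendstoD[OF this \<delta>]
    show "\<forall>\<^sub>F y in at 0. dist (\<integral>x. \<bar>indicat_real A (x + y) *\<^sub>R c - indicat_real A x *\<^sub>R c\<bar> \<partial>lborel) 0 < e"
    proof eventually_elim
      case (elim y)
      have iy: "integrable lborel (\<lambda>x. \<bar>indicat_real U (x + y) - indicat_real U x\<bar>)"
        using iU integrable_translate[OF iU, of y] by simp
      have iy2: "integrable lborel (\<lambda>x. indicat_real (U - A) (x + y))"
        by (intro integrable_translate iUA)
      have "(\<integral>x. \<bar>indicat_real A (x + y) *\<^sub>R c - indicat_real A x *\<^sub>R c\<bar> \<partial>lborel) \<le>
         (\<integral>x. \<bar>c\<bar> * (\<bar>indicat_real U (x + y) - indicat_real U x\<bar> + indicat_real (U - A) (x + y) + indicat_real (U - A) x) \<partial>lborel)"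
        using iy iy2 iUA iA U(2) integrable_translate[OF iA, of y]
        by (intro integral_mono) (auto split: split_indicator)
      also have "\<dots> = \<bar>c\<bar> * ((\<integral>x. \<bar>indicat_real U (x + y) - indicat_real U x\<bar> \<partial>lborel) +
          2 * (\<integral>x. indicat_real (U - A) x \<partial>lborel))"
        using iy iy2 iUA integral_translate[of "indicat_real (U - A)" y] by simp
      also have "\<dots> \<le> \<bar>c\<bar> * (\<delta> + 2 * \<delta>)"
        using elim \<open>(\<integral>x. indicat_real (U - A) x \<partial>lborel) < \<delta>\<close>
        by (intro mult_left_mono) auto
      also have "\<dots> < e"
      proof -
        have "4 * (\<bar>c\<bar> + 1) * \<delta> = e" by (simp add: \<delta>_def)
        moreover have "\<bar>c\<bar> * (\<delta> + 2 * \<delta>) = 4 * (\<bar>c\<bar> + 1) * \<delta> - \<bar>c\<bar> * \<delta> - 4 * \<delta>"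
          by (simp add: algebra_simps)
        ultimately show ?thesis using \<delta> mult_nonneg_nonneg[of "\<bar>c\<bar>" \<delta>] by linarith
      qed
      finally show ?case by (simp add: dist_real_def)
    qed
  qed
next
  case (add f g)
  have s: "((\<lambda>y. (\<integral>x. \<bar>f (x + y) - f x\<bar> \<partial>lborel) + (\<integral>x. \<bar>g (x + y) - g x\<bar> \<partial>lborel)) \<longlongrightarrow> 0) (at 0)"
    using tendsto_add[OF add.IH] by simp
  have le: "(\<integral>x. \<bar>f (x + y) + g (x + y) - (f x + g x)\<bar> \<partial>lborel) \<le>
      (\<integral>x. \<bar>f (x + y) - f x\<bar> \<partial>lborel) + (\<integral>x. \<bar>g (x + y) - g x\<bar> \<partial>lborel)" for y
  proof -
    have i: "integrable lborel (\<lambda>x. \<bar>f (x + y) - f x\<bar>)" "integrable lborel (\<lambda>x. \<bar>g (x + y) - g x\<bar>)"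
      using add.hyps integrable_translate[OF add.hyps(1), of y] integrable_translate[OF add.hyps(2), of y]
      by simp_all
    have "(\<integral>x. \<bar>f (x + y) + g (x + y) - (f x + g x)\<bar> \<partial>lborel) \<le>
      (\<integral>x. \<bar>f (x + y) - f x\<bar> + \<bar>g (x + y) - g x\<bar> \<partial>lborel)"
      using add.hyps i integrable_translate[OF add.hyps(1), of y] integrable_translate[OF add.hyps(2), of y]
      by (intro integral_mono) auto
    then show ?thesis using i by simp
  qed
  show ?case by (rule tendsto_zero_le[OF s]) (use le in auto)
next
  case (lim f s)
  show ?case
  proof (rule tendstoI)
    fix e :: real assume e: "e > 0"
    have "(\<lambda>i. \<integral>x. norm (s i x - f x) \<partial>lborel) \<longlonglongrightarrow> (\<integral>x. 0 \<partial>(lborel :: (real ^ 'n) measure))"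
    proof (rule integral_dominated_convergence[where w = "\<lambda>x. 3 * norm (f x)"])
      show "integrable lborel (\<lambda>x. 3 * norm (f x))" using lim by simp
      show "AE x in lborel. (\<lambda>i. norm (s i x - f x)) \<longlonglongrightarrow> 0"
        using lim.hyps(2) by (intro AE_I2 tendsto_norm_zero) (simp add: LIM_zero)
      show "AE x in lborel. norm (norm (s i x - f x)) \<le> 3 * norm (f x)" for i
      proof (rule AE_I2)
        fix x
        show "norm (norm (s i x - f x)) \<le> 3 * norm (f x)"
          using lim.hyps(3)[of x i] norm_triangle_ineq4[of "s i x" "f x"] by simp
      qed
    qed (use lim.hyps in auto)
    then have "(\<lambda>i. \<integral>x. norm (s i x - f x) \<partial>lborel) \<longlonglongrightarrow> 0" by simp
    moreover have "0 < e / 3" using e by simp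
    ultimately have "\<forall>\<^sub>F i in sequentially. (\<integral>x. norm (s i x - f x) \<partial>lborel) < e / 3"
      by (rule order_tendstoD(2))
    then obtain i where i: "(\<integral>x. norm (s i x - f x) \<partial>lborel) < e / 3"
      using eventually_happens'[OF sequentially_bot] by blast
    have "0 < e / 3" using e by simp
    from tendstoD[OF lim.IH[of i] this]
    show "\<forall>\<^sub>F y in at 0. dist (\<integral>x. \<bar>f (x + y) - f x\<bar> \<partial>lborel) 0 < e"
    proof eventually_elim
      case (elim y)
      have i1: "integrable lborel (\<lambda>x. \<bar>s i (x + y) - s i x\<bar>)"
        using lim.hyps(1) integrable_translate[OF lim.hyps(1), of i y] by simp
      have i2: "integrable lborel (\<lambda>x. norm (s i x - f x))"
        using lim.hyps by auto
      have i3: "integrable lborel (\<lambda>x. norm (s i (x + y) - f (x + y)))"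
        by (rule integrable_translate[OF i2])
      have "(\<integral>x. \<bar>f (x + y) - f x\<bar> \<partial>lborel) \<le>
        (\<integral>x. norm (s i (x + y) - f (x + y)) + \<bar>s i (x + y) - s i x\<bar> + norm (s i x - f x) \<partial>lborel)"
        using i1 i2 i3 lim.hyps(4) integrable_translate[OF lim.hyps(4), of y]
        by (intro integral_mono) auto
      also have "\<dots> = (\<integral>x. \<bar>s i (x + y) - s i x\<bar> \<partial>lborel) + 2 * (\<integral>x. norm (s i x - f x) \<partial>lborel)"
        using i1 i2 i3 integral_translate[OF borel_measurable_integrable[OF i2, simplified], of y] by simp
      finally show ?case using elim i by (simp add: dist_real_def)
    qed
  qed
qed

text \<open>The inequality \<open>(a - b)^2 \<le> 2 * \<bar>a * \<bar>a\<bar> - b *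
  \<bar>b\<bar>\<bar>\<close> reduces the claim to continuity of translations in L^1 for the signed
  square \<open>f * \<bar>f\<bar>\<close>.\<close>

lemma L2_translate_continuous:
  fixes f :: "real ^ 'n::finite \<Rightarrow> real"
  assumes f: "f \<in> L2"
  shows "((\<lambda>y. L2_norm (\<lambda>x. f (x + y) - f x)) \<longlongrightarrow> 0) (at 0)"
proof -
  have sq: "(a - b)\<^sup>2 \<le> 2 * \<bar>a * \<bar>a\<bar> - b * \<bar>b\<bar>\<bar>" for a b :: real
  proof (cases "0 \<le> a * b")
    case True
    have "(a - b)\<^sup>2 \<le> \<bar>a * a - b * b\<bar>"
    proof -
      have "\<bar>a - b\<bar> \<le> \<bar>a + b\<bar>" using True by (auto simp: zero_le_mult_iff abs_if)
      then have "\<bar>a - b\<bar> * \<bar>a - b\<bar> \<le> \<bar>a - b\<bar> * \<bar>a + b\<bar>" by (intro mult_left_mono) auto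
      also have "\<dots> = \<bar>a * a - b * b\<bar>" unfolding abs_mult[symmetric] by (simp add: algebra_simps)
      finally show ?thesis by (simp add: power2_eq_square)
    qed
    also have "\<dots> = \<bar>a * \<bar>a\<bar> - b * \<bar>b\<bar>\<bar>" using True
      by (auto simp: zero_le_mult_iff abs_if intro: mult_neg_neg)
    finally show ?thesis by (rule order_trans) simp
  next
    case False
    have "(a - b)\<^sup>2 \<le> 2 * (a * a + b * b)"
      using zero_le_power2[of "a + b"] by (simp add: power2_eq_square algebra_simps)
    also have "a * a + b * b = \<bar>a * \<bar>a\<bar> - b * \<bar>b\<bar>\<bar>"
    proof -
      have "(a < 0 \<and> 0 < b) \<or> (0 < a \<and> b < 0)" using False by (auto simp: not_le mult_less_0_iff)
      then show ?thesis
      proof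
        assume "a < 0 \<and> 0 < b"
        then have "a * \<bar>a\<bar> - b * \<bar>b\<bar> = - (a * a + b * b)" by simp
        then show ?thesis using zero_le_square[of a] zero_le_square[of b] by linarith
      next
        assume "0 < a \<and> b < 0"
        then have "a * \<bar>a\<bar> - b * \<bar>b\<bar> = a * a + b * b" by simp
        then show ?thesis using zero_le_square[of a] zero_le_square[of b] by linarith
      qed
    qed
    finally show ?thesis .
  qed
  have [measurable]: "f \<in> borel_measurable borel" using f by (rule L2_measurable)
  have int: "integrable lborel (\<lambda>x. f x * \<bar>f x\<bar>)"
    by (rule Bochner_Integration.integrable_bound[OF L2_integrable_square[OF f]])
      (auto simp: abs_mult power2_eq_square)
  let ?D = "\<lambda>y. \<integral>x. \<bar>f (x + y) * \<bar>f (x + y)\<bar> - f x * \<bar>f x\<bar>\<bar> \<partial>lborel"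
  have "(?D \<longlongrightarrow> 0) (at 0)" by (rule integrable_translate_continuous[OF int])
  then have "((\<lambda>y. sqrt (2 * ?D y)) \<longlongrightarrow> sqrt (2 * 0)) (at 0)" by (intro tendsto_intros)
  then have s: "((\<lambda>y. sqrt (2 * ?D y)) \<longlongrightarrow> 0) (at 0)" by simp
  have le: "L2_norm (\<lambda>x. f (x + y) - f x) \<le> sqrt (2 * ?D y)" for y
  proof -
    have "(\<integral>x. (f (x + y) - f x)\<^sup>2 \<partial>lborel) \<le> (\<integral>x. 2 * \<bar>f (x + y) * \<bar>f (x + y)\<bar> - f x * \<bar>f x\<bar>\<bar> \<partial>lborel)"
    proof (rule integral_mono)
      show "integrable lborel (\<lambda>x. 2 * \<bar>f (x + y) * \<bar>f (x + y)\<bar> - f x * \<bar>f x\<bar>\<bar>)"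
        using int integrable_translate[OF int, of y] by simp
    qed (use L2_integrable_square[OF L2_diff[OF L2_translate[OF f, of y] f]] sq in auto)
    then show ?thesis unfolding L2_norm_def by simp
  qed
  show ?thesis by (rule tendsto_zero_le[OF s]) (use le in auto)
qed

section \<open>Limits and derivatives in the mean\<close>

text \<open>Membership of \<open>F h\<close> in L^2 is only asked eventually, because quotients in
  time make sense only for steps that stay in the interval.\<close>

definition L2_lim :: "('a \<Rightarrow> real ^ 'n \<Rightarrow> real) \<Rightarrow> (real ^ 'n \<Rightarrow> real) \<Rightarrow> 'a filter \<Rightarrow> bool" where
  "L2_lim F f \<FF> \<longleftrightarrow> f \<in> L2 \<and> (\<forall>\<^sub>F h in \<FF>. F h \<in> L2) \<and>
     ((\<lambda>h. L2_norm (\<lambda>x. F h x - f x)) \<longlongrightarrow> 0) \<FF>"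

lemma L2_limI:
  "f \<in> L2 \<Longrightarrow> \<forall>\<^sub>F h in \<FF>. F h \<in> L2 \<Longrightarrow> ((\<lambda>h. L2_norm (\<lambda>x. F h x - f x)) \<longlongrightarrow> 0) \<FF> \<Longrightarrow> L2_lim F f \<FF>"
  by (simp add: L2_lim_def)

lemma L2_lim_in [dest]: "L2_lim F f \<FF> \<Longrightarrow> f \<in> L2"
  by (simp add: L2_lim_def)

lemma L2_limI_bound:
  assumes "f \<in> L2" "\<forall>\<^sub>F h in \<FF>. F h \<in> L2" "(b \<longlongrightarrow> 0) \<FF>"
    "\<forall>\<^sub>F h in \<FF>. L2_norm (\<lambda>x. F h x - f x) \<le> b h"
  shows "L2_lim F f \<FF>"
  using assms(1,2) by (rule L2_limI) (rule tendsto_zero_le[OF assms(3)], use assms(4) in simp)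

lemma L2_lim_const [simp]: "f \<in> L2 \<Longrightarrow> L2_lim (\<lambda>_. f) f \<FF>"
  by (simp add: L2_lim_def)

lemma L2_lim_mono: "L2_lim F f \<FF> \<Longrightarrow> \<GG> \<le> \<FF> \<Longrightarrow> L2_lim F f \<GG>"
  unfolding L2_lim_def by (auto intro: tendsto_mono filter_leD)

lemma L2_lim_add:
  assumes F: "L2_lim F f \<FF>" and G: "L2_lim G g \<FF>"
  shows "L2_lim (\<lambda>h x. F h x + G h x) (\<lambda>x. f x + g x) \<FF>"
proof (rule L2_limI_bound)
  have ev: "\<forall>\<^sub>F h in \<FF>. F h \<in> L2" "\<forall>\<^sub>F h in \<FF>. G h \<in> L2" using F G by (auto simp: L2_lim_def)
  show "(\<lambda>x. f x + g x) \<in> L2" using F G by auto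
  show "\<forall>\<^sub>F h in \<FF>. (\<lambda>x. F h x + G h x) \<in> L2" using ev by eventually_elim simp
  show "((\<lambda>h. L2_norm (\<lambda>x. F h x - f x) + L2_norm (\<lambda>x. G h x - g x)) \<longlongrightarrow> 0) \<FF>"
    using F G unfolding L2_lim_def by (intro tendsto_add_zero) auto
  show "\<forall>\<^sub>F h in \<FF>. L2_norm (\<lambda>x. F h x + G h x - (f x + g x)) \<le>
      L2_norm (\<lambda>x. F h x - f x) + L2_norm (\<lambda>x. G h x - g x)"
    using ev
  proof eventually_elim
    case (elim h)
    then show ?case
      using L2_norm_triangle[of "\<lambda>x. F h x - f x" "\<lambda>x. G h x - g x"] L2_lim_in[OF F] L2_lim_in[OF G]
      by (simp add: algebra_simps)
  qed
qed

lemma L2_lim_cmult: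
  assumes F: "L2_lim F f \<FF>" shows "L2_lim (\<lambda>h x. c * F h x) (\<lambda>x. c * f x) \<FF>"
proof (rule L2_limI)
  show "(\<lambda>x. c * f x) \<in> L2" using F by auto
  show "\<forall>\<^sub>F h in \<FF>. (\<lambda>x. c * F h x) \<in> L2"
    using F unfolding L2_lim_def by (auto elim: eventually_mono)
  show "((\<lambda>h. L2_norm (\<lambda>x. c * F h x - c * f x)) \<longlongrightarrow> 0) \<FF>"
    using F tendsto_mult_left[of _ 0 \<FF> "\<bar>c\<bar>"]
    by (simp add: L2_lim_def right_diff_distrib[symmetric])
qed

lemma L2_lim_uminus: "L2_lim F f \<FF> \<Longrightarrow> L2_lim (\<lambda>h x. - F h x) (\<lambda>x. - f x) \<FF>"
  using L2_lim_cmult[of F f \<FF> "-1"] by simp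

lemma L2_lim_diff:
  "L2_lim F f \<FF> \<Longrightarrow> L2_lim G g \<FF> \<Longrightarrow> L2_lim (\<lambda>h x. F h x - G h x) (\<lambda>x. f x - g x) \<FF>"
  using L2_lim_add[OF _ L2_lim_uminus, of F f \<FF> G g] by simp

lemma L2_lim_sum:
  "(\<And>i. i \<in> I \<Longrightarrow> L2_lim (F i) (f i) \<FF>) \<Longrightarrow> L2_lim (\<lambda>h x. \<Sum>i\<in>I. F i h x) (\<lambda>x. \<Sum>i\<in>I. f i x) \<FF>"
  by (induction I rule: infinite_finite_induct) (auto simp: L2_lim_add)

lemma L2_lim_cong:
  assumes "L2_lim F f \<FF>" "\<forall>\<^sub>F h in \<FF>. G h \<in> borel_measurable borel \<and> (AE x in lborel. F h x = G h x)"
    "g \<in> borel_measurable borel" "AE x in lborel. f x = g x"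
  shows "L2_lim G g \<FF>"
proof (rule L2_limI)
  have f: "f \<in> L2" using assms(1) by auto
  show g: "g \<in> L2" using L2_cong_AE[OF f assms(3,4)] .
  have ev: "\<forall>\<^sub>F h in \<FF>. F h \<in> L2" using assms(1) by (simp add: L2_lim_def)
  show "\<forall>\<^sub>F h in \<FF>. G h \<in> L2"
    using ev assms(2) by eventually_elim (auto intro: L2_cong_AE)
  have "\<forall>\<^sub>F h in \<FF>. L2_norm (\<lambda>x. F h x - f x) = L2_norm (\<lambda>x. G h x - g x)"
    using ev assms(2)
  proof eventually_elim
    case (elim h)
    show ?case
    proof (rule L2_norm_cong_AE)
      show "AE x in lborel. F h x - f x = G h x - g x"
        using elim(2) assms(4) by (auto elim: eventually_elim2)
    qed (use elim f g in \<open>auto intro!: borel_measurable_diff simp: L2_measurable assms(3)\<close>)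
  qed
  then show "((\<lambda>h. L2_norm (\<lambda>x. G h x - g x)) \<longlongrightarrow> 0) \<FF>"
    using assms(1) by (auto simp: L2_lim_def elim: Lim_transform_eventually)
qed

lemma L2_lim_norm:
  assumes F: "L2_lim F f \<FF>" shows "((\<lambda>h. L2_norm (F h)) \<longlongrightarrow> L2_norm f) \<FF>"
proof (rule LIM_zero_cancel, rule tendsto_zero_le)
  show "((\<lambda>h. L2_norm (\<lambda>x. F h x - f x)) \<longlongrightarrow> 0) \<FF>" using F by (simp add: L2_lim_def)
  have "\<forall>\<^sub>F h in \<FF>. F h \<in> L2" using F by (simp add: L2_lim_def)
  then show "\<forall>\<^sub>F h in \<FF>. \<bar>L2_norm (F h) - L2_norm f\<bar> \<le> L2_norm (\<lambda>x. F h x - f x)"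
    by eventually_elim (use L2_norm_triangle_ineq2 L2_lim_in[OF F] in auto)
qed

lemma L2_lim_norm_bound:
  assumes F: "L2_lim F f \<FF>" "\<FF> \<noteq> bot" "\<forall>\<^sub>F h in \<FF>. L2_norm (F h) \<le> M"
  shows "L2_norm f \<le> M"
  using tendsto_upperbound[OF L2_lim_norm[OF F(1)] F(3,2)] .

lemma L2_lim_inner:
  assumes F: "L2_lim F f \<FF>" and G: "L2_lim G g \<FF>"
  shows "((\<lambda>h. L2_inner (F h) (G h)) \<longlongrightarrow> L2_inner f g) \<FF>"
proof (rule LIM_zero_cancel, rule tendsto_zero_le)
  note f = L2_lim_in[OF F] and g = L2_lim_in[OF G]
  let ?b = "\<lambda>h. L2_norm (\<lambda>x. F h x - f x) * L2_norm (G h) + L2_norm f * L2_norm (\<lambda>x. G h x - g x)"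
  have "(?b \<longlongrightarrow> 0 * L2_norm g + L2_norm f * 0) \<FF>"
    using F G by (intro tendsto_intros L2_lim_norm) (auto simp: L2_lim_def)
  then show "(?b \<longlongrightarrow> 0) \<FF>" by simp
  have "\<forall>\<^sub>F h in \<FF>. F h \<in> L2" "\<forall>\<^sub>F h in \<FF>. G h \<in> L2" using F G by (auto simp: L2_lim_def)
  then show "\<forall>\<^sub>F h in \<FF>. \<bar>L2_inner (F h) (G h) - L2_inner f g\<bar> \<le> ?b h"
  proof eventually_elim
    case (elim h)
    have "L2_inner (F h) (G h) - L2_inner f g =
        L2_inner (\<lambda>x. F h x - f x) (G h) + L2_inner f (\<lambda>x. G h x - g x)"
      using elim f g by (simp add: L2_inner_diff_left L2_inner_diff_right)
    then show ?case
      using L2_Cauchy_Schwarz[of "\<lambda>x. F h x - f x" "G h"] L2_Cauchy_Schwarz[of f "\<lambda>x. G h x - g x"] elim f g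
      by simp
  qed
qed

lemma L2_lim_unique:
  assumes F: "L2_lim F f \<FF>" and G: "L2_lim F g \<FF>" and "\<FF> \<noteq> bot"
  shows "AE x in lborel. f x = g x"
proof -
  have "L2_lim (\<lambda>h x. F h x - F h x) (\<lambda>x. f x - g x) \<FF>" by (rule L2_lim_diff[OF F G])
  then have "L2_norm (\<lambda>x. f x - g x) \<le> 0"
    by (rule L2_lim_norm_bound[OF _ assms(3)]) simp
  then have "L2_norm (\<lambda>x. f x - g x) = 0" using L2_norm_nonneg[of "\<lambda>x. f x - g x"] by linarith
  then have "AE x in lborel. f x - g x = 0"
    using L2_norm_zero_AE[of "\<lambda>x. f x - g x"] L2_lim_in[OF F] L2_lim_in[OF G] by simp
  then show ?thesis by simp
qed

lemma L2_lim_translate: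
  assumes F: "L2_lim F f \<FF>" shows "L2_lim (\<lambda>h x. F h (x + y)) (\<lambda>x. f (x + y)) \<FF>"
proof (rule L2_limI_bound)
  have ev: "\<forall>\<^sub>F h in \<FF>. F h \<in> L2" using F by (simp add: L2_lim_def)
  show "(\<lambda>x. f (x + y)) \<in> L2" using F by auto
  show "\<forall>\<^sub>F h in \<FF>. (\<lambda>x. F h (x + y)) \<in> L2" using ev by eventually_elim simp
  show "((\<lambda>h. L2_norm (\<lambda>x. F h x - f x)) \<longlongrightarrow> 0) \<FF>" using F by (simp add: L2_lim_def)
  show "\<forall>\<^sub>F h in \<FF>. L2_norm (\<lambda>x. F h (x + y) - f (x + y)) \<le> L2_norm (\<lambda>x. F h x - f x)"
    using ev by eventually_elim (use L2_lim_in[OF F] L2_norm_translate[of "\<lambda>x. F _ x - f x" y] in auto)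
qed

lemma L2_lim_bounded_mult:
  assumes F: "L2_lim F f \<FF>" and a: "a \<in> borel_measurable borel" "AE x in lborel. \<bar>a x\<bar> \<le> M"
  shows "L2_lim (\<lambda>h x. a x * F h x) (\<lambda>x. a x * f x) \<FF>"
proof (rule L2_limI_bound)
  note f = L2_lim_in[OF F]
  have ev: "\<forall>\<^sub>F h in \<FF>. F h \<in> L2" using F by (simp add: L2_lim_def)
  show "(\<lambda>x. a x * f x) \<in> L2" using L2_norm_bounded_mult(1)[OF f a] .
  show "\<forall>\<^sub>F h in \<FF>. (\<lambda>x. a x * F h x) \<in> L2"
    using ev by eventually_elim (use L2_norm_bounded_mult(1)[OF _ a] in blast)
  show "((\<lambda>h. \<bar>M\<bar> * L2_norm (\<lambda>x. F h x - f x)) \<longlongrightarrow> 0) \<FF>"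
    using F tendsto_mult_left[of _ 0 \<FF> "\<bar>M\<bar>"] by (simp add: L2_lim_def)
  show "\<forall>\<^sub>F h in \<FF>. L2_norm (\<lambda>x. a x * F h x - a x * f x) \<le> \<bar>M\<bar> * L2_norm (\<lambda>x. F h x - f x)"
    using ev
  proof eventually_elim
    case (elim h)
    show ?case using L2_norm_bounded_mult(2)[OF L2_diff[OF elim f] a] by (simp add: right_diff_distrib)
  qed
qed

section \<open>Differentiable paths in the space of square integrable functions\<close>

definition L2_deriv :: "(real \<Rightarrow> real ^ 'n \<Rightarrow> real) \<Rightarrow> (real ^ 'n \<Rightarrow> real) \<Rightarrow> real \<Rightarrow> real set \<Rightarrow> bool" where
  "L2_deriv k k' t S \<longleftrightarrow> k t \<in> L2 \<and> L2_lim (\<lambda>s x. (k s x - k t x) / (s - t)) k' (at t within S)"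

lemma L2_deriv_add:
  "L2_deriv k k' t S \<Longrightarrow> L2_deriv l l' t S \<Longrightarrow> L2_deriv (\<lambda>s x. k s x + l s x) (\<lambda>x. k' x + l' x) t S"
  unfolding L2_deriv_def using L2_lim_add[of "\<lambda>s x. (k s x - k t x) / (s - t)" k' "at t within S"
      "\<lambda>s x. (l s x - l t x) / (s - t)" l']
  by (auto simp: diff_divide_distrib add_divide_distrib algebra_simps)

lemma L2_deriv_cmult:
  "L2_deriv k k' t S \<Longrightarrow> L2_deriv (\<lambda>s x. c * k s x) (\<lambda>x. c * k' x) t S"
  unfolding L2_deriv_def using L2_lim_cmult[of "\<lambda>s x. (k s x - k t x) / (s - t)" k' "at t within S" c]
  by (auto simp: right_diff_distrib diff_divide_distrib)

lemma L2_deriv_diff: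
  "L2_deriv k k' t S \<Longrightarrow> L2_deriv l l' t S \<Longrightarrow> L2_deriv (\<lambda>s x. k s x - l s x) (\<lambda>x. k' x - l' x) t S"
  using L2_deriv_add[OF _ L2_deriv_cmult[of l l' t S "-1"], of k k'] by simp

lemma L2_deriv_const: "f \<in> L2 \<Longrightarrow> L2_deriv (\<lambda>_. f) (\<lambda>_. 0) t S"
  by (simp add: L2_deriv_def)

lemma L2_deriv_subset: "L2_deriv k k' t S \<Longrightarrow> T \<subseteq> S \<Longrightarrow> L2_deriv k k' t T"
  unfolding L2_deriv_def by (auto intro: L2_lim_mono at_le)

lemma L2_deriv_imp_lim:
  assumes D: "L2_deriv k k' t S"
  shows "L2_lim k (k t) (at t within S)"
proof -
  have kt: "k t \<in> L2" and L: "L2_lim (\<lambda>s x. (k s x - k t x) / (s - t)) k' (at t within S)"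
    using D by (auto simp: L2_deriv_def)
  have ne: "\<forall>\<^sub>F s in at t within S. s \<noteq> t" by (simp add: eventually_at_filter)
  have ev: "\<forall>\<^sub>F s in at t within S. k s \<in> L2"
    using L[unfolded L2_lim_def, THEN conjunct2, THEN conjunct1] ne
  proof eventually_elim
    case (elim s)
    have "(\<lambda>x. (s - t) * ((k s x - k t x) / (s - t)) + k t x) \<in> L2"
      by (rule L2_add[OF L2_cmult[OF elim(1)] kt])
    then show ?case using elim by simp
  qed
  show ?thesis
  proof (rule L2_limI_bound[OF kt ev])
    have "((\<lambda>s. s - t) \<longlongrightarrow> t - t) (at t within S)" by (intro tendsto_intros)
    then have "((\<lambda>s. \<bar>s - t\<bar> * L2_norm (\<lambda>x. (k s x - k t x) / (s - t))) \<longlongrightarrow> \<bar>0\<bar> * L2_norm k') (at t within S)"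
      by (intro tendsto_mult tendsto_rabs L2_lim_norm L) simp
    then show "((\<lambda>s. \<bar>s - t\<bar> * L2_norm (\<lambda>x. (k s x - k t x) / (s - t))) \<longlongrightarrow> 0) (at t within S)" by simp
    show "\<forall>\<^sub>F s in at t within S. L2_norm (\<lambda>x. k s x - k t x) \<le> \<bar>s - t\<bar> * L2_norm (\<lambda>x. (k s x - k t x) / (s - t))"
      using ne by eventually_elim (simp add: L2_norm_divide[of "\<lambda>x. k _ x - k t x"])
  qed
qed

lemma L2_deriv_inner:
  assumes k: "L2_deriv k k' t S" and l: "L2_deriv l l' t S"
  shows "((\<lambda>s. L2_inner (k s) (l s)) has_real_derivative (L2_inner k' (l t) + L2_inner (k t) l')) (at t within S)"
proof -
  have kt: "k t \<in> L2" "l t \<in> L2" using k l by (auto simp: L2_deriv_def)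
  have lim: "L2_lim k (k t) (at t within S)" "L2_lim l (l t) (at t within S)"
    using k l by (auto intro: L2_deriv_imp_lim)
  have "((\<lambda>s. L2_inner (\<lambda>x. (k s x - k t x) / (s - t)) (l s) + L2_inner (k t) (\<lambda>x. (l s x - l t x) / (s - t)))
      \<longlongrightarrow> L2_inner k' (l t) + L2_inner (k t) l') (at t within S)"
    using k l kt by (intro tendsto_add L2_lim_inner lim) (auto simp: L2_deriv_def)
  moreover have "\<forall>\<^sub>F s in at t within S.
      L2_inner (\<lambda>x. (k s x - k t x) / (s - t)) (l s) + L2_inner (k t) (\<lambda>x. (l s x - l t x) / (s - t)) =
      (L2_inner (k s) (l s) - L2_inner (k t) (l t)) / (s - t)"
    using lim[THEN L2_lim_def[THEN iffD1], THEN conjunct2, THEN conjunct1]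
  proof eventually_elim
    case (elim s)
    then show ?case using kt
      by (simp add: L2_inner_commute[of "k t"] L2_inner_diff_left L2_inner_diff_right diff_divide_distrib)
  qed
  ultimately show ?thesis
    unfolding has_field_derivative_iff by (rule Lim_transform_eventually)
qed

text \<open>Pairing the path with its own increment \<open>\<psi>\<close> gives a real function, to
  which the scalar mean value theorem applies; Cauchy-Schwarz then allows one factor
  \<open>L2_norm \<psi>\<close> to be cancelled.\<close>

lemma L2_mean_value:
  assumes ab: "a \<le> b" and k: "\<And>t. t \<in> {a..b} \<Longrightarrow> L2_deriv k (k' t) t {a..b}"
    and M: "\<And>t. t \<in> {a..b} \<Longrightarrow> L2_norm (k' t) \<le> M"
  shows "L2_norm (\<lambda>x. k b x - k a x) \<le> M * (b - a)"
proof -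
  define \<psi> where "\<psi> = (\<lambda>x. k b x - k a x)"
  have ka: "k a \<in> L2" "k b \<in> L2" using k[of a] k[of b] ab by (auto simp: L2_deriv_def)
  then have \<psi>: "\<psi> \<in> L2" by (simp add: \<psi>_def)
  have D: "((\<lambda>s. L2_inner (k s) \<psi>) has_derivative (*) (L2_inner (k' t) \<psi>)) (at t within {a..b})" if "t \<in> {a..b}" for t
    using L2_deriv_inner[OF k[OF that] L2_deriv_const[OF \<psi>]]
    by (simp add: has_field_derivative_def L2_inner_commute[of "k t" "\<lambda>_. 0"])
  obtain \<xi> where \<xi>: "\<xi> \<in> {a..b}" "L2_inner (k b) \<psi> - L2_inner (k a) \<psi> = L2_inner (k' \<xi>) \<psi> * (b - a)"
    using mvt_very_simple[OF ab D] by auto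
  have k\<xi>: "k' \<xi> \<in> L2" using k[OF \<xi>(1)] by (auto simp: L2_deriv_def)
  have "L2_norm \<psi> * L2_norm \<psi> = L2_inner (k' \<xi>) \<psi> * (b - a)"
    using \<xi>(2) \<psi> ka by (simp add: power2_eq_square[symmetric] L2_norm_square \<psi>_def L2_inner_diff_left)
  also have "\<dots> \<le> (L2_norm (k' \<xi>) * L2_norm \<psi>) * (b - a)"
    using L2_Cauchy_Schwarz[OF k\<xi> \<psi>] ab by (intro mult_right_mono) auto
  also have "\<dots> \<le> (M * L2_norm \<psi>) * (b - a)"
    using M[OF \<xi>(1)] ab by (intro mult_right_mono) auto
  finally have "L2_norm \<psi> * L2_norm \<psi> \<le> (M * (b - a)) * L2_norm \<psi>" by (simp add: mult_ac)
  moreover have "0 \<le> M * (b - a)" using order_trans[OF L2_norm_nonneg M[OF \<xi>(1)]] ab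
    by (intro mult_nonneg_nonneg) auto
  ultimately show ?thesis unfolding \<psi>_def[symmetric]
    by (metis L2_norm_nonneg less_eq_real_def mult_le_cancel_right_pos)
qed

text \<open>The partial derivative as the derivative at 0 of the path of translates. In this form it
  shares product rule and mean value inequality with time derivatives.\<close>

definition strong_partial :: "'n::finite \<Rightarrow> (real ^ 'n \<Rightarrow> real) \<Rightarrow> (real ^ 'n \<Rightarrow> real) \<Rightarrow> bool" where
  "strong_partial j f g \<longleftrightarrow> L2_deriv (\<lambda>h x. f (x + h *\<^sub>R axis j 1)) g 0 UNIV"

lemma strong_partial_iff:
  "strong_partial j f g \<longleftrightarrow> f \<in> L2 \<and> L2_lim (\<lambda>h x. (f (x + h *\<^sub>R axis j 1) - f x) / h) g (at 0)"
  by (simp add: strong_partial_def L2_deriv_def)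

lemma strong_partial_in: "strong_partial j f g \<Longrightarrow> f \<in> L2" "strong_partial j f g \<Longrightarrow> g \<in> L2"
  by (auto simp: strong_partial_iff)

lemma strong_partial_translate:
  "strong_partial j f g \<Longrightarrow> strong_partial j (\<lambda>x. f (x + y)) (\<lambda>x. g (x + y))"
  using L2_lim_translate[of "\<lambda>h x. (f (x + h *\<^sub>R axis j 1) - f x) / h" g "at 0" y]
  by (simp add: strong_partial_iff add_ac)

lemma strong_partial_cmult:
  "strong_partial j f g \<Longrightarrow> strong_partial j (\<lambda>x. c * f x) (\<lambda>x. c * g x)"
  unfolding strong_partial_def by (rule L2_deriv_cmult)

lemma strong_partial_diff:
  "strong_partial j f g \<Longrightarrow> strong_partial j f' g' \<Longrightarrow> strong_partial j (\<lambda>x. f x - f' x) (\<lambda>x. g x - g' x)"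
  unfolding strong_partial_def by (rule L2_deriv_diff)

text \<open>Translation is an isometry, so differentiability of the path of translates at 0
  propagates to every \<open>t\<close>.\<close>

lemma strong_partial_path:
  assumes "strong_partial j f g"
  shows "L2_deriv (\<lambda>h x. f (x + h *\<^sub>R axis j 1)) (\<lambda>x. g (x + t *\<^sub>R axis j 1)) t UNIV"
proof -
  have f: "f \<in> L2" and L: "L2_lim (\<lambda>h x. (f (x + h *\<^sub>R axis j 1) - f x) / h) g (at 0)"
    using assms by (auto simp: strong_partial_iff)
  have "L2_lim (\<lambda>h x. (f (x + t *\<^sub>R axis j 1 + h *\<^sub>R axis j 1) - f (x + t *\<^sub>R axis j 1)) / h)
      (\<lambda>x. g (x + t *\<^sub>R axis j 1)) (at 0)"
    using L2_lim_translate[OF L, of "t *\<^sub>R axis j 1"] by simp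
  then show ?thesis
    using f unfolding L2_deriv_def L2_lim_def at_to_0[of t] filterlim_filtermap eventually_filtermap
    by (auto simp: scaleR_add_left add_ac)
qed

lemma strong_partial_mean_value:
  assumes "strong_partial j f g"
  shows "L2_norm (\<lambda>x. f (x + h *\<^sub>R axis j 1) - f x) \<le> \<bar>h\<bar> * L2_norm g"
proof -
  have fg: "f \<in> L2" "g \<in> L2" using strong_partial_in assms by auto
  have pos: "L2_norm (\<lambda>x. f (x + h *\<^sub>R axis j 1) - f x) \<le> h * L2_norm g" if "0 \<le> h" for h
  proof -
    have "L2_deriv (\<lambda>h x. f (x + h *\<^sub>R axis j 1)) (\<lambda>x. g (x + t *\<^sub>R axis j 1)) t {0..h}" for t
      by (rule L2_deriv_subset[OF strong_partial_path[OF assms]]) simp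
    then show ?thesis
      using L2_mean_value[of 0 h "\<lambda>h x. f (x + h *\<^sub>R axis j 1)" "\<lambda>t x. g (x + t *\<^sub>R axis j 1)" "L2_norm g"]
        that fg by (simp add: mult.commute)
  qed
  show ?thesis
  proof (cases "0 \<le> h")
    case False
    \<comment> \<open>A negative step becomes a positive one after translating the whole difference
      by \<open>- h\<close>.\<close>
    have "L2_norm (\<lambda>x. f (x + h *\<^sub>R axis j 1) - f x) =
        L2_norm (\<lambda>x. f (x + (- h) *\<^sub>R axis j 1 + h *\<^sub>R axis j 1) - f (x + (- h) *\<^sub>R axis j 1))"
      by (rule L2_norm_translate[symmetric, of "\<lambda>x. f (x + h *\<^sub>R axis j 1) - f x" "(- h) *\<^sub>R axis j 1"])
        (use fg in simp)
    also have "\<dots> = L2_norm (\<lambda>x. f (x + (- h) *\<^sub>R axis j 1) - f x)"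
      by (subst L2_norm_minus_commute) simp
    finally show ?thesis using pos[of "- h"] False by simp
  qed (use pos in auto)
qed

text \<open>Integration by parts without boundary terms: translating both factors leaves their inner
  product constant, so its derivative vanishes.\<close>

lemma strong_partial_inner:
  assumes fg: "strong_partial j f g" and kl: "strong_partial j k l"
  shows "L2_inner g k = - L2_inner f l"
proof -
  have in2: "f \<in> L2" "g \<in> L2" "k \<in> L2" "l \<in> L2" using strong_partial_in fg kl by auto
  have "((\<lambda>s. L2_inner (\<lambda>x. f (x + s *\<^sub>R axis j 1)) (\<lambda>x. k (x + s *\<^sub>R axis j 1)))
      has_real_derivative L2_inner g k + L2_inner f l) (at 0)"
    using L2_deriv_inner[OF fg[unfolded strong_partial_def] kl[unfolded strong_partial_def]] by simp
  moreover have "L2_inner (\<lambda>x. f (x + s *\<^sub>R axis j 1)) (\<lambda>x. k (x + s *\<^sub>R axis j 1)) = L2_inner f k" for s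
    using in2 by (subst L2_inner_translate) auto
  ultimately have "L2_inner g k + L2_inner f l = 0"
    using DERIV_unique[of "\<lambda>_. L2_inner f k" _ 0 0] by simp
  then show ?thesis by simp
qed

section \<open>Weak derivatives are strong derivatives\<close>

lemma L2_locally_integrable:
  fixes f :: "real ^ 'n \<Rightarrow> real"
  assumes f: "f \<in> L2"
  shows "locally_integrable f"
  unfolding locally_integrable_def
proof (intro allI impI)
  fix K :: "(real ^ 'n) set" assume K: "compact K"
  have [measurable]: "f \<in> borel_measurable borel" "K \<in> sets borel"
    by (fact L2_measurable[OF f], fact borel_compact[OF K])
  have "integrable lborel (\<lambda>x. indicat_real K x)"
    by (rule integrable_real_indicator[OF _ emeasure_compact_finite[OF K]]) simp
  then have "integrable lborel (\<lambda>x. (f x)\<^sup>2 + indicat_real K x)"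
    by (rule Bochner_Integration.integrable_add[OF L2_integrable_square[OF f]])
  then show "set_integrable lborel K f"
    unfolding set_integrable_def
  proof (rule Bochner_Integration.integrable_bound)
    have "\<bar>a\<bar> \<le> a\<^sup>2 + 1" for a :: real using abs_mult_le_squares[of a 1] by simp
    then show "AE x in lborel. norm (indicat_real K x *\<^sub>R f x) \<le> norm ((f x)\<^sup>2 + indicat_real K x)"
      by (intro AE_I2) (auto split: split_indicator)
  qed simp
qed

lemma test_function_continuous:
  assumes "test_function \<phi>" shows "continuous_on UNIV \<phi>"
proof -
  have "iterated_partial [] \<phi> differentiable (at x)" for x
    using assms unfolding test_function_def by blast
  then show ?thesis
    by (simp add: continuous_at_imp_continuous_on differentiable_imp_continuous_within)
qed

lemma test_function_L2:
  assumes \<phi>: "test_function \<phi>" shows "\<phi> \<in> L2"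
proof (rule L2I)
  have c: "continuous_on UNIV \<phi>" using \<phi> by (rule test_function_continuous)
  then show "\<phi> \<in> borel_measurable borel" by (rule borel_measurable_continuous_onI)
  define K where "K = closure {x. \<phi> x \<noteq> 0}"
  have K: "compact K" using \<phi> by (simp add: test_function_def K_def)
  have "integrable lborel (\<lambda>x. indicator K x *\<^sub>R (\<phi> x)\<^sup>2)"
    by (rule borel_integrable_compact[OF K])
      (intro continuous_intros continuous_on_subset[OF c] subset_UNIV)
  moreover have "indicator K x *\<^sub>R (\<phi> x)\<^sup>2 = (\<phi> x)\<^sup>2" for x
    using closure_subset[of "{x. \<phi> x \<noteq> 0}"] by (auto simp: K_def split: split_indicator)
  ultimately show "integrable lborel (\<lambda>x. (\<phi> x)\<^sup>2)" by (simp only:)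
qed

lemma partial_deriv_translate:
  assumes "\<phi> differentiable (at (x + y))"
  shows "partial_deriv j (\<lambda>x. \<phi> (x + y)) x = partial_deriv j \<phi> (x + y)"
proof -
  have 1: "(\<phi> has_derivative frechet_derivative \<phi> (at (x + y))) (at (x + y))"
    using assms by (simp add: frechet_derivative_works)
  have 2: "((\<lambda>x. x + y) has_derivative (\<lambda>v. v)) (at x)"
    by (auto intro!: derivative_eq_intros)
  show ?thesis
    unfolding partial_deriv_def frechet_derivative_at[OF has_derivative_compose[OF 2 1], symmetric] by simp
qed

lemma iterated_partial_translate:
  assumes "test_function \<phi>"
  shows "iterated_partial is (\<lambda>x. \<phi> (x + y)) = (\<lambda>x. iterated_partial is \<phi> (x + y))"
proof (induction "is")
  case (Cons j js)
  have "iterated_partial js \<phi> differentiable (at (x + y))" for x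
    using assms by (simp add: test_function_def)
  then show ?case using Cons by (auto intro!: ext partial_deriv_translate)
qed simp

lemma test_function_translate:
  assumes \<phi>: "test_function \<phi>" shows "test_function (\<lambda>x. \<phi> (x + y))"
proof -
  have d: "(\<lambda>x. iterated_partial is \<phi> (x + y)) differentiable (at x)" for "is" x
  proof -
    have "iterated_partial is \<phi> differentiable (at (x + y))" using \<phi> by (simp add: test_function_def)
    then have "(iterated_partial is \<phi> \<circ> (\<lambda>x. x + y)) differentiable (at x)"
      by (intro differentiable_chain_at) auto
    then show ?thesis by (simp add: o_def)
  qed
  have "{x. \<phi> (x + y) \<noteq> 0} \<subseteq> (\<lambda>x. x - y) ` closure {x. \<phi> x \<noteq> 0}"
  proof
    fix x assume "x \<in> {x. \<phi> (x + y) \<noteq> 0}"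
    then have "x + y \<in> closure {x. \<phi> x \<noteq> 0}" using closure_subset[of "{x. \<phi> x \<noteq> 0}"] by auto
    then show "x \<in> (\<lambda>x. x - y) ` closure {x. \<phi> x \<noteq> 0}" by (intro image_eqI[of _ _ "x + y"]) auto
  qed
  moreover have "bounded ((\<lambda>x. x - y) ` closure {x. \<phi> x \<noteq> 0})"
    using \<phi> unfolding test_function_def by (intro compact_imp_bounded compact_translation_subtract) blast
  ultimately have "compact (closure {x. \<phi> (x + y) \<noteq> 0})" by (meson bounded_subset compact_closure)
  then show ?thesis using d by (simp add: test_function_def iterated_partial_translate[OF \<phi>])
qed

lemma test_function_partial_deriv:
  assumes \<phi>: "test_function \<phi>" shows "test_function (partial_deriv j \<phi>)"
proof -
  have d: "iterated_partial is (partial_deriv j \<phi>) differentiable (at x)" for "is" x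
  proof -
    have "iterated_partial (is @ [j]) \<phi> differentiable (at x)"
      using \<phi> unfolding test_function_def by blast
    then show ?thesis by simp
  qed
  have "{x. partial_deriv j \<phi> x \<noteq> 0} \<subseteq> closure {x. \<phi> x \<noteq> 0}"
  proof (rule ccontr)
    assume "\<not> ?thesis"
    then obtain x where x: "partial_deriv j \<phi> x \<noteq> 0" "x \<notin> closure {x. \<phi> x \<noteq> 0}" by blast
    have "((\<lambda>_. 0) has_derivative (\<lambda>_. 0)) (at x)" by simp
    then have "(\<phi> has_derivative (\<lambda>_. 0)) (at x)"
      by (rule has_derivative_transform_within_open[of _ _ _ _ "- closure {x. \<phi> x \<noteq> 0}"])
        (use x closure_subset[of "{x. \<phi> x \<noteq> 0}"] in auto)
    then show False using x(1) frechet_derivative_at[of \<phi> "\<lambda>_. 0" x] unfolding partial_deriv_def by simp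
  qed
  moreover have "bounded (closure {x. \<phi> x \<noteq> 0})"
    using \<phi> unfolding test_function_def by (blast intro: compact_imp_bounded)
  ultimately have "compact (closure {x. partial_deriv j \<phi> x \<noteq> 0})" by (meson bounded_subset compact_closure)
  with d show ?thesis by (simp add: test_function_def)
qed

lemma test_function_line_integral:
  assumes \<phi>: "test_function \<phi>"
  shows "h * (LINT \<theta>:{0..1}|lborel. partial_deriv j \<phi> (x - (\<theta> * h) *\<^sub>R axis j 1)) =
    \<phi> x - \<phi> (x - h *\<^sub>R axis j 1)"
proof -
  let ?d = "\<lambda>\<theta>. partial_deriv j \<phi> (x - (\<theta> * h) *\<^sub>R axis j 1)"
  have d: "((\<lambda>\<theta>. \<phi> (x - (\<theta> * h) *\<^sub>R axis j 1)) has_vector_derivative (- h * ?d \<theta>)) (at \<theta> within {0..1})" for \<theta>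
  proof -
    have "iterated_partial [] \<phi> differentiable (at (x - (\<theta> * h) *\<^sub>R axis j 1))"
      using \<phi> unfolding test_function_def by blast
    then have D: "(\<phi> has_derivative frechet_derivative \<phi> (at (x - (\<theta> * h) *\<^sub>R axis j 1))) (at (x - (\<theta> * h) *\<^sub>R axis j 1))"
      by (simp add: frechet_derivative_works)
    have "((\<lambda>\<theta>. x - (\<theta> * h) *\<^sub>R axis j 1) has_derivative (\<lambda>t. (- h * t) *\<^sub>R axis j 1)) (at \<theta> within {0..1})"
      by (auto intro!: derivative_eq_intros)
    from has_derivative_compose[OF this D]
    have "((\<lambda>\<theta>. \<phi> (x - (\<theta> * h) *\<^sub>R axis j 1)) has_derivative
        (\<lambda>t. frechet_derivative \<phi> (at (x - (\<theta> * h) *\<^sub>R axis j 1)) ((- h * t) *\<^sub>R axis j 1))) (at \<theta> within {0..1})" .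
    moreover have "(\<lambda>t. frechet_derivative \<phi> (at (x - (\<theta> * h) *\<^sub>R axis j 1)) ((- h * t) *\<^sub>R axis j 1)) =
        (\<lambda>t. t *\<^sub>R (- h * ?d \<theta>))"
      unfolding partial_deriv_def by (rule ext, subst linear_scale[OF has_derivative_linear[OF D]]) simp
    ultimately show ?thesis unfolding has_vector_derivative_def by (simp only:)
  qed
  have cont: "continuous_on {0..1} ?d"
    by (rule continuous_on_compose2[OF test_function_continuous[OF test_function_partial_deriv[OF \<phi>]]])
      (auto intro!: continuous_intros)
  have "(LBINT \<theta>:{0..1}. - h * ?d \<theta>) = \<phi> (x - (1 * h) *\<^sub>R axis j 1) - \<phi> (x - (0 * h) *\<^sub>R axis j 1)"
    unfolding set_lebesgue_integral_def
    by (rule integral_FTC_Icc[OF _ d]) (auto intro!: continuous_intros cont)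
  then have "- h * (LBINT \<theta>:{0..1}. ?d \<theta>) = \<phi> (x - h *\<^sub>R axis j 1) - \<phi> x"
    unfolding set_integral_mult_right by simp
  then show ?thesis by simp
qed

abbreviation unit_interval_measure :: "real measure" where
  "unit_interval_measure \<equiv> uniform_measure lborel {0..1}"

lemma prob_space_unit_interval: "prob_space unit_interval_measure"
  by (rule prob_space_uniform_measure) auto

lemma integral_uniform_measure:
  fixes f :: "'a \<Rightarrow> real"
  assumes A: "A \<in> sets M" "emeasure M A = 1" and f: "f \<in> borel_measurable M"
  shows "(\<integral>x. f x \<partial>uniform_measure M A) = (LINT x:A|M. f x)"
proof -
  have eq: "uniform_measure M A = density M (\<lambda>x. ennreal (indicat_real A x))"
    unfolding uniform_measure_def A(2)
    by (rule arg_cong[where f = "density M"]) (auto simp: ennreal_indicator divide_ennreal_def)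
  have "integral\<^sup>L (density M (\<lambda>x. ennreal (indicat_real A x))) f = (LINT x:A|M. f x)"
    unfolding set_lebesgue_integral_def by (rule integral_density) (use A f in auto)
  then show ?thesis by (simp add: eq)
qed

lemma line_average_measurable:
  fixes g :: "real ^ 'n \<Rightarrow> real"
  assumes "g \<in> borel_measurable borel"
  shows "(\<lambda>(x, \<theta>). g (x + (\<theta> * h) *\<^sub>R v)) \<in> borel_measurable (lborel \<Otimes>\<^sub>M unit_interval_measure)"
proof -
  have "(\<lambda>p. fst p + (snd p * h) *\<^sub>R v) \<in> borel_measurable (borel \<Otimes>\<^sub>M borel)"
    by measurable
  from measurable_compose[OF this assms]
  have m: "(\<lambda>(x, \<theta>). g (x + (\<theta> * h) *\<^sub>R v)) \<in> borel_measurable (borel \<Otimes>\<^sub>M borel)"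
    by (simp only: split_beta')
  have s: "sets (lborel \<Otimes>\<^sub>M unit_interval_measure) = sets ((borel :: (real ^ 'n) measure) \<Otimes>\<^sub>M borel)"
    by (rule sets_pair_measure_cong) simp_all
  show ?thesis using m unfolding measurable_cong_sets[OF s refl] .
qed

lemma line_average:
  fixes g :: "real ^ 'n::finite \<Rightarrow> real" and v :: "real ^ 'n"
  assumes g: "g \<in> L2"
  defines "A \<equiv> (\<lambda>h x. \<integral>\<theta>. g (x + (\<theta> * h) *\<^sub>R v) \<partial>unit_interval_measure)"
  shows "A h \<in> L2" "\<psi> \<in> L2 \<Longrightarrow> L2_inner (A h) \<psi> = (\<integral>\<theta>. L2_inner (\<lambda>x. g (x + (\<theta> * h) *\<^sub>R v)) \<psi> \<partial>unit_interval_measure)"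
  unfolding A_def
  by (rule L2_average[OF prob_space_unit_interval line_average_measurable, where M = "L2_norm g"];
      use g in \<open>auto simp: L2_measurable\<close>)+

text \<open>The fundamental theorem of calculus for weak derivatives. Tested against
  \<open>\<phi>\<close>, the translations and the derivative are moved onto \<open>\<phi>\<close>,
  where the classical theorem along segments applies; the fundamental lemma turns the tested
  identity into one almost everywhere.\<close>

lemma weak_imp_difference_quotient:
  fixes f g :: "real ^ 'n::finite \<Rightarrow> real"
  assumes w: "has_weak_deriv ((\<lambda>_. 0)(j := 1)) f g" and f: "f \<in> L2" and g: "g \<in> L2"
  defines "A \<equiv> (\<lambda>h x. \<integral>\<theta>. g (x + (\<theta> * h) *\<^sub>R axis j 1) \<partial>unit_interval_measure)"
  shows "AE x in lborel. f (x + h *\<^sub>R axis j 1) - f x = h * A h x"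
proof -
  let ?e = "axis j 1 :: real ^ 'n"
  have A: "A h \<in> L2" unfolding A_def by (rule line_average(1)[OF g])
  have ibp: "L2_inner f (partial_deriv j \<phi>) = - L2_inner g \<phi>" if "test_function \<phi>" for \<phi>
  proof -
    have c: "\<forall>i. count_list [j] i = ((\<lambda>_. 0)(j := 1)) i" by simp
    from w that c have "(\<integral>x. f x * iterated_partial [j] \<phi> x \<partial>lborel) =
        (-1) ^ mi_size ((\<lambda>_. 0)(j := 1)) * (\<integral>x. g x * \<phi> x \<partial>lborel)"
      unfolding has_weak_deriv_def by blast
    then show ?thesis by (simp add: mi_size_def L2_inner_def)
  qed
  have "AE x in lborel. f (x + h *\<^sub>R ?e) - f x - h * A h x = 0"
  proof (rule fundamental_lemma_variations)
    show "locally_integrable (\<lambda>x. f (x + h *\<^sub>R ?e) - f x - h * A h x)"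
      using f A by (intro L2_locally_integrable) auto
    fix \<phi> :: "real ^ 'n \<Rightarrow> real" assume \<phi>: "test_function \<phi>"
    have \<phi>2: "\<phi> \<in> L2" "partial_deriv j \<phi> \<in> L2"
      using \<phi> by (auto intro: test_function_L2 test_function_partial_deriv)
    have "h * L2_inner (A h) \<phi> = h * (\<integral>\<theta>. L2_inner (\<lambda>x. g (x + (\<theta> * h) *\<^sub>R ?e)) \<phi> \<partial>unit_interval_measure)"
      unfolding A_def by (subst line_average(2)[OF g \<phi>2(1)]) simp
    also have "\<dots> = h * (\<integral>\<theta>. - L2_inner (\<lambda>x. partial_deriv j \<phi> (x + (\<theta> * (- h)) *\<^sub>R ?e)) f \<partial>unit_interval_measure)"
    proof -
      have "L2_inner (\<lambda>x. g (x + (\<theta> * h) *\<^sub>R ?e)) \<phi> =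
          - L2_inner (\<lambda>x. partial_deriv j \<phi> (x + (\<theta> * (- h)) *\<^sub>R ?e)) f" for \<theta>
      proof -
        have "L2_inner (\<lambda>x. g (x + (\<theta> * h) *\<^sub>R ?e)) \<phi> = L2_inner g (\<lambda>x. \<phi> (x + (\<theta> * (- h)) *\<^sub>R ?e))"
          using L2_inner_translate[OF g \<phi>2(1)] by simp
        also have "\<dots> = - L2_inner f (partial_deriv j (\<lambda>x. \<phi> (x + (\<theta> * (- h)) *\<^sub>R ?e)))"
          using ibp[OF test_function_translate[OF \<phi>, of "(\<theta> * (- h)) *\<^sub>R ?e"]] by simp
        also have "partial_deriv j (\<lambda>x. \<phi> (x + (\<theta> * (- h)) *\<^sub>R ?e)) = (\<lambda>x. partial_deriv j \<phi> (x + (\<theta> * (- h)) *\<^sub>R ?e))"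
          using iterated_partial_translate[OF \<phi>, of "[j]" "(\<theta> * (- h)) *\<^sub>R ?e"] by simp
        finally show ?thesis by (simp add: L2_inner_commute)
      qed
      then show ?thesis by simp
    qed
    also have "\<dots> = - (h * L2_inner (\<lambda>x. \<integral>\<theta>. partial_deriv j \<phi> (x + (\<theta> * (- h)) *\<^sub>R ?e) \<partial>unit_interval_measure) f)"
      by (subst line_average(2)[OF \<phi>2(2) f]) simp
    also have "\<dots> = - L2_inner (\<lambda>x. \<phi> x - \<phi> (x - h *\<^sub>R ?e)) f"
    proof -
      have "h * (\<integral>\<theta>. partial_deriv j \<phi> (x + (\<theta> * (- h)) *\<^sub>R ?e) \<partial>unit_interval_measure) =
          \<phi> x - \<phi> (x - h *\<^sub>R ?e)" for x
      proof -
        have m: "(\<lambda>\<theta>. partial_deriv j \<phi> (x + (\<theta> * (- h)) *\<^sub>R ?e)) \<in> borel_measurable lborel"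
          using test_function_continuous[OF test_function_partial_deriv[OF \<phi>, of j]]
          by (auto intro!: borel_measurable_continuous_onI continuous_on_compose2[of UNIV "partial_deriv j \<phi>"] continuous_intros)
        show ?thesis
          using test_function_line_integral[OF \<phi>, of h j x] integral_uniform_measure[OF _ _ m, of "{0..1}"]
          by simp
      qed
      then show ?thesis by (simp only: L2_inner_cmult_left[symmetric])
    qed
    finally have *: "h * L2_inner (A h) \<phi> = L2_inner (\<lambda>x. \<phi> (x - h *\<^sub>R ?e) - \<phi> x) f"
      using \<phi>2 L2_translate[OF \<phi>2(1), of "- h *\<^sub>R ?e"] f by (simp add: L2_inner_diff_left)
    have "(\<integral>x. (f (x + h *\<^sub>R ?e) - f x - h * A h x) * \<phi> x \<partial>lborel) =
        L2_inner (\<lambda>x. f (x + h *\<^sub>R ?e) - f x - h * A h x) \<phi>"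
      by (simp add: L2_inner_def)
    also have "\<dots> = L2_inner (\<lambda>x. f (x + h *\<^sub>R ?e)) \<phi> - L2_inner f \<phi> - h * L2_inner (A h) \<phi>"
      using f A \<phi>2 by (simp add: L2_inner_diff_left)
    also have "\<dots> = 0"
      using * \<phi>2 L2_translate[OF \<phi>2(1), of "- h *\<^sub>R ?e"] f L2_inner_translate[OF f \<phi>2(1), of "h *\<^sub>R ?e"]
      by (simp add: L2_inner_diff_left L2_inner_commute[of f])
    finally show "(\<integral>x. (f (x + h *\<^sub>R ?e) - f x - h * A h x) * \<phi> x \<partial>lborel) = 0" .
  qed
  then show ?thesis by simp
qed

text \<open>The quotient minus \<open>g\<close> is an average of differences between translates of
  \<open>g\<close> and \<open>g\<close> itself, and these are uniformly small for small
  \<open>h\<close> by continuity of translations.\<close>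

theorem weak_imp_strong_partial:
  fixes f g :: "real ^ 'n::finite \<Rightarrow> real"
  assumes w: "has_weak_deriv ((\<lambda>_. 0)(j := 1)) f g" and f: "f \<in> L2" and g: "g \<in> L2"
  shows "strong_partial j f g"
  unfolding strong_partial_iff
proof (intro conjI f L2_limI g)
  let ?e = "axis j 1 :: real ^ 'n"
  let ?A = "\<lambda>h x. \<integral>\<theta>. g (x + (\<theta> * h) *\<^sub>R ?e) \<partial>unit_interval_measure"
  have [measurable]: "g \<in> borel_measurable borel" using g by (rule L2_measurable)
  show "\<forall>\<^sub>F h in at 0. (\<lambda>x. (f (x + h *\<^sub>R ?e) - f x) / h) \<in> L2"
    using f by (intro always_eventually) auto
  show "((\<lambda>h. L2_norm (\<lambda>x. (f (x + h *\<^sub>R ?e) - f x) / h - g x)) \<longlongrightarrow> 0) (at 0)"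
  proof (rule tendstoI)
    fix \<epsilon> :: real assume \<epsilon>: "\<epsilon> > 0"
    obtain d where d: "d > 0" "\<And>y. y \<noteq> 0 \<Longrightarrow> norm y < d \<Longrightarrow> L2_norm (\<lambda>x. g (x + y) - g x) < \<epsilon> / 2"
      using tendstoD[OF L2_translate_continuous[OF g], of "\<epsilon> / 2"] \<epsilon>
      by (auto simp: eventually_at dist_real_def)
    have "dist (L2_norm (\<lambda>x. (f (x + h *\<^sub>R ?e) - f x) / h - g x)) 0 < \<epsilon>" if h: "h \<noteq> 0" "\<bar>h\<bar> < d" for h
    proof -
      have small: "L2_norm (\<lambda>x. g (x + (\<theta> * h) *\<^sub>R ?e) - g x) \<le> \<epsilon> / 2" if "\<theta> \<in> {0..1}" for \<theta>
      proof (cases "\<theta> = 0")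
        case False
        have "\<bar>\<theta> * h\<bar> \<le> \<bar>h\<bar>" using that by (auto simp: abs_mult intro: mult_left_le_one_le)
        then show ?thesis using d(2)[of "(\<theta> * h) *\<^sub>R ?e"] False h by (auto simp: axis_eq_0_iff)
      qed (use \<epsilon> in simp)
      let ?F = "\<lambda>\<theta> x. g (x + (\<theta> * h) *\<^sub>R ?e) - g x"
      have mg: "(\<lambda>(x, \<theta>). g x) \<in> borel_measurable (lborel \<Otimes>\<^sub>M unit_interval_measure)"
        by (simp add: split_beta')
      have mF: "(\<lambda>(x, \<theta>). ?F \<theta> x) \<in> borel_measurable (lborel \<Otimes>\<^sub>M unit_interval_measure)"
        using borel_measurable_diff[OF line_average_measurable[of g h ?e] mg] by (simp add: split_beta')
      have ae: "AE \<theta> in unit_interval_measure. L2_norm (?F \<theta>) \<le> \<epsilon> / 2"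
        by (rule AE_uniform_measureI) (use small in auto)
      note avg = L2_average[OF prob_space_unit_interval mF _ ae]
      have ig: "AE x in lborel. integrable unit_interval_measure (\<lambda>\<theta>. g (x + (\<theta> * h) *\<^sub>R ?e))"
        by (rule L2_average(1)[OF prob_space_unit_interval line_average_measurable, where M = "L2_norm g"])
          (use g in auto)
      have "AE x in lborel. (f (x + h *\<^sub>R ?e) - f x) / h - g x = (\<integral>\<theta>. ?F \<theta> x \<partial>unit_interval_measure)"
        using weak_imp_difference_quotient[OF w f g, of h] ig
      proof eventually_elim
        case (elim x)
        interpret prob_space unit_interval_measure by (rule prob_space_unit_interval)
        show ?case using elim h by (simp add: prob_space)
      qed
      then have "L2_norm (\<lambda>x. (f (x + h *\<^sub>R ?e) - f x) / h - g x) = L2_norm (\<lambda>x. \<integral>\<theta>. ?F \<theta> x \<partial>unit_interval_measure)"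
        using f g avg(2) by (intro L2_norm_cong_AE) (auto intro!: L2_measurable)
      also have "\<dots> \<le> \<epsilon> / 2" by (rule avg(3)) (use g in auto)
      finally show ?thesis using \<epsilon> by (simp add: dist_real_def)
    qed
    then show "\<forall>\<^sub>F h in at 0. dist (L2_norm (\<lambda>x. (f (x + h *\<^sub>R ?e) - f x) / h - g x)) 0 < \<epsilon>"
      using d(1) by (auto simp: eventually_at dist_real_def intro!: exI[of _ d])
  qed
qed

section \<open>A bilinear Sobolev inequality\<close>

abbreviation unit_cube_measure :: "(real ^ 'n) measure" where
  "unit_cube_measure \<equiv> uniform_measure lborel (cbox 0 One)"

lemma emeasure_unit_cube: "emeasure lborel (cbox 0 One :: (real ^ 'n) set) = 1"
  by (subst emeasure_lborel_cbox) (auto simp: inner_Basis)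

lemma prob_space_unit_cube: "prob_space unit_cube_measure"
  by (rule prob_space_uniform_measure) (simp_all add: emeasure_unit_cube)

definition cube_average :: "real \<Rightarrow> (real ^ 'n \<Rightarrow> real) \<Rightarrow> real ^ 'n \<Rightarrow> real" where
  "cube_average r f x = (\<integral>y. f (x + r *\<^sub>R y) \<partial>unit_cube_measure)"

lemma cube_average_measurable_pair:
  fixes g :: "real ^ 'n \<Rightarrow> real"
  assumes "g \<in> borel_measurable borel"
  shows "(\<lambda>(x, y). g (x + r *\<^sub>R y)) \<in> borel_measurable (lborel \<Otimes>\<^sub>M unit_cube_measure)"
proof -
  have "(\<lambda>p :: (real ^ 'n) \<times> (real ^ 'n). fst p + r *\<^sub>R snd p) \<in> borel_measurable (borel \<Otimes>\<^sub>M borel)"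
    by measurable
  from measurable_compose[OF this assms]
  have m: "(\<lambda>(x, y). g (x + r *\<^sub>R y)) \<in> borel_measurable (borel \<Otimes>\<^sub>M borel)"
    by (simp only: split_beta')
  have s: "sets (lborel \<Otimes>\<^sub>M unit_cube_measure) = sets ((borel :: (real ^ 'n) measure) \<Otimes>\<^sub>M (borel :: (real ^ 'n) measure))"
    by (rule sets_pair_measure_cong) simp_all
  show ?thesis using m unfolding measurable_cong_sets[OF s refl] .
qed

lemma
  fixes f :: "real ^ 'n \<Rightarrow> real"
  assumes f: "f \<in> L2"
  shows cube_average_L2 [simp]: "cube_average r f \<in> L2"
    and cube_average_norm: "L2_norm (cube_average r f) \<le> L2_norm f"
    and cube_average_integrable: "AE x in lborel. integrable unit_cube_measure (\<lambda>y. f (x + r *\<^sub>R y))"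
    and cube_average_inner: "g \<in> L2 \<Longrightarrow>
      L2_inner (cube_average r f) g = (\<integral>y. L2_inner (\<lambda>x. f (x + r *\<^sub>R y)) g \<partial>unit_cube_measure)"
  unfolding cube_average_def[abs_def]
  by (rule L2_average[OF prob_space_unit_cube cube_average_measurable_pair, where M = "L2_norm f"];
      use f L2_measurable[OF f] in simp)+

text \<open>Averaging over the cube with the reflected side vector is the adjoint operation; this is
  why \<open>cube_average\<close> admits negative \<open>r\<close>.\<close>

lemma cube_average_adjoint:
  assumes "f \<in> L2" "g \<in> L2"
  shows "L2_inner (cube_average r f) g = L2_inner f (cube_average (- r) g)"
proof -
  have "L2_inner (\<lambda>x. f (x + r *\<^sub>R y)) g = L2_inner (\<lambda>x. g (x + (- r) *\<^sub>R y)) f" for y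
    using L2_inner_translate[OF assms, of "r *\<^sub>R y"] by (simp add: L2_inner_commute)
  then show ?thesis
    using assms by (simp only: cube_average_inner L2_inner_commute[of f])
qed

lemma cube_average_translate: "cube_average r f (x + y) = cube_average r (\<lambda>x. f (x + y)) x"
  by (simp add: cube_average_def add_ac)

lemma cube_average_lincomb:
  assumes "f \<in> L2" "g \<in> L2" "k \<in> L2"
  shows "AE x in lborel. cube_average r (\<lambda>x. (f x - g x) / c - k x) x =
    (cube_average r f x - cube_average r g x) / c - cube_average r k x"
  using cube_average_integrable[OF assms(1), of r] cube_average_integrable[OF assms(2), of r]
    cube_average_integrable[OF assms(3), of r]
  by eventually_elim (simp add: cube_average_def)

lemma cube_average_lincomb_norm:
  assumes "f \<in> L2" "g \<in> L2" "k \<in> L2"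
  shows "L2_norm (\<lambda>x. (cube_average r f x - cube_average r g x) / c - cube_average r k x)
    \<le> L2_norm (\<lambda>x. (f x - g x) / c - k x)"
proof -
  have 1: "(\<lambda>x. (f x - g x) / c - k x) \<in> L2" using assms by (intro L2_diff L2_divide)
  have 2: "(\<lambda>x. (cube_average r f x - cube_average r g x) / c - cube_average r k x) \<in> L2"
    using assms by (intro L2_diff L2_divide cube_average_L2)
  have "L2_norm (\<lambda>x. (cube_average r f x - cube_average r g x) / c - cube_average r k x) =
      L2_norm (cube_average r (\<lambda>x. (f x - g x) / c - k x))"
    by (rule L2_norm_cong_AE[symmetric, OF cube_average_lincomb[OF assms] L2_measurable[OF cube_average_L2[OF 1]] L2_measurable[OF 2]])
  also have "\<dots> \<le> L2_norm (\<lambda>x. (f x - g x) / c - k x)" by (rule cube_average_norm[OF 1])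
  finally show ?thesis .
qed

lemma strong_partial_cube_average:
  assumes fg: "strong_partial j f g"
  shows "strong_partial j (cube_average r f) (cube_average r g)"
  unfolding strong_partial_iff
proof (intro conjI)
  have f: "f \<in> L2" and g: "g \<in> L2" using strong_partial_in[OF fg] by auto
  show "cube_average r f \<in> L2" using f by simp
  show "L2_lim (\<lambda>h x. (cube_average r f (x + h *\<^sub>R axis j 1) - cube_average r f x) / h) (cube_average r g) (at 0)"
  proof (rule L2_limI_bound)
    show "cube_average r g \<in> L2" using g by simp
    have ft: "cube_average r (\<lambda>x. f (x + h *\<^sub>R axis j 1)) \<in> L2" for h using f by simp
    show "\<forall>\<^sub>F h in at 0. (\<lambda>x. (cube_average r f (x + h *\<^sub>R axis j 1) - cube_average r f x) / h) \<in> L2"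
      unfolding cube_average_translate using f ft by (intro always_eventually allI L2_divide L2_diff) auto
    show "((\<lambda>h. L2_norm (\<lambda>x. (f (x + h *\<^sub>R axis j 1) - f x) / h - g x)) \<longlongrightarrow> 0) (at 0)"
      using fg by (simp add: strong_partial_iff L2_lim_def)
    show "\<forall>\<^sub>F h in at 0. L2_norm (\<lambda>x. (cube_average r f (x + h *\<^sub>R axis j 1) - cube_average r f x) / h - cube_average r g x)
        \<le> L2_norm (\<lambda>x. (f (x + h *\<^sub>R axis j 1) - f x) / h - g x)"
      unfolding cube_average_translate using f g
      by (intro always_eventually allI cube_average_lincomb_norm) auto
  qed
qed

text \<open>The translation by \<open>y\<close> is carried out one coordinate at a time, each move
  being controlled by the mean value inequality in that direction.\<close>

lemma translate_norm_le:
  fixes f :: "real ^ 'n::finite \<Rightarrow> real"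
  assumes fg: "\<And>j. strong_partial j f (g j)" and N: "\<And>j. L2_norm (g j) \<le> N"
  shows "L2_norm (\<lambda>x. f (x + y) - f x) \<le> (\<Sum>j\<in>UNIV. \<bar>y $ j\<bar>) * N"
proof -
  have f: "f \<in> L2" by (rule strong_partial_in(1)[OF fg])
  have "L2_norm (\<lambda>x. f (x + (\<Sum>j\<in>J. y $ j *\<^sub>R axis j 1)) - f x) \<le> (\<Sum>j\<in>J. \<bar>y $ j\<bar>) * N" if "finite J" for J
    using that
  proof (induction J)
    case (insert j J)
    let ?z = "\<Sum>j\<in>J. y $ j *\<^sub>R axis j 1 :: real ^ 'n"
    let ?e = "y $ j *\<^sub>R axis j 1 :: real ^ 'n"
    have "L2_norm (\<lambda>x. (f (x + ?z + ?e) - f (x + ?z)) + (f (x + ?z) - f x)) \<le>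
        L2_norm (\<lambda>x. f (x + ?z + ?e) - f (x + ?z)) + L2_norm (\<lambda>x. f (x + ?z) - f x)"
      using f L2_translate[OF L2_translate[OF f, of ?e], of ?z]
      by (intro L2_norm_triangle L2_diff L2_translate) auto
    moreover have "L2_norm (\<lambda>x. f (x + ?z + ?e) - f (x + ?z)) = L2_norm (\<lambda>x. f (x + ?e) - f x)"
      using f by (intro L2_norm_translate[of "\<lambda>x. f (x + ?e) - f x" ?z]) auto
    moreover have "L2_norm (\<lambda>x. f (x + ?e) - f x) \<le> \<bar>y $ j\<bar> * N"
      using strong_partial_mean_value[OF fg[of j], of "y $ j"] N[of j]
      by (meson abs_ge_zero mult_left_mono order_trans)
    ultimately show ?case using insert by (simp add: algebra_simps)
  qed simp
  from this[of UNIV] show ?thesis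
    by (simp add: basis_expansion[of y, unfolded scalar_mult_eq_scaleR])
qed

lemma cube_average_close:
  fixes f :: "real ^ 'n::finite \<Rightarrow> real"
  assumes fg: "\<And>j. strong_partial j f (g j)" and N: "\<And>j. L2_norm (g j) \<le> N"
  shows "L2_norm (\<lambda>x. cube_average r f x - f x) \<le> \<bar>r\<bar> * CARD('n) * N"
proof -
  have f: "f \<in> L2" by (rule strong_partial_in(1)[OF fg])
  have N0: "0 \<le> N" using order_trans[OF L2_norm_nonneg N] .
  let ?F = "\<lambda>y x. f (x + r *\<^sub>R y) - f x"
  have [measurable]: "f \<in> borel_measurable borel" using f by (rule L2_measurable)
  have mf: "(\<lambda>(x, y). f x) \<in> borel_measurable (lborel \<Otimes>\<^sub>M unit_cube_measure)"
    by (simp add: split_beta')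
  have mF: "(\<lambda>(x, y). ?F y x) \<in> borel_measurable (lborel \<Otimes>\<^sub>M unit_cube_measure)"
    using borel_measurable_diff[OF cube_average_measurable_pair[of f r] mf] by (simp add: split_beta')
  have "L2_norm (?F y) \<le> \<bar>r\<bar> * CARD('n) * N" if "y \<in> cbox 0 One" for y
  proof -
    have y: "\<bar>y $ j\<bar> \<le> 1" for j
    proof -
      have "axis j 1 \<in> (Basis :: (real ^ 'n) set)" by (auto simp: Basis_vec_def)
      then show ?thesis using that by (auto simp: mem_box cart_eq_inner_axis inner_sum_left_Basis dest!: bspec)
    qed
    have "L2_norm (?F y) \<le> (\<Sum>j\<in>UNIV. \<bar>(r *\<^sub>R y) $ j\<bar>) * N" by (rule translate_norm_le[OF fg N])
    also have "\<dots> \<le> (\<Sum>j\<in>(UNIV :: 'n set). \<bar>r\<bar>) * N"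
      using y N0 by (intro mult_right_mono sum_mono) (auto simp: abs_mult mult_left_le)
    finally show ?thesis by (simp add: mult_ac)
  qed
  then have ae: "AE y in unit_cube_measure. L2_norm (?F y) \<le> \<bar>r\<bar> * CARD('n) * N"
    by (intro AE_uniform_measureI) auto
  note avg = L2_average[OF prob_space_unit_cube mF _ ae]
  have "AE x in lborel. cube_average r f x - f x = (\<integral>y. ?F y x \<partial>unit_cube_measure)"
    using cube_average_integrable[OF f, of r]
  proof eventually_elim
    case (elim x)
    interpret prob_space "unit_cube_measure :: (real ^ 'n) measure" by (rule prob_space_unit_cube)
    show ?case using elim by (simp add: cube_average_def prob_space)
  qed
  moreover have "(\<lambda>x. \<integral>y. ?F y x \<partial>unit_cube_measure) \<in> L2" using f by (intro avg(2)) auto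
  ultimately have "L2_norm (\<lambda>x. cube_average r f x - f x) = L2_norm (\<lambda>x. \<integral>y. ?F y x \<partial>unit_cube_measure)"
    using f by (intro L2_norm_cong_AE L2_measurable) auto
  also have "\<dots> \<le> \<bar>r\<bar> * CARD('n) * N" using f by (intro avg(3)) auto
  finally show ?thesis .
qed

text \<open>Jensen's inequality bounds the squared average by the mean of the square, and rescaling
  the cube to side \<open>\<bar>r\<bar>\<close> produces the volume factor. This is the only passage
  from an L^2 bound to a pointwise bound.\<close>

lemma cube_average_bound:
  fixes k :: "real ^ 'n::finite \<Rightarrow> real"
  assumes k: "k \<in> L2" and r: "r \<noteq> 0"
  shows "\<bar>cube_average r k x\<bar> \<le> L2_norm k / sqrt (\<bar>r\<bar> ^ CARD('n))"
proof -
  interpret prob_space "unit_cube_measure :: (real ^ 'n) measure" by (rule prob_space_unit_cube)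
  have [measurable]: "k \<in> borel_measurable borel" using k by (rule L2_measurable)
  have mk: "(\<lambda>y. k (x + r *\<^sub>R y)) \<in> borel_measurable borel" by measurable
  let ?R = "\<bar>r\<bar> ^ CARD('n)"
  have R: "?R > 0" using r by simp
  have "ennreal ((L2_norm k)\<^sup>2) = (\<integral>\<^sup>+z. ennreal ((k z)\<^sup>2) \<partial>lborel)"
    using L2_integrable_square[OF k] by (simp add: nn_integral_eq_integral L2_norm_def)
  also have "\<dots> = (\<integral>\<^sup>+z. ennreal ((k z)\<^sup>2) \<partial>density (distr lborel borel (\<lambda>y. x + r *\<^sub>R y)) (\<lambda>_. ennreal ?R))"
    by (subst lborel_affine[OF r, of x]) (simp add: ennreal_power)
  also have "\<dots> = (\<integral>\<^sup>+y. ennreal ?R * ennreal ((k (x + r *\<^sub>R y))\<^sup>2) \<partial>lborel)"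
    by (subst nn_integral_density) (auto simp: nn_integral_distr)
  also have "\<dots> = ennreal ?R * (\<integral>\<^sup>+y. ennreal ((k (x + r *\<^sub>R y))\<^sup>2) \<partial>lborel)"
    using mk by (subst nn_integral_cmult) auto
  finally have eq: "ennreal ((L2_norm k)\<^sup>2) = ennreal ?R * (\<integral>\<^sup>+y. ennreal ((k (x + r *\<^sub>R y))\<^sup>2) \<partial>lborel)" .
  have "(\<integral>\<^sup>+y. ennreal ((k (x + r *\<^sub>R y))\<^sup>2) \<partial>unit_cube_measure) =
      (\<integral>\<^sup>+y. ennreal ((k (x + r *\<^sub>R y))\<^sup>2) * indicator (cbox 0 One) y \<partial>lborel)"
    using mk by (subst nn_integral_uniform_measure) (auto simp: emeasure_unit_cube divide_ennreal_def)
  also have "\<dots> \<le> (\<integral>\<^sup>+y. ennreal ((k (x + r *\<^sub>R y))\<^sup>2) \<partial>lborel)"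
    by (rule nn_integral_mono) (auto split: split_indicator)
  finally have le: "ennreal ?R * (\<integral>\<^sup>+y. ennreal ((k (x + r *\<^sub>R y))\<^sup>2) \<partial>unit_cube_measure) \<le> ennreal ((L2_norm k)\<^sup>2)"
    unfolding eq by (rule mult_left_mono) simp
  have fin: "(\<integral>\<^sup>+y. ennreal ((k (x + r *\<^sub>R y))\<^sup>2) \<partial>unit_cube_measure) < \<infinity>"
  proof (rule ccontr)
    assume "\<not> ?thesis"
    then have "(\<integral>\<^sup>+y. ennreal ((k (x + r *\<^sub>R y))\<^sup>2) \<partial>unit_cube_measure) = top"
      by (simp add: less_top[symmetric])
    then show False using le r by (simp add: ennreal_mult_top top_unique)
  qed
  have i: "integrable unit_cube_measure (\<lambda>y. (k (x + r *\<^sub>R y))\<^sup>2)"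
    using fin mk by (intro integrableI_nonneg) auto
  have "ennreal (?R * (\<integral>y. (k (x + r *\<^sub>R y))\<^sup>2 \<partial>unit_cube_measure)) \<le> ennreal ((L2_norm k)\<^sup>2)"
    using le R by (simp add: nn_integral_eq_integral[OF i] ennreal_mult)
  then have "?R * (\<integral>y. (k (x + r *\<^sub>R y))\<^sup>2 \<partial>unit_cube_measure) \<le> (L2_norm k)\<^sup>2"
    by (subst (asm) ennreal_le_iff) auto
  moreover have "(cube_average r k x)\<^sup>2 \<le> (\<integral>y. (k (x + r *\<^sub>R y))\<^sup>2 \<partial>unit_cube_measure)"
    unfolding cube_average_def using mk by (intro expectation_square_le(2) i) auto
  ultimately have "(cube_average r k x)\<^sup>2 \<le> (L2_norm k)\<^sup>2 / ?R"
    using R by (simp add: field_simps) (meson less_imp_le mult_left_mono order_trans R)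
  then have "sqrt ((cube_average r k x)\<^sup>2) \<le> sqrt ((L2_norm k)\<^sup>2 / ?R)" by (rule real_sqrt_le_mono)
  then show ?thesis by (simp add: real_sqrt_divide)
qed

text \<open>\<open>smoothing r\<close> has the form \<open>B\<^sup>* B\<close> for a contraction \<open>B\<close>; this makes the identity minus
  \<open>smoothing r\<close> a contraction too.\<close>

definition smoothing :: "real \<Rightarrow> (real ^ 'n \<Rightarrow> real) \<Rightarrow> real ^ 'n \<Rightarrow> real" where
  "smoothing r f = cube_average (- r) (cube_average r f)"

lemma smoothing_L2 [simp]: "f \<in> L2 \<Longrightarrow> smoothing r f \<in> L2"
  by (simp add: smoothing_def)

lemma smoothing_norm: "f \<in> L2 \<Longrightarrow> L2_norm (smoothing r f) \<le> L2_norm f"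
  unfolding smoothing_def using cube_average_norm cube_average_L2 order_trans by metis

text \<open>Expanding the square gives \<open>L2_inner (smoothing r f) f = (L2_norm ?B)^2\<close>,
  so the cross term outweighs the last term, which is at most \<open>(L2_norm ?B)^2\<close>.\<close>

lemma smoothing_complement_norm:
  assumes f: "f \<in> L2" shows "L2_norm (\<lambda>x. f x - smoothing r f x) \<le> L2_norm f"
proof (rule power2_le_imp_le)
  let ?B = "cube_average r f"
  have B: "?B \<in> L2" using f by simp
  have "L2_inner (smoothing r f) f = (L2_norm ?B)\<^sup>2"
    using cube_average_adjoint[OF f B, of r] unfolding smoothing_def L2_norm_square
    by (simp add: L2_inner_commute)
  then have "(L2_norm (\<lambda>x. f x - smoothing r f x))\<^sup>2 =
      (L2_norm f)\<^sup>2 - 2 * (L2_norm ?B)\<^sup>2 + (L2_norm (smoothing r f))\<^sup>2"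
    unfolding L2_norm_square[of f] L2_norm_square[of "smoothing r f"] L2_norm_square[of "\<lambda>x. f x - smoothing r f x"]
    using f smoothing_L2[OF f, of r]
    by (simp add: L2_inner_diff_left L2_inner_diff_right L2_inner_commute[of f "smoothing r f"])
  moreover have "(L2_norm (smoothing r f))\<^sup>2 \<le> (L2_norm ?B)\<^sup>2"
    unfolding smoothing_def using cube_average_norm[OF B] by (simp add: power_mono)
  ultimately show "(L2_norm (\<lambda>x. f x - smoothing r f x))\<^sup>2 \<le> (L2_norm f)\<^sup>2"
    using zero_le_power2[of "L2_norm ?B"] by linarith
qed simp

lemma smoothing_close:
  fixes f :: "real ^ 'n::finite \<Rightarrow> real"
  assumes fg: "\<And>j. strong_partial j f (g j)" and N: "\<And>j. L2_norm (g j) \<le> N"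
  shows "L2_norm (\<lambda>x. f x - smoothing r f x) \<le> 2 * (\<bar>r\<bar> * CARD('n) * N)"
proof -
  have f: "f \<in> L2" by (rule strong_partial_in(1)[OF fg])
  have "L2_norm (\<lambda>x. cube_average (- r) (cube_average r f) x - cube_average r f x) \<le> \<bar>- r\<bar> * CARD('n) * N"
    using strong_partial_cube_average[OF fg] order_trans[OF cube_average_norm N] strong_partial_in(2)[OF fg]
    by (intro cube_average_close[where g = "\<lambda>j. cube_average r (g j)"]) auto
  moreover have "L2_norm (\<lambda>x. cube_average r f x - f x) \<le> \<bar>r\<bar> * CARD('n) * N"
    by (rule cube_average_close[OF fg N])
  moreover have "L2_norm (\<lambda>x. f x - smoothing r f x) \<le>
      L2_norm (\<lambda>x. f x - cube_average r f x) + L2_norm (\<lambda>x. cube_average r f x - cube_average (- r) (cube_average r f) x)"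
    using L2_norm_triangle[of "\<lambda>x. f x - cube_average r f x" "\<lambda>x. cube_average r f x - cube_average (- r) (cube_average r f) x"] f
    by (simp add: smoothing_def)
  ultimately show ?thesis
    by (simp add: L2_norm_minus_commute[of f] L2_norm_minus_commute[of "cube_average r f" "cube_average (- r) (cube_average r f)"])
qed

lemma smoothing_bound:
  fixes k :: "real ^ 'n::finite \<Rightarrow> real"
  assumes k: "k \<in> L2" and r: "r \<noteq> 0"
  shows "\<bar>smoothing r k x\<bar> \<le> L2_norm k / sqrt (\<bar>r\<bar> ^ CARD('n))"
proof -
  have "\<bar>smoothing r k x\<bar> \<le> L2_norm (cube_average r k) / sqrt (\<bar>- r\<bar> ^ CARD('n))"
    unfolding smoothing_def using k r by (intro cube_average_bound) auto
  also have "\<dots> \<le> L2_norm k / sqrt (\<bar>r\<bar> ^ CARD('n))"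
    using cube_average_norm[OF k] by (simp add: divide_right_mono)
  finally show ?thesis .
qed

section \<open>Multiscale decomposition\<close>

primrec residual :: "nat \<Rightarrow> (real ^ 'n \<Rightarrow> real) \<Rightarrow> real ^ 'n \<Rightarrow> real" where
  "residual 0 f = f"
| "residual (Suc i) f = (\<lambda>x. residual i f x - smoothing ((1/2) ^ i) (residual i f) x)"

lemma residual_L2 [simp]: "f \<in> L2 \<Longrightarrow> residual i f \<in> L2"
  by (induction i) auto

lemma residual_norm: "f \<in> L2 \<Longrightarrow> L2_norm (residual i f) \<le> L2_norm f"
proof (induction i)
  case (Suc i)
  have "L2_norm (residual (Suc i) f) \<le> L2_norm (residual i f)"
    unfolding residual.simps by (rule smoothing_complement_norm[OF residual_L2[OF Suc.prems]])
  then show ?case using Suc by simp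
qed simp

lemma strong_partial_residual:
  "strong_partial j f g \<Longrightarrow> strong_partial j (residual i f) (residual i g)"
  by (induction i) (auto simp: smoothing_def intro: strong_partial_diff strong_partial_cube_average)

text \<open>Bounded sets of H^s, described through strong derivatives. The existential at each level
  spares any choice of representatives, and the one bound \<open>N\<close> for all derivatives makes
  products of bounds easy to track.\<close>

primrec sobolev_bound :: "nat \<Rightarrow> real \<Rightarrow> (real ^ 'n::finite \<Rightarrow> real) \<Rightarrow> bool" where
  "sobolev_bound 0 N f \<longleftrightarrow> f \<in> L2 \<and> L2_norm f \<le> N"
| "sobolev_bound (Suc s) N f \<longleftrightarrow> f \<in> L2 \<and> L2_norm f \<le> N \<and>
     (\<forall>j. \<exists>g. strong_partial j f g \<and> sobolev_bound s N g)"

lemma sobolev_bound_L2: "sobolev_bound s N f \<Longrightarrow> f \<in> L2 \<and> L2_norm f \<le> N"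
  by (cases s) auto

text \<open>Taking residuals commutes with strong derivatives. One more smoothing at scale
  \<open>(1/2)^k\<close> therefore costs \<open>(1/2)^k\<close> times the residual of a derivative,
  to which the induction hypothesis for one order less applies.\<close>

lemma residual_decay:
  "\<exists>C\<ge>1. \<forall>(f :: real ^ 'n::finite \<Rightarrow> real) N i. sobolev_bound s N f \<longrightarrow>
    L2_norm (residual i f) \<le> C * ((1/2) ^ s) ^ i * N"
proof (induction s)
  case 0
  have "L2_norm (residual i f) \<le> 1 * ((1/2) ^ 0) ^ i * N" if "sobolev_bound 0 N f"
    for f :: "real ^ 'n \<Rightarrow> real" and N i
    using that residual_norm[of f i] by simp
  then show ?case by blast
next
  case (Suc s)
  then obtain C where C: "C \<ge> 1" "\<And>(f :: real ^ 'n \<Rightarrow> real) N i. sobolev_bound s N f \<Longrightarrow>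
    L2_norm (residual i f) \<le> C * ((1/2) ^ s) ^ i * N" by blast
  \<comment> \<open>The summand 1 covers \<open>i = 0\<close>. The rest is the factor
    \<open>2 * n\<close> of \<open>smoothing_close\<close>, with \<open>2 ^ Suc s\<close>
    compensating that residual \<open>i\<close> uses the scale of index
    \<open>i - 1\<close>.\<close>
  define C' where "C' = 1 + 2 * CARD('n) * C * 2 ^ Suc s"
  have C': "C' \<ge> 1" using C(1) by (simp add: C'_def)
  have "L2_norm (residual i f) \<le> C' * ((1/2) ^ Suc s) ^ i * N" if H: "sobolev_bound (Suc s) N f"
    for f :: "real ^ 'n \<Rightarrow> real" and N i
  proof -
    have f: "f \<in> L2" "L2_norm f \<le> N" using H by auto
    have N: "0 \<le> N" using f L2_norm_nonneg order_trans by blast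
    obtain g where g: "\<And>j. strong_partial j f (g j)" "\<And>j. sobolev_bound s N (g j)"
      using H by simp metis
    show ?thesis
    proof (cases i)
      case 0
      have "L2_norm f \<le> 1 * N" using f by simp
      also have "\<dots> \<le> C' * N" by (rule mult_right_mono[OF C' N])
      finally show ?thesis using 0 by simp
    next
      case (Suc k)
      have "L2_norm (residual i f) \<le> 2 * (\<bar>(1/2) ^ k\<bar> * CARD('n) * (C * ((1/2) ^ s) ^ k * N))"
        unfolding Suc residual.simps
        by (rule smoothing_close[OF strong_partial_residual[OF g(1)] C(2)[OF g(2)]])
      also have "\<dots> = (2 * CARD('n) * C * 2 ^ Suc s) * ((1/2) ^ Suc s) ^ i * N"
        unfolding Suc by (simp add: power_mult_distrib power_mult[symmetric] field_simps power_add)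
      also have "\<dots> \<le> C' * ((1/2) ^ Suc s) ^ i * N"
        using N by (intro mult_right_mono) (auto simp: C'_def)
      finally show ?thesis .
    qed
  qed
  then show ?case using C' by blast
qed

text \<open>Products of sequences converging in L^2 converge in L^1 by Cauchy-Schwarz, and uniform
  L^2 bounds survive such a limit.\<close>

lemma L2_mult_bound_limit:
  fixes f g :: "real ^ 'n \<Rightarrow> real"
  assumes F: "L2_lim F f sequentially" "\<And>k. F k \<in> L2" and G: "L2_lim G g sequentially" "\<And>k. G k \<in> L2"
    and M: "\<And>k. (\<lambda>x. F k x * G k x) \<in> L2" "\<And>k. L2_norm (\<lambda>x. F k x * G k x) \<le> M"
  shows "(\<lambda>x. f x * g x) \<in> L2" "L2_norm (\<lambda>x. f x * g x) \<le> M"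
proof -
  note f = L2_lim_in[OF F(1)] and g = L2_lim_in[OF G(1)]
  have abs_L2: "(\<lambda>x. \<bar>k x\<bar>) \<in> L2" if "k \<in> L2" for k :: "real ^ 'n \<Rightarrow> real"
    using that L2_measurable[OF that] by (simp add: L2_def)
  have abs_norm: "L2_norm (\<lambda>x. \<bar>k x\<bar>) = L2_norm k" for k :: "real ^ 'n \<Rightarrow> real"
    by (simp add: L2_norm_def)
  have int: "integrable lborel (\<lambda>x. F k x * G k x - f x * g x)" for k
    by (intro Bochner_Integration.integrable_diff L2_integrable_mult F G f g)
  let ?b = "\<lambda>k. L2_norm (\<lambda>x. F k x - f x) * L2_norm (G k) + L2_norm f * L2_norm (\<lambda>x. G k x - g x)"
  have le: "(\<integral>x. \<bar>F k x * G k x - f x * g x\<bar> \<partial>lborel) \<le> ?b k" for k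
  proof -
    have d: "(\<lambda>x. F k x - f x) \<in> L2" "(\<lambda>x. G k x - g x) \<in> L2" using F G f g by auto
    note i1 = L2_integrable_mult[OF abs_L2[OF d(1)] abs_L2[OF G(2)[of k]]]
    note i2 = L2_integrable_mult[OF abs_L2[OF f] abs_L2[OF d(2)]]
    have "(\<integral>x. \<bar>F k x * G k x - f x * g x\<bar> \<partial>lborel) \<le>
        (\<integral>x. \<bar>F k x - f x\<bar> * \<bar>G k x\<bar> + \<bar>f x\<bar> * \<bar>G k x - g x\<bar> \<partial>lborel)"
    proof (rule integral_mono)
      show "\<bar>F k x * G k x - f x * g x\<bar> \<le> \<bar>F k x - f x\<bar> * \<bar>G k x\<bar> + \<bar>f x\<bar> * \<bar>G k x - g x\<bar>" for x
        unfolding abs_mult[symmetric]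
        by (rule order_trans[OF _ abs_triangle_ineq]) (simp add: algebra_simps)
    qed (use int i1 i2 in simp_all)
    also have "\<dots> = L2_inner (\<lambda>x. \<bar>F k x - f x\<bar>) (\<lambda>x. \<bar>G k x\<bar>) + L2_inner (\<lambda>x. \<bar>f x\<bar>) (\<lambda>x. \<bar>G k x - g x\<bar>)"
      using i1 i2 by (simp add: L2_inner_def)
    also have "\<dots> \<le> ?b k"
      using L2_Cauchy_Schwarz[OF abs_L2[OF d(1)] abs_L2[OF G(2)[of k]]] L2_Cauchy_Schwarz[OF abs_L2[OF f] abs_L2[OF d(2)]]
      by (simp add: abs_norm)
    finally show ?thesis .
  qed
  have "(?b \<longlongrightarrow> 0 * L2_norm g + L2_norm f * 0) sequentially"
    using F G by (intro tendsto_intros L2_lim_norm) (auto simp: L2_lim_def)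
  then have b: "?b \<longlonglongrightarrow> 0" by simp
  have lim: "(\<lambda>k. \<integral>x. \<bar>F k x * G k x - f x * g x\<bar> \<partial>lborel) \<longlonglongrightarrow> 0"
    by (rule tendsto_zero_le[OF b]) (use le in auto)
  have m: "(\<lambda>x. f x * g x) \<in> borel_measurable borel"
    by (intro borel_measurable_times L2_measurable f g)
  show "(\<lambda>x. f x * g x) \<in> L2" "L2_norm (\<lambda>x. f x * g x) \<le> M"
    using L2_norm_le_of_L1_limit[OF M m int lim] by auto
qed

text \<open>Equivalently the sum of the first \<open>k\<close> smoothed pieces; it starts at 0 and
  tends to \<open>f\<close> as the residuals decay.\<close>

definition approximant :: "nat \<Rightarrow> (real ^ 'n \<Rightarrow> real) \<Rightarrow> real ^ 'n \<Rightarrow> real" where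
  "approximant k f x = f x - residual k f x"

lemma approximant_L2: "f \<in> L2 \<Longrightarrow> approximant k f \<in> L2"
  unfolding approximant_def[abs_def] by simp

lemma approximant_Suc:
  "approximant (Suc k) f x = approximant k f x + smoothing ((1/2) ^ k) (residual k f) x"
  by (simp add: approximant_def)

lemma geometric_sum_le:
  fixes q :: real assumes "0 \<le> q" "q < 1" shows "(\<Sum>i<k. q ^ i) \<le> 1 / (1 - q)"
proof -
  have "(\<Sum>i<k. q ^ i) = (1 - q ^ k) / (1 - q)" using assms by (simp add: sum_gp_strict)
  also have "\<dots> \<le> 1 / (1 - q)" using assms by (intro divide_right_mono) auto
  finally show ?thesis .
qed

text \<open>The piece at scale \<open>(1/2)^k\<close> has small L^2 norm by the decay of the
  residual; its sup-norm pays the factor \<open>sqrt (2^n)^k\<close> for the volume of the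
  cube.\<close>

lemma smoothing_residual_bound:
  fixes f :: "real ^ 'n::finite \<Rightarrow> real"
  assumes f: "f \<in> L2" and d: "L2_norm (residual k f) \<le> C * ((1/2) ^ s) ^ k * N"
  shows "\<bar>smoothing ((1/2) ^ k) (residual k f) x\<bar> \<le> C * N * (sqrt (2 ^ CARD('n)) * (1/2) ^ s) ^ k"
    and "L2_norm (smoothing ((1/2) ^ k) (residual k f)) \<le> C * N * ((1/2) ^ s) ^ k"
proof -
  have eq: "1 / sqrt (((1/2) ^ k) ^ CARD('n)) = sqrt (2 ^ CARD('n)) ^ k"
    by (simp add: real_sqrt_power[symmetric] power_one_over real_sqrt_divide power_mult[symmetric] mult.commute)
  have "\<bar>smoothing ((1/2) ^ k) (residual k f) x\<bar> \<le> L2_norm (residual k f) / sqrt (\<bar>(1/2) ^ k\<bar> ^ CARD('n))"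
    by (rule smoothing_bound) (use f in auto)
  also have "\<dots> = L2_norm (residual k f) * (1 / sqrt (((1/2) ^ k) ^ CARD('n)))" by simp
  also have "\<dots> \<le> C * ((1/2) ^ s) ^ k * N * sqrt (2 ^ CARD('n)) ^ k"
    unfolding eq by (intro mult_right_mono d) simp
  finally show "\<bar>smoothing ((1/2) ^ k) (residual k f) x\<bar> \<le> C * N * (sqrt (2 ^ CARD('n)) * (1/2) ^ s) ^ k"
    by (simp add: power_mult_distrib mult_ac)
  have "L2_norm (smoothing ((1/2) ^ k) (residual k f)) \<le> L2_norm (residual k f)"
    by (rule smoothing_norm) (use f in auto)
  also note d
  finally show "L2_norm (smoothing ((1/2) ^ k) (residual k f)) \<le> C * N * ((1/2) ^ s) ^ k"
    by (simp add: mult_ac)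
qed

lemma approximant_bound:
  fixes f :: "real ^ 'n::finite \<Rightarrow> real"
  assumes f: "f \<in> L2" and d: "\<And>k. L2_norm (residual k f) \<le> C * ((1/2) ^ s) ^ k * N"
    and \<Gamma>: "sqrt (2 ^ CARD('n)) * (1/2) ^ s \<le> \<Gamma>" and CN: "0 \<le> C" "0 \<le> N"
  shows "\<bar>approximant k f x\<bar> \<le> C * N * (\<Sum>i<k. \<Gamma> ^ i)"
proof (induction k)
  case (Suc k)
  have "\<bar>smoothing ((1/2) ^ k) (residual k f) x\<bar> \<le> C * N * (sqrt (2 ^ CARD('n)) * (1/2) ^ s) ^ k"
    by (rule smoothing_residual_bound(1)[OF f d])
  also have "\<dots> \<le> C * N * \<Gamma> ^ k"
    using CN \<Gamma> by (intro mult_left_mono power_mono) auto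
  finally show ?case using Suc by (simp add: approximant_Suc distrib_left)
qed (simp add: approximant_def)

lemma approximant_lim:
  fixes f :: "real ^ 'n::finite \<Rightarrow> real"
  assumes f: "f \<in> L2" and d: "\<And>k. L2_norm (residual k f) \<le> C * ((1/2) ^ Suc s) ^ k * N"
  shows "L2_lim (\<lambda>k. approximant k f) f sequentially"
proof (rule L2_limI_bound[OF f])
  show "\<forall>\<^sub>F k in sequentially. approximant k f \<in> L2" using approximant_L2[OF f] by simp
  have "(1 / 2 :: real) ^ Suc s < 1" using power_Suc_less_one[of "1/2 :: real" s] by simp
  then have "(\<lambda>k. C * ((1/2) ^ Suc s) ^ k * N) \<longlonglongrightarrow> C * 0 * N"
    by (intro tendsto_intros LIMSEQ_realpow_zero) auto
  then show "(\<lambda>k. C * ((1/2) ^ Suc s) ^ k * N) \<longlonglongrightarrow> 0" by simp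
  show "\<forall>\<^sub>F k in sequentially. L2_norm (\<lambda>x. approximant k f x - f x) \<le> C * ((1/2) ^ Suc s) ^ k * N"
    using d by (intro always_eventually) (simp add: approximant_def)
qed

lemma sqrt_half: "0 \<le> sqrt (1/2)" "sqrt (1/2) < 1" "5/8 \<le> sqrt (1/2)"
proof -
  show "5/8 \<le> sqrt (1/2)" by (rule real_le_rsqrt) (simp add: power2_eq_square)
qed (auto simp: real_sqrt_lt_1_iff)

text \<open>Here the strict inequality \<open>2 * s > n\<close> enters: between integers it leaves
  room for one full factor \<open>1/2\<close> under the root, hence geometric series of ratio at
  most \<open>sqrt (1/2)\<close>.\<close>

lemma sobolev_ratio:
  assumes "n + 1 \<le> 2 * s"
  shows "sqrt (2 ^ n) * (1/2) ^ s \<le> sqrt (1/2 :: real)"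
proof (rule real_le_rsqrt)
  have "(2::real) ^ (n + 1) \<le> 2 ^ (2 * s)" using assms by (intro power_increasing) auto
  then show "(sqrt (2 ^ n) * (1/2) ^ s)\<^sup>2 \<le> (1/2 :: real)"
    by (simp add: power_mult_distrib power_one_over power_mult[symmetric] mult.commute field_simps)
qed

text \<open>In essence the embedding of H^s into bounded functions: the sup-norms of the pieces of
  \<open>f\<close> form a convergent geometric series, so the approximants act as uniformly bounded
  multipliers.\<close>

lemma sobolev_product_zero:
  assumes s: "CARD('n) + 1 \<le> 2 * s"
  shows "\<exists>K\<ge>0. \<forall>(f :: real ^ 'n::finite \<Rightarrow> real) g M N. sobolev_bound s M f \<longrightarrow> g \<in> L2 \<longrightarrow> L2_norm g \<le> N \<longrightarrow>
    (\<lambda>x. f x * g x) \<in> L2 \<and> L2_norm (\<lambda>x. f x * g x) \<le> K * M * N"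
proof -
  obtain s' where s': "s = Suc s'" using s by (cases s) auto
  obtain C where C: "C \<ge> 1" "\<And>(f :: real ^ 'n \<Rightarrow> real) N i. sobolev_bound s N f \<Longrightarrow>
    L2_norm (residual i f) \<le> C * ((1/2) ^ s) ^ i * N" using residual_decay[of s] by blast
  define K where "K = C * (1 / (1 - sqrt (1/2)))"
  have "(\<lambda>x. f x * g x) \<in> L2 \<and> L2_norm (\<lambda>x. f x * g x) \<le> K * M * N"
    if f: "sobolev_bound s M f" and g: "g \<in> L2" "L2_norm g \<le> N" for f g :: "real ^ 'n \<Rightarrow> real" and M N
  proof -
    have f2: "f \<in> L2" and M: "0 \<le> M"
      using sobolev_bound_L2[OF f] L2_norm_nonneg order_trans by blast+
    have bd: "\<bar>approximant k f x\<bar> \<le> K * M" for k x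
    proof -
      have "\<bar>approximant k f x\<bar> \<le> C * M * (\<Sum>i<k. sqrt (1/2) ^ i)"
        by (rule approximant_bound[OF f2 C(2)[OF f] sobolev_ratio[OF s]]) (use C M in auto)
      also have "\<dots> \<le> C * M * (1 / (1 - sqrt (1/2)))"
        using C M by (intro mult_left_mono geometric_sum_le sqrt_half) auto
      finally show ?thesis by (simp add: K_def mult_ac)
    qed
    have am: "approximant k f \<in> borel_measurable borel" for k
      by (rule L2_measurable[OF approximant_L2[OF f2]])
    have KM: "0 \<le> K * M" using bd[of 0 0] by (meson abs_ge_zero order_trans)
    have ae: "AE x in lborel. \<bar>approximant k f x\<bar> \<le> K * M" for k using bd by simp
    have n: "L2_norm (\<lambda>x. approximant k f x * g x) \<le> K * M * N" for k
    proof -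
      have "L2_norm (\<lambda>x. approximant k f x * g x) \<le> \<bar>K * M\<bar> * L2_norm g"
        by (rule L2_norm_bounded_mult(2)[OF g(1) am ae])
      also have "\<dots> \<le> K * M * N" using KM g(2) by (simp add: mult_left_mono)
      finally show ?thesis .
    qed
    show ?thesis
      using L2_mult_bound_limit[OF approximant_lim[OF f2 C(2)[OF f, unfolded s']] approximant_L2[OF f2]
          L2_lim_const[OF g(1)] g(1) L2_norm_bounded_mult(1)[OF g(1) am ae] n]
      by blast
  qed
  moreover have "0 \<le> K" using C sqrt_half by (simp add: K_def)
  ultimately show ?thesis by blast
qed

text \<open>Neither factor need be bounded here. In each increment of the product the approximant
  may grow in sup-norm like \<open>\<Gamma>^k\<close>, but it meets a piece of the other factor
  whose L^2 norm decays fast enough to leave the ratio \<open>sqrt (1/2)\<close>.\<close>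

lemma sobolev_product_pos:
  assumes s: "CARD('n) + 1 \<le> 2 * (Suc s1 + Suc s2)"
  shows "\<exists>K\<ge>0. \<forall>(f :: real ^ 'n::finite \<Rightarrow> real) g M N. sobolev_bound (Suc s1) M f \<longrightarrow> sobolev_bound (Suc s2) N g \<longrightarrow>
    (\<lambda>x. f x * g x) \<in> L2 \<and> L2_norm (\<lambda>x. f x * g x) \<le> K * M * N"
proof -
  obtain C1 where C1: "C1 \<ge> 1" "\<And>(f :: real ^ 'n \<Rightarrow> real) N i. sobolev_bound (Suc s1) N f \<Longrightarrow>
    L2_norm (residual i f) \<le> C1 * ((1/2) ^ Suc s1) ^ i * N" using residual_decay[of "Suc s1"] by blast
  obtain C2 where C2: "C2 \<ge> 1" "\<And>(f :: real ^ 'n \<Rightarrow> real) N i. sobolev_bound (Suc s2) N f \<Longrightarrow>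
    L2_norm (residual i f) \<le> C2 * ((1/2) ^ Suc s2) ^ i * N" using residual_decay[of "Suc s2"] by blast
  let ?q = "sqrt (1/2) :: real"
  \<comment> \<open>The lower bound 5/4 makes partial geometric sums at most
    \<open>4 * \<Gamma>^k\<close>, even if the true ratio is close to or below 1. It is harmless
    since 5/4 times 1/2 is still below \<open>sqrt (1/2)\<close>.\<close>
  define \<Gamma> where "\<Gamma> s = max (sqrt (2 ^ CARD('n)) * (1/2) ^ s) (5/4 :: real)" for s
  have \<Gamma>: "5/4 \<le> \<Gamma> s" "sqrt (2 ^ CARD('n)) * (1/2) ^ s \<le> \<Gamma> s" for s by (auto simp: \<Gamma>_def)
  have \<Gamma>sum: "(\<Sum>i<k. \<Gamma> s ^ i) \<le> 4 * \<Gamma> s ^ k" for s k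
  proof -
    have "(\<Sum>i<k. \<Gamma> s ^ i) = (\<Gamma> s ^ k - 1) / (\<Gamma> s - 1)" using \<Gamma>(1)[of s] by (subst geometric_sum) auto
    also have "\<dots> \<le> (\<Gamma> s ^ k) / (1/4)" using \<Gamma>(1)[of s] by (intro frac_le) auto
    finally show ?thesis by simp
  qed
  have ratio: "\<Gamma> (Suc s) * (1/2) ^ Suc t \<le> ?q" if "CARD('n) + 1 \<le> 2 * (Suc s + Suc t)" for s t
  proof -
    have 1: "(1/2 :: real) ^ Suc t \<le> 1/2" using power_le_one[of "1/2::real" t] by simp
    have 2: "(1/2 :: real) ^ Suc t > 0" by simp
    have "sqrt (2 ^ CARD('n)) * (1/2) ^ Suc s * (1/2) ^ Suc t \<le> ?q"
      using sobolev_ratio[OF that] by (simp only: power_add mult.assoc)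
    moreover have "5/4 * (1/2 :: real) ^ Suc t \<le> ?q" using 1 sqrt_half by linarith
    ultimately show ?thesis by (auto simp: \<Gamma>_def max_def)
  qed
  define L where "L = \<Gamma> (Suc s2)"
  \<comment> \<open>The two summands belong to the two halves of an increment; \<open>L\<close> is
    the extra power of \<open>\<Gamma>\<close> caused by the index \<open>Suc k\<close> in the first
    half.\<close>
  define K where "K = (4 * C1 * C2 * L + 4 * C1 * C2) * (1 / (1 - ?q))"
  have L: "0 \<le> L" using \<Gamma>(1)[of "Suc s2"] by (simp add: L_def)
  have K0: "0 \<le> K" using C1 C2 L sqrt_half by (simp add: K_def)
  have "(\<lambda>x. f x * g x) \<in> L2 \<and> L2_norm (\<lambda>x. f x * g x) \<le> K * M * N"
    if f: "sobolev_bound (Suc s1) M f" and g: "sobolev_bound (Suc s2) N g" for f g :: "real ^ 'n \<Rightarrow> real" and M N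
  proof -
    have f2: "f \<in> L2" and M: "0 \<le> M"
      using sobolev_bound_L2[OF f] L2_norm_nonneg order_trans by blast+
    have g2: "g \<in> L2" and N: "0 \<le> N"
      using sobolev_bound_L2[OF g] L2_norm_nonneg order_trans by blast+
    note fd = C1(2)[OF f] and gd = C2(2)[OF g]
    let ?F = "\<lambda>k. approximant k f" and ?G = "\<lambda>k. approximant k g"
    let ?p = "\<lambda>k. smoothing ((1/2) ^ k) (residual k f)" and ?r = "\<lambda>k. smoothing ((1/2) ^ k) (residual k g)"
    have F2: "?F k \<in> L2" "?G k \<in> L2" "?p k \<in> L2" "?r k \<in> L2" for k
      using f2 g2 by (auto intro: approximant_L2)
    have Fb: "AE x in lborel. \<bar>?F k x\<bar> \<le> 4 * C1 * M * \<Gamma> (Suc s1) ^ k" for k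
    proof (rule AE_I2)
      fix x
      have "\<bar>?F k x\<bar> \<le> C1 * M * (\<Sum>i<k. \<Gamma> (Suc s1) ^ i)"
        by (rule approximant_bound[OF f2 fd \<Gamma>(2)]) (use C1 M in auto)
      also have "\<dots> \<le> C1 * M * (4 * \<Gamma> (Suc s1) ^ k)" using C1 M by (intro mult_left_mono \<Gamma>sum) auto
      finally show "\<bar>?F k x\<bar> \<le> 4 * C1 * M * \<Gamma> (Suc s1) ^ k" by (simp add: mult_ac)
    qed
    have Gb: "AE x in lborel. \<bar>?G k x\<bar> \<le> 4 * C2 * N * \<Gamma> (Suc s2) ^ k" for k
    proof (rule AE_I2)
      fix x
      have "\<bar>?G k x\<bar> \<le> C2 * N * (\<Sum>i<k. \<Gamma> (Suc s2) ^ i)"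
        by (rule approximant_bound[OF g2 gd \<Gamma>(2)]) (use C2 N in auto)
      also have "\<dots> \<le> C2 * N * (4 * \<Gamma> (Suc s2) ^ k)" using C2 N by (intro mult_left_mono \<Gamma>sum) auto
      finally show "\<bar>?G k x\<bar> \<le> 4 * C2 * N * \<Gamma> (Suc s2) ^ k" by (simp add: mult_ac)
    qed
    have prod_le: "(\<lambda>x. a x * k x) \<in> L2 \<and> L2_norm (\<lambda>x. a x * k x) \<le> c * q ^ i"
      if "a \<in> L2" "k \<in> L2" "AE x in lborel. \<bar>a x\<bar> \<le> c1 * G ^ j" "L2_norm k \<le> c2 * h ^ i"
        "c1 * G ^ j * (c2 * h ^ i) \<le> c * q ^ i" "0 \<le> c1" "0 \<le> G"
      for a k :: "real ^ 'n \<Rightarrow> real" and c1 c2 G h q c :: real and i j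
    proof
      note b = L2_norm_bounded_mult[OF that(2) L2_measurable[OF that(1)] that(3)]
      show "(\<lambda>x. a x * k x) \<in> L2" by (rule b(1))
      have "L2_norm (\<lambda>x. a x * k x) \<le> (c1 * G ^ j) * L2_norm k" using b(2) that(6,7) by simp
      also have "\<dots> \<le> c1 * G ^ j * (c2 * h ^ i)" using that(4,6,7) by (intro mult_left_mono) auto
      finally show "L2_norm (\<lambda>x. a x * k x) \<le> c * q ^ i" using that(5) by linarith
    qed
    have pq: "x ^ k * y ^ k \<le> ?q ^ k" if "0 \<le> x * y" "x * y \<le> ?q" for x y :: real and k
      unfolding power_mult_distrib[symmetric] using that by (intro power_mono)
    have 1: "(\<lambda>x. ?G (Suc k) x * ?p k x) \<in> L2 \<and>
        L2_norm (\<lambda>x. ?G (Suc k) x * ?p k x) \<le> (4 * C1 * C2 * L * M * N) * ?q ^ k" for k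
    proof (rule prod_le[OF F2(2) F2(3) Gb smoothing_residual_bound(2)[OF f2 fd]])
      have "4 * C2 * N * \<Gamma> (Suc s2) ^ Suc k * (C1 * M * ((1/2) ^ Suc s1) ^ k) =
          (4 * C1 * C2 * L * M * N) * (\<Gamma> (Suc s2) ^ k * ((1/2) ^ Suc s1) ^ k)"
        by (simp add: L_def mult_ac)
      also have "\<dots> \<le> (4 * C1 * C2 * L * M * N) * ?q ^ k"
        using ratio[of s2 s1] s C1 C2 M N L \<Gamma>(1)[of "Suc s2"] by (intro mult_left_mono pq) (auto simp: add.commute)
      finally show "4 * C2 * N * \<Gamma> (Suc s2) ^ Suc k * (C1 * M * ((1/2) ^ Suc s1) ^ k) \<le>
        (4 * C1 * C2 * L * M * N) * ?q ^ k" .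
    qed (use C2 N \<Gamma>(1)[of "Suc s2"] in auto)
    have 2: "(\<lambda>x. ?F k x * ?r k x) \<in> L2 \<and>
        L2_norm (\<lambda>x. ?F k x * ?r k x) \<le> (4 * C1 * C2 * M * N) * ?q ^ k" for k
    proof (rule prod_le[OF F2(1) F2(4) Fb smoothing_residual_bound(2)[OF g2 gd]])
      have "4 * C1 * M * \<Gamma> (Suc s1) ^ k * (C2 * N * ((1/2) ^ Suc s2) ^ k) =
          (4 * C1 * C2 * M * N) * (\<Gamma> (Suc s1) ^ k * ((1/2) ^ Suc s2) ^ k)"
        by (simp add: mult_ac)
      also have "\<dots> \<le> (4 * C1 * C2 * M * N) * ?q ^ k"
        using ratio[of s1 s2] s C1 C2 M N \<Gamma>(1)[of "Suc s1"] by (intro mult_left_mono pq) auto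
      finally show "4 * C1 * M * \<Gamma> (Suc s1) ^ k * (C2 * N * ((1/2) ^ Suc s2) ^ k) \<le>
        (4 * C1 * C2 * M * N) * ?q ^ k" .
    qed (use C1 M \<Gamma>(1)[of "Suc s1"] in auto)
    let ?c = "(4 * C1 * C2 * L + 4 * C1 * C2) * M * N"
    have FG: "(\<lambda>x. ?F k x * ?G k x) \<in> L2 \<and> L2_norm (\<lambda>x. ?F k x * ?G k x) \<le> ?c * (\<Sum>i<k. ?q ^ i)" for k
    proof (induction k)
      case 0
      show ?case by (simp add: approximant_def)
    next
      case (Suc k)
      \<comment> \<open>The new piece of \<open>f\<close> is paired with the updated approximant of
        \<open>g\<close>, the new piece of \<open>g\<close> with the old approximant of
        \<open>f\<close>, so there is no product of two pieces.\<close>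
      have eq: "?F (Suc k) x * ?G (Suc k) x = ?F k x * ?G k x + (?G (Suc k) x * ?p k x + ?F k x * ?r k x)" for x
        by (simp add: approximant_Suc algebra_simps)
      have i: "(\<lambda>x. ?G (Suc k) x * ?p k x + ?F k x * ?r k x) \<in> L2" using 1 2 by (intro L2_add) blast+
      have "L2_norm (\<lambda>x. ?F (Suc k) x * ?G (Suc k) x) \<le>
          L2_norm (\<lambda>x. ?F k x * ?G k x) + L2_norm (\<lambda>x. ?G (Suc k) x * ?p k x + ?F k x * ?r k x)"
        unfolding eq using Suc i by (intro L2_norm_triangle) blast+
      moreover have "L2_norm (\<lambda>x. ?G (Suc k) x * ?p k x + ?F k x * ?r k x) \<le>
          L2_norm (\<lambda>x. ?G (Suc k) x * ?p k x) + L2_norm (\<lambda>x. ?F k x * ?r k x)"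
        using 1 2 by (intro L2_norm_triangle) blast+
      moreover have "?c * (\<Sum>i<Suc k. ?q ^ i) = ?c * (\<Sum>i<k. ?q ^ i) + (4 * C1 * C2 * L * M * N) * ?q ^ k + (4 * C1 * C2 * M * N) * ?q ^ k"
        by (simp add: algebra_simps)
      moreover note conjunct2[OF Suc] conjunct2[OF 1[of k]] conjunct2[OF 2[of k]]
      ultimately have "L2_norm (\<lambda>x. ?F (Suc k) x * ?G (Suc k) x) \<le> ?c * (\<Sum>i<Suc k. ?q ^ i)" by linarith
      moreover have "(\<lambda>x. ?F (Suc k) x * ?G (Suc k) x) \<in> L2"
        unfolding eq by (rule L2_add[OF conjunct1[OF Suc] i])
      ultimately show ?case by blast
    qed
    have b: "L2_norm (\<lambda>x. ?F k x * ?G k x) \<le> K * M * N" for k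
    proof -
      have "?c * (\<Sum>i<k. ?q ^ i) \<le> ?c * (1 / (1 - ?q))"
        using C1 C2 L M N by (intro mult_left_mono geometric_sum_le sqrt_half) auto
      then show ?thesis using FG[of k] by (simp add: K_def mult_ac)
    qed
    show ?thesis
      using L2_mult_bound_limit[OF approximant_lim[OF f2 fd] F2(1) approximant_lim[OF g2 gd] F2(2) FG[THEN conjunct1] b]
      by blast
  qed
  then show ?thesis using K0 by blast
qed

text \<open>Only finitely many pairs of orders occur, so the sum of their constants serves for all
  pairs at once.\<close>

theorem sobolev_product_estimate:
  "\<exists>K\<ge>0. \<forall>s1\<le>m. \<forall>s2\<le>m. CARD('n) + 1 \<le> 2 * (s1 + s2) \<longrightarrow>
    (\<forall>(f :: real ^ 'n::finite \<Rightarrow> real) g M N. sobolev_bound s1 M f \<longrightarrow> sobolev_bound s2 N g \<longrightarrow>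
      (\<lambda>x. f x * g x) \<in> L2 \<and> L2_norm (\<lambda>x. f x * g x) \<le> K * M * N)"
proof -
  let ?P = "\<lambda>s1 s2 K. \<forall>(f :: real ^ 'n \<Rightarrow> real) g M N. sobolev_bound s1 M f \<longrightarrow> sobolev_bound s2 N g \<longrightarrow>
      (\<lambda>x. f x * g x) \<in> L2 \<and> L2_norm (\<lambda>x. f x * g x) \<le> K * M * N"
  have ex: "\<exists>K\<ge>0. ?P s1 s2 K" if s: "CARD('n) + 1 \<le> 2 * (s1 + s2)" for s1 s2
  proof (cases s1)
    case 0
    then obtain K where K: "K \<ge> 0" "\<And>(f :: real ^ 'n \<Rightarrow> real) g M N. sobolev_bound s2 M f \<Longrightarrow> g \<in> L2 \<Longrightarrow> L2_norm g \<le> N \<Longrightarrow>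
        (\<lambda>x. f x * g x) \<in> L2 \<and> L2_norm (\<lambda>x. f x * g x) \<le> K * M * N"
      using sobolev_product_zero[where 'n = 'n, of s2] s by auto
    have "?P s1 s2 K"
    proof (intro allI impI)
      fix f g :: "real ^ 'n \<Rightarrow> real" and M N
      assume "sobolev_bound s1 M f" "sobolev_bound s2 N g"
      then show "(\<lambda>x. f x * g x) \<in> L2 \<and> L2_norm (\<lambda>x. f x * g x) \<le> K * M * N"
        using K(2)[of N g f M] 0 by (simp add: mult_ac)
    qed
    then show ?thesis using K(1) by blast
  next
    case s1: (Suc s1')
    show ?thesis
    proof (cases s2)
      case 0
      then obtain K where "K \<ge> 0" "\<And>(f :: real ^ 'n \<Rightarrow> real) g M N. sobolev_bound s1 M f \<Longrightarrow> g \<in> L2 \<Longrightarrow> L2_norm g \<le> N \<Longrightarrow>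
          (\<lambda>x. f x * g x) \<in> L2 \<and> L2_norm (\<lambda>x. f x * g x) \<le> K * M * N"
        using sobolev_product_zero[where 'n = 'n, of s1] s by auto
      then show ?thesis using 0 by (intro exI[of _ K]) auto
    next
      case (Suc s2')
      then show ?thesis using sobolev_product_pos[where 'n = 'n, of s1' s2'] s s1 by simp
    qed
  qed
  then obtain K where K: "\<And>s1 s2. CARD('n) + 1 \<le> 2 * (s1 + s2) \<Longrightarrow> K s1 s2 \<ge> 0 \<and> ?P s1 s2 (K s1 s2)"
    by metis
  define K' where "K' = (\<Sum>s1\<le>m. \<Sum>s2\<le>m. max 0 (K s1 s2))"
  have le: "K s1 s2 \<le> K'" if "s1 \<le> m" "s2 \<le> m" for s1 s2
  proof -
    have "K s1 s2 \<le> (\<Sum>s2\<le>m. max 0 (K s1 s2))"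
      using that member_le_sum[of s2 "{..m}" "\<lambda>s2. max 0 (K s1 s2)"] by simp
    also have "\<dots> \<le> K'"
      unfolding K'_def using that member_le_sum[of s1 "{..m}" "\<lambda>s1. \<Sum>s2\<le>m. max 0 (K s1 s2)"]
      by (simp add: sum_nonneg)
    finally show ?thesis .
  qed
  have "?P s1 s2 K'" if s: "s1 \<le> m" "s2 \<le> m" "CARD('n) + 1 \<le> 2 * (s1 + s2)" for s1 s2
  proof (intro allI impI conjI)
    fix f g :: "real ^ 'n \<Rightarrow> real" and M N
    assume f: "sobolev_bound s1 M f" and g: "sobolev_bound s2 N g"
    have MN: "0 \<le> M" "0 \<le> N"
      using sobolev_bound_L2[OF f] sobolev_bound_L2[OF g] L2_norm_nonneg order_trans by blast+
    show "(\<lambda>x. f x * g x) \<in> L2" using K[OF s(3)] f g by blast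
    have "L2_norm (\<lambda>x. f x * g x) \<le> K s1 s2 * M * N" using K[OF s(3)] f g by blast
    also have "\<dots> \<le> K' * M * N" using MN le[OF s(1,2)] by (intro mult_right_mono) auto
    finally show "L2_norm (\<lambda>x. f x * g x) \<le> K' * M * N" .
  qed
  moreover have "0 \<le> K'" unfolding K'_def by (intro sum_nonneg) auto
  ultimately show ?thesis by blast
qed

section \<open>Space-time multi-indices\<close>

text \<open>The index \<open>None\<close> stands for the time direction, \<open>Some j\<close> for the \<open>j\<close>-th space direction.\<close>

type_synonym 'n spacetime_index = "'n option \<Rightarrow> nat"

definition inc :: "'i \<Rightarrow> ('i \<Rightarrow> nat) \<Rightarrow> 'i \<Rightarrow> nat" where
  "inc d A = A(d := Suc (A d))"

lemma inc_commute: "inc d (inc e A) = inc e (inc d A)"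
  by (auto simp: inc_def fun_eq_iff)

lemma mi_size_inc [simp]: "mi_size (inc d A) = Suc (mi_size A)"
proof -
  have "mi_size A = A d + (\<Sum>i\<in>UNIV - {d}. A i)" for A :: "'a multi_index"
    unfolding mi_size_def by (simp add: sum.remove[of UNIV d])
  from this[of "inc d A"] this[of A] show ?thesis by (simp add: inc_def)
qed

lemma mi_size_zero [simp]: "mi_size (\<lambda>_. 0) = 0"
  by (simp add: mi_size_def)

lemma inc_None [simp]: "inc None A None = Suc (A None)" "inc (Some j) A None = A None"
  by (auto simp: inc_def)

lemma index_le_mi_size: "A i \<le> mi_size A"
  unfolding mi_size_def by (rule member_le_sum) auto

lemma finite_mi_size_le: "finite {A :: 'n::finite multi_index. mi_size A \<le> k}"
proof (rule finite_subset)
  show "{A :: 'n multi_index. mi_size A \<le> k} \<subseteq> PiE UNIV (\<lambda>_. {..k})"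
    using index_le_mi_size order_trans by fastforce
qed (intro finite_PiE, auto)

definition space_extensions :: "nat \<Rightarrow> 'n::finite spacetime_index \<Rightarrow> 'n spacetime_index set" where
  "space_extensions s A = {B. B None = A None \<and> mi_size A \<le> mi_size B \<and> mi_size B \<le> mi_size A + s}"

lemma finite_space_extensions [simp]: "finite (space_extensions s A)"
  by (rule finite_subset[OF _ finite_mi_size_le[of "mi_size A + s"]]) (auto simp: space_extensions_def)

lemma self_in_space_extensions: "A \<in> space_extensions s A"
  by (simp add: space_extensions_def)

lemma space_extensions_Suc:
  "B \<in> space_extensions s (inc (Some j) A) \<Longrightarrow> B \<in> space_extensions (Suc s) A"
  by (auto simp: space_extensions_def)

lemma sobolev_boundI:
  assumes "\<And>B j. B \<in> space_extensions s A \<Longrightarrow> mi_size B < mi_size A + s \<Longrightarrow>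
      strong_partial j (W B) (W (inc (Some j) B))"
    and "\<And>B. B \<in> space_extensions s A \<Longrightarrow> W B \<in> L2 \<and> L2_norm (W B) \<le> N"
  shows "sobolev_bound s N (W A)"
  using assms
proof (induction s arbitrary: A)
  case 0
  show ?case using "0.prems"(2)[OF self_in_space_extensions] by simp
next
  case (Suc s)
  have "sobolev_bound s N (W (inc (Some j) A))" for j
  proof (rule Suc.IH)
    fix B i assume "B \<in> space_extensions s (inc (Some j) A)" "mi_size B < mi_size (inc (Some j) A) + s"
    then show "strong_partial i (W B) (W (inc (Some i) B))"
      using Suc.prems(1)[OF space_extensions_Suc] by simp
  next
    fix B assume "B \<in> space_extensions s (inc (Some j) A)"
    then show "W B \<in> L2 \<and> L2_norm (W B) \<le> N" using Suc.prems(2)[OF space_extensions_Suc] by blast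
  qed
  moreover have "strong_partial j (W A) (W (inc (Some j) A))" for j
    using Suc.prems(1)[OF self_in_space_extensions] by simp
  ultimately show ?case using Suc.prems(2)[OF self_in_space_extensions] by auto
qed

section \<open>Convergence in Sobolev norm\<close>

text \<open>Convergence in H^s in the language of \<open>sobolev_bound\<close>: the differences
  admit bounds \<open>\<nu> h\<close> tending to 0. Such bounds can be fed directly into the
  bilinear estimate.\<close>

definition sobolev_lim :: "nat \<Rightarrow> ('a \<Rightarrow> real ^ 'n::finite \<Rightarrow> real) \<Rightarrow> (real ^ 'n \<Rightarrow> real) \<Rightarrow> 'a filter \<Rightarrow> bool" where
  "sobolev_lim s F f \<FF> \<longleftrightarrow> (\<exists>M. sobolev_bound s M f) \<and>
     (\<exists>\<nu>. (\<nu> \<longlongrightarrow> 0) \<FF> \<and> (\<forall>\<^sub>F h in \<FF>. F h \<in> L2 \<and> sobolev_bound s (\<nu> h) (\<lambda>x. F h x - f x)))"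

lemma sobolev_limI:
  fixes W :: "'a \<Rightarrow> 'n::finite spacetime_index \<Rightarrow> real ^ 'n \<Rightarrow> real"
  assumes W: "\<forall>\<^sub>F h in \<FF>. \<forall>B j. B \<in> space_extensions s A \<longrightarrow> mi_size B < mi_size A + s \<longrightarrow>
      strong_partial j (W h B) (W h (inc (Some j) B))"
    and W0: "\<And>B j. B \<in> space_extensions s A \<Longrightarrow> mi_size B < mi_size A + s \<Longrightarrow>
      strong_partial j (W0 B) (W0 (inc (Some j) B))"
    and lim: "\<And>B. B \<in> space_extensions s A \<Longrightarrow> L2_lim (\<lambda>h. W h B) (W0 B) \<FF>"
  shows "sobolev_lim s (\<lambda>h. W h A) (W0 A) \<FF>"
  unfolding sobolev_lim_def
proof (intro conjI exI)
  let ?X = "space_extensions s A"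
  have in2: "W0 B \<in> L2" if "B \<in> ?X" for B using lim[OF that] by auto
  show "sobolev_bound s (\<Sum>B\<in>?X. L2_norm (W0 B)) (W0 A)"
  proof (rule sobolev_boundI)
    fix B assume B: "B \<in> ?X"
    then show "W0 B \<in> L2 \<and> L2_norm (W0 B) \<le> (\<Sum>B\<in>?X. L2_norm (W0 B))"
      using in2 member_le_sum[OF B, of "\<lambda>B. L2_norm (W0 B)"] finite_space_extensions by auto
  qed (use W0 in auto)
  let ?\<nu> = "\<lambda>h. \<Sum>B\<in>?X. L2_norm (\<lambda>x. W h B x - W0 B x)"
  have "(?\<nu> \<longlongrightarrow> (\<Sum>B\<in>?X. 0)) \<FF>"
    using lim by (intro tendsto_sum) (simp add: L2_lim_def)
  then show "(?\<nu> \<longlongrightarrow> 0) \<FF>" by simp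
  have "\<forall>\<^sub>F h in \<FF>. \<forall>B\<in>?X. W h B \<in> L2"
    using lim finite_space_extensions by (subst eventually_ball_finite_distrib) (auto simp: L2_lim_def)
  then show "\<forall>\<^sub>F h in \<FF>. W h A \<in> L2 \<and> sobolev_bound s (?\<nu> h) (\<lambda>x. W h A x - W0 A x)"
    using W
  proof eventually_elim
    case (elim h)
    have "sobolev_bound s (?\<nu> h) ((\<lambda>B x. W h B x - W0 B x) A)"
    proof (rule sobolev_boundI)
      fix B j assume B: "B \<in> ?X" "mi_size B < mi_size A + s"
      then show "strong_partial j (\<lambda>x. W h B x - W0 B x) (\<lambda>x. W h (inc (Some j) B) x - W0 (inc (Some j) B) x)"
        using elim(2) W0 by (intro strong_partial_diff) auto
    next
      fix B assume B: "B \<in> ?X"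
      then show "(\<lambda>x. W h B x - W0 B x) \<in> L2 \<and> L2_norm (\<lambda>x. W h B x - W0 B x) \<le> ?\<nu> h"
        using elim in2 member_le_sum[OF B, of "\<lambda>B. L2_norm (\<lambda>x. W h B x - W0 B x)"] finite_space_extensions by auto
    qed
    moreover have "W h A \<in> L2" using elim(1) self_in_space_extensions by blast
    ultimately show ?case by simp
  qed
qed

section \<open>Shifts in time and space\<close>

fun shift :: "'n::finite option \<Rightarrow> real \<Rightarrow> (real \<Rightarrow> real ^ 'n \<Rightarrow> real) \<Rightarrow> real \<Rightarrow> real ^ 'n \<Rightarrow> real" where
  "shift None h W t = W (t + h)"
| "shift (Some j) h W t = (\<lambda>x. W t (x + h *\<^sub>R axis j 1))"

fun shift_domain :: "'n::finite option \<Rightarrow> real set \<Rightarrow> real \<Rightarrow> real set" where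
  "shift_domain None S t = {h. t + h \<in> S}"
| "shift_domain (Some j) S t = UNIV"

text \<open>One notion for time and space, so that the equation can be differentiated by a single
  induction over words of directions.\<close>

definition has_derivative_along where
  "has_derivative_along d S W W' t \<longleftrightarrow> L2_deriv (\<lambda>h. shift d h W t) W' 0 (shift_domain d S t)"

lemma shift_0 [simp]: "shift d 0 W t = W t"
  by (cases d) auto

lemma has_derivative_along_iff:
  "has_derivative_along d S W W' t \<longleftrightarrow> W t \<in> L2 \<and>
    L2_lim (\<lambda>h x. (shift d h W t x - W t x) / h) W' (at 0 within shift_domain d S t)"
  by (simp add: has_derivative_along_def L2_deriv_def)

lemma has_derivative_along_Some [simp]:
  "has_derivative_along (Some j) S W W' t \<longleftrightarrow> strong_partial j (W t) W'"
  by (simp add: has_derivative_along_def strong_partial_def)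

lemma at_within_shift:
  fixes t :: real
  shows "at t within S = filtermap (\<lambda>h. t + h) (at 0 within {h. t + h \<in> S})"
proof (rule filter_eqI)
  fix P
  have "eventually P (at t within S) \<longleftrightarrow> (\<exists>d>0. \<forall>x\<in>S. x \<noteq> t \<and> dist x t < d \<longrightarrow> P x)"
    by (simp add: eventually_at)
  also have "\<dots> \<longleftrightarrow> (\<exists>d>0. \<forall>h. t + h \<in> S \<longrightarrow> h \<noteq> 0 \<and> dist h 0 < d \<longrightarrow> P (t + h))"
  proof (rule ex_cong1, rule conj_cong[OF refl], safe)
    fix d x assume *: "\<forall>h. t + h \<in> S \<longrightarrow> h \<noteq> 0 \<and> dist h 0 < d \<longrightarrow> P (t + h)" "x \<in> S" "x \<noteq> t" "dist x t < d"
    then show "P x" using *(1)[rule_format, of "x - t"] by (simp add: dist_real_def)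
  qed (auto simp: dist_real_def)
  also have "\<dots> \<longleftrightarrow> eventually P (filtermap (\<lambda>h. t + h) (at 0 within {h. t + h \<in> S}))"
    by (simp add: eventually_filtermap eventually_at)
  finally show "eventually P (at t within S) \<longleftrightarrow> eventually P (filtermap (\<lambda>h. t + h) (at 0 within {h. t + h \<in> S}))" .
qed

lemma L2_lim_at_within_shift:
  fixes t :: real
  shows "L2_lim F f (at t within S) \<longleftrightarrow> L2_lim (\<lambda>h. F (t + h)) f (at 0 within {h. t + h \<in> S})"
  unfolding L2_lim_def at_within_shift[of t S] eventually_filtermap filterlim_filtermap by simp

lemma has_derivative_along_None [simp]:
  "has_derivative_along None S W W' t \<longleftrightarrow> L2_deriv W W' t S"
  unfolding has_derivative_along_iff L2_deriv_def L2_lim_at_within_shift[of _ _ t S] by simp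

lemma has_derivative_along_in: "has_derivative_along d S W W' t \<Longrightarrow> W t \<in> L2"
  "has_derivative_along d S W W' t \<Longrightarrow> W' \<in> L2"
  by (auto simp: has_derivative_along_iff)

lemma shift_add: "shift d h (\<lambda>t x. W t x + Z t x) t x = shift d h W t x + shift d h Z t x"
  by (cases d) auto

lemma shift_cmult: "shift d h (\<lambda>t x. k * W t x) t x = k * shift d h W t x"
  by (cases d) auto

lemma shift_diff: "shift d h (\<lambda>t x. W t x - Z t x) t x = shift d h W t x - shift d h Z t x"
  by (cases d) auto

lemma shift_mult: "shift d h (\<lambda>t x. W t x * Z t x) t x = shift d h W t x * shift d h Z t x"
  by (cases d) auto

lemma shift_sum: "shift d h (\<lambda>t x. \<Sum>i\<in>I. W i t x) t x = (\<Sum>i\<in>I. shift d h (W i) t x)"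
  by (cases d) auto

lemma has_derivative_along_add:
  "has_derivative_along d S W W' t \<Longrightarrow> has_derivative_along d S Z Z' t \<Longrightarrow>
    has_derivative_along d S (\<lambda>t x. W t x + Z t x) (\<lambda>x. W' x + Z' x) t"
  unfolding has_derivative_along_def
  using L2_deriv_add[of "\<lambda>h. shift d h W t" W' 0 "shift_domain d S t" "\<lambda>h. shift d h Z t" Z']
  by (simp add: shift_add[abs_def])

lemma has_derivative_along_cmult:
  "has_derivative_along d S W W' t \<Longrightarrow> has_derivative_along d S (\<lambda>t x. k * W t x) (\<lambda>x. k * W' x) t"
  unfolding has_derivative_along_def
  using L2_deriv_cmult[of "\<lambda>h. shift d h W t" W' 0 "shift_domain d S t" k]
  by (simp add: shift_cmult[abs_def])

lemma has_derivative_along_diff: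
  "has_derivative_along d S W W' t \<Longrightarrow> has_derivative_along d S Z Z' t \<Longrightarrow>
    has_derivative_along d S (\<lambda>t x. W t x - Z t x) (\<lambda>x. W' x - Z' x) t"
  unfolding has_derivative_along_def
  using L2_deriv_diff[of "\<lambda>h. shift d h W t" W' 0 "shift_domain d S t" "\<lambda>h. shift d h Z t" Z']
  by (simp add: shift_diff[abs_def])

lemma has_derivative_along_zero: "has_derivative_along d S (\<lambda>t x. 0) (\<lambda>x. 0) t"
  by (cases d) (auto simp: strong_partial_def L2_deriv_const)

lemma has_derivative_along_sum:
  "(\<And>i. i \<in> I \<Longrightarrow> has_derivative_along d S (W i) (W' i) t) \<Longrightarrow>
    has_derivative_along d S (\<lambda>t x. \<Sum>i\<in>I. W i t x) (\<lambda>x. \<Sum>i\<in>I. W' i x) t"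
  by (induction I rule: infinite_finite_induct) (auto intro: has_derivative_along_add has_derivative_along_zero)

lemma at_within_shift_domain_nontrivial:
  assumes "t \<in> {0..T::real}" "0 < T"
  shows "at 0 within shift_domain d {0..T} t \<noteq> bot"
proof (cases d)
  case None
  have "at t within {0..T} \<noteq> bot" using assms by (simp add: trivial_limit_within islimpt_Icc)
  then show ?thesis using None at_within_shift[of t "{0..T}"] by (auto simp: filtermap_bot_iff)
qed simp

text \<open>This differentiates equations: shifts preserve equality almost everywhere, so the two
  sides have the same difference quotients and hence, up to null sets, the same derivative.\<close>

lemma has_derivative_along_unique:
  assumes W: "has_derivative_along d {0..T} W W' t" and Z: "has_derivative_along d {0..T} Z Z' t"
    and t: "t \<in> {0..T}" "0 < T"
    and eq: "\<And>t. t \<in> {0..T} \<Longrightarrow> AE x in lborel. W t x = Z t x"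
  shows "AE x in lborel. W' x = Z' x"
proof -
  let ?F = "at 0 within shift_domain d {0..T} t"
  have sh: "AE x in lborel. shift d h W t x = shift d h Z t x" if "h \<in> shift_domain d {0..T} t" for h
  proof (cases d)
    case None
    then show ?thesis using eq[of "t + h"] that by simp
  next
    case (Some j)
    then show ?thesis using AE_translate[OF eq[OF t(1)]] by simp
  qed
  have "L2_lim (\<lambda>h x. (shift d h Z t x - Z t x) / h) W' ?F"
  proof (rule L2_lim_cong)
    show "L2_lim (\<lambda>h x. (shift d h W t x - W t x) / h) W' ?F"
      using W by (simp add: has_derivative_along_iff)
    have "\<forall>\<^sub>F h in ?F. (\<lambda>x. (shift d h Z t x - Z t x) / h) \<in> L2"
      using Z by (simp add: has_derivative_along_iff L2_lim_def)
    moreover have "\<forall>\<^sub>F h in ?F. h \<in> shift_domain d {0..T} t" by (simp add: eventually_at_filter)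
    ultimately show "\<forall>\<^sub>F h in ?F. (\<lambda>x. (shift d h Z t x - Z t x) / h) \<in> borel_measurable borel \<and>
        (AE x in lborel. (shift d h W t x - W t x) / h = (shift d h Z t x - Z t x) / h)"
    proof eventually_elim
      case (elim h)
      have "AE x in lborel. (shift d h W t x - W t x) / h = (shift d h Z t x - Z t x) / h"
        using sh[OF elim(2)] eq[OF t(1)] by eventually_elim simp
      then show ?case using L2_measurable[OF elim(1)] by blast
    qed
    show "W' \<in> borel_measurable borel" by (rule L2_measurable[OF has_derivative_along_in(2)[OF W]])
  qed simp
  moreover have "L2_lim (\<lambda>h x. (shift d h Z t x - Z t x) / h) Z' ?F"
    using Z by (simp add: has_derivative_along_iff)
  ultimately show ?thesis
    by (rule L2_lim_unique) (rule at_within_shift_domain_nontrivial[OF t])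
qed

section \<open>Families of derivatives\<close>

text \<open>The index of the pure time derivative of order \<open>m + 1\<close> is admitted only if \<open>full\<close> holds: the
  existence of that derivative is not assumed but follows from the equation.\<close>

definition admissible :: "nat \<Rightarrow> bool \<Rightarrow> 'n::finite spacetime_index \<Rightarrow> bool" where
  "admissible m full A \<longleftrightarrow> mi_size A \<le> m + 1 \<and> (full \<or> A None \<le> m)"

lemma admissible_small: "mi_size A \<le> m \<Longrightarrow> admissible m full A"
  using index_le_mi_size[of A None] by (auto simp: admissible_def)

lemma admissible_extension:
  "B \<in> space_extensions s A \<Longrightarrow> admissible m full A \<Longrightarrow> mi_size A + s \<le> m + 1 \<Longrightarrow> admissible m full B"
  by (auto simp: admissible_def space_extensions_def)

lemma strong_partial_divide:
  "strong_partial j f g \<Longrightarrow> strong_partial j (\<lambda>x. f x / c) (\<lambda>x. g x / c)"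
  using strong_partial_cmult[of j f g "1/c"] by simp

lemma strong_partial_shift:
  assumes "\<And>t. t \<in> S \<Longrightarrow> strong_partial j (W t) (Z t)" "t \<in> S" "h \<in> shift_domain d S t"
  shows "strong_partial j (shift d h W t) (shift d h Z t)"
  using assms by (cases d) (auto intro: strong_partial_translate)

lemma sobolev_lim_const:
  fixes f :: "real ^ 'n::finite \<Rightarrow> real"
  assumes f: "sobolev_bound s M f"
  shows "sobolev_lim s (\<lambda>_. f) f \<FF>"
proof -
  have zero: "sobolev_bound s 0 (\<lambda>x::real ^ 'n. 0)" for s
  proof (induction s)
    case (Suc s)
    have "strong_partial j (\<lambda>x. 0) (\<lambda>x::real ^ 'n. 0)" for j
      by (simp add: strong_partial_def L2_deriv_const)
    then show ?case using Suc by auto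
  qed simp
  then show ?thesis using f sobolev_bound_L2[OF f] unfolding sobolev_lim_def
    by (intro conjI exI[of _ M] exI[of _ "\<lambda>_. 0"]) auto
qed

text \<open>The abstract properties of the family of all space-time derivatives of the solution.
  Continuity in time is required also at order \<open>m + 1\<close>, where no further derivative
  exists. The product constant \<open>K\<close> is a parameter, so one constant can serve all
  solutions.\<close>

locale derivative_family =
  fixes m :: nat and T K :: real and V :: "'n::finite spacetime_index \<Rightarrow> real \<Rightarrow> real ^ 'n \<Rightarrow> real"
    and full :: bool
  assumes T: "0 < T" and m: "CARD('n) + 3 \<le> 2 * m" and K: "0 \<le> K"
    and product: "\<And>s1 s2 (f :: real ^ 'n \<Rightarrow> real) g M N. s1 \<le> m + 1 \<Longrightarrow> s2 \<le> m + 1 \<Longrightarrow> CARD('n) + 1 \<le> 2 * (s1 + s2) \<Longrightarrow>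
      sobolev_bound s1 M f \<Longrightarrow> sobolev_bound s2 N g \<Longrightarrow>
      (\<lambda>x. f x * g x) \<in> L2 \<and> L2_norm (\<lambda>x. f x * g x) \<le> K * M * N"
    and V_lim: "\<And>A t. admissible m full A \<Longrightarrow> t \<in> {0..T} \<Longrightarrow> L2_lim (V A) (V A t) (at t within {0..T})"
    and V_space: "\<And>A j t. mi_size A \<le> m \<Longrightarrow> t \<in> {0..T} \<Longrightarrow> strong_partial j (V A t) (V (inc (Some j) A) t)"
    and V_time: "\<And>A t. mi_size A \<le> m \<Longrightarrow> admissible m full (inc None A) \<Longrightarrow> t \<in> {0..T} \<Longrightarrow>
      L2_deriv (V A) (V (inc None A) t) t {0..T}"
begin

abbreviation shift_filter :: "'n option \<Rightarrow> real \<Rightarrow> real filter" where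
  "shift_filter d t \<equiv> at 0 within shift_domain d {0..T} t"

lemma V_L2: "admissible m full A \<Longrightarrow> t \<in> {0..T} \<Longrightarrow> V A t \<in> L2"
  using V_lim by blast

lemma V_along:
  "mi_size A \<le> m \<Longrightarrow> admissible m full (inc d A) \<Longrightarrow> t \<in> {0..T} \<Longrightarrow>
    has_derivative_along d {0..T} (V A) (V (inc d A) t) t"
  by (cases d) (auto intro: V_time V_space)

lemma V_shift_lim:
  assumes "admissible m full A" "t \<in> {0..T}"
  shows "L2_lim (\<lambda>h. shift d h (V A) t) (V A t) (shift_filter d t)"
proof (cases d)
  case None
  then show ?thesis using V_lim[OF assms] by (simp add: L2_lim_at_within_shift[of _ _ t])
next
  case (Some j)
  have f: "V A t \<in> L2" by (rule V_L2[OF assms])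
  have "((\<lambda>h::real. h *\<^sub>R axis j 1 :: real ^ 'n) \<longlongrightarrow> 0 *\<^sub>R axis j 1) (at 0)" by (intro tendsto_intros)
  moreover have "\<forall>\<^sub>F h::real in at 0. h *\<^sub>R axis j 1 \<noteq> (0 :: real ^ 'n)"
    by (simp add: eventually_at_filter axis_eq_0_iff)
  ultimately have "filterlim (\<lambda>h::real. h *\<^sub>R axis j 1 :: real ^ 'n) (at 0) (at 0)"
    by (simp add: filterlim_at)
  from filterlim_compose[OF L2_translate_continuous[OF f] this]
  show ?thesis using Some f by (simp add: L2_lim_def)
qed

lemma V_sobolev_bound:
  assumes A: "admissible m full A" "mi_size A + s \<le> m + 1" and t: "t \<in> {0..T}"
    and N: "\<And>B. B \<in> space_extensions s A \<Longrightarrow> L2_norm (V B t) \<le> N"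
  shows "sobolev_bound s N (V A t)"
proof (rule sobolev_boundI[of s A "\<lambda>A. V A t"])
  fix B j assume "B \<in> space_extensions s A" "mi_size B < mi_size A + s"
  then show "strong_partial j (V B t) (V (inc (Some j) B) t)" using A t by (intro V_space) auto
next
  fix B assume "B \<in> space_extensions s A"
  then show "V B t \<in> L2 \<and> L2_norm (V B t) \<le> N"
    using admissible_extension[OF _ A] N t by (auto intro: V_L2)
qed

lemma shift_domain_eventually: "\<forall>\<^sub>F h in shift_filter d t. h \<in> shift_domain d {0..T} t"
  by (simp add: eventually_at_filter)

lemma V_sobolev_lim:
  assumes A: "admissible m full A" "mi_size A + s \<le> m + 1" and t: "t \<in> {0..T}"
  shows "sobolev_lim s (\<lambda>h. shift d h (V A) t) (V A t) (shift_filter d t)"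
proof (rule sobolev_limI[where W = "\<lambda>h A. shift d h (V A) t" and ?W0.0 = "\<lambda>A. V A t"])
  show "\<forall>\<^sub>F h in shift_filter d t. \<forall>B j. B \<in> space_extensions s A \<longrightarrow> mi_size B < mi_size A + s \<longrightarrow>
      strong_partial j (shift d h (V B) t) (shift d h (V (inc (Some j) B)) t)"
    using shift_domain_eventually
  proof eventually_elim
    case (elim h)
    show ?case
    proof (intro allI impI)
      fix B j assume "B \<in> space_extensions s A" "mi_size B < mi_size A + s"
      then show "strong_partial j (shift d h (V B) t) (shift d h (V (inc (Some j) B)) t)"
        using A t elim by (intro strong_partial_shift[of "{0..T}"] V_space) auto
    qed
  qed
next
  fix B j assume "B \<in> space_extensions s A" "mi_size B < mi_size A + s"
  then show "strong_partial j (V B t) (V (inc (Some j) B) t)" using A t by (intro V_space) auto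
next
  fix B assume "B \<in> space_extensions s A"
  then show "L2_lim (\<lambda>h. shift d h (V B) t) (V B t) (shift_filter d t)"
    by (rule V_shift_lim[OF admissible_extension[OF _ A] t])
qed

lemma extension_inc:
  assumes "B \<in> space_extensions s A" "admissible m full (inc d A)" "mi_size A + s \<le> m"
  shows "mi_size B \<le> m" "admissible m full (inc d B)"
  using assms by (cases d; auto simp: space_extensions_def admissible_def)+

text \<open>A difference quotient of a space derivative is the space derivative of the difference
  quotient, so convergence in H^s reduces to convergence in L^2 at each index of
  \<open>space_extensions s A\<close>.\<close>

lemma V_quotient_sobolev_lim:
  assumes A: "admissible m full (inc d A)" "mi_size A + s \<le> m" and t: "t \<in> {0..T}"
  shows "sobolev_lim s (\<lambda>h x. (shift d h (V A) t x - V A t x) / h) (V (inc d A) t) (shift_filter d t)"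
proof (rule sobolev_limI[where W = "\<lambda>h A x. (shift d h (V A) t x - V A t x) / h" and ?W0.0 = "\<lambda>A. V (inc d A) t"])
  show "\<forall>\<^sub>F h in shift_filter d t. \<forall>B j. B \<in> space_extensions s A \<longrightarrow> mi_size B < mi_size A + s \<longrightarrow>
      strong_partial j (\<lambda>x. (shift d h (V B) t x - V B t x) / h)
        (\<lambda>x. (shift d h (V (inc (Some j) B)) t x - V (inc (Some j) B) t x) / h)"
    using shift_domain_eventually
  proof eventually_elim
    case (elim h)
    show ?case
    proof (intro allI impI)
      fix B j assume "B \<in> space_extensions s A" "mi_size B < mi_size A + s"
      then show "strong_partial j (\<lambda>x. (shift d h (V B) t x - V B t x) / h)
        (\<lambda>x. (shift d h (V (inc (Some j) B)) t x - V (inc (Some j) B) t x) / h)"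
        using A t elim
        by (intro strong_partial_divide strong_partial_diff strong_partial_shift[of "{0..T}"] V_space) auto
    qed
  qed
next
  fix B j assume "B \<in> space_extensions s A" "mi_size B < mi_size A + s"
  then show "strong_partial j (V (inc d B) t) (V (inc d (inc (Some j) B)) t)"
    unfolding inc_commute[of d] using A t by (intro V_space) auto
next
  fix B assume "B \<in> space_extensions s A"
  from extension_inc[OF this A] show "L2_lim (\<lambda>h x. (shift d h (V B) t x - V B t x) / h) (V (inc d B) t) (shift_filter d t)"
    using V_along[of B d t] t by (simp add: has_derivative_along_iff)
qed

text \<open>In \<open>F * G - f * g = (F - f) * (G - g) + (F - f) * g + f * (G - g)\<close> every
  summand has a factor that tends to 0 in its Sobolev norm.\<close>

lemma sobolev_lim_mult:
  fixes f g :: "real ^ 'n \<Rightarrow> real"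
  assumes F: "sobolev_lim s1 F f \<FF>" and G: "sobolev_lim s2 G g \<FF>"
    and s: "s1 \<le> m + 1" "s2 \<le> m + 1" "CARD('n) + 1 \<le> 2 * (s1 + s2)"
  shows "L2_lim (\<lambda>h x. F h x * G h x) (\<lambda>x. f x * g x) \<FF>"
proof -
  obtain M \<mu> where M: "sobolev_bound s1 M f" "(\<mu> \<longlongrightarrow> 0) \<FF>"
    and evF: "\<forall>\<^sub>F h in \<FF>. F h \<in> L2 \<and> sobolev_bound s1 (\<mu> h) (\<lambda>x. F h x - f x)"
    using F unfolding sobolev_lim_def by blast
  obtain N \<nu> where N: "sobolev_bound s2 N g" "(\<nu> \<longlongrightarrow> 0) \<FF>"
    and evG: "\<forall>\<^sub>F h in \<FF>. G h \<in> L2 \<and> sobolev_bound s2 (\<nu> h) (\<lambda>x. G h x - g x)"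
    using G unfolding sobolev_lim_def by blast
  let ?b = "\<lambda>h. K * \<mu> h * \<nu> h + K * \<mu> h * N + K * M * \<nu> h"
  have "(?b \<longlongrightarrow> K * 0 * 0 + K * 0 * N + K * M * 0) \<FF>" using M(2) N(2) by (intro tendsto_intros)
  then have b: "(?b \<longlongrightarrow> 0) \<FF>" by simp
  have fg: "(\<lambda>x. f x * g x) \<in> L2" using product[OF s M(1) N(1)] by blast
  have *: "\<forall>\<^sub>F h in \<FF>. (\<lambda>x. F h x * G h x - f x * g x) \<in> L2 \<and> L2_norm (\<lambda>x. F h x * G h x - f x * g x) \<le> ?b h"
    using evF evG
  proof eventually_elim
    case (elim h)
    let ?F = "\<lambda>x. F h x - f x" and ?G = "\<lambda>x. G h x - g x"
    have 1: "(\<lambda>x. ?F x * ?G x) \<in> L2 \<and> L2_norm (\<lambda>x. ?F x * ?G x) \<le> K * \<mu> h * \<nu> h"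
      using elim by (intro product[OF s]) auto
    have 2: "(\<lambda>x. ?F x * g x) \<in> L2 \<and> L2_norm (\<lambda>x. ?F x * g x) \<le> K * \<mu> h * N"
      using elim N by (intro product[OF s]) auto
    have 3: "(\<lambda>x. f x * ?G x) \<in> L2 \<and> L2_norm (\<lambda>x. f x * ?G x) \<le> K * M * \<nu> h"
      using elim M by (intro product[OF s]) auto
    have eq: "(\<lambda>x. F h x * G h x - f x * g x) = (\<lambda>x. ?F x * ?G x + ?F x * g x + f x * ?G x)"
      by (simp add: algebra_simps)
    have 12: "(\<lambda>x. ?F x * ?G x + ?F x * g x) \<in> L2" using 1 2 by (intro L2_add) blast+
    have "L2_norm (\<lambda>x. ?F x * ?G x + ?F x * g x + f x * ?G x) \<le>
        L2_norm (\<lambda>x. ?F x * ?G x + ?F x * g x) + L2_norm (\<lambda>x. f x * ?G x)"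
      using 12 3 by (intro L2_norm_triangle) blast+
    moreover have "L2_norm (\<lambda>x. ?F x * ?G x + ?F x * g x) \<le> L2_norm (\<lambda>x. ?F x * ?G x) + L2_norm (\<lambda>x. ?F x * g x)"
      using 1 2 by (intro L2_norm_triangle) blast+
    ultimately have "L2_norm (\<lambda>x. ?F x * ?G x + ?F x * g x + f x * ?G x) \<le> ?b h"
      using 1 2 3 by linarith
    moreover have "(\<lambda>x. ?F x * ?G x + ?F x * g x + f x * ?G x) \<in> L2"
      by (rule L2_add[OF 12 conjunct1[OF 3]])
    ultimately show ?case unfolding eq by blast
  qed
  show ?thesis
  proof (rule L2_limI_bound[OF fg _ b])
    show "\<forall>\<^sub>F h in \<FF>. (\<lambda>x. F h x * G h x) \<in> L2"
      using * by eventually_elim (use L2_add[OF _ fg] in fastforce)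
    show "\<forall>\<^sub>F h in \<FF>. L2_norm (\<lambda>x. F h x * G h x - f x * g x) \<le> ?b h"
      using * by eventually_elim blast
  qed
qed

text \<open>The central count: a derivative of order \<open>k\<close> has \<open>m + 1 - k\<close>
  space derivatives left. Two derivatives of total order at most \<open>m + 3\<close> keep at least
  \<open>m - 1\<close> between them, which suffices because
  \<open>2 * m \<ge> n + 3\<close>.\<close>

lemma product_regularity:
  assumes "mi_size B + mi_size C \<le> m + 3" "mi_size B \<le> m + 1" "mi_size C \<le> m + 1"
  shows "CARD('n) + 1 \<le> 2 * ((m + 1 - mi_size B) + (m + 1 - mi_size C))"
proof -
  define r where "r = (m + 1 - mi_size B) + (m + 1 - mi_size C)"
  have "m \<le> r + 1" using assms unfolding r_def by linarith
  then show ?thesis using m unfolding r_def[symmetric] by linarith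
qed

lemma V_mult_lim:
  assumes B: "admissible m full B" and C: "admissible m full C" and BC: "mi_size B + mi_size C \<le> m + 3"
    and t: "t \<in> {0..T}"
  shows "L2_lim (\<lambda>h x. shift d h (V B) t x * shift d h (V C) t x) (\<lambda>x. V B t x * V C t x) (shift_filter d t)"
proof (rule sobolev_lim_mult)
  have s: "mi_size B \<le> m + 1" "mi_size C \<le> m + 1" using B C by (auto simp: admissible_def)
  show "sobolev_lim (m + 1 - mi_size B) (\<lambda>h. shift d h (V B) t) (V B t) (shift_filter d t)"
    "sobolev_lim (m + 1 - mi_size C) (\<lambda>h. shift d h (V C) t) (V C t) (shift_filter d t)"
    using B C s t by (auto intro!: V_sobolev_lim)
  show "CARD('n) + 1 \<le> 2 * ((m + 1 - mi_size B) + (m + 1 - mi_size C))"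
    by (rule product_regularity[OF BC s])
qed auto

lemma V_mult_continuous:
  assumes "admissible m full B" "admissible m full C" "mi_size B + mi_size C \<le> m + 3" "t \<in> {0..T}"
  shows "L2_lim (\<lambda>s x. V B s x * V C s x) (\<lambda>x. V B t x * V C t x) (at t within {0..T})"
  using V_mult_lim[OF assms, of None] by (simp add: L2_lim_at_within_shift[of _ _ t])

lemma V_mult_L2:
  "admissible m full B \<Longrightarrow> admissible m full C \<Longrightarrow> mi_size B + mi_size C \<le> m + 3 \<Longrightarrow> t \<in> {0..T} \<Longrightarrow>
    (\<lambda>x. V B t x * V C t x) \<in> L2"
  by (rule L2_lim_in[OF V_mult_continuous])

text \<open>The discrete product rule shifts only one factor. The total order is limited to
  \<open>m + 2\<close> because each resulting product contains one derivative more.\<close>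

lemma V_mult_along:
  assumes B: "admissible m full (inc d B)" "mi_size B \<le> m" and C: "admissible m full (inc d C)" "mi_size C \<le> m"
    and BC: "mi_size B + mi_size C \<le> m + 2" and t: "t \<in> {0..T}"
  shows "has_derivative_along d {0..T} (\<lambda>t x. V B t x * V C t x)
    (\<lambda>x. V (inc d B) t x * V C t x + V B t x * V (inc d C) t x) t"
proof -
  note B' = admissible_small[OF B(2), of full] and C' = admissible_small[OF C(2), of full]
  have r1: "CARD('n) + 1 \<le> 2 * ((m - mi_size B) + (m + 1 - mi_size C))"
    using product_regularity[of "inc d B" C] BC B C by simp
  have r2: "CARD('n) + 1 \<le> 2 * ((m + 1 - mi_size B) + (m - mi_size C))"
    using product_regularity[of B "inc d C"] BC B C by simp
  have 1: "L2_lim (\<lambda>h x. (shift d h (V B) t x - V B t x) / h * shift d h (V C) t x)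
      (\<lambda>x. V (inc d B) t x * V C t x) (shift_filter d t)"
    by (rule sobolev_lim_mult[OF V_quotient_sobolev_lim[OF B(1) _ t] V_sobolev_lim[OF C' _ t] _ _ r1])
      (use B C in auto)
  have "sobolev_lim (m + 1 - mi_size B) (\<lambda>h. V B t) (V B t) (shift_filter d t)"
  proof -
    obtain M where M: "sobolev_bound (m + 1 - mi_size B) M (V B t)"
      using V_sobolev_lim[OF B', of "m + 1 - mi_size B" t d] B t unfolding sobolev_lim_def by auto
    then show ?thesis by (rule sobolev_lim_const)
  qed
  then have 2: "L2_lim (\<lambda>h x. V B t x * ((shift d h (V C) t x - V C t x) / h))
      (\<lambda>x. V B t x * V (inc d C) t x) (shift_filter d t)"
    by (rule sobolev_lim_mult[OF _ V_quotient_sobolev_lim[OF C(1) _ t] _ _ r2]) (use B C in auto)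
  have "L2_lim (\<lambda>h x. (shift d h (\<lambda>t x. V B t x * V C t x) t x - V B t x * V C t x) / h)
      (\<lambda>x. V (inc d B) t x * V C t x + V B t x * V (inc d C) t x) (shift_filter d t)"
  proof -
    have eq: "(\<lambda>h x. (shift d h (V B) t x - V B t x) / h * shift d h (V C) t x +
        V B t x * ((shift d h (V C) t x - V C t x) / h)) =
        (\<lambda>h x. (shift d h (\<lambda>t x. V B t x * V C t x) t x - V B t x * V C t x) / h)"
      by (intro ext) (simp add: shift_mult diff_divide_distrib algebra_simps)
    show ?thesis using L2_lim_add[OF 1 2] unfolding eq .
  qed
  moreover have "(\<lambda>x. V B t x * V C t x) \<in> L2" using B' C' BC t by (intro V_mult_L2) auto
  ultimately show ?thesis by (simp add: has_derivative_along_iff)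
qed

end

section \<open>The differentiated equation\<close>

abbreviation unit_index :: "'n option \<Rightarrow> 'n::finite spacetime_index" where
  "unit_index d \<equiv> inc d (\<lambda>_. 0)"

abbreviation add_word :: "'i::finite list \<Rightarrow> 'i multi_index \<Rightarrow> 'i multi_index" where
  "add_word ds A \<equiv> foldr inc ds A"

lemma mi_size_add_word [simp]: "mi_size (add_word ds A) = length ds + mi_size A"
  by (induction ds) auto

text \<open>A list of pairs of indices stands for the sum of the corresponding products, as in
  \<open>quad\<close>; differentiating the sum becomes an operation on lists.\<close>

definition leibniz :: "'n option \<Rightarrow> ('n::finite spacetime_index \<times> 'n spacetime_index) list \<Rightarrow>
    ('n spacetime_index \<times> 'n spacetime_index) list" where
  "leibniz d L = concat (map (\<lambda>(B, C). [(inc d B, C), (B, inc d C)]) L)"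

text \<open>The products arising from \<open>\<partial>\<^sup>d\<^sup>s (V\<^sub>B V\<^sub>C)\<close> by the product rule, except for the one in which
  all derivatives fall on the second factor.\<close>

primrec leibniz_rest :: "'n option list \<Rightarrow> 'n::finite spacetime_index \<Rightarrow> 'n spacetime_index \<Rightarrow>
    ('n spacetime_index \<times> 'n spacetime_index) list" where
  "leibniz_rest [] B C = []"
| "leibniz_rest (d # ds) B C = (inc d B, add_word ds C) # leibniz d (leibniz_rest ds B C)"

text \<open>At least one derivative has fallen on the first factor of every listed product. This
  strict increase keeps the second factor one order below the top, so the list can be differentiated
  once more.\<close>

lemma leibniz_rest_sizes:
  "(B', C') \<in> set (leibniz_rest ds B C) \<Longrightarrow>
    mi_size B' + mi_size C' = length ds + mi_size B + mi_size C \<and> mi_size B < mi_size B' \<and> mi_size C \<le> mi_size C'"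
proof (induction ds arbitrary: B' C')
  case (Cons d ds)
  then show ?case by (fastforce simp: leibniz_def)
qed simp

lemma length_leibniz: "length (leibniz d L) = 2 * length L"
  unfolding leibniz_def by (induction L) auto

lemma length_leibniz_rest: "length (leibniz_rest ds B C) \<le> 2 ^ length ds"
proof -
  have "Suc (length (leibniz_rest ds B C)) \<le> 2 ^ length ds"
    by (induction ds) (auto simp: length_leibniz)
  then show ?thesis by simp
qed

definition quad :: "('n::finite spacetime_index \<Rightarrow> real \<Rightarrow> real ^ 'n \<Rightarrow> real) \<Rightarrow>
    ('n spacetime_index \<times> 'n spacetime_index) list \<Rightarrow> real \<Rightarrow> real ^ 'n \<Rightarrow> real" where
  "quad V L t x = (\<Sum>(B, C)\<leftarrow>L. V B t x * V C t x)"

lemma quad_simps [simp]: "quad V [] t x = 0" "quad V ((B, C) # L) t x = V B t x * V C t x + quad V L t x"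
  by (auto simp: quad_def)

context derivative_family
begin

lemma quad_along:
  assumes "\<And>B C. (B, C) \<in> set L \<Longrightarrow> mi_size B + 1 \<le> m \<and> mi_size C + 1 \<le> m \<and> mi_size B + mi_size C \<le> m + 2"
    and t: "t \<in> {0..T}"
  shows "has_derivative_along d {0..T} (quad V L) (quad V (leibniz d L) t) t"
  using assms(1)
proof (induction L)
  case Nil
  show ?case by (simp add: quad_def[abs_def] leibniz_def has_derivative_along_zero)
next
  case (Cons p L)
  obtain B C where p: "p = (B, C)" by (cases p)
  have "has_derivative_along d {0..T} (\<lambda>t x. V B t x * V C t x)
      (\<lambda>x. V (inc d B) t x * V C t x + V B t x * V (inc d C) t x) t"
    using Cons.prems[of B C] p by (intro V_mult_along t admissible_small) auto
  moreover have "has_derivative_along d {0..T} (quad V L) (quad V (leibniz d L) t) t"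
    by (rule Cons.IH) (use Cons.prems in auto)
  note has_derivative_along_add[OF calculation this]
  then show ?case using p by (simp add: quad_def[abs_def] leibniz_def add_ac)
qed

lemma quad_continuous:
  assumes "\<And>B C. (B, C) \<in> set L \<Longrightarrow> admissible m full B \<and> admissible m full C \<and> mi_size B + mi_size C \<le> m + 3"
    and t: "t \<in> {0..T}"
  shows "L2_lim (quad V L) (quad V L t) (at t within {0..T})"
  using assms(1)
proof (induction L)
  case Nil
  show ?case by (simp add: quad_def[abs_def])
next
  case (Cons p L)
  obtain B C where p: "p = (B, C)" by (cases p)
  have "L2_lim (\<lambda>s x. V B s x * V C s x) (\<lambda>x. V B t x * V C t x) (at t within {0..T})"
    using Cons.prems[of B C] p by (intro V_mult_continuous t) auto
  moreover have "L2_lim (quad V L) (quad V L t) (at t within {0..T})"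
    by (rule Cons.IH) (use Cons.prems in auto)
  note L2_lim_add[OF calculation this]
  then show ?case using p by (simp add: quad_def[abs_def])
qed

end

text \<open>The equation expressed through the family, with \<open>a\<close> for
  \<open>\<alpha> * \<epsilon>\<close> and \<open>b\<close> for \<open>\<beta> * \<epsilon>\<close>;
  \<open>small\<close> keeps the coefficient \<open>1 - a * V et\<close> of the second time
  derivative between 1/2 and 3/2.\<close>

locale wave_family = derivative_family m T K V full
  for m :: nat and T K :: real and V :: "'n::finite spacetime_index \<Rightarrow> real \<Rightarrow> real ^ 'n \<Rightarrow> real" and full :: bool +
  fixes c a b :: real
  assumes equation: "\<And>t. t \<in> {0..T} \<Longrightarrow> AE x in lborel.
      V (inc None (unit_index None)) t x - c\<^sup>2 * (\<Sum>j\<in>UNIV. V (inc (Some j) (unit_index (Some j))) t x) =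
      a * (V (unit_index None) t x * V (inc None (unit_index None)) t x) +
      b * (\<Sum>j\<in>UNIV. V (unit_index (Some j)) t x * V (inc None (unit_index (Some j))) t x)"
    and small: "\<And>t. t \<in> {0..T} \<Longrightarrow> AE x in lborel. \<bar>a * V (unit_index None) t x\<bar> \<le> 1/2"
begin

abbreviation "et \<equiv> unit_index None :: 'n spacetime_index"
abbreviation "es j \<equiv> unit_index (Some j) :: 'n spacetime_index"

abbreviation linear_part :: "'n option list \<Rightarrow> real \<Rightarrow> real ^ 'n \<Rightarrow> real" where
  "linear_part ds t x \<equiv> V (add_word ds (inc None et)) t x -
    c\<^sup>2 * (\<Sum>j\<in>UNIV. V (add_word ds (inc (Some j) (es j))) t x)"

abbreviation nonlinear_part :: "'n option list \<Rightarrow> real \<Rightarrow> real ^ 'n \<Rightarrow> real" where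
  "nonlinear_part ds t x \<equiv>
    a * (V et t x * V (add_word ds (inc None et)) t x + quad V (leibniz_rest ds et (inc None et)) t x) +
    b * (\<Sum>j\<in>UNIV. V (es j) t x * V (add_word ds (inc None (es j))) t x +
      quad V (leibniz_rest ds (es j) (inc None (es j))) t x)"

lemma rest_along:
  assumes "length ds + 2 \<le> m" "mi_size B = 1" "mi_size C = 2" "t \<in> {0..T}"
  shows "has_derivative_along d {0..T} (quad V (leibniz_rest ds B C)) (quad V (leibniz d (leibniz_rest ds B C)) t) t"
proof (rule quad_along[OF _ assms(4)])
  fix B' C' assume "(B', C') \<in> set (leibniz_rest ds B C)"
  from leibniz_rest_sizes[OF this] assms(1-3)
  show "mi_size B' + 1 \<le> m \<and> mi_size C' + 1 \<le> m \<and> mi_size B' + mi_size C' \<le> m + 2" by linarith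
qed

text \<open>Both sides are differentiated along one direction at a time and compared by uniqueness
  of derivatives. For words of length \<open>m - 1\<close> the pure time derivative of order
  \<open>m + 1\<close> may occur, whence the condition on \<open>full\<close>.\<close>

lemma differentiated_equation:
  "length ds + 1 \<le> m \<Longrightarrow> full \<or> length ds + 2 \<le> m \<Longrightarrow> t \<in> {0..T} \<Longrightarrow>
    AE x in lborel. linear_part ds t x = nonlinear_part ds t x"
proof (induction ds arbitrary: t)
  case Nil
  then show ?case using equation by simp
next
  case (Cons d ds)
  have le: "length ds + 2 \<le> m" using Cons.prems by simp
  have adm: "admissible m full (inc d (add_word ds A))" if "mi_size A = 2" for A
    using Cons.prems that index_le_mi_size[of "inc d (add_word ds A)" None] unfolding admissible_def by auto
  have al: "has_derivative_along d {0..T} (V (add_word ds A)) (V (add_word (d # ds) A) t) t" if "mi_size A = 2" for A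
    using V_along[OF _ adm[OF that] Cons.prems(3)] that le by simp
  have p: "has_derivative_along d {0..T} (\<lambda>t x. V B t x * V (add_word ds C) t x + quad V (leibniz_rest ds B C) t x)
      (\<lambda>x. V B t x * V (add_word (d # ds) C) t x + quad V (leibniz_rest (d # ds) B C) t x) t"
    if B: "mi_size B = 1" and C: "mi_size C = 2" for B C
  proof -
    have "has_derivative_along d {0..T} (\<lambda>t x. V B t x * V (add_word ds C) t x)
        (\<lambda>x. V (inc d B) t x * V (add_word ds C) t x + V B t x * V (inc d (add_word ds C)) t x) t"
    proof (rule V_mult_along[OF _ _ adm[OF C] _ _ Cons.prems(3)])
      show "admissible m full (inc d B)" using B le by (intro admissible_small) auto
    qed (use B C le in auto)
    from has_derivative_along_add[OF this rest_along[OF le B C Cons.prems(3), of d]]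
    show ?thesis by (simp add: algebra_simps)
  qed
  show ?case
  proof (rule has_derivative_along_unique[OF _ _ Cons.prems(3) T, where W = "linear_part ds" and Z = "nonlinear_part ds"])
    show "has_derivative_along d {0..T} (linear_part ds) (linear_part (d # ds) t) t"
      by (intro has_derivative_along_diff has_derivative_along_cmult has_derivative_along_sum al) auto
    show "has_derivative_along d {0..T} (nonlinear_part ds) (nonlinear_part (d # ds) t) t"
      by (intro has_derivative_along_add has_derivative_along_cmult has_derivative_along_sum p) auto
    show "AE x in lborel. linear_part ds t x = nonlinear_part ds t x" if "t \<in> {0..T}" for t
      using Cons.prems that by (intro Cons.IH) auto
  qed
qed

lemma coefficient_bounds:
  assumes "t \<in> {0..T}"
  shows "AE x in lborel. 1/2 \<le> 1 - a * V et t x \<and> 1 - a * V et t x \<le> 3/2"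
  using small[OF assms] by eventually_elim linarith

lemma m_ge_2: "2 \<le> m"
  using m by (cases m) auto

text \<open>Solved for the coefficient times the time derivative of order \<open>m\<close>, the
  equation has a right hand side that can be differentiated in time with the derivatives already
  available; only the coefficient has to be divided out.\<close>

lemma top_time_derivative:
  "\<exists>U. \<forall>t\<in>{0..T}. L2_deriv (V (add_word (replicate (m - 2) None) (inc None et))) (U t) t {0..T} \<and>
    L2_lim U (U t) (at t within {0..T})"
proof -
  define ds :: "'n option list" where "ds = replicate (m - 2) None"
  have len: "length ds + 2 = m" using m_ge_2 by (simp add: ds_def)
  let ?W = "V (add_word ds (inc None et))"
  let ?Q = "\<lambda>t x. c\<^sup>2 * (\<Sum>j\<in>UNIV. V (add_word ds (inc (Some j) (es j))) t x) +
      (a * quad V (leibniz_rest ds et (inc None et)) t x +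
       b * (\<Sum>j\<in>UNIV. V (es j) t x * V (add_word ds (inc None (es j))) t x +
         quad V (leibniz_rest ds (es j) (inc None (es j))) t x))"
  let ?Q' = "\<lambda>t x. c\<^sup>2 * (\<Sum>j\<in>UNIV. V (inc None (add_word ds (inc (Some j) (es j)))) t x) +
      (a * quad V (leibniz None (leibniz_rest ds et (inc None et))) t x +
       b * (\<Sum>j\<in>UNIV. (V (inc None (es j)) t x * V (add_word ds (inc None (es j))) t x +
           V (es j) t x * V (inc None (add_word ds (inc None (es j)))) t x) +
         quad V (leibniz None (leibniz_rest ds (es j) (inc None (es j)))) t x))"
  \<comment> \<open>The equation reads \<open>(1 - a * V et) * ?W = ?Q\<close>. Formal
    differentiation gives \<open>(1 - a * V et) * ?U = ?Y\<close>, the last summand of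
    \<open>?Y\<close> coming from the coefficient.\<close>
  let ?Y = "\<lambda>t x. ?Q' t x + a * (V (inc None et) t x * ?W t x)"
  let ?U = "\<lambda>t x. (1 / (1 - a * V et t x)) * ?Y t x"
  have none: "add_word ds A None = m - 2 + A None" for A
  proof -
    have "add_word (replicate n None) A None = n + A None" for n by (induction n) auto
    then show ?thesis by (simp add: ds_def)
  qed
  have admS: "admissible m full (inc None (add_word ds A))" if "mi_size A = 2" "A None \<le> 1" for A
    using that none[of A] len by (auto simp: admissible_def)
  have admW: "admissible m full (add_word ds A)" if "mi_size A = 2" for A
    using that len by (intro admissible_small) simp
  have adm1: "admissible m full (inc d (unit_index e))" for d e
    using m_ge_2 by (intro admissible_small) simp
  have adm0: "admissible m full (unit_index e)" for e
    using m_ge_2 by (intro admissible_small) simp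
  have in_rest: "admissible m full B' \<and> admissible m full C' \<and> mi_size B' + mi_size C' \<le> m + 3"
    if mem: "(B', C') \<in> set (leibniz None (leibniz_rest ds B C))" "mi_size B = 1" "mi_size C = 2" for B C B' C'
  proof -
    obtain B0 C0 where "(B0, C0) \<in> set (leibniz_rest ds B C)" "(B', C') = (inc None B0, C0) \<or> (B', C') = (B0, inc None C0)"
      using mem(1) by (auto simp: leibniz_def)
    moreover from leibniz_rest_sizes[OF calculation(1)] that(2,3) len
    have "mi_size B0 + 1 \<le> m" "mi_size C0 + 1 \<le> m" "mi_size B0 + mi_size C0 \<le> m + 1" by linarith+
    ultimately show ?thesis by (auto intro!: admissible_small)
  qed
  have main: "L2_deriv ?W (?U t) t {0..T} \<and> L2_lim ?U (?U t) (at t within {0..T})" if t: "t \<in> {0..T}" for t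
  proof
    have Q': "has_derivative_along None {0..T} ?Q (?Q' t) t"
    proof (intro has_derivative_along_add has_derivative_along_cmult has_derivative_along_sum)
      show "has_derivative_along None {0..T} (V (add_word ds (inc (Some j) (es j))))
          (V (inc None (add_word ds (inc (Some j) (es j)))) t) t" for j
        using len by (intro V_along admS t) auto
      show "has_derivative_along None {0..T} (quad V (leibniz_rest ds et (inc None et)))
          (quad V (leibniz None (leibniz_rest ds et (inc None et))) t) t"
        using len by (intro rest_along t) auto
      show "has_derivative_along None {0..T} (quad V (leibniz_rest ds (es j) (inc None (es j))))
          (quad V (leibniz None (leibniz_rest ds (es j) (inc None (es j)))) t) t" for j
        using len by (intro rest_along t) auto
      show "has_derivative_along None {0..T} (\<lambda>t x. V (es j) t x * V (add_word ds (inc None (es j))) t x)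
          (\<lambda>x. V (inc None (es j)) t x * V (add_word ds (inc None (es j))) t x +
            V (es j) t x * V (inc None (add_word ds (inc None (es j)))) t x) t" for j
        using len m_ge_2 by (intro V_mult_along admS adm1 t) auto
    qed
    have Wlim: "sobolev_lim 0 (\<lambda>h. shift None h ?W t) (?W t) (shift_filter None t)"
      using len by (intro V_sobolev_lim admW t) auto
    \<comment> \<open>\<open>?W\<close> has order \<open>m\<close> and is used here merely as an L^2
      function; the other factor, with \<open>m - 1\<close> derivatives, is a multiplier of L^2 on
      its own.\<close>
    have r: "CARD('n) + 1 \<le> 2 * ((m - 1) + 0)"
      using m by (cases m) auto
    have "sobolev_lim (m - 1) (\<lambda>h x. (shift None h (V et) t x - V et t x) / h) (V (inc None et) t) (shift_filter None t)"
      using m_ge_2 by (intro V_quotient_sobolev_lim adm1 t) auto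
    from sobolev_lim_mult[OF this Wlim _ _ r]
    have aW: "L2_lim (\<lambda>h x. (V et (t + h) x - V et t x) / h * ?W (t + h) x) (\<lambda>x. V (inc None et) t x * ?W t x) (shift_filter None t)"
      by simp
    have Y: "L2_lim (\<lambda>h x. (?Q (t + h) x - ?Q t x) / h + a * ((V et (t + h) x - V et t x) / h * ?W (t + h) x)) (?Y t)
        (shift_filter None t)"
      using Q' by (intro L2_lim_add L2_lim_cmult aW) (simp add: has_derivative_along_iff)
    have mW: "V et t \<in> borel_measurable borel" by (rule L2_measurable[OF V_L2[OF adm0 t]])
    have mi: "(\<lambda>x. 1 / (1 - a * V et t x)) \<in> borel_measurable borel" using mW by measurable
    have bi: "AE x in lborel. \<bar>1 / (1 - a * V et t x)\<bar> \<le> 2"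
      using coefficient_bounds[OF t] by eventually_elim (simp add: field_simps)
    note lim = L2_lim_bounded_mult[OF Y mi bi]
    have Wt: "?W t \<in> L2" using len by (intro V_L2 admW t) auto
    have eqW: "AE x in lborel. (1 - a * V et s x) * ?W s x = ?Q s x" if "s \<in> {0..T}" for s
      using differentiated_equation[of ds, OF _ _ that] len by (auto simp: algebra_simps elim: eventually_mono)
    have "L2_lim (\<lambda>h x. (?W (t + h) x - ?W t x) / h) (?U t) (shift_filter None t)"
    proof (rule L2_lim_cong[OF lim])
      show "\<forall>\<^sub>F h in shift_filter None t. (\<lambda>x. (?W (t + h) x - ?W t x) / h) \<in> borel_measurable borel \<and>
        (AE x in lborel. 1 / (1 - a * V et t x) * ((?Q (t + h) x - ?Q t x) / h + a * ((V et (t + h) x - V et t x) / h * ?W (t + h) x))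
          = (?W (t + h) x - ?W t x) / h)"
        using shift_domain_eventually[of None t]
      proof eventually_elim
        case (elim h)
        then have th: "t + h \<in> {0..T}" by simp
        have "?W (t + h) \<in> L2" using len by (intro V_L2 admW th) auto
        then have "(\<lambda>x. (?W (t + h) x - ?W t x) / h) \<in> borel_measurable borel"
          using Wt by (intro L2_measurable L2_divide L2_diff)
        moreover have "AE x in lborel. 1 / (1 - a * V et t x) * ((?Q (t + h) x - ?Q t x) / h + a * ((V et (t + h) x - V et t x) / h * ?W (t + h) x))
          = (?W (t + h) x - ?W t x) / h"
          using eqW[OF t] eqW[OF th] coefficient_bounds[OF t]
        proof eventually_elim
          case (elim x)
          \<comment> \<open>The product rule is arranged so that the coefficient stays at time
            \<open>t\<close>. Its reciprocal is then one fixed bounded function and passes through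
            the limit.\<close>
          have "(?Q (t + h) x - ?Q t x) / h + a * ((V et (t + h) x - V et t x) / h * ?W (t + h) x) =
              (1 - a * V et t x) * ((?W (t + h) x - ?W t x) / h)"
            unfolding elim(1,2)[symmetric] by (cases "h = 0") (auto simp: field_simps)
          then show ?case using elim(3) by simp
        qed
        ultimately show ?case by blast
      qed
      show "?U t \<in> borel_measurable borel" by (rule L2_measurable[OF L2_lim_in[OF lim]])
    qed simp
    then have "has_derivative_along None {0..T} ?W (?U t) t"
      using Wt by (simp add: has_derivative_along_iff)
    then show "L2_deriv ?W (?U t) t {0..T}" by simp
    have Yc: "L2_lim ?Y (?Y s) (at s within {0..T})" if s: "s \<in> {0..T}" for s
    proof (intro L2_lim_add L2_lim_cmult L2_lim_sum)
      show "L2_lim (V (inc None (add_word ds (inc (Some j) (es j))))) (V (inc None (add_word ds (inc (Some j) (es j)))) s) (at s within {0..T})" for j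
        by (intro V_lim admS s) auto
      show "L2_lim (quad V (leibniz None (leibniz_rest ds et (inc None et)))) (quad V (leibniz None (leibniz_rest ds et (inc None et))) s) (at s within {0..T})"
        by (rule quad_continuous[OF in_rest s]) auto
      show "L2_lim (quad V (leibniz None (leibniz_rest ds (es j) (inc None (es j))))) (quad V (leibniz None (leibniz_rest ds (es j) (inc None (es j)))) s) (at s within {0..T})" for j
        by (rule quad_continuous[OF in_rest s]) auto
      show "L2_lim (\<lambda>t x. V (inc None (es j)) t x * V (add_word ds (inc None (es j))) t x)
        (\<lambda>x. V (inc None (es j)) s x * V (add_word ds (inc None (es j))) s x) (at s within {0..T})" for j
        using len by (intro V_mult_continuous adm1 admW s) auto
      show "L2_lim (\<lambda>t x. V (es j) t x * V (inc None (add_word ds (inc None (es j)))) t x)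
        (\<lambda>x. V (es j) s x * V (inc None (add_word ds (inc None (es j)))) s x) (at s within {0..T})" for j
        using len by (intro V_mult_continuous adm0 admS s) auto
      show "L2_lim (\<lambda>t x. V (inc None et) t x * ?W t x) (\<lambda>x. V (inc None et) s x * ?W s x) (at s within {0..T})"
        using len by (intro V_mult_continuous adm1 admW s) auto
    qed
    show "L2_lim ?U (?U t) (at t within {0..T})"
    proof (rule L2_limI_bound)
      show Ut: "?U t \<in> L2" by (rule L2_lim_in[OF lim])
      have Yt: "?Y t \<in> L2" by (rule L2_lim_in[OF Yc[OF t]])
      have evS: "\<forall>\<^sub>F s in at t within {0..T}. s \<in> {0..T}" by (simp add: eventually_at_filter)
      have mi': "(\<lambda>x. 1 / (1 - a * V et s x)) \<in> borel_measurable borel" if "s \<in> {0..T}" for s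
        using L2_measurable[OF V_L2[OF adm0 that]] by measurable
      have bi': "AE x in lborel. \<bar>1 / (1 - a * V et s x)\<bar> \<le> 2" if "s \<in> {0..T}" for s
        using coefficient_bounds[OF that] by eventually_elim (simp add: field_simps)
      have Us: "?U s \<in> L2" if s: "s \<in> {0..T}" for s
        by (rule L2_bounded_mult[OF L2_lim_in[OF Yc[OF s]] mi'[OF s] bi'[OF s]])
      show "\<forall>\<^sub>F s in at t within {0..T}. ?U s \<in> L2" using evS by eventually_elim (rule Us)
      \<comment> \<open>For continuity of \<open>?U\<close> the coefficient does vary with
        \<open>s\<close>. Its effect is tested on the fixed L^2 function \<open>?Y t\<close>, for
        which convergence of \<open>V et s\<close> in H^(m-1) is enough.\<close>
      have "sobolev_lim (m - 1) (\<lambda>h. shift None h (V et) t) (V et t) (shift_filter None t)"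
        using m_ge_2 by (intro V_sobolev_lim adm0 t) auto
      moreover have "sobolev_lim 0 (\<lambda>h. ?Y t) (?Y t) (shift_filter None t)"
        by (rule sobolev_lim_const[of 0 "L2_norm (?Y t)"]) (use Yt in simp)
      ultimately have "L2_lim (\<lambda>h x. shift None h (V et) t x * ?Y t x) (\<lambda>x. V et t x * ?Y t x) (shift_filter None t)"
        by (rule sobolev_lim_mult[OF _ _ _ _ r]) auto
      then have cY: "L2_lim (\<lambda>s x. V et s x * ?Y t x) (\<lambda>x. V et t x * ?Y t x) (at t within {0..T})"
        by (simp add: L2_lim_at_within_shift[of _ _ t])
      let ?b = "\<lambda>s. 2 * L2_norm (\<lambda>x. ?Y s x - ?Y t x) + 4 * \<bar>a\<bar> * L2_norm (\<lambda>x. V et s x * ?Y t x - V et t x * ?Y t x)"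
      have "(?b \<longlongrightarrow> 2 * 0 + 4 * \<bar>a\<bar> * 0) (at t within {0..T})"
        using Yc[OF t] cY unfolding L2_lim_def by (intro tendsto_intros) blast+
      then show "(?b \<longlongrightarrow> 0) (at t within {0..T})" by simp
      have evc: "\<forall>\<^sub>F s in at t within {0..T}. (\<lambda>x. V et s x * ?Y t x) \<in> L2" using cY unfolding L2_lim_def by blast
      show "\<forall>\<^sub>F s in at t within {0..T}. L2_norm (\<lambda>x. ?U s x - ?U t x) \<le> ?b s"
        using evS evc
      proof eventually_elim
        case (elim s)
        let ?D = "\<lambda>x. V et s x * ?Y t x - V et t x * ?Y t x"
        let ?w = "\<lambda>x. 1 / (1 - a * V et s x) * (1 / (1 - a * V et t x)) * a"
        have D: "?D \<in> L2" using elim(2) L2_lim_in[OF cY] by (rule L2_diff)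
        have dY: "(\<lambda>x. ?Y s x - ?Y t x) \<in> L2" by (rule L2_diff[OF L2_lim_in[OF Yc[OF elim(1)]] Yt])
        have wm: "?w \<in> borel_measurable borel"
          using mi'[OF elim(1)] mi by (intro borel_measurable_times) auto
        have wb: "AE x in lborel. \<bar>?w x\<bar> \<le> 4 * \<bar>a\<bar>"
          using bi'[OF elim(1)] bi
        proof eventually_elim
          case (elim x)
          have "\<bar>1 / (1 - a * V et s x)\<bar> * \<bar>1 / (1 - a * V et t x)\<bar> \<le> 2 * 2"
            using elim by (intro mult_mono) auto
          then show ?case by (simp only: abs_mult) (rule mult_right_mono, auto)
        qed
        note n1 = L2_norm_bounded_mult[OF dY mi'[OF elim(1)] bi'[OF elim(1)]]
        note n2 = L2_norm_bounded_mult[OF D wm wb]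
        have "AE x in lborel. ?U s x - ?U t x = 1 / (1 - a * V et s x) * (?Y s x - ?Y t x) + ?w x * ?D x"
          using coefficient_bounds[OF t] coefficient_bounds[OF elim(1)]
        proof eventually_elim
          case (elim x)
          \<comment> \<open>This separates the change of \<open>?Y\<close> from the change of the
            coefficient. Both reciprocals are at most 2, hence the factors 2 and
            \<open>4 * \<bar>a\<bar>\<close> in \<open>?b\<close>.\<close>
          have gen: "1 / p * y - 1 / q * z = 1 / p * (y - z) + 1 / p * (1 / q) * (q - p) * z"
            if "p \<noteq> 0" "q \<noteq> 0" for p q y z :: real
            using that by (simp add: field_simps)
          have "?U s x - ?U t x = 1 / (1 - a * V et s x) * (?Y s x - ?Y t x) +
            1 / (1 - a * V et s x) * (1 / (1 - a * V et t x)) * ((1 - a * V et t x) - (1 - a * V et s x)) * ?Y t x"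
            by (rule gen) (use elim in auto)
          also have "\<dots> = 1 / (1 - a * V et s x) * (?Y s x - ?Y t x) + ?w x * ?D x"
            by (simp only: right_diff_distrib left_diff_distrib mult_ac)
          finally show ?case .
        qed
        then have "L2_norm (\<lambda>x. ?U s x - ?U t x) =
            L2_norm (\<lambda>x. 1 / (1 - a * V et s x) * (?Y s x - ?Y t x) + ?w x * ?D x)"
          by (rule L2_norm_cong_AE) (intro L2_measurable L2_diff Us Ut elim(1), intro L2_measurable L2_add n1 n2)
        also have "\<dots> \<le> L2_norm (\<lambda>x. 1 / (1 - a * V et s x) * (?Y s x - ?Y t x)) + L2_norm (\<lambda>x. ?w x * ?D x)"
          by (rule L2_norm_triangle[OF n1(1) n2(1)])
        also have "\<dots> \<le> ?b s" using n1(2) n2(2) by simp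
        finally show ?case .
      qed
    qed
  qed
  show ?thesis unfolding ds_def[symmetric] by (intro exI[of _ ?U] ballI main)
qed

end

section \<open>The energy identity\<close>

lemma sobolev_lim_mono: "sobolev_lim s F f \<FF> \<Longrightarrow> \<GG> \<le> \<FF> \<Longrightarrow> sobolev_lim s F f \<GG>"
  unfolding sobolev_lim_def by (blast intro: tendsto_mono filter_leD)

lemma sobolev_lim_0: "L2_lim F f \<FF> \<Longrightarrow> sobolev_lim 0 F f \<FF>"
  unfolding sobolev_lim_def
  by (intro conjI exI[of _ "L2_norm f"] exI[of _ "\<lambda>h. L2_norm (\<lambda>x. F h x - f x)"])
    (auto simp: L2_lim_def elim: eventually_mono)

text \<open>The mean value theorem for \<open>F\<close> minus the indefinite integral of
  \<open>g\<close>; the derivative \<open>D\<close> itself need not be integrable.\<close>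

lemma le_integral_of_derivative_le:
  fixes F D g :: "real \<Rightarrow> real"
  assumes t: "0 \<le> t" and D: "\<And>s. s \<in> {0..t} \<Longrightarrow> (F has_real_derivative D s) (at s within {0..t})"
    and le: "\<And>s. s \<in> {0..t} \<Longrightarrow> D s \<le> g s" and g: "continuous_on {0..t} g"
  shows "F t \<le> F 0 + integral {0..t} g"
proof -
  let ?H = "\<lambda>s. F s - integral {0..s} g"
  have H: "(?H has_derivative (\<lambda>v. (D s - g s) * v)) (at s within {0..t})" if "s \<in> {0..t}" for s
  proof -
    have "((\<lambda>s. integral {0..s} g) has_real_derivative g s) (at s within {0..t})"
      using integral_has_vector_derivative[OF g that] by (simp add: has_real_derivative_iff_has_vector_derivative)
    from DERIV_diff[OF D[OF that] this] show ?thesis by (simp add: has_field_derivative_def)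
  qed
  obtain \<xi> where \<xi>: "\<xi> \<in> {0..t}" "?H t - ?H 0 = (D \<xi> - g \<xi>) * (t - 0)"
    using mvt_very_simple[OF t H] by auto
  have "(D \<xi> - g \<xi>) * (t - 0) \<le> 0" using le[OF \<xi>(1)] t by (simp add: mult_nonpos_nonneg)
  then show ?thesis using \<xi>(2) by simp
qed

context derivative_family
begin

lemma regularity_m: "CARD('n) + 1 \<le> 2 * ((m - 1) + 0)" "CARD('n) + 1 \<le> 2 * (m + 0)" "1 \<le> m"
  using m by (cases m; auto)+

text \<open>First derivatives of the solution have \<open>m\<close> space derivatives left and
  \<open>2 * m > n\<close>, so they multiply L^2 into itself.\<close>

lemma V_coefficient_L2:
  assumes "mi_size A = 1" "t \<in> {0..T}" "f \<in> L2"
  shows "(\<lambda>x. V A t x * f x) \<in> L2"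
proof -
  have "admissible m full A" using assms regularity_m by (intro admissible_small) simp
  then have "sobolev_lim m (\<lambda>h. shift None h (V A) t) (V A t) (shift_filter None t)"
    using assms by (intro V_sobolev_lim) auto
  then obtain M where "sobolev_bound m M (V A t)" unfolding sobolev_lim_def by blast
  then show ?thesis
    using product[of m 0 M "V A t" "L2_norm f" f] regularity_m assms by auto
qed

lemma V_coefficient_lim:
  assumes "mi_size A = 1" "t \<in> {0..T}" "L2_lim F f \<FF>"
  shows "L2_lim (\<lambda>h x. V A t x * F h x) (\<lambda>x. V A t x * f x) \<FF>"
proof -
  have "admissible m full A" using assms regularity_m by (intro admissible_small) simp
  then have "sobolev_lim m (\<lambda>h. shift None h (V A) t) (V A t) (shift_filter None t)"
    using assms by (intro V_sobolev_lim) auto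
  then obtain M where "sobolev_bound m M (V A t)" unfolding sobolev_lim_def by blast
  from sobolev_lim_mult[OF sobolev_lim_const[OF this] sobolev_lim_0[OF assms(3)] _ _ regularity_m(2)]
  show ?thesis by simp
qed

text \<open>A product rule in which the second factor is differentiable merely in L^2: the quotients
  of the first factor converge in H^(m-1), which is enough for a multiplier. The shorter interval
  \<open>{0..T'}\<close> accommodates forward quotients in time.\<close>

lemma V_coefficient_along:
  assumes A: "mi_size A = 1" and t: "t \<in> {0..T'}" "T' \<le> T"
    and Z: "has_derivative_along d {0..T'} Z Z' t"
  shows "has_derivative_along d {0..T'} (\<lambda>t x. V A t x * Z t x)
    (\<lambda>x. V (inc d A) t x * Z t x + V A t x * Z' x) t"
proof -
  let ?F = "at 0 within shift_domain d {0..T'} t"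
  have tT: "t \<in> {0..T}" using t by auto
  have le: "?F \<le> shift_filter d t" using t by (cases d) (auto intro!: at_le)
  have Z2: "Z t \<in> L2" using has_derivative_along_in(1)[OF Z] .
  have Zq: "L2_lim (\<lambda>h x. (shift d h Z t x - Z t x) / h) Z' ?F" using Z by (simp add: has_derivative_along_iff)
  have Zl: "L2_lim (\<lambda>h. shift d h Z t) (Z t) ?F"
    using L2_deriv_imp_lim[OF Z[unfolded has_derivative_along_def]] by simp
  have "admissible m full (inc d A)"
    using m A by (intro admissible_small) (cases m; auto)
  then have "sobolev_lim (m - 1) (\<lambda>h x. (shift d h (V A) t x - V A t x) / h) (V (inc d A) t) (shift_filter d t)"
    using regularity_m A by (intro V_quotient_sobolev_lim tT) auto
  from sobolev_lim_mult[OF sobolev_lim_mono[OF this le] sobolev_lim_0[OF Zl] _ _ regularity_m(1)]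
  have 1: "L2_lim (\<lambda>h x. (shift d h (V A) t x - V A t x) / h * shift d h Z t x) (\<lambda>x. V (inc d A) t x * Z t x) ?F"
    by simp
  have 2: "L2_lim (\<lambda>h x. V A t x * ((shift d h Z t x - Z t x) / h)) (\<lambda>x. V A t x * Z' x) ?F"
    by (rule V_coefficient_lim[OF A tT Zq])
  have eq: "(\<lambda>h x. (shift d h (V A) t x - V A t x) / h * shift d h Z t x + V A t x * ((shift d h Z t x - Z t x) / h)) =
      (\<lambda>h x. (shift d h (\<lambda>t x. V A t x * Z t x) t x - V A t x * Z t x) / h)"
    by (intro ext) (simp add: shift_mult diff_divide_distrib algebra_simps)
  show ?thesis
    using L2_lim_add[OF 1 2] V_coefficient_L2[OF A tT Z2] unfolding eq has_derivative_along_iff by blast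
qed

end

context wave_family
begin

text \<open>The wave energy with the kinetic part weighted by \<open>1 - a * V et\<close>. The
  weight absorbs the top order term \<open>a * V et * Z11\<close>, which could not be
  estimated.\<close>

definition energy_functional :: "real \<Rightarrow> (real ^ 'n \<Rightarrow> real) \<Rightarrow> ('n \<Rightarrow> real ^ 'n \<Rightarrow> real) \<Rightarrow> real" where
  "energy_functional t z1 z = (L2_inner z1 z1 - a * L2_inner (\<lambda>x. V et t x * z1 x) z1 +
     c\<^sup>2 * (\<Sum>j\<in>UNIV. L2_inner (z j) (z j))) / 2"

text \<open>Stated for arbitrary \<open>Z1\<close>, \<open>Z\<close> and a remainder
  \<open>R\<close>, so that it applies both to the solution and to its difference quotients. Pairing
  with \<open>Z1\<close> cancels the second order terms; the coefficients survive only through their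
  own first derivatives.\<close>

lemma energy_derivative:
  fixes Z1 Z11 R :: "real \<Rightarrow> real ^ 'n \<Rightarrow> real" and Z Z1s Zss :: "'n \<Rightarrow> real \<Rightarrow> real ^ 'n \<Rightarrow> real"
  assumes s: "s \<in> {0..T'}" "T' \<le> T"
    and Z1: "L2_deriv Z1 (Z11 s) s {0..T'}" and Z: "\<And>j. L2_deriv (Z j) (Z1s j s) s {0..T'}"
    and Z1s: "\<And>j. strong_partial j (Z1 s) (Z1s j s)" and Zss: "\<And>j. strong_partial j (Z j s) (Zss j s)"
    and R: "R s \<in> L2"
    and eq: "AE x in lborel. Z11 s x - c\<^sup>2 * (\<Sum>j\<in>UNIV. Zss j s x) =
      a * (V et s x * Z11 s x) + b * (\<Sum>j\<in>UNIV. V (es j) s x * Z1s j s x) + R s x"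
  shows "((\<lambda>s. energy_functional s (Z1 s) (\<lambda>j. Z j s)) has_real_derivative
     (L2_inner (R s) (Z1 s) - a / 2 * L2_inner (\<lambda>x. V (inc None et) s x * Z1 s x) (Z1 s)
      - b / 2 * (\<Sum>j\<in>UNIV. L2_inner (\<lambda>x. V (inc (Some j) (es j)) s x * Z1 s x) (Z1 s)))) (at s within {0..T'})"
proof -
  have sT: "s \<in> {0..T}" using s by auto
  have et1: "mi_size et = 1" and es1: "mi_size (es j) = 1" for j by auto
  have z1: "Z1 s \<in> L2" "Z11 s \<in> L2" using Z1 by (auto simp: L2_deriv_def)
  have z: "Z j s \<in> L2" "Z1s j s \<in> L2" "Zss j s \<in> L2" for j
    using strong_partial_in[OF Z1s] strong_partial_in[OF Zss] by auto
  have prod: "L2_deriv (\<lambda>s x. V et s x * Z1 s x) (\<lambda>x. V (inc None et) s x * Z1 s x + V et s x * Z11 s x) s {0..T'}"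
    using V_coefficient_along[OF et1 s, of None Z1 "Z11 s"] Z1 by simp
  let ?w = "\<lambda>x. V (inc None et) s x * Z1 s x" and ?u = "\<lambda>x. V et s x * Z11 s x"
  have u: "?u \<in> L2" "(\<lambda>x. V et s x * Z1 s x) \<in> L2"
    using V_coefficient_L2[OF et1 sT] z1 by auto
  have "(\<lambda>x. ?w x + ?u x) \<in> L2" using prod by (auto simp: L2_deriv_def)
  from L2_diff[OF this u(1)] have w: "?w \<in> L2" by simp
  have sym: "L2_inner (\<lambda>x. f x * g x) h = L2_inner (\<lambda>x. f x * h x) g" for f g h :: "real ^ 'n \<Rightarrow> real"
    by (simp add: L2_inner_def mult_ac)
  let ?D = "(L2_inner (Z11 s) (Z1 s) + L2_inner (Z1 s) (Z11 s) -
      a * (L2_inner (\<lambda>x. ?w x + ?u x) (Z1 s) + L2_inner (\<lambda>x. V et s x * Z1 s x) (Z11 s)) +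
      c\<^sup>2 * (\<Sum>j\<in>UNIV. L2_inner (Z1s j s) (Z j s) + L2_inner (Z j s) (Z1s j s))) / 2"
  have deriv: "((\<lambda>s. energy_functional s (Z1 s) (\<lambda>j. Z j s)) has_real_derivative ?D) (at s within {0..T'})"
    unfolding energy_functional_def
    by (intro DERIV_cdivide DERIV_add DERIV_diff DERIV_cmult DERIV_sum L2_deriv_inner Z1 Z prod)
  have sumL: "(\<lambda>x. \<Sum>j\<in>UNIV. Zss j s x) \<in> L2" using z by (intro L2_sum) auto
  have vz: "(\<lambda>x. V (es j) s x * Z1s j s x) \<in> L2" for j using V_coefficient_L2[OF es1 sT z(2)] .
  have sumV: "(\<lambda>x. \<Sum>j\<in>UNIV. V (es j) s x * Z1s j s x) \<in> L2" using vz by (intro L2_sum) auto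
  have main: "L2_inner (Z11 s) (Z1 s) - c\<^sup>2 * (\<Sum>j\<in>UNIV. L2_inner (Zss j s) (Z1 s)) =
      a * L2_inner ?u (Z1 s) + b * (\<Sum>j\<in>UNIV. L2_inner (\<lambda>x. V (es j) s x * Z1s j s x) (Z1 s)) + L2_inner (R s) (Z1 s)"
  proof -
    have "L2_inner (\<lambda>x. Z11 s x - c\<^sup>2 * (\<Sum>j\<in>UNIV. Zss j s x)) (Z1 s) =
        L2_inner (\<lambda>x. a * ?u x + b * (\<Sum>j\<in>UNIV. V (es j) s x * Z1s j s x) + R s x) (Z1 s)"
      using z1 sumL u sumV R
      by (intro L2_inner_cong_AE eq L2_measurable AE_I2 refl L2_diff L2_add L2_cmult) auto
    moreover have "L2_inner (\<lambda>x. Z11 s x - c\<^sup>2 * (\<Sum>j\<in>UNIV. Zss j s x)) (Z1 s) =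
        L2_inner (Z11 s) (Z1 s) - c\<^sup>2 * (\<Sum>j\<in>UNIV. L2_inner (Zss j s) (Z1 s))"
      using z1 sumL z by (simp add: L2_inner_diff_left L2_inner_sum_left)
    moreover have "L2_inner (\<lambda>x. a * ?u x + b * (\<Sum>j\<in>UNIV. V (es j) s x * Z1s j s x) + R s x) (Z1 s) =
        a * L2_inner ?u (Z1 s) + b * (\<Sum>j\<in>UNIV. L2_inner (\<lambda>x. V (es j) s x * Z1s j s x) (Z1 s)) + L2_inner (R s) (Z1 s)"
      using z1 u sumV R vz by (simp add: L2_inner_add_left L2_inner_sum_left)
    ultimately show ?thesis by simp
  qed
  have ibp1: "L2_inner (Zss j s) (Z1 s) = - L2_inner (Z j s) (Z1s j s)" for j
    by (rule strong_partial_inner[OF Zss Z1s])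
  \<comment> \<open>The integrand is the coefficient times half of the derivative of
    \<open>Z1^2\<close>; integrating by parts moves that derivative onto the coefficient.\<close>
  have ibp2: "L2_inner (\<lambda>x. V (es j) s x * Z1s j s x) (Z1 s) =
      - L2_inner (\<lambda>x. V (inc (Some j) (es j)) s x * Z1 s x) (Z1 s) / 2" for j
  proof -
    let ?q = "\<lambda>x. V (inc (Some j) (es j)) s x * Z1 s x"
    have sp: "strong_partial j (\<lambda>x. V (es j) s x * Z1 s x) (\<lambda>x. ?q x + V (es j) s x * Z1s j s x)"
      using V_coefficient_along[OF es1 s, of "Some j" Z1 "Z1s j s"] Z1s by simp
    have "(\<lambda>x. ?q x + V (es j) s x * Z1s j s x) \<in> L2" by (rule strong_partial_in(2)[OF sp])
    from L2_diff[OF this vz[of j]] have q: "?q \<in> L2" by simp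
    have "L2_inner (\<lambda>x. ?q x + V (es j) s x * Z1s j s x) (Z1 s) = - L2_inner (\<lambda>x. V (es j) s x * Z1 s x) (Z1s j s)"
      by (rule strong_partial_inner[OF sp Z1s])
    then show ?thesis
      using sym[of "V (es j) s" "Z1 s" "Z1s j s"] q vz z1 by (simp add: L2_inner_add_left)
  qed
  have u2: "L2_inner (\<lambda>x. V et s x * Z1 s x) (Z11 s) = L2_inner ?u (Z1 s)" by (rule sym)
  have D: "?D = L2_inner (R s) (Z1 s) - a / 2 * L2_inner ?w (Z1 s)
      - b / 2 * (\<Sum>j\<in>UNIV. L2_inner (\<lambda>x. V (inc (Some j) (es j)) s x * Z1 s x) (Z1 s))"
  proof -
    have s1: "(\<Sum>j\<in>UNIV. L2_inner (Z1s j s) (Z j s) + L2_inner (Z j s) (Z1s j s)) = - 2 * (\<Sum>j\<in>UNIV. L2_inner (Zss j s) (Z1 s))"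
      unfolding sum_distrib_left by (intro sum.cong refl) (simp add: ibp1 L2_inner_commute[of "Z1s _ s"])
    have s2: "(\<Sum>j\<in>UNIV. L2_inner (\<lambda>x. V (es j) s x * Z1s j s x) (Z1 s)) =
        - (\<Sum>j\<in>UNIV. L2_inner (\<lambda>x. V (inc (Some j) (es j)) s x * Z1 s x) (Z1 s)) / 2"
      unfolding ibp2 by (simp add: sum_negf sum_divide_distrib)
    have s3: "L2_inner (\<lambda>x. ?w x + ?u x) (Z1 s) = L2_inner ?w (Z1 s) + L2_inner ?u (Z1 s)"
      using w u z1 by (simp add: L2_inner_add_left)
    show ?thesis
      using main unfolding s1 s2 s3 u2 L2_inner_commute[of "Z1 s" "Z11 s"] by (simp add: field_simps)
  qed
  show ?thesis using deriv unfolding D .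
qed

end

section \<open>Energy estimate at every level\<close>

lemma add_word_inc: "add_word ds (inc d A) = inc d (add_word ds A)"
  by (induction ds) (simp_all, metis inc_commute)

lemma index_as_word: "\<exists>ds. A = add_word ds (\<lambda>_. 0)"
proof (induction "mi_size A" arbitrary: A)
  case 0
  then have "A = (\<lambda>_. 0)" using index_le_mi_size[of A] by (auto simp: fun_eq_iff)
  then show ?case by (intro exI[of _ "[]"]) simp
next
  case (Suc k)
  then obtain d where d: "A d \<noteq> 0" unfolding mi_size_def by (metis sum.neutral nat.distinct(1))
  then have A: "A = inc d (A(d := A d - 1))" by (auto simp: inc_def)
  then have "k = mi_size (A(d := A d - 1))" using Suc(2) mi_size_inc by (metis Suc_inject)
  from Suc(1)[OF this] obtain ds where "A(d := A d - 1) = add_word ds (\<lambda>_. 0)" by blast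
  then have "A = add_word (d # ds) (\<lambda>_. 0)" using A by simp
  then show ?case by blast
qed

lemma AE_shift:
  assumes "\<And>t. t \<in> S \<Longrightarrow> AE x in lborel. F t x = G t x" "t \<in> S" "h \<in> shift_domain d S t"
  shows "AE x in lborel. shift d h F t x = shift d h G t x"
proof (cases d)
  case None
  then show ?thesis using assms by simp
next
  case (Some j)
  then show ?thesis using AE_translate[OF assms(1)[OF assms(2)]] by simp
qed

definition diff_quot :: "'n::finite option \<Rightarrow> real \<Rightarrow> (real \<Rightarrow> real ^ 'n \<Rightarrow> real) \<Rightarrow> real \<Rightarrow> real ^ 'n \<Rightarrow> real" where
  "diff_quot d h W t x = (shift d h W t x - W t x) / h"

text \<open>Shifting only the second factor leaves the coefficient unshifted in front of the top
  order quotient, just as in the differentiated equation.\<close>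

lemma quotient_mult:
  "diff_quot d h (\<lambda>t x. W t x * Z t x) t x = diff_quot d h W t x * shift d h Z t x + W t x * diff_quot d h Z t x"
  by (simp add: diff_quot_def shift_mult diff_divide_distrib algebra_simps)

lemma quotient_add: "diff_quot d h (\<lambda>t x. W t x + Z t x) t x = diff_quot d h W t x + diff_quot d h Z t x"
  by (simp add: diff_quot_def shift_add diff_divide_distrib add_divide_distrib)

lemma quotient_diff: "diff_quot d h (\<lambda>t x. W t x - Z t x) t x = diff_quot d h W t x - diff_quot d h Z t x"
  by (simp add: diff_quot_def shift_diff diff_divide_distrib)

lemma quotient_cmult: "diff_quot d h (\<lambda>t x. k * W t x) t x = k * diff_quot d h W t x"
  by (simp add: diff_quot_def shift_cmult right_diff_distrib diff_divide_distrib)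

lemma quotient_sum: "diff_quot d h (\<lambda>t x. \<Sum>i\<in>I. W i t x) t x = (\<Sum>i\<in>I. diff_quot d h (W i) t x)"
  by (simp add: diff_quot_def shift_sum sum_subtractf[symmetric] sum_divide_distrib)

lemma L2_norm_add_le:
  "f \<in> L2 \<Longrightarrow> g \<in> L2 \<Longrightarrow> L2_norm f \<le> p \<Longrightarrow> L2_norm g \<le> q \<Longrightarrow>
    (\<lambda>x. f x + g x) \<in> L2 \<and> L2_norm (\<lambda>x. f x + g x) \<le> p + q"
  using L2_norm_triangle[of f g] by auto

text \<open>\<open>E\<close> abstracts from the energy what the growth estimate needs: it dominates
  the squared norm of every derivative of order 1 to \<open>m + 1\<close>, and it is
  continuous.\<close>

locale energy_family = wave_family m T K V True c a b
  for m :: nat and T K :: real and V :: "'n::finite spacetime_index \<Rightarrow> real \<Rightarrow> real ^ 'n \<Rightarrow> real" and c a b :: real +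
  fixes E :: "real \<Rightarrow> real"
  assumes ab: "0 \<le> a" "0 \<le> b"
    and E_bound: "\<And>A t. t \<in> {0..T} \<Longrightarrow> 1 \<le> mi_size A \<Longrightarrow> mi_size A \<le> m + 1 \<Longrightarrow> (L2_norm (V A t))\<^sup>2 \<le> E t"
    and E_continuous: "continuous_on {0..T} E"
begin

lemma adm [simp]: "admissible m True A \<longleftrightarrow> mi_size A \<le> m + 1"
  by (simp add: admissible_def)

lemma E_nonneg: "t \<in> {0..T} \<Longrightarrow> 0 \<le> E t"
  using E_bound[of t et] regularity_m order_trans[OF zero_le_power2] by auto

lemma V_norm:
  assumes "t \<in> {0..T}" "1 \<le> mi_size A" "mi_size A \<le> m + 1" "E t \<le> e"
  shows "V A t \<in> L2" "L2_norm (V A t) \<le> sqrt e"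
proof -
  show "V A t \<in> L2" using assms by (intro V_L2) auto
  show "L2_norm (V A t) \<le> sqrt e" using E_bound[OF assms(1-3)] assms(4) by (intro real_le_rsqrt) simp
qed

lemma V_sobolev:
  assumes "t \<in> {0..T}" "1 \<le> mi_size A" "mi_size A + s \<le> m + 1" "E t \<le> e"
  shows "sobolev_bound s (sqrt e) (V A t)"
proof (rule V_sobolev_bound)
  fix B assume "B \<in> space_extensions s A"
  then show "L2_norm (V B t) \<le> sqrt e"
    using assms by (intro V_norm) (auto simp: space_extensions_def)
qed (use assms in auto)

text \<open>A quotient in time depends on derivatives throughout \<open>[t, t + h]\<close>, so
  \<open>e\<close> has to bound the energy on this whole window. Space quotients use the same
  condition to keep the cases uniform.\<close>

definition energy_below :: "'n option \<Rightarrow> real \<Rightarrow> real \<Rightarrow> real \<Rightarrow> bool" where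
  "energy_below d h t e \<longleftrightarrow> t \<in> {0..T} \<and> 0 < h \<and> h \<in> shift_domain d {0..T} t \<and>
    (\<forall>\<sigma>\<in>{0..T}. t \<le> \<sigma> \<longrightarrow> \<sigma> \<le> t + h \<longrightarrow> E \<sigma> \<le> e)"

lemma energy_belowD:
  assumes "energy_below d h t e"
  shows "t \<in> {0..T}" "0 < h" "h \<in> shift_domain d {0..T} t" "E t \<le> e"
  using assms by (auto simp: energy_below_def)

lemma shift_norm:
  assumes e: "energy_below d h t e" and A: "1 \<le> mi_size A" "mi_size A \<le> m + 1"
  shows "shift d h (V A) t \<in> L2 \<and> L2_norm (shift d h (V A) t) \<le> sqrt e"
proof (cases d)
  case None
  then have "t + h \<in> {0..T}" "E (t + h) \<le> e" using e by (auto simp: energy_below_def)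
  then show ?thesis using None V_norm[of "t + h" A e] A by auto
next
  case (Some j)
  then show ?thesis using V_norm[of t A e] A energy_belowD[OF e] by auto
qed

text \<open>By the mean value inequality a quotient is bounded like the derivative it approximates:
  along the window in time, by translation invariance in space.\<close>

lemma quotient_norm:
  assumes e: "energy_below d h t e" and A: "1 \<le> mi_size A" "mi_size A \<le> m"
  shows "diff_quot d h (V A) t \<in> L2 \<and> L2_norm (diff_quot d h (V A) t) \<le> sqrt e"
proof -
  note eD = energy_belowD[OF e]
  have A1: "mi_size A \<le> m + 1" using A by simp
  have "diff_quot d h (V A) t \<in> L2"
    unfolding diff_quot_def[abs_def]
    using shift_norm[OF e A(1) A1] V_norm(1)[OF eD(1) A(1) A1 eD(4)] by (intro L2_divide L2_diff) auto
  moreover have "L2_norm (\<lambda>x. shift d h (V A) t x - V A t x) \<le> sqrt e * h"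
  proof (cases d)
    case None
    have th: "t + h \<in> {0..T}" using eD(3) None by simp
    have "L2_norm (\<lambda>x. V A (t + h) x - V A t x) \<le> sqrt e * (t + h - t)"
    proof (rule L2_mean_value[where k' = "V (inc None A)"])
      fix s assume s: "s \<in> {t..t + h}"
      have sT: "s \<in> {0..T}" using s th eD(1) by auto
      show "L2_deriv (V A) (V (inc None A) s) s {t..t + h}"
        by (rule L2_deriv_subset[OF V_time]) (use sT th eD(1) A in auto)
      show "L2_norm (V (inc None A) s) \<le> sqrt e"
        using e s sT A by (intro V_norm) (auto simp: energy_below_def)
    qed (use eD in auto)
    then show ?thesis using None by simp
  next
    case (Some j)
    have "L2_norm (\<lambda>x. V A t (x + h *\<^sub>R axis j 1) - V A t x) \<le> \<bar>h\<bar> * L2_norm (V (inc (Some j) A) t)"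
      by (rule strong_partial_mean_value[OF V_space[OF A(2) eD(1)]])
    also have "\<dots> \<le> \<bar>h\<bar> * sqrt e"
      using A eD by (intro mult_left_mono V_norm) auto
    finally show ?thesis using Some eD by (simp add: mult.commute)
  qed
  ultimately show ?thesis
    using eD(2) by (simp add: diff_quot_def[abs_def] field_simps)
qed

lemma shift_sobolev:
  assumes e: "energy_below d h t e" and A: "1 \<le> mi_size A" "mi_size A + s \<le> m + 1"
  shows "sobolev_bound s (sqrt e) (shift d h (V A) t)"
proof (rule sobolev_boundI[where W = "\<lambda>A. shift d h (V A) t"])
  note eD = energy_belowD[OF e]
  show "strong_partial j (shift d h (V B) t) (shift d h (V (inc (Some j) B)) t)"
    if "B \<in> space_extensions s A" "mi_size B < mi_size A + s" for B j
    using that A by (intro strong_partial_shift[OF V_space eD(1,3)]) auto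
  show "shift d h (V B) t \<in> L2 \<and> L2_norm (shift d h (V B) t) \<le> sqrt e"
    if "B \<in> space_extensions s A" for B
    using that A by (intro shift_norm[OF e]) (auto simp: space_extensions_def)
qed

lemma strong_partial_quotient:
  assumes e: "energy_below d h t e" and "mi_size B \<le> m"
  shows "strong_partial j (diff_quot d h (V B) t) (diff_quot d h (V (inc (Some j) B)) t)"
  unfolding diff_quot_def[abs_def] using assms energy_belowD[OF e]
  by (intro strong_partial_divide strong_partial_diff strong_partial_shift[of "{0..T}"] V_space) auto

lemma quotient_sobolev:
  assumes e: "energy_below d h t e" and A: "1 \<le> mi_size A" "mi_size A + s \<le> m"
  shows "sobolev_bound s (sqrt e) (diff_quot d h (V A) t)"
proof (rule sobolev_boundI[where W = "\<lambda>A. diff_quot d h (V A) t"])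
  show "strong_partial j (diff_quot d h (V B) t) (diff_quot d h (V (inc (Some j) B)) t)"
    if "B \<in> space_extensions s A" "mi_size B < mi_size A + s" for B j
    using that A by (intro strong_partial_quotient[OF e]) auto
  show "diff_quot d h (V B) t \<in> L2 \<and> L2_norm (diff_quot d h (V B) t) \<le> sqrt e"
    if "B \<in> space_extensions s A" for B
    using that A by (intro quotient_norm[OF e]) (auto simp: space_extensions_def)
qed

lemma energy_below_nonneg: "energy_below d h t e \<Longrightarrow> 0 \<le> e"
  using E_nonneg[of t] energy_belowD[of d h t e] by linarith

text \<open>In the count of orders the quotient stands for one derivative more, so a total of
  \<open>m + 2\<close> here corresponds to the limit \<open>m + 3\<close>.\<close>

lemma quotient_shift_mult:
  assumes e: "energy_below d h t e" and B: "1 \<le> mi_size B" "mi_size B \<le> m"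
    and C: "1 \<le> mi_size C" "mi_size C \<le> m + 1" and BC: "mi_size B + mi_size C \<le> m + 2"
  shows "(\<lambda>x. diff_quot d h (V B) t x * shift d h (V C) t x) \<in> L2 \<and>
    L2_norm (\<lambda>x. diff_quot d h (V B) t x * shift d h (V C) t x) \<le> K * e"
proof -
  have "CARD('n) + 1 \<le> 2 * ((m - mi_size B) + (m + 1 - mi_size C))"
    using product_regularity[of "inc d B" C] B C BC by simp
  from product[OF _ _ this quotient_sobolev[OF e B(1)] shift_sobolev[OF e C(1)]]
  show ?thesis using B C energy_below_nonneg[OF e] by (simp add: mult.assoc)
qed

lemma mult_quotient:
  assumes e: "energy_below d h t e" and B: "1 \<le> mi_size B" "mi_size B \<le> m + 1"
    and C: "1 \<le> mi_size C" "mi_size C \<le> m" and BC: "mi_size B + mi_size C \<le> m + 2"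
  shows "(\<lambda>x. V B t x * diff_quot d h (V C) t x) \<in> L2 \<and>
    L2_norm (\<lambda>x. V B t x * diff_quot d h (V C) t x) \<le> K * e"
proof -
  note eD = energy_belowD[OF e]
  have "CARD('n) + 1 \<le> 2 * ((m + 1 - mi_size B) + (m - mi_size C))"
    using product_regularity[of B "inc d C"] B C BC by simp
  from product[OF _ _ this V_sobolev[OF eD(1) B(1) _ eD(4)] quotient_sobolev[OF e C(1)]]
  show ?thesis using B C energy_below_nonneg[OF e] by (simp add: mult.assoc)
qed

text \<open>The discrete product rule turns every product of the list into two, each bounded by
  \<open>K * e\<close>.\<close>

lemma quotient_quad:
  assumes e: "energy_below d h t e"
    and L: "\<And>B C. (B, C) \<in> set L \<Longrightarrow> 1 \<le> mi_size B \<and> mi_size B \<le> m \<and> 1 \<le> mi_size C \<and> mi_size C \<le> m \<and>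
      mi_size B + mi_size C \<le> m + 2"
  shows "diff_quot d h (quad V L) t \<in> L2 \<and> L2_norm (diff_quot d h (quad V L) t) \<le> 2 * length L * (K * e)"
  using L
proof (induction L)
  case Nil
  have "diff_quot d h (quad V []) t = (\<lambda>x. 0)"
    by (cases d) (auto simp: diff_quot_def fun_eq_iff quad_def)
  then show ?case by (simp only:) simp
next
  case (Cons p L)
  obtain B C where p: "p = (B, C)" by (cases p)
  have eq: "diff_quot d h (quad V (p # L)) t = (\<lambda>x. (diff_quot d h (V B) t x * shift d h (V C) t x +
      V B t x * diff_quot d h (V C) t x) + diff_quot d h (quad V L) t x)"
    unfolding p quad_simps[abs_def] by (simp add: fun_eq_iff quotient_add quotient_mult quad_simps[abs_def])
  have BC: "1 \<le> mi_size B" "mi_size B \<le> m" "1 \<le> mi_size C" "mi_size C \<le> m" "mi_size B + mi_size C \<le> m + 2"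
    using Cons.prems[of B C] p by auto
  have 1: "(\<lambda>x. diff_quot d h (V B) t x * shift d h (V C) t x) \<in> L2 \<and>
    L2_norm (\<lambda>x. diff_quot d h (V B) t x * shift d h (V C) t x) \<le> K * e"
    using BC by (intro quotient_shift_mult[OF e]) auto
  have 2: "(\<lambda>x. V B t x * diff_quot d h (V C) t x) \<in> L2 \<and>
    L2_norm (\<lambda>x. V B t x * diff_quot d h (V C) t x) \<le> K * e"
    using BC by (intro mult_quotient[OF e]) auto
  have 3: "diff_quot d h (quad V L) t \<in> L2 \<and> L2_norm (diff_quot d h (quad V L) t) \<le> 2 * length L * (K * e)"
    by (rule Cons.IH) (use Cons.prems in auto)
  note 12 = L2_norm_add_le[OF conjunct1[OF 1] conjunct1[OF 2] conjunct2[OF 1] conjunct2[OF 2]]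
  note 123 = L2_norm_add_le[OF conjunct1[OF 12] conjunct1[OF 3] conjunct2[OF 12] conjunct2[OF 3]]
  show ?case unfolding eq using 123 by (simp add: algebra_simps)
qed

definition rate_const :: real where
  "rate_const = (real CARD('n) + 1) * (2 + 2 ^ m) * K * max a b"

text \<open>Quadratic remainders of size \<open>K * e\<close> are paired with \<open>z\<close> of
  norm at most \<open>sqrt e\<close>; this is the origin of the exponent 3/2.\<close>

lemma rate_bound:
  assumes t: "t \<in> {0..T}" "E t \<le> e" and z: "z \<in> L2" "L2_norm z \<le> sqrt e"
    and R: "R \<in> L2" "L2_norm R \<le> (a + CARD('n) * b) * (1 + 2 ^ m) * (K * e)"
  shows "L2_inner R z - a / 2 * L2_inner (\<lambda>x. V (inc None et) t x * z x) z
      - b / 2 * (\<Sum>j\<in>UNIV. L2_inner (\<lambda>x. V (inc (Some j) (es j)) t x * z x) z) \<le> rate_const * e powr (3/2)"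
proof -
  have e0: "0 \<le> e" using E_nonneg[OF t(1)] t(2) by linarith
  have powr: "e * sqrt e = e powr (3/2)"
    using e0 powr_add[of e 1 "1/2"] by (simp add: powr_half_sqrt)
  have Ke: "0 \<le> K * e" using K e0 by simp
  have q: "\<bar>L2_inner (\<lambda>x. V (inc d (unit_index d')) t x * z x) z\<bar> \<le> K * e * sqrt e" for d d'
  proof -
    have "sobolev_bound (m - 1) (sqrt e) (V (inc d (unit_index d')) t)"
      using t regularity_m by (intro V_sobolev) auto
    moreover have "sobolev_bound 0 (sqrt e) z" using z by simp
    ultimately have p: "(\<lambda>x. V (inc d (unit_index d')) t x * z x) \<in> L2 \<and>
        L2_norm (\<lambda>x. V (inc d (unit_index d')) t x * z x) \<le> K * sqrt e * sqrt e"
      by (rule product[OF _ _ regularity_m(1), rotated 2]) auto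
    have "\<bar>L2_inner (\<lambda>x. V (inc d (unit_index d')) t x * z x) z\<bar> \<le>
        L2_norm (\<lambda>x. V (inc d (unit_index d')) t x * z x) * L2_norm z"
      using p z by (intro L2_Cauchy_Schwarz) auto
    also have "\<dots> \<le> (K * sqrt e * sqrt e) * sqrt e"
      using p z K e0 by (intro mult_mono) auto
    finally show ?thesis using e0 by (simp add: mult.assoc)
  qed
  have r: "L2_inner R z \<le> (a + CARD('n) * b) * (1 + 2 ^ m) * (K * e) * sqrt e"
  proof -
    have "L2_inner R z \<le> L2_norm R * L2_norm z" using L2_Cauchy_Schwarz[OF R(1) z(1)] by linarith
    also have "\<dots> \<le> ((a + CARD('n) * b) * (1 + 2 ^ m) * (K * e)) * sqrt e"
      using R z Ke ab by (intro mult_mono) auto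
    finally show ?thesis .
  qed
  have s: "(\<Sum>j\<in>(UNIV :: 'n set). - L2_inner (\<lambda>x. V (inc (Some j) (es j)) t x * z x) z) \<le> (\<Sum>j\<in>(UNIV :: 'n set). K * e * sqrt e)"
    using q[of "Some _" "Some _"] by (intro sum_mono) (meson abs_le_D2)
  have 1: "- (a / 2) * L2_inner (\<lambda>x. V (inc None et) t x * z x) z \<le> a / 2 * (K * e * sqrt e)"
    using mult_left_mono[OF abs_le_D2[OF q[of None None]], of "a / 2"] ab by simp
  have 2: "- (b / 2) * (\<Sum>j\<in>UNIV. L2_inner (\<lambda>x. V (inc (Some j) (es j)) t x * z x) z) \<le> b / 2 * (CARD('n) * (K * e * sqrt e))"
    using mult_left_mono[OF s, of "b / 2"] ab by (simp add: sum_negf)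
  have "L2_inner R z - a / 2 * L2_inner (\<lambda>x. V (inc None et) t x * z x) z
      - b / 2 * (\<Sum>j\<in>UNIV. L2_inner (\<lambda>x. V (inc (Some j) (es j)) t x * z x) z) \<le>
      (a + CARD('n) * b) * (1 + 2 ^ m) * (K * e) * sqrt e + a / 2 * (K * e * sqrt e) + b / 2 * (CARD('n) * (K * e * sqrt e))"
    using r 1 2 by linarith
  \<comment> \<open>The remainder contributes \<open>1 + 2^m\<close>, the derivatives of the
    coefficients another 1/2. Next 3/2 is rounded up to 2, and \<open>a + n * b\<close> is replaced
    by \<open>(n + 1) * max a b\<close>.\<close>
  also have "\<dots> = (a + CARD('n) * b) * ((3/2 + 2 ^ m) * (K * e * sqrt e))" by (simp add: algebra_simps)
  also have "\<dots> \<le> ((real CARD('n) + 1) * max a b) * ((2 + 2 ^ m) * (K * e * sqrt e))"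
  proof (rule mult_mono)
    have "CARD('n) * b \<le> CARD('n) * max a b" by (intro mult_left_mono) auto
    moreover have "(real CARD('n) + 1) * max a b = CARD('n) * max a b + max a b" by (simp add: algebra_simps)
    ultimately show "a + CARD('n) * b \<le> (real CARD('n) + 1) * max a b"
      using max.cobounded1[of a b] by linarith
    show "(3/2 + 2 ^ m) * (K * e * sqrt e) \<le> (2 + 2 ^ m) * (K * e * sqrt e)"
      using Ke e0 by (intro mult_right_mono) auto
  qed (use ab Ke e0 in auto)
  also have "\<dots> = rate_const * (e * sqrt e)" by (simp add: rate_const_def mult_ac)
  finally show ?thesis unfolding powr .
qed

end

lemma L2_deriv_translate:
  "L2_deriv k k' t S \<Longrightarrow> L2_deriv (\<lambda>s x. k s (x + y)) (\<lambda>x. k' (x + y)) t S"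
  unfolding L2_deriv_def using L2_lim_translate[of "\<lambda>s x. (k s x - k t x) / (s - t)" k' "at t within S" y]
  by auto

lemma L2_deriv_time_shift:
  assumes "L2_deriv k k' (t + h) {0..T}" "0 \<le> h"
  shows "L2_deriv (\<lambda>s. k (s + h)) k' t {0..T - h}"
proof -
  have "L2_lim (\<lambda>r x. (k (t + h + r) x - k (t + h) x) / r) k' (at 0 within {r. t + h + r \<in> {0..T}})"
    using assms(1) by (simp add: L2_deriv_def L2_lim_at_within_shift[of _ _ "t + h"])
  moreover have "{r. t + r \<in> {0..T - h}} \<subseteq> {r. t + h + r \<in> {0..T}}" using assms(2) by auto
  ultimately have "L2_lim (\<lambda>r x. (k (t + h + r) x - k (t + h) x) / r) k' (at 0 within {r. t + r \<in> {0..T - h}})"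
    by (rule L2_lim_mono[OF _ at_le])
  moreover have "t + h + r = t + r + h" for r by simp
  ultimately have "L2_lim (\<lambda>r x. (k (t + r + h) x - k (t + h) x) / r) k' (at 0 within {r. t + r \<in> {0..T - h}})"
    by (simp only:)
  then show ?thesis using assms(1) by (simp add: L2_deriv_def L2_lim_at_within_shift[of _ _ t])
qed

context energy_family
begin

abbreviation upper :: "'n option \<Rightarrow> real \<Rightarrow> real" where
  "upper d h \<equiv> (case d of None \<Rightarrow> T - h | Some _ \<Rightarrow> T)"

lemma upper_domain: "s \<in> {0..upper d h} \<Longrightarrow> 0 < h \<Longrightarrow> s \<in> {0..T} \<and> h \<in> shift_domain d {0..T} s"
  by (cases d) auto

lemma diff_quot_deriv:
  assumes s: "s \<in> {0..upper d h}" and h: "0 < h" and B: "mi_size B \<le> m"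
  shows "L2_deriv (diff_quot d h (V B)) (diff_quot d h (V (inc None B)) s) s {0..upper d h}"
proof -
  have sT: "s \<in> {0..T}" using upper_domain[OF s h] by simp
  have 1: "L2_deriv (V B) (V (inc None B) s) s {0..upper d h}"
    using B h by (intro L2_deriv_subset[OF V_time[OF B _ sT]]) (cases d; auto)+
  have 2: "L2_deriv (shift d h (V B)) (shift d h (V (inc None B)) s) s {0..upper d h}"
  proof (cases d)
    case None
    then have "s + h \<in> {0..T}" using s h by auto
    from L2_deriv_time_shift[OF V_time[OF B _ this]] show ?thesis
      using None B h by (simp add: fun_eq_iff[of "shift None h (V B)"] shift.simps(1)[abs_def])
  next
    case (Some j)
    have "L2_deriv (\<lambda>s x. V B s (x + h *\<^sub>R axis j 1)) (\<lambda>x. V (inc None B) s (x + h *\<^sub>R axis j 1)) s {0..T}"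
      using B by (intro L2_deriv_translate V_time sT) auto
    then show ?thesis using Some by (simp add: shift.simps(2)[abs_def])
  qed
  show ?thesis
    using L2_deriv_cmult[OF L2_deriv_diff[OF 2 1], of "1 / h"] by (simp add: diff_quot_def[abs_def])
qed

text \<open>The quotient of the differentiated equation has the shape required by
  \<open>energy_derivative\<close>: top order quotients with unshifted coefficients, and a remainder
  in which a quotient meets a shifted or lower factor.\<close>

lemma diff_quot_equation:
  assumes s: "s \<in> {0..T}" "h \<in> shift_domain d {0..T} s" and ds: "length ds + 1 \<le> m"
  defines "P \<equiv> add_word ds (\<lambda>_. 0)"
  shows "AE x in lborel. diff_quot d h (V (inc None (inc None P))) s x -
      c\<^sup>2 * (\<Sum>j\<in>UNIV. diff_quot d h (V (inc (Some j) (inc (Some j) P))) s x) =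
    a * (V et s x * diff_quot d h (V (inc None (inc None P))) s x) +
    b * (\<Sum>j\<in>UNIV. V (es j) s x * diff_quot d h (V (inc None (inc (Some j) P))) s x) +
    (a * (diff_quot d h (V et) s x * shift d h (V (inc None (inc None P))) s x +
        diff_quot d h (quad V (leibniz_rest ds et (inc None et))) s x) +
     b * (\<Sum>j\<in>UNIV. diff_quot d h (V (es j)) s x * shift d h (V (inc None (inc (Some j) P))) s x +
        diff_quot d h (quad V (leibniz_rest ds (es j) (inc None (es j)))) s x))"
proof -
  have eqn: "AE x in lborel. linear_part ds t x = nonlinear_part ds t x" if "t \<in> {0..T}" for t
    using ds that by (intro differentiated_equation) auto
  have sh: "AE x in lborel. shift d h (linear_part ds) s x = shift d h (nonlinear_part ds) s x"
    by (rule AE_shift[OF eqn s])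
  have "AE x in lborel. diff_quot d h (linear_part ds) s x = diff_quot d h (nonlinear_part ds) s x"
    using sh eqn[OF s(1)] by eventually_elim (simp add: diff_quot_def)
  then show ?thesis
    by eventually_elim
      (simp add: quotient_diff quotient_cmult quotient_sum quotient_add quotient_mult add_word_inc P_def[symmetric]
        sum.distrib algebra_simps)
qed

lemma remainder_bound:
  assumes e: "energy_below d h s e" and ds: "length ds + 1 \<le> m"
  defines "P \<equiv> add_word ds (\<lambda>_. 0)"
  defines "R \<equiv> \<lambda>x. a * (diff_quot d h (V et) s x * shift d h (V (inc None (inc None P))) s x +
        diff_quot d h (quad V (leibniz_rest ds et (inc None et))) s x) +
     b * (\<Sum>j\<in>UNIV. diff_quot d h (V (es j)) s x * shift d h (V (inc None (inc (Some j) P))) s x +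
        diff_quot d h (quad V (leibniz_rest ds (es j) (inc None (es j)))) s x)"
  shows "R \<in> L2 \<and> L2_norm R \<le> (a + CARD('n) * b) * (1 + 2 ^ m) * (K * e)"
proof -
  have Ke: "0 \<le> K * e" using K energy_below_nonneg[OF e] by simp
  have part: "(\<lambda>x. diff_quot d h (V (unit_index i)) s x * shift d h (V (inc None (inc i P))) s x +
        diff_quot d h (quad V (leibniz_rest ds (unit_index i) (inc None (unit_index i)))) s x) \<in> L2 \<and>
      L2_norm (\<lambda>x. diff_quot d h (V (unit_index i)) s x * shift d h (V (inc None (inc i P))) s x +
        diff_quot d h (quad V (leibniz_rest ds (unit_index i) (inc None (unit_index i)))) s x) \<le> (1 + 2 ^ m) * (K * e)" for i
  proof -
    let ?L = "leibniz_rest ds (unit_index i) (inc None (unit_index i))"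
    have 1: "(\<lambda>x. diff_quot d h (V (unit_index i)) s x * shift d h (V (inc None (inc i P))) s x) \<in> L2 \<and>
        L2_norm (\<lambda>x. diff_quot d h (V (unit_index i)) s x * shift d h (V (inc None (inc i P))) s x) \<le> K * e"
      using ds by (intro quotient_shift_mult[OF e]) (auto simp: P_def)
    have 2: "diff_quot d h (quad V ?L) s \<in> L2 \<and> L2_norm (diff_quot d h (quad V ?L) s) \<le> 2 * length ?L * (K * e)"
    proof (rule quotient_quad[OF e])
      fix B C assume "(B, C) \<in> set ?L"
      from leibniz_rest_sizes[OF this] ds
      show "1 \<le> mi_size B \<and> mi_size B \<le> m \<and> 1 \<le> mi_size C \<and> mi_size C \<le> m \<and> mi_size B + mi_size C \<le> m + 2"
        by simp
    qed
    \<comment> \<open>Two products arise per entry of the list, and the word has length at most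
      \<open>m - 1\<close>.\<close>
    have "2 * length ?L \<le> 2 ^ Suc (length ds)" using length_leibniz_rest[of ds] by simp
    also have "\<dots> \<le> 2 ^ m" using ds by (intro power_increasing) auto
    finally have "real (2 * length ?L) \<le> 2 ^ m" using of_nat_mono by fastforce
    then have "2 * length ?L * (K * e) \<le> 2 ^ m * (K * e)" using Ke by (intro mult_right_mono) auto
    moreover note L2_norm_add_le[OF conjunct1[OF 1] conjunct1[OF 2] conjunct2[OF 1] conjunct2[OF 2]]
    ultimately show ?thesis by (simp add: distrib_right)
  qed
  let ?f = "\<lambda>i x. diff_quot d h (V (unit_index i)) s x * shift d h (V (inc None (inc i P))) s x +
        diff_quot d h (quad V (leibniz_rest ds (unit_index i) (inc None (unit_index i)))) s x"
  let ?M = "(1 + 2 ^ m) * (K * e)"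
  have 1: "(\<lambda>x. a * ?f None x) \<in> L2" "L2_norm (\<lambda>x. a * ?f None x) \<le> a * ?M"
    using part[of None] ab by (auto intro: mult_left_mono)
  have s: "(\<lambda>x. \<Sum>j\<in>UNIV. ?f (Some j) x) \<in> L2" using part by (intro L2_sum) blast
  have "L2_norm (\<lambda>x. \<Sum>j\<in>UNIV. ?f (Some j) x) \<le> (\<Sum>j\<in>(UNIV :: 'n set). L2_norm (?f (Some j)))"
    using part by (intro L2_norm_sum_le) blast
  also have "\<dots> \<le> (\<Sum>j\<in>(UNIV :: 'n set). ?M)" using part by (intro sum_mono) blast
  finally have "L2_norm (\<lambda>x. \<Sum>j\<in>UNIV. ?f (Some j) x) \<le> CARD('n) * ?M" by simp
  then have 2: "(\<lambda>x. b * (\<Sum>j\<in>UNIV. ?f (Some j) x)) \<in> L2" "L2_norm (\<lambda>x. b * (\<Sum>j\<in>UNIV. ?f (Some j) x)) \<le> b * (CARD('n) * ?M)"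
    using s ab by (auto intro: mult_left_mono)
  show ?thesis
    using L2_norm_add_le[OF 1(1) 2(1) 1(2) 2(2)] unfolding R_def by (simp add: algebra_simps)
qed

text \<open>A level of order at most \<open>m - 1\<close> is used, so all derivatives of the
  quotients that the energy identity asks for exist. The error \<open>\<eta>\<close> pays for
  replacing the energy on \<open>[s, s + h]\<close> by its value at \<open>s\<close>.\<close>

lemma quotient_energy_estimate:
  assumes h: "0 < h" and t: "t \<in> {0..upper d h}" and ds: "length ds + 1 \<le> m"
    and close: "\<And>s \<sigma>. s \<in> {0..T} \<Longrightarrow> \<sigma> \<in> {0..T} \<Longrightarrow> \<bar>\<sigma> - s\<bar> \<le> h \<Longrightarrow> E \<sigma> powr (3/2) \<le> E s powr (3/2) + \<eta>"
    and \<eta>: "0 \<le> \<eta>"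
  defines "P \<equiv> add_word ds (\<lambda>_. 0)"
  shows "energy_functional t (diff_quot d h (V (inc None P)) t) (\<lambda>j. diff_quot d h (V (inc (Some j) P)) t) \<le>
    energy_functional 0 (diff_quot d h (V (inc None P)) 0) (\<lambda>j. diff_quot d h (V (inc (Some j) P)) 0) +
    rate_const * (integral {0..t} (\<lambda>s. E s powr (3/2)) + \<eta> * t)"
proof -
  let ?Z = "\<lambda>A. diff_quot d h (V A)"
  \<comment> \<open>Chosen so that its power 3/2 is exactly \<open>E s powr (3/2) + \<eta>\<close>;
    by \<open>close\<close> it dominates the energy on the window.\<close>
  define e where "e s = (E s powr (3/2) + \<eta>) powr (2/3)" for s
  have e_powr: "e s powr (3/2) = E s powr (3/2) + \<eta>" for s
    using \<eta> by (simp add: e_def powr_powr)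
  have tT: "t \<in> {0..T}" using upper_domain[OF t h] by simp
  have below: "energy_below d h s (e s)" if "s \<in> {0..upper d h}" for s
    unfolding energy_below_def
  proof (intro conjI ballI impI)
    show "s \<in> {0..T}" "h \<in> shift_domain d {0..T} s" using upper_domain[OF that h] by auto
    fix \<sigma> assume \<sigma>: "\<sigma> \<in> {0..T}" "s \<le> \<sigma>" "\<sigma> \<le> s + h"
    have "E \<sigma> = (E \<sigma> powr (3/2)) powr (2/3)" using E_nonneg[OF \<sigma>(1)] by (simp add: powr_powr)
    also have "\<dots> \<le> e s"
      unfolding e_def using close[OF \<open>s \<in> {0..T}\<close> \<sigma>(1)] \<sigma> by (intro powr_mono2) auto
    finally show "E \<sigma> \<le> e s" .
  qed (rule h)
  let ?F = "\<lambda>s. energy_functional s (?Z (inc None P) s) (\<lambda>j. ?Z (inc (Some j) P) s)"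
  let ?R = "\<lambda>s x. a * (diff_quot d h (V et) s x * shift d h (V (inc None (inc None P))) s x +
        diff_quot d h (quad V (leibniz_rest ds et (inc None et))) s x) +
     b * (\<Sum>j\<in>UNIV. diff_quot d h (V (es j)) s x * shift d h (V (inc None (inc (Some j) P))) s x +
        diff_quot d h (quad V (leibniz_rest ds (es j) (inc None (es j)))) s x)"
  let ?D = "\<lambda>s. L2_inner (?R s) (?Z (inc None P) s) - a / 2 * L2_inner (\<lambda>x. V (inc None et) s x * ?Z (inc None P) s x) (?Z (inc None P) s)
      - b / 2 * (\<Sum>j\<in>UNIV. L2_inner (\<lambda>x. V (inc (Some j) (es j)) s x * ?Z (inc None P) s x) (?Z (inc None P) s))"
  have Psize: "mi_size (inc i P) \<le> m" "1 \<le> mi_size (inc i P)" for i using ds by (auto simp: P_def)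
  have R: "?R s \<in> L2 \<and> L2_norm (?R s) \<le> (a + CARD('n) * b) * (1 + 2 ^ m) * (K * e s)" if "s \<in> {0..upper d h}" for s
    using remainder_bound[OF below[OF that] ds] unfolding P_def .
  have up: "upper d h \<le> T" using h by (cases d) auto
  have deriv: "(?F has_real_derivative ?D s) (at s within {0..upper d h})" if s: "s \<in> {0..upper d h}" for s
  proof (rule energy_derivative[where ?Z11.0 = "?Z (inc None (inc None P))" and Z1s = "\<lambda>j. ?Z (inc None (inc (Some j) P))"
        and Zss = "\<lambda>j. ?Z (inc (Some j) (inc (Some j) P))" and R = ?R, OF s up])
    show "L2_deriv (?Z (inc None P)) (?Z (inc None (inc None P)) s) s {0..upper d h}"
      by (rule diff_quot_deriv[OF s h Psize(1)])
    show "L2_deriv (?Z (inc (Some j) P)) (?Z (inc None (inc (Some j) P)) s) s {0..upper d h}" for j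
      by (rule diff_quot_deriv[OF s h Psize(1)])
    show "strong_partial j (?Z (inc None P) s) (?Z (inc None (inc (Some j) P)) s)" for j
      using strong_partial_quotient[OF below[OF s] Psize(1)[of None], of j] by (simp add: inc_commute[of None])
    show "strong_partial j (?Z (inc (Some j) P) s) (?Z (inc (Some j) (inc (Some j) P)) s)" for j
      by (rule strong_partial_quotient[OF below[OF s] Psize(1)])
    show "?R s \<in> L2" using R[OF s] by blast
    show "AE x in lborel. ?Z (inc None (inc None P)) s x - c\<^sup>2 * (\<Sum>j\<in>UNIV. ?Z (inc (Some j) (inc (Some j) P)) s x) =
      a * (V et s x * ?Z (inc None (inc None P)) s x) + b * (\<Sum>j\<in>UNIV. V (es j) s x * ?Z (inc None (inc (Some j) P)) s x) + ?R s x"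
      using upper_domain[OF s h] unfolding P_def by (intro diff_quot_equation ds) auto
  qed
  have sub: "{0..t} \<subseteq> {0..upper d h}" using t by auto
  have le: "?D s \<le> rate_const * (E s powr (3/2) + \<eta>)" if "s \<in> {0..t}" for s
  proof -
    have s: "s \<in> {0..upper d h}" using that sub by blast
    note b = energy_belowD[OF below[OF s]]
    show ?thesis
      using rate_bound[OF b(1,4) _ _ conjunct1[OF R[OF s]] conjunct2[OF R[OF s]], of "?Z (inc None P) s"]
        quotient_norm[OF below[OF s] Psize(2,1)] unfolding e_powr by blast
  qed
  have Ec: "continuous_on {0..t} (\<lambda>s. E s powr (3/2))"
    using tT E_nonneg by (intro continuous_on_powr' continuous_on_subset[OF E_continuous]) (auto intro!: continuous_intros)
  have "?F t \<le> ?F 0 + integral {0..t} (\<lambda>s. rate_const * (E s powr (3/2) + \<eta>))"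
  proof (rule le_integral_of_derivative_le[where D = ?D])
    show "(?F has_real_derivative ?D s) (at s within {0..t})" if "s \<in> {0..t}" for s
      using deriv[of s] that sub by (blast intro: DERIV_subset)
  qed (use tT le Ec in \<open>auto intro!: continuous_intros\<close>)
  also have "integral {0..t} (\<lambda>s. rate_const * (E s powr (3/2) + \<eta>)) = rate_const * (integral {0..t} (\<lambda>s. E s powr (3/2)) + \<eta> * t)"
    using tT integral_add[OF integrable_continuous_interval[OF Ec] integrable_const_ivl[of \<eta> 0 t]]
    by (simp add: mult.commute)
  finally show ?thesis .
qed

abbreviation level_energy :: "'n spacetime_index \<Rightarrow> real \<Rightarrow> real" where
  "level_energy A t \<equiv> energy_functional t (V (inc None A) t) (\<lambda>j. V (inc (Some j) A) t)"

lemma energy_functional_lim: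
  assumes "t \<in> {0..T}" "L2_lim F1 f1 \<FF>" "\<And>j. L2_lim (F j) (f j) \<FF>"
  shows "((\<lambda>h. energy_functional t (F1 h) (\<lambda>j. F j h)) \<longlongrightarrow> energy_functional t f1 f) \<FF>"
  unfolding energy_functional_def
  by (intro tendsto_intros L2_lim_inner V_coefficient_lim assms) auto

text \<open>One direction \<open>d\<close> of \<open>A\<close> is realised by a quotient with step
  \<open>h\<close>. The estimate for quotients involves no derivative of order above
  \<open>m + 1\<close>, so both sides converge as \<open>h\<close> tends to 0.\<close>

theorem level_energy_estimate:
  assumes A: "mi_size A \<le> m" and t: "t \<in> {0..<T}"
  shows "level_energy A t \<le> level_energy A 0 + rate_const * integral {0..t} (\<lambda>s. E s powr (3/2))"
proof -
  obtain ds where ds: "A = add_word ds (\<lambda>_. 0)" using index_as_word by blast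
  have tT: "t \<in> {0..T}" using t by auto
  have Ec: "continuous_on {0..T} (\<lambda>s. E s powr (3/2))"
    using E_nonneg E_continuous by (intro continuous_on_powr') (auto intro!: continuous_intros)
  show ?thesis
  proof (cases ds)
    case Nil
    then have A0: "A = (\<lambda>_. 0)" using ds by simp
    \<comment> \<open>At order 0 there is no derivative to replace; the energy identity holds for
      the solution itself with remainder 0.\<close>
    let ?D = "\<lambda>s. L2_inner (\<lambda>x. 0) (V et s) - a / 2 * L2_inner (\<lambda>x. V (inc None et) s x * V et s x) (V et s)
      - b / 2 * (\<Sum>j\<in>UNIV. L2_inner (\<lambda>x. V (inc (Some j) (es j)) s x * V et s x) (V et s))"
    have deriv: "(level_energy A has_real_derivative ?D s) (at s within {0..T})" if s: "s \<in> {0..T}" for s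
      unfolding A0
    proof (rule energy_derivative[where ?Z11.0 = "V (inc None et)" and Z1s = "\<lambda>j. V (inc None (es j))"
          and Zss = "\<lambda>j. V (inc (Some j) (es j))" and R = "\<lambda>s x. 0", OF s order_refl])
      show "strong_partial j (V et s) (V (inc None (es j)) s)" for j
        using V_space[OF _ s, of et j] regularity_m by (simp add: inc_commute[of None])
    qed (use s equation[OF s] regularity_m in \<open>auto intro!: V_time V_space\<close>)
    have le: "?D s \<le> rate_const * E s powr (3/2)" if "s \<in> {0..t}" for s
    proof -
      have s: "s \<in> {0..T}" using that tT by auto
      have "0 \<le> (a + CARD('n) * b) * (1 + 2 ^ m) * (K * E s)" using ab K E_nonneg[OF s] by simp
      then show ?thesis
        using V_norm[OF s, of et "E s"] regularity_m by (intro rate_bound[OF s order_refl]) auto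
    qed
    have "level_energy A t \<le> level_energy A 0 + integral {0..t} (\<lambda>s. rate_const * E s powr (3/2))"
    proof (rule le_integral_of_derivative_le[where D = ?D])
      show "(level_energy A has_real_derivative ?D s) (at s within {0..t})" if "s \<in> {0..t}" for s
        using deriv[of s] that tT by (auto intro: DERIV_subset)
      show "continuous_on {0..t} (\<lambda>s. rate_const * E s powr (3/2))"
        using tT by (intro continuous_intros continuous_on_subset[OF Ec]) auto
    qed (use t le in auto)
    then show ?thesis by simp
  next
    case (Cons d es')
    let ?P = "add_word es' (\<lambda>_. 0)"
    have AP: "A = inc d ?P" and len: "length es' + 1 \<le> m" using ds Cons A by auto
    let ?Z = "\<lambda>h A t. diff_quot d h (V A) t"
    \<comment> \<open>These steps are legitimate at every \<open>s \<le> t\<close> for shifts in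
      time as well as in space. There are such steps because \<open>t < T\<close>.\<close>
    let ?\<FF> = "at 0 within {0<..<T - t}"
    have nt: "?\<FF> \<noteq> bot" using t by (simp add: trivial_limit_within islimpt_greaterThanLessThan1)
    have lim: "((\<lambda>h. energy_functional s (?Z h (inc None ?P) s) (\<lambda>j. ?Z h (inc (Some j) ?P) s)) \<longlongrightarrow> level_energy A s) ?\<FF>"
      if s: "s \<in> {0..t}" for s
    proof -
      have sT: "s \<in> {0..T}" using s t by auto
      have le: "?\<FF> \<le> shift_filter d s" using s by (cases d) (auto intro!: at_le)
      have "L2_lim (\<lambda>h. ?Z h (inc i ?P) s) (V (inc i A) s) ?\<FF>" for i
      proof (rule L2_lim_mono[OF _ le])
        show "L2_lim (\<lambda>h. ?Z h (inc i ?P) s) (V (inc i A) s) (shift_filter d s)"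
          using V_along[of "inc i ?P" d s] len sT unfolding AP inc_commute[of i d]
          by (simp add: has_derivative_along_iff diff_quot_def[abs_def])
      qed
      then show ?thesis by (intro energy_functional_lim sT)
    qed
    show ?thesis
    proof (rule field_le_epsilon)
      fix \<epsilon> :: real assume \<epsilon>: "0 < \<epsilon>"
      have rc: "0 \<le> rate_const" using K ab by (simp add: rate_const_def)
      \<comment> \<open>Makes \<open>rate_const * \<eta> * t\<close> at most
        \<open>\<epsilon>\<close>; the added 1 keeps the denominator positive even if
        \<open>rate_const\<close> is 0.\<close>
      define \<eta> where "\<eta> = \<epsilon> / ((rate_const + 1) * (T + 1))"
      have \<eta>: "0 < \<eta>" using rc T \<epsilon> by (simp add: \<eta>_def)
      have "uniformly_continuous_on {0..T} (\<lambda>s. E s powr (3/2))"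
        by (rule compact_uniformly_continuous[OF Ec compact_Icc])
      then obtain \<delta> where \<delta>: "\<delta> > 0" "\<And>s \<sigma>. s \<in> {0..T} \<Longrightarrow> \<sigma> \<in> {0..T} \<Longrightarrow> dist \<sigma> s < \<delta> \<Longrightarrow>
          dist (E \<sigma> powr (3/2)) (E s powr (3/2)) < \<eta>"
        using \<eta> unfolding uniformly_continuous_on_def by metis
      let ?I = "integral {0..t} (\<lambda>s. E s powr (3/2))"
      have ev: "\<forall>\<^sub>F h in ?\<FF>. energy_functional t (?Z h (inc None ?P) t) (\<lambda>j. ?Z h (inc (Some j) ?P) t) \<le>
          energy_functional 0 (?Z h (inc None ?P) 0) (\<lambda>j. ?Z h (inc (Some j) ?P) 0) + rate_const * (?I + \<eta> * t)"
      proof -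
        have "\<forall>\<^sub>F h in ?\<FF>. h \<in> {0<..<T - t} \<and> h < \<delta>"
          using \<delta>(1) by (auto simp: eventually_at intro!: exI[of _ \<delta>])
        then show ?thesis
        proof eventually_elim
          case (elim h)
          have th: "t \<in> {0..upper d h}" using elim t by (cases d) auto
          show ?case
          proof (rule quotient_energy_estimate[OF _ th len _ less_imp_le[OF \<eta>]])
            show "E \<sigma> powr (3/2) \<le> E s powr (3/2) + \<eta>" if "s \<in> {0..T}" "\<sigma> \<in> {0..T}" "\<bar>\<sigma> - s\<bar> \<le> h" for s \<sigma>
              using \<delta>(2)[OF that(1,2)] that(3) elim by (simp add: dist_real_def)
          qed (use elim in auto)
        qed
      qed
      have "level_energy A t \<le> level_energy A 0 + rate_const * (?I + \<eta> * t)"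
        by (rule tendsto_le[OF nt _ lim ev]) (use t in \<open>auto intro!: tendsto_intros lim\<close>)
      also have "\<dots> = level_energy A 0 + rate_const * ?I + rate_const * \<eta> * t" by (simp add: algebra_simps)
      also have "rate_const * \<eta> * t \<le> \<epsilon>"
      proof -
        have "rate_const * \<eta> * t \<le> (rate_const + 1) * \<eta> * (T + 1)"
          using rc \<eta> t by (intro mult_mono) auto
        also have "\<dots> = \<epsilon>" using rc T by (simp add: \<eta>_def)
        finally show ?thesis .
      qed
      finally show "level_energy A t \<le> level_energy A 0 + rate_const * ?I + \<epsilon>" by simp
    qed
  qed
qed

end

section \<open>Weak derivatives in Sobolev spaces\<close>

lemma count_list_add_word: "count_list ds i = add_word ds (\<lambda>_. 0) i"
  by (induction ds) (auto simp: inc_def)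

lemma word_of_index: "\<exists>is. \<forall>i. count_list is i = a i" for a :: "'n::finite multi_index"
  using index_as_word[of a] count_list_add_word by metis

lemma locally_integrable_test_mult:
  fixes g :: "real ^ 'n::finite \<Rightarrow> real"
  assumes g: "locally_integrable g" and \<phi>: "test_function \<phi>"
  shows "integrable lborel (\<lambda>x. g x * \<phi> x)"
proof -
  define C where "C = closure {x. \<phi> x \<noteq> 0}"
  have C: "compact C" using \<phi> by (simp add: test_function_def C_def)
  have c: "continuous_on C \<phi>" using continuous_on_subset[OF test_function_continuous[OF \<phi>]] by blast
  obtain B where B: "\<And>x. x \<in> C \<Longrightarrow> \<bar>\<phi> x\<bar> \<le> B"
    using compact_imp_bounded[OF compact_continuous_image[OF c C]] by (auto simp: bounded_iff)
  have z: "\<phi> x = 0" if "x \<notin> C" for x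
    using that closure_subset[of "{x. \<phi> x \<noteq> 0}"] by (auto simp: C_def)
  have m: "g \<in> borel_measurable borel" "\<phi> \<in> borel_measurable borel"
    using locally_integrable_measurable[OF g] L2_measurable[OF test_function_L2[OF \<phi>]] by auto
  have i: "integrable lborel (\<lambda>x. \<bar>B\<bar> * (indicator C x *\<^sub>R g x))"
    using g C by (intro integrable_mult_right) (simp add: locally_integrable_def set_integrable_def)
  show ?thesis
  proof (rule Bochner_Integration.integrable_bound[OF i])
    show "AE x in lborel. norm (g x * \<phi> x) \<le> norm (\<bar>B\<bar> * (indicator C x *\<^sub>R g x))"
    proof (rule AE_I2)
      fix x
      show "norm (g x * \<phi> x) \<le> norm (\<bar>B\<bar> * (indicator C x *\<^sub>R g x))"
      proof (cases "x \<in> C")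
        case True
        have "\<bar>\<phi> x\<bar> * \<bar>g x\<bar> \<le> \<bar>B\<bar> * \<bar>g x\<bar>" using B[OF True] by (intro mult_right_mono) auto
        then show ?thesis using True by (simp add: abs_mult mult.commute)
      qed (simp add: z)
    qed
  qed (use m in simp)
qed

lemma test_function_iterated_partial: "test_function \<phi> \<Longrightarrow> test_function (iterated_partial is \<phi>)"
  by (induction "is") (auto intro: test_function_partial_deriv)

lemma has_weak_derivD:
  "has_weak_deriv a f g \<Longrightarrow> test_function \<phi> \<Longrightarrow> (\<And>i. count_list is i = a i) \<Longrightarrow>
    (\<integral>x. f x * iterated_partial is \<phi> x \<partial>lborel) = (-1) ^ mi_size a * (\<integral>x. g x * \<phi> x \<partial>lborel)"
  unfolding has_weak_deriv_def by blast

text \<open>The difference of two weak derivatives is orthogonal to all test functions; a word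
  realising the multi-index \<open>a\<close> is needed to apply the definition.\<close>

lemma has_weak_deriv_unique:
  assumes g: "has_weak_deriv a f g" and g': "has_weak_deriv a f g'"
  shows "AE x in lborel. g x = g' x"
proof -
  have l: "locally_integrable g" "locally_integrable g'" using g g' by (auto simp: has_weak_deriv_def)
  have "AE x in lborel. g x - g' x = 0"
  proof (rule fundamental_lemma_variations)
    show "locally_integrable (\<lambda>x. g x - g' x)"
      using l unfolding locally_integrable_def by (auto intro: set_integral_diff)
    fix \<phi> :: "real ^ 'a \<Rightarrow> real" assume \<phi>: "test_function \<phi>"
    obtain "is" where "is": "\<And>i. count_list is i = a i" using word_of_index by blast
    have "(-1) ^ mi_size a * (\<integral>x. g x * \<phi> x \<partial>lborel) = (-1) ^ mi_size a * (\<integral>x. g' x * \<phi> x \<partial>lborel)"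
      using has_weak_derivD[OF g \<phi> "is"] has_weak_derivD[OF g' \<phi> "is"] by simp
    then have "(\<integral>x. g x * \<phi> x \<partial>lborel) = (\<integral>x. g' x * \<phi> x \<partial>lborel)" by simp
    then show "(\<integral>x. (g x - g' x) * \<phi> x \<partial>lborel) = 0"
      using locally_integrable_test_mult[OF l(1) \<phi>] locally_integrable_test_mult[OF l(2) \<phi>]
      by (simp add: left_diff_distrib)
  qed
  then show ?thesis by simp
qed

lemma locally_integrable_cong_AE:
  assumes "locally_integrable f" "AE x in lborel. f x = f' x" "f' \<in> borel_measurable borel"
  shows "locally_integrable f'"
  unfolding locally_integrable_def set_integrable_def
proof (intro allI impI)
  fix C :: "(real ^ 'a) set" assume C: "compact C"
  then have [measurable]: "C \<in> sets borel" by (rule borel_compact)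
  have [measurable]: "f' \<in> borel_measurable borel" by fact
  have "integrable lborel (\<lambda>x. indicator C x *\<^sub>R f x)"
    using assms(1) C by (simp add: locally_integrable_def set_integrable_def)
  then show "integrable lborel (\<lambda>x. indicator C x *\<^sub>R f' x)"
    by (rule integrable_cong_AE_imp) (use assms(2) in \<open>auto elim: eventually_mono\<close>)
qed

lemma has_weak_deriv_cong:
  fixes a :: "'n::finite multi_index"
  assumes w: "has_weak_deriv a f g" and f: "AE x in lborel. f x = f' x" "f' \<in> borel_measurable borel"
  shows "has_weak_deriv a f' g"
  unfolding has_weak_deriv_def
proof (intro conjI allI impI)
  have fm: "f \<in> borel_measurable borel" using w locally_integrable_measurable by (auto simp: has_weak_deriv_def)
  show "locally_integrable f'" "locally_integrable g"
    using w f by (auto simp: has_weak_deriv_def intro: locally_integrable_cong_AE)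
  fix \<phi> :: "real ^ 'n \<Rightarrow> real" and "is" :: "'n list" assume \<phi>: "test_function \<phi>" and i: "\<forall>i. count_list is i = a i"
  have m: "iterated_partial is \<phi> \<in> borel_measurable borel"
    by (rule L2_measurable[OF test_function_L2[OF test_function_iterated_partial[OF \<phi>]]])
  have "(\<integral>x. f' x * iterated_partial is \<phi> x \<partial>lborel) = (\<integral>x. f x * iterated_partial is \<phi> x \<partial>lborel)"
    using f fm m by (intro integral_cong_AE) (auto elim: eventually_mono)
  then show "(\<integral>x. f' x * iterated_partial is \<phi> x \<partial>lborel) = (-1) ^ mi_size a * (\<integral>x. g x * \<phi> x \<partial>lborel)"
    using has_weak_derivD[OF w \<phi>] i by simp
qed

text \<open>An identity of functions, not only almost everywhere: functions equal up to null sets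
  have the same weak derivatives, so the choice operator is applied to the same predicate.\<close>

lemma weak_deriv_cong:
  assumes "AE x in lborel. f x = f' x" "f \<in> borel_measurable borel" "f' \<in> borel_measurable borel"
  shows "weak_deriv a f = weak_deriv a f'"
proof -
  have "AE x in lborel. f' x = f x" using assms(1) by (auto elim: eventually_mono)
  then have "has_weak_deriv a f g = has_weak_deriv a f' g" for g
    using assms has_weak_deriv_cong by blast
  then show ?thesis by (simp add: weak_deriv_def)
qed

lemma weak_deriv_eq:
  assumes "has_weak_deriv a f g"
  shows "has_weak_deriv a f (weak_deriv a f)" "AE x in lborel. weak_deriv a f x = g x"
proof -
  show "has_weak_deriv a f (weak_deriv a f)" unfolding weak_deriv_def by (rule someI[of _ g]) fact
  then show "AE x in lborel. weak_deriv a f x = g x" by (rule has_weak_deriv_unique[OF _ assms])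
qed

lemma has_weak_deriv_lincomb:
  fixes a :: "'n::finite multi_index"
  assumes f: "has_weak_deriv a f g" "f \<in> L2" "g \<in> L2" and f': "has_weak_deriv a f' g'" "f' \<in> L2" "g' \<in> L2"
  shows "has_weak_deriv a (\<lambda>x. p * f x + q * f' x) (\<lambda>x. p * g x + q * g' x)"
  unfolding has_weak_deriv_def
proof (intro conjI allI impI)
  show "locally_integrable (\<lambda>x. p * f x + q * f' x)" "locally_integrable (\<lambda>x. p * g x + q * g' x)"
    using f f' by (auto intro!: L2_locally_integrable)
  fix \<phi> :: "real ^ 'n \<Rightarrow> real" and "is" :: "'n list" assume \<phi>: "test_function \<phi>" and i: "\<forall>i. count_list is i = a i"
  note d = test_function_L2[OF test_function_iterated_partial[OF \<phi>, of "is"]] and \<phi>2 = test_function_L2[OF \<phi>]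
  have "L2_inner (\<lambda>x. p * f x + q * f' x) (iterated_partial is \<phi>) =
      (-1) ^ mi_size a * L2_inner (\<lambda>x. p * g x + q * g' x) \<phi>"
    using f f' d \<phi>2 has_weak_derivD[OF f(1) \<phi>] has_weak_derivD[OF f'(1) \<phi>] i
    by (simp add: L2_inner_add_left) (simp add: L2_inner_def algebra_simps)
  then show "(\<integral>x. (p * f x + q * f' x) * iterated_partial is \<phi> x \<partial>lborel) =
      (-1) ^ mi_size a * (\<integral>x. (p * g x + q * g' x) * \<phi> x \<partial>lborel)"
    by (simp add: L2_inner_def)
qed

text \<open>The weak derivative of order \<open>a\<close> is tested with the derivative of order
  \<open>b\<close> of the test function, which is again a test function.\<close>

lemma has_weak_deriv_compose:
  fixes a b :: "'n::finite multi_index"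
  assumes f: "has_weak_deriv a f g" and h: "has_weak_deriv (\<lambda>i. a i + b i) f h"
  shows "has_weak_deriv b g h"
  unfolding has_weak_deriv_def
proof (intro conjI allI impI)
  show "locally_integrable g" "locally_integrable h" using f h by (auto simp: has_weak_deriv_def)
  fix \<phi> :: "real ^ 'n \<Rightarrow> real" and "is" :: "'n list" assume \<phi>: "test_function \<phi>" and i: "\<forall>i. count_list is i = b i"
  obtain ja where ja: "\<And>i. count_list ja i = a i" using word_of_index by blast
  have "mi_size (\<lambda>i. a i + b i) = mi_size a + mi_size b" by (simp add: mi_size_def sum.distrib)
  moreover have "count_list (ja @ is) i = a i + b i" for i using ja i by simp
  ultimately have "(\<integral>x. f x * iterated_partial (ja @ is) \<phi> x \<partial>lborel) =
      (-1) ^ (mi_size a + mi_size b) * (\<integral>x. h x * \<phi> x \<partial>lborel)"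
    using has_weak_derivD[OF h \<phi>, of "ja @ is"] by simp
  moreover have "(\<integral>x. f x * iterated_partial ja (iterated_partial is \<phi>) x \<partial>lborel) =
      (-1) ^ mi_size a * (\<integral>x. g x * iterated_partial is \<phi> x \<partial>lborel)"
    by (rule has_weak_derivD[OF f test_function_iterated_partial[OF \<phi>] ja])
  ultimately have "(-1) ^ mi_size a * (\<integral>x. g x * iterated_partial is \<phi> x \<partial>lborel) =
      (-1) ^ mi_size a * ((-1) ^ mi_size b * (\<integral>x. h x * \<phi> x \<partial>lborel))"
    by (simp add: power_add)
  then show "(\<integral>x. g x * iterated_partial is \<phi> x \<partial>lborel) = (-1) ^ mi_size b * (\<integral>x. h x * \<phi> x \<partial>lborel)"
    by simp
qed

lemma has_weak_deriv_zero:
  assumes "f \<in> L2" shows "has_weak_deriv (\<lambda>_. 0) f f"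
  unfolding has_weak_deriv_def
proof (intro conjI allI impI L2_locally_integrable assms)
  fix \<phi> :: "real ^ 'a \<Rightarrow> real" and "is" :: "'a list" assume "\<forall>i. count_list is i = 0"
  then have "is = []" by (metis count_list_0_iff list.set_intros(1) neq_Nil_conv)
  then show "(\<integral>x. f x * iterated_partial is \<phi> x \<partial>lborel) = (- 1) ^ mi_size (\<lambda>_::'a. 0) * (\<integral>x. f x * \<phi> x \<partial>lborel)"
    by simp
qed

lemma sobolevD:
  assumes "f \<in> sobolev s" "mi_size a \<le> s"
  shows "has_weak_deriv a f (weak_deriv a f)" "weak_deriv a f \<in> L2"
proof -
  obtain g where g: "g \<in> L2" "has_weak_deriv a f g" using assms by (auto simp: sobolev_def)
  note w = weak_deriv_eq[OF g(2)]
  show "has_weak_deriv a f (weak_deriv a f)" by (rule w(1))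
  then have "weak_deriv a f \<in> borel_measurable borel"
    using locally_integrable_measurable by (auto simp: has_weak_deriv_def)
  then show "weak_deriv a f \<in> L2"
    by (rule L2_cong_AE[OF g(1) _ AE_symmetric[OF w(2)]])
qed

lemma sobolev_L2: "f \<in> sobolev s \<Longrightarrow> f \<in> L2"
  by (simp add: sobolev_def)

lemma mi_size_unit [simp]: "mi_size ((\<lambda>_. 0)(j := k)) = k"
  by (simp add: mi_size_def)

lemma weak_deriv_compose:
  assumes "f \<in> sobolev s" "mi_size a + mi_size b \<le> s"
  shows "has_weak_deriv b (weak_deriv a f) (weak_deriv (\<lambda>i. a i + b i) f)"
    "AE x in lborel. weak_deriv b (weak_deriv a f) x = weak_deriv (\<lambda>i. a i + b i) f x"
    "weak_deriv (\<lambda>i. a i + b i) f \<in> L2"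
proof -
  have s: "mi_size (\<lambda>i. a i + b i) \<le> s" using assms(2) by (simp add: mi_size_def sum.distrib)
  show "has_weak_deriv b (weak_deriv a f) (weak_deriv (\<lambda>i. a i + b i) f)"
    by (rule has_weak_deriv_compose[OF sobolevD(1)[OF assms(1)] sobolevD(1)[OF assms(1) s]]) (use assms in simp)
  then show "AE x in lborel. weak_deriv b (weak_deriv a f) x = weak_deriv (\<lambda>i. a i + b i) f x"
    by (rule weak_deriv_eq(2))
  show "weak_deriv (\<lambda>i. a i + b i) f \<in> L2" by (rule sobolevD(2)[OF assms(1) s])
qed

lemma inc_eq_add: "inc j a = (\<lambda>i. a i + ((\<lambda>_. 0)(j := 1)) i)"
  by (auto simp: inc_def)

text \<open>The bridge from weak derivatives in the definition of H^s to the L^2 limits on which the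
  whole calculus rests.\<close>

lemma sobolev_strong_partial:
  assumes "f \<in> sobolev s" "mi_size a < s"
  shows "strong_partial j (weak_deriv a f) (weak_deriv (inc j a) f)"
proof (rule weak_imp_strong_partial)
  show "has_weak_deriv ((\<lambda>_. 0)(j := 1)) (weak_deriv a f) (weak_deriv (inc j a) f)"
    unfolding inc_eq_add by (rule weak_deriv_compose(1)[OF assms(1)]) (use assms in simp)
  show "weak_deriv a f \<in> L2" "weak_deriv (inc j a) f \<in> L2"
    using assms by (auto intro!: sobolevD(2)[OF assms(1)])
qed

lemma weak_deriv_zero:
  assumes "f \<in> L2"
  shows "AE x in lborel. weak_deriv (\<lambda>_. 0) f x = f x" "weak_deriv (\<lambda>_. 0) f \<in> borel_measurable borel"
proof -
  note w = weak_deriv_eq[OF has_weak_deriv_zero[OF assms]]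
  show "AE x in lborel. weak_deriv (\<lambda>_. 0) f x = f x" by (rule w(2))
  show "weak_deriv (\<lambda>_. 0) f \<in> borel_measurable borel"
    using w(1) locally_integrable_measurable by (auto simp: has_weak_deriv_def)
qed

lemma mi_size_eq_0 [simp]: "mi_size a = 0 \<longleftrightarrow> a = (\<lambda>_. 0)"
  by (auto simp: mi_size_def fun_eq_iff)

lemma sobolev_0: "sobolev 0 = L2"
  unfolding sobolev_def using has_weak_deriv_zero by auto

lemma sobolev_norm_0:
  assumes "f \<in> L2" shows "sobolev_norm 0 f = L2_norm f"
proof -
  have "{a :: 'a multi_index. mi_size a \<le> 0} = {\<lambda>_. 0}" by auto
  moreover have "L2_norm (weak_deriv (\<lambda>_. 0) f) = L2_norm f"
    by (rule L2_norm_cong_AE[OF weak_deriv_zero L2_measurable]) (use assms in auto)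
  ultimately show ?thesis by (simp add: sobolev_norm_def)
qed

lemma sobolev_norm_ge:
  assumes "mi_size a \<le> s" shows "L2_norm (weak_deriv a f) \<le> sobolev_norm s f"
  unfolding sobolev_norm_def
proof (rule real_le_rsqrt)
  show "(L2_norm (weak_deriv a f))\<^sup>2 \<le> (\<Sum>a | mi_size a \<le> s. (L2_norm (weak_deriv a f))\<^sup>2)"
    using assms by (intro member_le_sum finite_mi_size_le) auto
qed

lemma sobolev_norm_square: "(sobolev_norm s f)\<^sup>2 = (\<Sum>a | mi_size a \<le> s. (L2_norm (weak_deriv a f))\<^sup>2)"
  unfolding sobolev_norm_def by (simp add: sum_nonneg)

lemma weak_deriv_lincomb:
  assumes f: "f \<in> sobolev s" and g: "g \<in> sobolev s" and a: "mi_size a \<le> s"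
  shows "has_weak_deriv a (\<lambda>x. p * f x + q * g x) (\<lambda>x. p * weak_deriv a f x + q * weak_deriv a g x)"
  using assms by (intro has_weak_deriv_lincomb sobolevD sobolev_L2) auto

lemma sobolev_lincomb:
  assumes f: "f \<in> sobolev s" and g: "g \<in> sobolev s"
  shows "(\<lambda>x. p * f x + q * g x) \<in> sobolev s"
  unfolding sobolev_def using weak_deriv_lincomb[OF assms] sobolevD(2)[OF f] sobolevD(2)[OF g] sobolev_L2[OF f] sobolev_L2[OF g]
  by (auto intro!: bexI[of _ "\<lambda>x. p * weak_deriv _ f x + q * weak_deriv _ g x"])

lemma weak_deriv_lincomb_AE:
  assumes f: "f \<in> sobolev s" and g: "g \<in> sobolev s" and a: "mi_size a \<le> s"
  shows "AE x in lborel. weak_deriv a (\<lambda>x. p * f x + q * g x) x = p * weak_deriv a f x + q * weak_deriv a g x"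
  by (rule weak_deriv_eq(2)[OF weak_deriv_lincomb[OF assms]])

lemma L2_norm_weak_deriv_diff_le:
  assumes f: "f \<in> sobolev s" and g: "g \<in> sobolev s" and a: "mi_size a \<le> s"
  shows "L2_norm (\<lambda>x. weak_deriv a f x - weak_deriv a g x) \<le> sobolev_norm s (\<lambda>x. f x - g x)"
proof -
  have d: "(\<lambda>x. 1 * f x + (-1) * g x) \<in> sobolev s" by (rule sobolev_lincomb[OF f g])
  have "L2_norm (weak_deriv a (\<lambda>x. 1 * f x + (-1) * g x)) = L2_norm (\<lambda>x. 1 * weak_deriv a f x + (-1) * weak_deriv a g x)"
    by (rule L2_norm_cong_AE[OF weak_deriv_lincomb_AE[OF assms]])
      (intro L2_measurable L2_add L2_cmult sobolevD(2)[OF _ a] f g d)+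
  moreover have "L2_norm (weak_deriv a (\<lambda>x. 1 * f x + (-1) * g x)) \<le> sobolev_norm s (\<lambda>x. 1 * f x + (-1) * g x)"
    by (rule sobolev_norm_ge[OF a])
  ultimately show ?thesis by simp
qed

section \<open>Derivatives of a regular solution\<close>

lemma at_within_interval_nontrivial:
  "t \<in> {0..T::real} \<Longrightarrow> 0 < T \<Longrightarrow> at t within {0..T} \<noteq> bot"
  by (simp add: trivial_limit_within islimpt_Icc)

text \<open>Each weak derivative of order at most \<open>s\<close> is linear and bounded from H^s to
  L^2, hence commutes with the limit defining the time derivative.\<close>

lemma weak_time_deriv:
  fixes W :: "real \<Rightarrow> real ^ 'n::finite \<Rightarrow> real"
  assumes D: "has_time_deriv_at s S W v t" and t: "t \<in> S" and a: "mi_size a \<le> s"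
  shows "L2_deriv (\<lambda>\<tau>. weak_deriv a (W \<tau>)) (weak_deriv a v) t S"
proof -
  have W: "W \<tau> \<in> sobolev s" if "\<tau> \<in> S" for \<tau> using D that by (simp add: has_time_deriv_at_def)
  have v: "v \<in> sobolev s" using D by (simp add: has_time_deriv_at_def)
  have lim: "((\<lambda>\<tau>. sobolev_norm s (\<lambda>x. (W \<tau> x - W t x) / (\<tau> - t) - v x)) \<longlongrightarrow> 0) (at t within S)"
    using D by (simp add: has_time_deriv_at_def)
  have wd: "weak_deriv a (W \<tau>) \<in> L2" if "\<tau> \<in> S" for \<tau> by (rule sobolevD(2)[OF W[OF that] a])
  have wv: "weak_deriv a v \<in> L2" by (rule sobolevD(2)[OF v a])
  have ev: "\<forall>\<^sub>F \<tau> in at t within S. \<tau> \<in> S" by (simp add: eventually_at_filter)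
  show ?thesis
    unfolding L2_deriv_def
  proof (intro conjI wd t L2_limI_bound[OF wv _ lim])
    show "\<forall>\<^sub>F \<tau> in at t within S. (\<lambda>x. (weak_deriv a (W \<tau>) x - weak_deriv a (W t) x) / (\<tau> - t)) \<in> L2"
      using ev by eventually_elim (use wd t in auto)
    show "\<forall>\<^sub>F \<tau> in at t within S. L2_norm (\<lambda>x. (weak_deriv a (W \<tau>) x - weak_deriv a (W t) x) / (\<tau> - t) - weak_deriv a v x) \<le>
        sobolev_norm s (\<lambda>x. (W \<tau> x - W t x) / (\<tau> - t) - v x)"
      using ev
    proof eventually_elim
      case (elim \<tau>)
      let ?p = "1 / (\<tau> - t)" and ?q = "- 1 / (\<tau> - t)"
      have eq: "(\<lambda>x. (f x - g x) / (\<tau> - t)) = (\<lambda>x. ?p * f x + ?q * g x)" for f g :: "real ^ 'n \<Rightarrow> real"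
        by (simp add: fun_eq_iff diff_divide_distrib)
      have q: "(\<lambda>x. (W \<tau> x - W t x) / (\<tau> - t)) \<in> sobolev s"
        unfolding eq by (rule sobolev_lincomb[OF W[OF elim] W[OF t]])
      have "AE x in lborel. weak_deriv a (\<lambda>x. (W \<tau> x - W t x) / (\<tau> - t)) x =
          (weak_deriv a (W \<tau>) x - weak_deriv a (W t) x) / (\<tau> - t)"
        using weak_deriv_lincomb_AE[OF W[OF elim] W[OF t] a, of ?p ?q] unfolding eq
        by (simp add: diff_divide_distrib)
      then have "L2_norm (\<lambda>x. (weak_deriv a (W \<tau>) x - weak_deriv a (W t) x) / (\<tau> - t) - weak_deriv a v x) =
          L2_norm (\<lambda>x. weak_deriv a (\<lambda>x. (W \<tau> x - W t x) / (\<tau> - t)) x - weak_deriv a v x)"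
        using wd[OF elim] wd[OF t] wv sobolevD(2)[OF q a]
        by (intro L2_norm_cong_AE L2_measurable L2_diff L2_divide) (auto elim: eventually_mono)
      also have "\<dots> \<le> sobolev_norm s (\<lambda>x. (W \<tau> x - W t x) / (\<tau> - t) - v x)"
        by (rule L2_norm_weak_deriv_diff_le[OF q v a])
      finally show ?case .
    qed
  qed
qed

lemma L2_deriv_cong:
  assumes "L2_deriv k k' t S" "t \<in> S" "\<And>s. s \<in> S \<Longrightarrow> AE x in lborel. k s x = l s x"
    "\<And>s. s \<in> S \<Longrightarrow> l s \<in> L2" "AE x in lborel. k' x = l' x" "l' \<in> borel_measurable borel"
  shows "L2_deriv l l' t S"
  unfolding L2_deriv_def
proof (intro conjI assms(2,4))
  have ev: "\<forall>\<^sub>F s in at t within S. s \<in> S" by (simp add: eventually_at_filter)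
  show "L2_lim (\<lambda>s x. (l s x - l t x) / (s - t)) l' (at t within S)"
  proof (rule L2_lim_cong)
    show "L2_lim (\<lambda>s x. (k s x - k t x) / (s - t)) k' (at t within S)"
      using assms(1) by (simp add: L2_deriv_def)
    show "\<forall>\<^sub>F s in at t within S. (\<lambda>x. (l s x - l t x) / (s - t)) \<in> borel_measurable borel \<and>
        (AE x in lborel. (k s x - k t x) / (s - t) = (l s x - l t x) / (s - t))"
      using ev
    proof eventually_elim
      case (elim s)
      have "(\<lambda>x. (l s x - l t x) / (s - t)) \<in> L2" using assms(2,4) elim by (intro L2_divide L2_diff)
      moreover have "AE x in lborel. (k s x - k t x) / (s - t) = (l s x - l t x) / (s - t)"
        using assms(3)[OF elim] assms(3)[OF assms(2)] by eventually_elim simp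
      ultimately show ?case using L2_measurable by blast
    qed
  qed (use assms in auto)
qed

text \<open>The representative chosen by \<open>time_deriv\<close> agrees almost everywhere with any
  known L^2 derivative, because limits in the mean are unique up to null sets.\<close>

lemma time_deriv_eq:
  assumes W: "\<And>\<tau>. \<tau> \<in> {0..T} \<Longrightarrow> W \<tau> \<in> L2" and D: "L2_deriv W v t {0..T}" and t: "t \<in> {0..T}" "0 < T"
  shows "time_deriv {0..T} W t \<in> L2" "AE x in lborel. time_deriv {0..T} W t x = v x"
proof -
  have iff: "has_time_deriv_at 0 {0..T} W w t \<longleftrightarrow> w \<in> L2 \<and> L2_deriv W w t {0..T}" for w
  proof -
    have ev: "\<forall>\<^sub>F \<tau> in at t within {0..T}. \<tau> \<in> {0..T}" by (simp add: eventually_at_filter)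
    have "\<forall>\<^sub>F \<tau> in at t within {0..T}. (\<lambda>x. (W \<tau> x - W t x) / (\<tau> - t)) \<in> L2"
      using ev by eventually_elim (use W t in auto)
    moreover have "((\<lambda>\<tau>. sobolev_norm 0 (\<lambda>x. (W \<tau> x - W t x) / (\<tau> - t) - w x)) \<longlongrightarrow> 0) (at t within {0..T}) \<longleftrightarrow>
        ((\<lambda>\<tau>. L2_norm (\<lambda>x. (W \<tau> x - W t x) / (\<tau> - t) - w x)) \<longlongrightarrow> 0) (at t within {0..T})" if w: "w \<in> L2"
      by (rule tendsto_cong) (use ev in eventually_elim, use W t w in \<open>auto intro!: sobolev_norm_0\<close>)
    ultimately show ?thesis
      using W t unfolding has_time_deriv_at_def L2_deriv_def L2_lim_def sobolev_0 by auto
  qed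
  have "has_time_deriv_at 0 {0..T} W v t" using D iff by (auto simp: L2_deriv_def)
  then have "has_time_deriv_at 0 {0..T} W (time_deriv {0..T} W t) t"
    unfolding time_deriv_def by (rule someI[of "\<lambda>v. has_time_deriv_at 0 {0..T} W v t"])
  then have td: "time_deriv {0..T} W t \<in> L2" "L2_deriv W (time_deriv {0..T} W t) t {0..T}" using iff by auto
  show "time_deriv {0..T} W t \<in> L2" by (rule td(1))
  show "AE x in lborel. time_deriv {0..T} W t x = v x"
    using td(2) D at_within_interval_nontrivial[OF t] by (auto simp: L2_deriv_def intro: L2_lim_unique)
qed

lemma mi_size_option: "mi_size A = A None + mi_size (\<lambda>j. A (Some j))"
  unfolding mi_size_def UNIV_option_conv by (simp add: sum.reindex)

locale regular_solution =
  fixes m :: nat and T :: real and u :: "real \<Rightarrow> real ^ 'n::finite \<Rightarrow> real"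
  assumes T: "0 < T" and m_pos: "1 \<le> m"
    and regular: "\<And>r. r \<le> m \<Longrightarrow> u \<in> C_sobolev r (m + 1 - r) {0..T}"
begin

abbreviation TD :: "nat \<Rightarrow> real \<Rightarrow> real ^ 'n \<Rightarrow> real" where
  "TD i \<equiv> (time_deriv {0..T} ^^ i) u"

definition V :: "'n spacetime_index \<Rightarrow> real \<Rightarrow> real ^ 'n \<Rightarrow> real" where
  "V A t = weak_deriv (\<lambda>j. A (Some j)) (TD (A None) t)"

text \<open>The witnesses in \<open>C_sobolev\<close> depend on \<open>r\<close>. Induction on the
  order identifies each of them almost everywhere with the iterates of \<open>time_deriv\<close>,
  which do not depend on \<open>r\<close>.\<close>

lemma time_derivatives:
  assumes r: "r \<le> m"
  shows "\<exists>U. (\<forall>i\<le>r. \<forall>t\<in>{0..T}. U i t \<in> sobolev (m + 1 - r) \<and>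
      ((\<lambda>\<tau>. sobolev_norm (m + 1 - r) (\<lambda>x. U i \<tau> x - U i t x)) \<longlongrightarrow> 0) (at t within {0..T}) \<and>
      TD i t \<in> L2 \<and> (AE x in lborel. U i t x = TD i t x)) \<and>
    (\<forall>i<r. \<forall>t\<in>{0..T}. has_time_deriv_at (m + 1 - r) {0..T} (U i) (U (Suc i) t) t)"
proof -
  obtain U where U0: "U 0 = u"
    and U1: "\<And>i t. i \<le> r \<Longrightarrow> t \<in> {0..T} \<Longrightarrow> U i t \<in> sobolev (m + 1 - r) \<and>
      ((\<lambda>\<tau>. sobolev_norm (m + 1 - r) (\<lambda>x. U i \<tau> x - U i t x)) \<longlongrightarrow> 0) (at t within {0..T})"
    and U2: "\<And>i t. i < r \<Longrightarrow> t \<in> {0..T} \<Longrightarrow> has_time_deriv_at (m + 1 - r) {0..T} (U i) (U (Suc i) t) t"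
    using regular[OF r] unfolding C_sobolev_def by blast
  have U_L2: "U i t \<in> L2" if "i \<le> r" "t \<in> {0..T}" for i t using sobolev_L2 U1[OF that] by blast
  have TD: "\<forall>t\<in>{0..T}. TD i t \<in> L2 \<and> (AE x in lborel. U i t x = TD i t x)" if "i \<le> r" for i
    using that
  proof (induction i)
    case 0
    then show ?case using U0 U_L2 by auto
  next
    case (Suc i)
    then have IH: "\<And>t. t \<in> {0..T} \<Longrightarrow> TD i t \<in> L2" "\<And>t. t \<in> {0..T} \<Longrightarrow> AE x in lborel. U i t x = TD i t x" by auto
    have ir: "i \<le> r" "i < r" using Suc.prems by auto
    show ?case
    proof
      fix t assume t: "t \<in> {0..T}"
      have w0: "AE x in lborel. weak_deriv (\<lambda>_. 0) (U i s) x = TD i s x" if "s \<in> {0..T}" for s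
        using weak_deriv_zero(1)[OF U_L2[OF ir(1) that]] IH(2)[OF that] by eventually_elim simp
      have "L2_deriv (\<lambda>\<tau>. weak_deriv (\<lambda>_. 0) (U i \<tau>)) (weak_deriv (\<lambda>_. 0) (U (Suc i) t)) t {0..T}"
        by (rule weak_time_deriv[OF U2[OF ir(2) t] t]) simp
      then have "L2_deriv (TD i) (U (Suc i) t) t {0..T}"
        by (rule L2_deriv_cong[OF _ t w0 IH(1) weak_deriv_zero(1) L2_measurable])
          (use U_L2[OF Suc.prems t] in auto)
      from time_deriv_eq[OF IH(1) this t T]
      show "TD (Suc i) t \<in> L2 \<and> (AE x in lborel. U (Suc i) t x = TD (Suc i) t x)"
        by (simp add: AE_symmetric)
    qed
  qed
  show ?thesis by (rule exI[of _ U]) (use U1 U2 TD in auto)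
qed

lemma TD_L2: "i \<le> m \<Longrightarrow> t \<in> {0..T} \<Longrightarrow> TD i t \<in> L2"
  using time_derivatives[of i] by blast

text \<open>The regularity hypothesis is used with \<open>r\<close> equal to the time order of
  \<open>A\<close>, which leaves \<open>m + 1 - r\<close> space derivatives, exactly enough for
  indices of size \<open>m + 1\<close>.\<close>

lemma V_facts:
  assumes i: "A None \<le> m" and A: "mi_size A \<le> m + 1" and t: "t \<in> {0..T}"
  shows "L2_lim (V A) (V A t) (at t within {0..T})"
    and "mi_size A \<le> m \<Longrightarrow> strong_partial j (V A t) (V (inc (Some j) A) t)"
proof -
  define r a where "r = A None" and "a = (\<lambda>j. A (Some j))"
  have r: "r \<le> m" using i by (simp add: r_def)
  have a: "mi_size a \<le> m + 1 - r" using A mi_size_option[of A] by (simp add: a_def r_def)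
  obtain U0 where U0: "\<forall>i\<le>r. \<forall>t\<in>{0..T}. U0 i t \<in> sobolev (m + 1 - r) \<and>
      ((\<lambda>\<tau>. sobolev_norm (m + 1 - r) (\<lambda>x. U0 i \<tau> x - U0 i t x)) \<longlongrightarrow> 0) (at t within {0..T}) \<and>
      TD i t \<in> L2 \<and> (AE x in lborel. U0 i t x = TD i t x)"
    using time_derivatives[OF r] by (elim exE conjE)
  define U where "U = U0 r"
  have U: "U t \<in> sobolev (m + 1 - r)" "AE x in lborel. U t x = TD r t x" if "t \<in> {0..T}" for t
    using U0 that by (auto simp: U_def)
  have Ulim: "((\<lambda>\<tau>. sobolev_norm (m + 1 - r) (\<lambda>x. U \<tau> x - U t x)) \<longlongrightarrow> 0) (at t within {0..T})"
    using U0 t by (simp add: U_def)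
  have eq: "weak_deriv b (U s) = weak_deriv b (TD r s)" if "s \<in> {0..T}" for b s
    by (rule weak_deriv_cong[OF U(2)[OF that] L2_measurable[OF sobolev_L2[OF U(1)[OF that]]] L2_measurable[OF TD_L2[OF r that]]])
  have VU: "V A s = weak_deriv a (U s)" if "s \<in> {0..T}" for s
    using eq[OF that] by (simp add: V_def a_def r_def)
  have VL2: "V A s \<in> L2" if "s \<in> {0..T}" for s
    unfolding VU[OF that] by (rule sobolevD(2)[OF U(1)[OF that] a])
  have ev: "\<forall>\<^sub>F s in at t within {0..T}. s \<in> {0..T}" by (simp add: eventually_at_filter)
  show "L2_lim (V A) (V A t) (at t within {0..T})"
  proof (rule L2_limI_bound[OF VL2[OF t] _ Ulim])
    show "\<forall>\<^sub>F s in at t within {0..T}. V A s \<in> L2" using ev by eventually_elim (rule VL2)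
    show "\<forall>\<^sub>F s in at t within {0..T}. L2_norm (\<lambda>x. V A s x - V A t x) \<le> sobolev_norm (m + 1 - r) (\<lambda>x. U s x - U t x)"
      using ev
    proof eventually_elim
      case (elim s)
      show ?case unfolding VU[OF t] VU[OF elim] by (rule L2_norm_weak_deriv_diff_le[OF U(1)[OF elim] U(1)[OF t] a])
    qed
  qed
  assume "mi_size A \<le> m"
  then have "mi_size a < m + 1 - r" using mi_size_option[of A] by (simp add: a_def r_def)
  from sobolev_strong_partial[OF U(1)[OF t] this, of j]
  show "strong_partial j (V A t) (V (inc (Some j) A) t)"
  proof -
    have "(\<lambda>i. inc (Some j) A (Some i)) = inc j a" by (auto simp: inc_def a_def)
    then have "V (inc (Some j) A) t = weak_deriv (inc j a) (U t)"
      using eq[OF t] by (simp add: V_def r_def)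
    then show ?thesis
      using \<open>strong_partial j (weak_deriv a (U t)) (weak_deriv (inc j a) (U t))\<close> VU[OF t] by simp
  qed
qed

text \<open>Differentiability in time needs the hypothesis with \<open>r\<close> one above the time
  order; the one space derivative lost is matched by \<open>mi_size A \<le> m\<close>.\<close>

lemma V_time:
  assumes i: "A None < m" and A: "mi_size A \<le> m" and t: "t \<in> {0..T}"
  shows "L2_deriv (V A) (V (inc None A) t) t {0..T}"
proof -
  define i a where "i = A None" and "a = (\<lambda>j. A (Some j))"
  have r: "Suc i \<le> m" using assms by (simp add: i_def)
  have a: "mi_size a \<le> m + 1 - Suc i" using A mi_size_option[of A] by (simp add: a_def i_def)
  obtain U where U0: "\<forall>i'\<le>Suc i. \<forall>t\<in>{0..T}. U i' t \<in> sobolev (m + 1 - Suc i) \<and>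
      ((\<lambda>\<tau>. sobolev_norm (m + 1 - Suc i) (\<lambda>x. U i' \<tau> x - U i' t x)) \<longlongrightarrow> 0) (at t within {0..T}) \<and>
      TD i' t \<in> L2 \<and> (AE x in lborel. U i' t x = TD i' t x)"
    "\<forall>i'<Suc i. \<forall>t\<in>{0..T}. has_time_deriv_at (m + 1 - Suc i) {0..T} (U i') (U (Suc i') t) t"
    using time_derivatives[OF r] by (elim exE conjE)
  have U: "U i' t \<in> sobolev (m + 1 - Suc i)" "AE x in lborel. U i' t x = TD i' t x" "TD i' t \<in> L2"
    if "i' \<le> Suc i" "t \<in> {0..T}" for i' t using U0(1) that by auto
  have eq: "weak_deriv b (U i' s) = weak_deriv b (TD i' s)" if "i' \<le> Suc i" "s \<in> {0..T}" for b i' s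
    by (rule weak_deriv_cong[OF U(2)[OF that] L2_measurable[OF sobolev_L2[OF U(1)[OF that]]] L2_measurable[OF U(3)[OF that]]])
  have D: "L2_deriv (\<lambda>\<tau>. weak_deriv a (U i \<tau>)) (weak_deriv a (U (Suc i) t)) t {0..T}"
    by (rule weak_time_deriv[OF _ t a]) (use U0(2) t in simp)
  have V1: "V (inc None A) t = weak_deriv a (U (Suc i) t)"
    using eq[OF _ t] by (simp add: V_def a_def i_def inc_def)
  have V0: "V A s = weak_deriv a (U i s)" if "s \<in> {0..T}" for s
    using eq[OF _ that] by (simp add: V_def a_def i_def)
  have L: "weak_deriv a (U i s) \<in> L2" if "s \<in> {0..T}" for s
    by (rule sobolevD(2)[OF U(1)[OF _ that] a]) simp
  show ?thesis unfolding V1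
  proof (rule L2_deriv_cong[OF D t])
    show "weak_deriv a (U (Suc i) t) \<in> borel_measurable borel" using D by (auto simp: L2_deriv_def intro: L2_measurable)
  qed (use V0 L in auto)
qed

lemma V_zero_space:
  assumes "\<And>j. A (Some j) = 0" "TD (A None) t \<in> L2"
  shows "AE x in lborel. V A t x = TD (A None) t x" "V A t \<in> L2"
proof -
  have "(\<lambda>j. A (Some j)) = (\<lambda>_. 0)" using assms by auto
  then have V: "V A t = weak_deriv (\<lambda>_. 0) (TD (A None) t)" by (simp add: V_def)
  show 1: "AE x in lborel. V A t x = TD (A None) t x" unfolding V by (rule weak_deriv_zero(1)[OF assms(2)])
  show "V A t \<in> L2"
    by (rule L2_cong_AE[OF assms(2) _ AE_symmetric[OF 1]]) (simp only: V weak_deriv_zero(2)[OF assms(2)])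
qed

end

section \<open>Energy estimates for the Kuznetsov equation\<close>

lemma Linf_norm_less_AE:
  fixes f :: "real ^ 'n \<Rightarrow> real"
  assumes "Linf_norm f < ereal M" shows "AE x in lborel. \<bar>f x\<bar> \<le> M"
proof -
  have "AE x in lborel. ereal (norm (f x)) \<le> esssup lborel (\<lambda>x. ereal (norm (f x)))" by (rule esssup_AE)
  then show ?thesis
  proof eventually_elim
    case (elim x)
    then have "ereal (norm (f x)) < ereal M" using assms unfolding Linf_norm_def by (rule le_less_trans)
    then show ?case by simp
  qed
qed

abbreviation mk_index :: "nat \<Rightarrow> 'n::finite multi_index \<Rightarrow> 'n spacetime_index" where
  "mk_index i a \<equiv> case_option i a"

lemma mi_size_mk_index [simp]: "mi_size (mk_index i a) = i + mi_size a"
  by (subst mi_size_option) simp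

lemma inc_mk_index [simp]: "inc None (mk_index i a) = mk_index (Suc i) a"
  "inc (Some j) (mk_index i a) = mk_index i (inc j a)"
  by (auto simp: inc_def fun_eq_iff split: option.split)

locale kuznetsov = regular_solution m T u
  for m :: nat and T :: real and u :: "real \<Rightarrow> real ^ 'n::finite \<Rightarrow> real" +
  fixes c \<alpha> \<beta> \<epsilon> K :: real and u0 u1 :: "real ^ 'n \<Rightarrow> real"
  assumes pos: "0 < \<alpha>" "0 < \<beta>" "0 < \<epsilon>"
    and m_large: "CARD('n) + 3 \<le> 2 * m" and K: "0 \<le> K"
    and product: "\<And>s1 s2 (f :: real ^ 'n \<Rightarrow> real) g M N. s1 \<le> m + 1 \<Longrightarrow> s2 \<le> m + 1 \<Longrightarrow> CARD('n) + 1 \<le> 2 * (s1 + s2) \<Longrightarrow>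
      sobolev_bound s1 M f \<Longrightarrow> sobolev_bound s2 N g \<Longrightarrow>
      (\<lambda>x. f x * g x) \<in> L2 \<and> L2_norm (\<lambda>x. f x * g x) \<le> K * M * N"
    and solution: "kuznetsov_solution c \<alpha> \<beta> \<epsilon> {0..T} u0 u1 u"
    and Linf: "\<And>t. t \<in> {0..T} \<Longrightarrow> Linf_norm (time_deriv {0..T} u t) < ereal (1 / (2 * \<alpha> * \<epsilon>))"
begin

lemma two_le_m: "2 \<le> m"
  using m_large by (cases m) auto

lemma base_equation:
  assumes t: "t \<in> {0..T}"
  shows "AE x in lborel.
      V (inc None (unit_index None)) t x - c\<^sup>2 * (\<Sum>j\<in>UNIV. V (inc (Some j) (unit_index (Some j))) t x) =
      (\<alpha> * \<epsilon>) * (V (unit_index None) t x * V (inc None (unit_index None)) t x) +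
      (\<beta> * \<epsilon>) * (\<Sum>j\<in>UNIV. V (unit_index (Some j)) t x * V (inc None (unit_index (Some j))) t x)"
proof -
  have TD1: "TD 1 t \<in> L2" and TD2: "TD 2 t \<in> L2" using TD_L2[OF _ t, of 1] TD_L2[OF _ t, of 2] two_le_m by simp_all
  have 1: "AE x in lborel. V (unit_index None) t x = TD 1 t x"
    using V_zero_space(1)[of "unit_index None" t] TD1 by (simp add: inc_def)
  have 2: "AE x in lborel. V (inc None (unit_index None)) t x = TD 2 t x"
    using V_zero_space(1)[of "inc None (unit_index None)" t] TD2 by (simp add: inc_def numeral_2_eq_2)
  have lap: "laplacian (u t) x = (\<Sum>j\<in>UNIV. V (inc (Some j) (unit_index (Some j))) t x)" for x
  proof -
    have eq: "(\<lambda>i. inc (Some j) (unit_index (Some j)) (Some i)) = (\<lambda>_. 0)(j := 2)" for j by (auto simp: inc_def)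
    show ?thesis unfolding laplacian_def V_def eq by (simp add: inc_def)
  qed
  have g0: "grad (u t) x $ j = V (unit_index (Some j)) t x" for x j
  proof -
    have eq: "(\<lambda>i. unit_index (Some j) (Some i)) = (\<lambda>_. 0)(j := 1)" by (auto simp: inc_def)
    show ?thesis unfolding grad_def weak_partial_def V_def eq by (simp add: inc_def)
  qed
  have g1: "grad (time_deriv {0..T} u t) x $ j = V (inc None (unit_index (Some j))) t x" for x j
  proof -
    have eq: "(\<lambda>i. inc None (unit_index (Some j)) (Some i)) = (\<lambda>_. 0)(j := 1)" "inc None (unit_index (Some j)) None = 1" by (auto simp: inc_def)
    show ?thesis unfolding grad_def weak_partial_def V_def eq by (simp add: inc_def)
  qed
  have "AE x in lborel. TD 2 t x - c\<^sup>2 * laplacian (u t) x =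
      \<alpha> * \<epsilon> * TD 1 t x * TD 2 t x + \<beta> * \<epsilon> * (grad (u t) x \<bullet> grad (time_deriv {0..T} u t) x)"
    using solution t unfolding kuznetsov_solution_def by simp
  then show ?thesis using 1 2
    by eventually_elim (simp add: lap inner_vec_def g0 g1 mult.assoc)
qed

lemma small_coefficient:
  assumes t: "t \<in> {0..T}"
  shows "AE x in lborel. \<bar>(\<alpha> * \<epsilon>) * V (unit_index None) t x\<bar> \<le> 1/2"
proof -
  have "TD 1 t \<in> L2" using TD_L2[OF _ t, of 1] two_le_m by simp
  then have 1: "AE x in lborel. V (unit_index None) t x = TD 1 t x"
    using V_zero_space(1)[of "unit_index None" t] by (simp add: inc_def)
  show ?thesis using Linf_norm_less_AE[OF Linf[OF t]] 1
  proof eventually_elim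
    case (elim x)
    then have "\<alpha> * \<epsilon> * \<bar>V (unit_index None) t x\<bar> \<le> \<alpha> * \<epsilon> * (1 / (2 * \<alpha> * \<epsilon>))"
      using pos by (intro mult_left_mono) auto
    then show ?case using pos by (simp add: abs_mult)
  qed
qed

text \<open>The derivative of order \<open>m + 1\<close> obtained from the equation has to be
  identified with the representative that \<open>V\<close> uses, which is done through
  \<open>time_deriv_eq\<close>.\<close>

lemma top_facts:
  assumes t: "t \<in> {0..T}"
  shows "L2_deriv (V (mk_index m (\<lambda>_. 0))) (V (mk_index (Suc m) (\<lambda>_. 0)) t) t {0..T}"
    and "L2_lim (V (mk_index (Suc m) (\<lambda>_. 0))) (V (mk_index (Suc m) (\<lambda>_. 0)) t) (at t within {0..T})"
proof -
  \<comment> \<open>At this stage only indices with at most \<open>m\<close> time derivatives are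
    available, hence the value \<open>False\<close> for \<open>full\<close>.\<close>
  interpret lower: wave_family m T K V False c "\<alpha> * \<epsilon>" "\<beta> * \<epsilon>"
  proof unfold_locales
    show "L2_lim (V A) (V A t) (at t within {0..T})" if "admissible m False A" "t \<in> {0..T}" for A t
      using that V_facts(1)[of A t] by (simp add: admissible_def)
    show "strong_partial j (V A t) (V (inc (Some j) A) t)" if "mi_size A \<le> m" "t \<in> {0..T}" for A j t
      using that V_facts(2)[of A t j] index_le_mi_size[of A None] by simp
    show "L2_deriv (V A) (V (inc None A) t) t {0..T}"
      if "mi_size A \<le> m" "admissible m False (inc None A)" "t \<in> {0..T}" for A t
      using that by (intro V_time) (auto simp: admissible_def)
  qed (use T m_large K product base_equation small_coefficient in auto)
  let ?M = "mk_index m (\<lambda>_. 0) :: 'n spacetime_index" and ?M' = "mk_index (Suc m) (\<lambda>_. 0) :: 'n spacetime_index"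
  have "add_word (replicate k None) (inc None (unit_index None)) = mk_index (k + 2) (\<lambda>_. 0)" for k
    by (induction k) (auto simp: inc_def fun_eq_iff split: option.split)
  from this[of "m - 2", unfolded le_add_diff_inverse2[OF two_le_m]] have M: "add_word (replicate (m - 2) None) (inc None (unit_index None)) = ?M" .
  obtain U where U: "\<And>t. t \<in> {0..T} \<Longrightarrow> L2_deriv (V ?M) (U t) t {0..T}"
    "\<And>t. t \<in> {0..T} \<Longrightarrow> L2_lim U (U t) (at t within {0..T})"
    using lower.top_time_derivative unfolding M by blast
  have U2: "U t \<in> L2" if "t \<in> {0..T}" for t using U(2)[OF that] by auto
  have VM: "AE x in lborel. V ?M s x = TD m s x" "V ?M s \<in> L2" if "s \<in> {0..T}" for s
    using V_zero_space[of ?M s] TD_L2[OF order_refl that] by auto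
  have TDm: "TD (Suc m) t \<in> L2" "AE x in lborel. TD (Suc m) t x = U t x" if t: "t \<in> {0..T}" for t
  proof -
    have "L2_deriv (TD m) (U t) t {0..T}"
      by (rule L2_deriv_cong[OF U(1)[OF t] t VM(1) TD_L2[OF order_refl] AE_I2 L2_measurable[OF U2[OF t]]]) auto
    from time_deriv_eq[OF TD_L2[OF order_refl] this t T]
    show "TD (Suc m) t \<in> L2" "AE x in lborel. TD (Suc m) t x = U t x" by auto
  qed
  have VM': "V ?M' s \<in> L2" "AE x in lborel. U s x = V ?M' s x" if "s \<in> {0..T}" for s
  proof -
    show "V ?M' s \<in> L2" using V_zero_space(2)[of ?M' s] TDm(1)[OF that] by simp
    have "AE x in lborel. V ?M' s x = TD (Suc m) s x" using V_zero_space(1)[of ?M' s] TDm(1)[OF that] by simp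
    then show "AE x in lborel. U s x = V ?M' s x" using TDm(2)[OF that] by eventually_elim simp
  qed
  show "L2_deriv (V ?M) (V ?M' t) t {0..T}"
    by (rule L2_deriv_cong[OF U(1)[OF t] t _ VM(2) VM'(2)[OF t] L2_measurable[OF VM'(1)[OF t]]]) auto
  have "\<forall>\<^sub>F s in at t within {0..T}. s \<in> {0..T}" by (simp add: eventually_at_filter)
  then have "\<forall>\<^sub>F s in at t within {0..T}. V ?M' s \<in> borel_measurable borel \<and> (AE x in lborel. U s x = V ?M' s x)"
    by eventually_elim (use VM' L2_measurable in blast)
  then show "L2_lim (V ?M') (V ?M' t) (at t within {0..T})"
    by (rule L2_lim_cong[OF U(2)[OF t] _ L2_measurable[OF VM'(1)[OF t]] VM'(2)[OF t]])
qed

lemma pure_time_index: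
  assumes "mi_size A \<le> A None" shows "A = mk_index (A None) (\<lambda>_. 0)"
proof -
  have "(\<lambda>j. A (Some j)) = (\<lambda>_. 0)" using assms mi_size_option[of A] by simp
  then show ?thesis by (auto simp: fun_eq_iff split: option.split)
qed

sublocale wave_family m T K V True c "\<alpha> * \<epsilon>" "\<beta> * \<epsilon>"
proof unfold_locales
  show "L2_lim (V A) (V A t) (at t within {0..T})" if "admissible m True A" "t \<in> {0..T}" for A t
  proof (cases "A None \<le> m")
    case True
    then show ?thesis using that V_facts(1)[of A t] by (simp add: admissible_def)
  next
    case False
    then have "A None = Suc m" "mi_size A \<le> Suc m" using that index_le_mi_size[of A None] by (auto simp: admissible_def)
    then have "A = mk_index (Suc m) (\<lambda>_. 0)" using pure_time_index[of A] by simp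
    then show ?thesis using top_facts(2)[OF that(2)] by simp
  qed
  show "strong_partial j (V A t) (V (inc (Some j) A) t)" if "mi_size A \<le> m" "t \<in> {0..T}" for A j t
    using that V_facts(2)[of A t j] index_le_mi_size[of A None] by simp
  show "L2_deriv (V A) (V (inc None A) t) t {0..T}"
    if "mi_size A \<le> m" "admissible m True (inc None A)" "t \<in> {0..T}" for A t
  proof (cases "A None < m")
    case True
    then show ?thesis using that by (intro V_time) auto
  next
    case False
    then have "A None = m" using that index_le_mi_size[of A None] by simp
    then have "A = mk_index m (\<lambda>_. 0)" using pure_time_index[of A] that by simp
    then show ?thesis using top_facts(1)[OF that(3)] by simp
  qed
qed (use T m_large K product base_equation small_coefficient in auto)

text \<open>The gradient part runs over pairs of a direction and a multi-index, so a space
  derivative of \<open>u\<close> is counted once for each direction in its support.\<close>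

lemma energy_eq:
  assumes t: "t \<in> {0..T}"
  shows "energy m {0..T} u t =
    (\<Sum>j\<in>UNIV. \<Sum>a | mi_size a \<le> m. (L2_norm (V (mk_index 0 (inc j a)) t))\<^sup>2) +
    (\<Sum>i=1..m+1. \<Sum>a | mi_size a \<le> m + 1 - i. (L2_norm (V (mk_index i a) t))\<^sup>2)"
proof -
  have u: "u t \<in> sobolev (m + 1)" using regular[of 0] t unfolding C_sobolev_def by auto
  have "L2_norm (weak_deriv a (weak_partial j (u t))) = L2_norm (V (mk_index 0 (inc j a)) t)" if "mi_size a \<le> m" for a j
  proof -
    have s: "mi_size ((\<lambda>_. 0)(j := 1)) + mi_size a \<le> m + 1" using that by simp
    have eq: "(\<lambda>i. ((\<lambda>_. 0)(j := 1)) i + a i) = inc j a" by (auto simp: inc_def)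
    note w = weak_deriv_compose[OF u s, unfolded eq]
    have "locally_integrable (weak_deriv a (weak_deriv ((\<lambda>_. 0)(j := 1)) (u t)))"
      using weak_deriv_eq(1)[OF w(1)] by (simp add: has_weak_deriv_def)
    then have "L2_norm (weak_deriv a (weak_deriv ((\<lambda>_. 0)(j := 1)) (u t))) = L2_norm (weak_deriv (inc j a) (u t))"
      by (intro L2_norm_cong_AE[OF w(2)] locally_integrable_measurable L2_measurable w(3))
    then show ?thesis by (simp add: weak_partial_def V_def)
  qed
  then show ?thesis by (simp add: energy_def sobolev_norm_square V_def)
qed

sublocale energy_family m T K V c "\<alpha> * \<epsilon>" "\<beta> * \<epsilon>" "energy m {0..T} u"
proof unfold_locales
  show "0 \<le> \<alpha> * \<epsilon>" "0 \<le> \<beta> * \<epsilon>" using pos by auto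
  \<comment> \<open>Without time derivatives, some space direction is split off from
    \<open>A\<close> and found in the gradient part; otherwise \<open>A\<close> is a summand of the
    time part.\<close>
  show "(L2_norm (V A t))\<^sup>2 \<le> energy m {0..T} u t" if t: "t \<in> {0..T}" and A: "1 \<le> mi_size A" "mi_size A \<le> m + 1" for A t
  proof -
    define i a where "i = A None" and "a = (\<lambda>j. A (Some j))"
    have Aeq: "A = mk_index i a" by (auto simp: i_def a_def fun_eq_iff split: option.split)
    let ?G = "\<Sum>j\<in>UNIV. \<Sum>a | mi_size a \<le> m. (L2_norm (V (mk_index 0 (inc j a)) t))\<^sup>2"
    let ?H = "\<Sum>i=1..m+1. \<Sum>a | mi_size a \<le> m + 1 - i. (L2_norm (V (mk_index i a) t))\<^sup>2"
    have nn: "0 \<le> ?G" "0 \<le> ?H" by (intro sum_nonneg zero_le_power2)+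
    show ?thesis
    proof (cases i)
      case 0
      then have "a \<noteq> (\<lambda>_. 0)" using A Aeq by auto
      then obtain j where j: "a j \<noteq> 0" by (auto simp: fun_eq_iff)
      let ?a = "a(j := a j - 1)"
      have aj: "a = inc j ?a" using j by (auto simp: inc_def)
      then have "mi_size a = Suc (mi_size ?a)" using mi_size_inc by metis
      then have sz: "mi_size ?a \<le> m" using A Aeq 0 by simp
      have "(L2_norm (V A t))\<^sup>2 = (L2_norm (V (mk_index 0 (inc j ?a)) t))\<^sup>2" unfolding Aeq 0 aj[symmetric] ..
      also have "\<dots> \<le> (\<Sum>a | mi_size a \<le> m. (L2_norm (V (mk_index 0 (inc j a)) t))\<^sup>2)"
        by (rule member_le_sum[of ?a "{a. mi_size a \<le> m}" "\<lambda>a. (L2_norm (V (mk_index 0 (inc j a)) t))\<^sup>2"])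
          (use sz finite_mi_size_le in auto)
      also have "\<dots> \<le> ?G"
        by (rule member_le_sum[of j UNIV "\<lambda>j. \<Sum>a | mi_size a \<le> m. (L2_norm (V (mk_index 0 (inc j a)) t))\<^sup>2"])
          (auto intro: sum_nonneg)
      finally show ?thesis unfolding energy_eq[OF t] using nn by linarith
    next
      case (Suc i')
      have sz: "mi_size a \<le> m + 1 - i" "i \<in> {1..m+1}" using A Aeq Suc by auto
      have "(L2_norm (V A t))\<^sup>2 \<le> (\<Sum>a | mi_size a \<le> m + 1 - i. (L2_norm (V (mk_index i a) t))\<^sup>2)"
        unfolding Aeq
        by (rule member_le_sum[of a "{a. mi_size a \<le> m + 1 - i}" "\<lambda>a. (L2_norm (V (mk_index i a) t))\<^sup>2"])
          (use sz finite_mi_size_le in auto)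
      also have "\<dots> \<le> ?H"
        by (rule member_le_sum[of i "{1..m+1}" "\<lambda>i. \<Sum>a | mi_size a \<le> m + 1 - i. (L2_norm (V (mk_index i a) t))\<^sup>2"])
          (use sz in \<open>auto intro: sum_nonneg\<close>)
      finally show ?thesis unfolding energy_eq[OF t] using nn by linarith
    qed
  qed
  have nc: "continuous_on {0..T} (\<lambda>t. (L2_norm (V A t))\<^sup>2)" if "mi_size A \<le> m + 1" for A
    unfolding continuous_on_def
  proof
    fix t assume t: "t \<in> {0..T}"
    have "L2_lim (V A) (V A t) (at t within {0..T})" using that by (intro V_lim t) (simp add: admissible_def)
    then show "((\<lambda>t. (L2_norm (V A t))\<^sup>2) \<longlongrightarrow> (L2_norm (V A t))\<^sup>2) (at t within {0..T})"
      by (intro tendsto_power L2_lim_norm)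
  qed
  have "continuous_on {0..T} (\<lambda>t.
    (\<Sum>j\<in>UNIV. \<Sum>a | mi_size a \<le> m. (L2_norm (V (mk_index 0 (inc j a)) t))\<^sup>2) +
    (\<Sum>i=1..m+1. \<Sum>a | mi_size a \<le> m + 1 - i. (L2_norm (V (mk_index i a) t))\<^sup>2))"
    by (intro continuous_on_add continuous_on_sum nc) auto
  then show "continuous_on {0..T} (energy m {0..T} u)"
    by (rule continuous_on_eq) (simp add: energy_eq)
qed

text \<open>The smallness of \<open>u_t\<close> puts the weight of the kinetic part between 1/2 and
  3/2; these numbers reappear in \<open>B\<close>.\<close>

lemma level_energy_bounds:
  assumes A: "mi_size A \<le> m" and t: "t \<in> {0..T}"
  shows "(L2_norm (V (inc None A) t))\<^sup>2 / 2 + c\<^sup>2 * (\<Sum>j\<in>UNIV. (L2_norm (V (inc (Some j) A) t))\<^sup>2) \<le> 2 * level_energy A t"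
    and "2 * level_energy A t \<le> 3 / 2 * (L2_norm (V (inc None A) t))\<^sup>2 + c\<^sup>2 * (\<Sum>j\<in>UNIV. (L2_norm (V (inc (Some j) A) t))\<^sup>2)"
proof -
  let ?z = "V (inc None A) t"
  have z: "?z \<in> L2" using A t by (intro V_L2) (auto simp: admissible_def)
  have e: "V et t \<in> borel_measurable borel" using two_le_m t by (intro L2_measurable V_L2) (auto simp: admissible_def)
  have em: "(\<lambda>x. \<alpha> * \<epsilon> * V et t x) \<in> borel_measurable borel" using e by measurable
  note b = L2_norm_bounded_mult[OF z em small_coefficient[OF t]]
  have "\<alpha> * \<epsilon> * L2_inner (\<lambda>x. V et t x * ?z x) ?z = L2_inner (\<lambda>x. \<alpha> * \<epsilon> * V et t x * ?z x) ?z"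
    unfolding L2_inner_cmult_left[symmetric] by (simp add: mult.assoc)
  moreover have "\<bar>L2_inner (\<lambda>x. \<alpha> * \<epsilon> * V et t x * ?z x) ?z\<bar> \<le> (L2_norm ?z)\<^sup>2 / 2"
  proof -
    have "\<bar>L2_inner (\<lambda>x. \<alpha> * \<epsilon> * V et t x * ?z x) ?z\<bar> \<le> L2_norm (\<lambda>x. \<alpha> * \<epsilon> * V et t x * ?z x) * L2_norm ?z"
      by (rule L2_Cauchy_Schwarz[OF b(1) z])
    also have "\<dots> \<le> (\<bar>1/2\<bar> * L2_norm ?z) * L2_norm ?z" by (rule mult_right_mono[OF b(2)]) simp
    finally show ?thesis by (simp add: power2_eq_square)
  qed
  ultimately have "\<bar>\<alpha> * \<epsilon> * L2_inner (\<lambda>x. V et t x * ?z x) ?z\<bar> \<le> (L2_norm ?z)\<^sup>2 / 2" by simp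
  moreover have "2 * level_energy A t = (L2_norm ?z)\<^sup>2 - \<alpha> * \<epsilon> * L2_inner (\<lambda>x. V et t x * ?z x) ?z +
      c\<^sup>2 * (\<Sum>j\<in>UNIV. (L2_norm (V (inc (Some j) A) t))\<^sup>2)"
    by (simp add: energy_functional_def L2_norm_square)
  ultimately show "(L2_norm ?z)\<^sup>2 / 2 + c\<^sup>2 * (\<Sum>j\<in>UNIV. (L2_norm (V (inc (Some j) A) t))\<^sup>2) \<le> 2 * level_energy A t"
    "2 * level_energy A t \<le> 3 / 2 * (L2_norm ?z)\<^sup>2 + c\<^sup>2 * (\<Sum>j\<in>UNIV. (L2_norm (V (inc (Some j) A) t))\<^sup>2)"
    by linarith+
qed

end

section \<open>Summation over the levels\<close>

text \<open>A derivative with index \<open>b\<close> in space occurs in the gradient terms of several levels, once for each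
  direction in the support of \<open>b\<close>. These weights keep the resulting total weight \<open>lower_weight b\<close>
  below \<open>1\<close>, so that the constant \<open>B\<close> does not pick up a factor \<open>n\<close>.\<close>

definition support_weight :: "'n::finite multi_index \<Rightarrow> real" where
  "support_weight a = 1 / (1 + real (card {j. a j \<noteq> 0}))"

definition lower_weight :: "'n::finite multi_index \<Rightarrow> real" where
  "lower_weight b = (\<Sum>j | b j \<noteq> 0. support_weight (b(j := b j - 1)))"

lemma support_weight_bounds: "0 \<le> support_weight a" "support_weight a \<le> 1"
  by (auto simp: support_weight_def)

lemma lower_weight_nonneg: "0 \<le> lower_weight b"
  unfolding lower_weight_def by (intro sum_nonneg support_weight_bounds)

text \<open>Lowering \<open>b\<close> in one direction removes at most one element from its support
  of size \<open>s\<close>, so each of the \<open>s\<close> summands is at most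
  \<open>1 / s\<close>.\<close>

lemma lower_weight_le: "lower_weight b \<le> 1"
proof (cases "card {j. b j \<noteq> 0} = 0")
  case True
  then have "{j. b j \<noteq> 0} = {}" by simp
  then show ?thesis unfolding lower_weight_def by (simp only: sum.empty)
next
  case False
  define s where "s = card {j. b j \<noteq> 0}"
  have "lower_weight b \<le> (\<Sum>j | b j \<noteq> 0. 1 / real s)"
    unfolding lower_weight_def
  proof (rule sum_mono)
    fix j assume j: "j \<in> {j. b j \<noteq> 0}"
    have "{j. b j \<noteq> 0} - {j} \<subseteq> {i. (b(j := b j - 1)) i \<noteq> 0}" by auto
    then have "card ({j. b j \<noteq> 0} - {j}) \<le> card {i. (b(j := b j - 1)) i \<noteq> 0}" by (intro card_mono) auto
    then have "s \<le> 1 + card {i. (b(j := b j - 1)) i \<noteq> 0}" using j by (simp add: s_def)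
    then have "real s \<le> 1 + real (card {i. (b(j := b j - 1)) i \<noteq> 0})" by linarith
    then show "support_weight (b(j := b j - 1)) \<le> 1 / real s"
      unfolding support_weight_def using False[folded s_def] by (intro divide_left_mono mult_pos_pos) simp_all
  qed
  also have "\<dots> = 1" using False by (simp add: s_def)
  finally show ?thesis .
qed

text \<open>Lowering never enlarges the support, so each of the \<open>s\<close> summands is at
  least \<open>1 / (1 + s)\<close>, and \<open>support_weight b\<close> is one more such
  term.\<close>

lemma support_weight_add_lower_weight: "1 \<le> support_weight b + lower_weight b"
proof -
  define s where "s = card {j. b j \<noteq> 0}"
  have "(\<Sum>j | b j \<noteq> 0. 1 / (1 + real s)) \<le> lower_weight b"
    unfolding lower_weight_def
  proof (rule sum_mono)
    fix j assume j: "j \<in> {j. b j \<noteq> 0}"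
    have "{i. (b(j := b j - 1)) i \<noteq> 0} \<subseteq> {j. b j \<noteq> 0}" using j by auto
    then have "card {i. (b(j := b j - 1)) i \<noteq> 0} \<le> s" unfolding s_def by (intro card_mono) auto
    then show "1 / (1 + real s) \<le> support_weight (b(j := b j - 1))"
      unfolding support_weight_def by (intro divide_left_mono mult_pos_pos) simp_all
  qed
  moreover have "(\<Sum>j | b j \<noteq> 0. 1 / (1 + real s)) + support_weight b = (real s + 1) / (1 + real s)"
    unfolding support_weight_def s_def[symmetric] by (simp add: s_def add_divide_distrib)
  ultimately show ?thesis by (simp add: add.commute)
qed

lemma lower_weight_zero: "lower_weight (\<lambda>_. 0) = 0"
  by (simp add: lower_weight_def)

lemma sum_inc_reindex:
  fixes f :: "'n::finite multi_index \<Rightarrow> real"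
  shows "(\<Sum>a | mi_size a \<le> k. support_weight a * (\<Sum>j\<in>UNIV. f (inc j a))) =
    (\<Sum>b | mi_size b \<le> Suc k. lower_weight b * f b)"
proof -
  have 1: "(\<Sum>a | mi_size a \<le> k. support_weight a * f (inc j a)) =
      (\<Sum>b | mi_size b \<le> Suc k. if b j \<noteq> 0 then support_weight (b(j := b j - 1)) * f b else 0)" for j
  proof -
    have "(\<Sum>a | mi_size a \<le> k. support_weight a * f (inc j a)) =
        (\<Sum>b | mi_size b \<le> Suc k \<and> b j \<noteq> 0. support_weight (b(j := b j - 1)) * f b)"
    proof (rule sum.reindex_bij_witness[where i = "\<lambda>b. b(j := b j - 1)" and j = "inc j"])
      fix b :: "'n multi_index" assume b: "b \<in> {b. mi_size b \<le> Suc k \<and> b j \<noteq> 0}"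
      then show eq: "inc j (b(j := b j - 1)) = b" by (auto simp: inc_def)
      have "mi_size b = Suc (mi_size (b(j := b j - 1)))" unfolding mi_size_inc[of j, symmetric] eq ..
      then show "b(j := b j - 1) \<in> {a. mi_size a \<le> k}" using b by simp
    next
      fix a :: "'n multi_index"
      show "(inc j a)(j := inc j a j - 1) = a" by (simp add: inc_def)
      then show "support_weight ((inc j a)(j := inc j a j - 1)) * f (inc j a) = support_weight a * f (inc j a)" by simp
      assume "a \<in> {a. mi_size a \<le> k}"
      then have "mi_size (inc j a) \<le> Suc k" by simp
      moreover have "inc j a j \<noteq> 0" by (simp add: inc_def)
      ultimately show "inc j a \<in> {b. mi_size b \<le> Suc k \<and> b j \<noteq> 0}" by blast
    qed
    also have "\<dots> = (\<Sum>b | mi_size b \<le> Suc k. if b j \<noteq> 0 then support_weight (b(j := b j - 1)) * f b else 0)"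
      using sum.inter_filter[OF finite_mi_size_le[of "Suc k"], of "\<lambda>b. support_weight (b(j := b j - 1)) * f b" "\<lambda>b. b j \<noteq> 0"]
      by simp
    finally show ?thesis .
  qed
  have filter: "(\<Sum>j\<in>UNIV. if b j \<noteq> 0 then g j else 0) = (\<Sum>j | b j \<noteq> 0. g j)" for b :: "'n multi_index" and g :: "'n \<Rightarrow> real"
    by (simp only: sum.If_cases[OF finite] Int_UNIV_left sum.neutral_const add_0_right)
  have "(\<Sum>a | mi_size a \<le> k. support_weight a * (\<Sum>j\<in>UNIV. f (inc j a))) =
      (\<Sum>j\<in>UNIV. \<Sum>a | mi_size a \<le> k. support_weight a * f (inc j a))"
    unfolding sum_distrib_left by (rule sum.swap)
  also have "\<dots> = (\<Sum>b | mi_size b \<le> Suc k. \<Sum>j\<in>UNIV. if b j \<noteq> 0 then support_weight (b(j := b j - 1)) * f b else 0)"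
    unfolding 1 by (rule sum.swap)
  also have "\<dots> = (\<Sum>b | mi_size b \<le> Suc k. lower_weight b * f b)"
    unfolding lower_weight_def sum_distrib_right
    unfolding filter by (rule refl)
  finally show ?thesis .
qed

text \<open>Without time derivatives the weight is 1, because there the energy itself counts
  gradient terms with multiplicity and matches the sum over levels exactly.\<close>

definition layer_weight :: "nat \<Rightarrow> 'n::finite multi_index \<Rightarrow> real" where
  "layer_weight i a = (if i = 0 then 1 else support_weight a)"

lemma layer_weight_bounds: "0 \<le> layer_weight i a" "layer_weight i a \<le> 1"
  by (auto simp: layer_weight_def support_weight_bounds)

text \<open>For \<open>i \<ge> 1\<close> the quantity \<open>P i a\<close> is met twice: as the time
  derivative term of the level \<open>(i - 1, a)\<close> and as a gradient term of levels at time
  order \<open>i\<close>. Collecting both gives its total coefficient.\<close>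

lemma weighted_layers:
  fixes P :: "nat \<Rightarrow> 'n::finite multi_index \<Rightarrow> real"
  shows "(\<Sum>i\<le>m. \<Sum>a | mi_size a \<le> m - i. layer_weight i a * (\<gamma> * P (Suc i) a + d * (\<Sum>j\<in>UNIV. P i (inc j a)))) =
    d * (\<Sum>j\<in>UNIV. \<Sum>a | mi_size a \<le> m. P 0 (inc j a)) +
    (\<Sum>i=1..m+1. \<Sum>a | mi_size a \<le> m + 1 - i. (\<gamma> * layer_weight (i - 1) a + d * lower_weight a) * P i a)"
proof -
  have 1: "(\<Sum>i\<le>m. \<Sum>a | mi_size a \<le> m - i. layer_weight i a * (\<gamma> * P (Suc i) a)) =
      (\<Sum>i=1..m+1. \<Sum>a | mi_size a \<le> m + 1 - i. \<gamma> * layer_weight (i - 1) a * P i a)"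
    unfolding atMost_atLeast0 using sum.shift_bounds_cl_Suc_ivl[of "\<lambda>i. \<Sum>a | mi_size a \<le> m + 1 - i. \<gamma> * layer_weight (i - 1) a * P i a" 0 m]
    by (simp add: mult_ac del: sum.cl_ivl_Suc)
  have 2: "(\<Sum>a | mi_size a \<le> m - i. support_weight a * (\<Sum>j\<in>UNIV. P i (inc j a))) =
      (\<Sum>a | mi_size a \<le> m + 1 - i. lower_weight a * P i a)" if "i \<in> {1..m}" for i
    using sum_inc_reindex[of "P i" "m - i"] that by (simp add: Suc_diff_le)
  have "(\<Sum>i\<le>m. \<Sum>a | mi_size a \<le> m - i. layer_weight i a * (\<Sum>j\<in>UNIV. P i (inc j a))) =
      (\<Sum>a | mi_size a \<le> m. \<Sum>j\<in>UNIV. P 0 (inc j a)) +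
      (\<Sum>i=1..m. \<Sum>a | mi_size a \<le> m - i. support_weight a * (\<Sum>j\<in>UNIV. P i (inc j a)))"
    unfolding atMost_atLeast0 by (subst sum.atLeast_Suc_atMost) (simp_all add: layer_weight_def)
  also have "\<dots> = (\<Sum>j\<in>UNIV. \<Sum>a | mi_size a \<le> m. P 0 (inc j a)) +
      (\<Sum>i=1..m. \<Sum>a | mi_size a \<le> m + 1 - i. lower_weight a * P i a)"
    using 2 by (subst sum.swap) simp
  \<comment> \<open>At \<open>i = m + 1\<close> only the zero index is left, and its lower weight
    vanishes.\<close>
  also have "(\<Sum>i=1..m. \<Sum>a | mi_size a \<le> m + 1 - i. lower_weight a * P i a) =
      (\<Sum>i=1..m+1. \<Sum>a | mi_size a \<le> m + 1 - i. lower_weight a * P i a)"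
    by (simp add: lower_weight_zero)
  finally have 3: "(\<Sum>i\<le>m. \<Sum>a | mi_size a \<le> m - i. layer_weight i a * (\<Sum>j\<in>UNIV. P i (inc j a))) =
      (\<Sum>j\<in>UNIV. \<Sum>a | mi_size a \<le> m. P 0 (inc j a)) +
      (\<Sum>i=1..m+1. \<Sum>a | mi_size a \<le> m + 1 - i. lower_weight a * P i a)" .
  have linear: "(\<Sum>i\<le>m. \<Sum>a | mi_size a \<le> m - i. layer_weight i a * (p i a + d * Q i a)) =
      (\<Sum>i\<le>m. \<Sum>a | mi_size a \<le> m - i. layer_weight i a * p i a) +
      d * (\<Sum>i\<le>m. \<Sum>a | mi_size a \<le> m - i. layer_weight i a * Q i a)"
    for p Q :: "nat \<Rightarrow> 'n multi_index \<Rightarrow> real"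
    by (simp only: sum_distrib_left[of d] sum.distrib distrib_left mult.left_commute[of _ d])
  show ?thesis unfolding linear 1 3
    by (simp only: sum_distrib_left[of d _ "{1..m+1}"] sum_distrib_left[of d _ "{a. mi_size a \<le> x}" for x]
        sum.distrib distrib_left distrib_right mult.assoc add.assoc)
qed

text \<open>The two weights of \<open>P i a\<close> are at most 1 each and at least 1 together, so
  its coefficient lies between \<open>min \<gamma> d\<close> and \<open>\<gamma> + d\<close>, free
  of the dimension.\<close>

lemma weighted_layers_bounds:
  fixes P :: "nat \<Rightarrow> 'n::finite multi_index \<Rightarrow> real" and m :: nat
  assumes P: "\<And>i a. 0 \<le> P i a" and \<gamma>: "0 \<le> \<gamma>" and d: "0 \<le> d"
  defines "S \<equiv> (\<Sum>j\<in>UNIV. \<Sum>a | mi_size a \<le> m. P 0 (inc j a)) +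
    (\<Sum>i=1..m+1. \<Sum>a | mi_size a \<le> m + 1 - i. P i a)"
    and "W \<equiv> (\<Sum>i\<le>m. \<Sum>a | mi_size a \<le> m - i. layer_weight i a * (\<gamma> * P (Suc i) a + d * (\<Sum>j\<in>UNIV. P i (inc j a))))"
  shows "min \<gamma> d * S \<le> W" and "W \<le> (\<gamma> + d) * S"
proof -
  have low: "min \<gamma> d \<le> \<gamma> * layer_weight i a + d * lower_weight a" for i and a :: "'n multi_index"
  proof -
    have "1 \<le> layer_weight i a + lower_weight a"
      using support_weight_add_lower_weight[of a] lower_weight_nonneg[of a] by (simp add: layer_weight_def)
    then have "min \<gamma> d * 1 \<le> min \<gamma> d * (layer_weight i a + lower_weight a)"
      using \<gamma> d by (intro mult_left_mono) auto
    also have "\<dots> \<le> \<gamma> * layer_weight i a + d * lower_weight a"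
      unfolding distrib_left by (intro add_mono mult_right_mono layer_weight_bounds lower_weight_nonneg) auto
    finally show ?thesis by simp
  qed
  have up: "\<gamma> * layer_weight i a + d * lower_weight a \<le> \<gamma> + d" for i and a :: "'n multi_index"
    using mult_left_mono[OF layer_weight_bounds(2) \<gamma>, of i a] mult_left_mono[OF lower_weight_le d, of a] by simp
  have G: "0 \<le> (\<Sum>j\<in>UNIV. \<Sum>a | mi_size a \<le> m. P 0 (inc j a))" by (intro sum_nonneg P)
  show "min \<gamma> d * S \<le> W"
    unfolding W_def weighted_layers S_def distrib_left[of "min \<gamma> d"] sum_distrib_left[of "min \<gamma> d" _ "{1..m+1}"]
      sum_distrib_left[of "min \<gamma> d" _ "{a. mi_size a \<le> x}" for x]
    by (intro add_mono mult_right_mono[OF _ G] sum_mono mult_right_mono[OF low P]) simp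
  show "W \<le> (\<gamma> + d) * S"
    unfolding W_def weighted_layers S_def distrib_left[of "\<gamma> + d"] sum_distrib_left[of "\<gamma> + d" _ "{1..m+1}"]
      sum_distrib_left[of "\<gamma> + d" _ "{a. mi_size a \<le> x}" for x]
    by (intro add_mono mult_right_mono[OF _ G] sum_mono mult_right_mono[OF up P]) (simp add: \<gamma>)
qed

context kuznetsov
begin

lemma energy_powr_continuous: "continuous_on {0..T} (\<lambda>s. energy m {0..T} u s powr (3/2))"
  using E_nonneg E_continuous by (intro continuous_on_powr') (auto intro!: continuous_intros)

text \<open>The lower bound is used at \<open>t\<close> with kinetic weight 1/2, the upper bound at
  0 with 3/2. Every level contributes the same integral term, and the number of levels is at most
  \<open>m + 1\<close> times the number of multi-indices of size at most \<open>m\<close>.\<close>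

lemma energy_estimate_half_open:
  assumes t: "t \<in> {0..<T}"
  shows "min (1/2) (c\<^sup>2) * energy m {0..T} u t \<le> (3/2 + c\<^sup>2) * energy m {0..T} u 0 +
    real ((m + 1) * card {a :: 'n multi_index. mi_size a \<le> m}) *
      (2 * (rate_const * integral {0..t} (\<lambda>s. energy m {0..T} u s powr (3/2))))"
proof -
  let ?E = "energy m {0..T} u"
  let ?I = "rate_const * integral {0..t} (\<lambda>s. ?E s powr (3/2))"
  let ?P = "\<lambda>t i a. (L2_norm (V (mk_index i a) t))\<^sup>2"
  let ?sum = "\<lambda>f. \<Sum>i\<le>m. \<Sum>a | mi_size a \<le> m - i. layer_weight i a * f i (a :: 'n multi_index)"
  have tT: "t \<in> {0..T}" "0 \<in> {0..T}" using t T by auto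
  have rc: "0 \<le> rate_const" using K pos by (simp add: rate_const_def max_def)
  have I: "0 \<le> ?I"
    using t by (intro mult_nonneg_nonneg[OF rc] integral_nonneg integrable_continuous_interval
      continuous_on_subset[OF energy_powr_continuous]) auto
  have step: "?P t (Suc i) a / 2 + c\<^sup>2 * (\<Sum>j\<in>UNIV. ?P t i (inc j a)) \<le>
      (3/2 * ?P 0 (Suc i) a + c\<^sup>2 * (\<Sum>j\<in>UNIV. ?P 0 i (inc j a))) + 2 * ?I" if "i \<le> m" "mi_size a \<le> m - i" for i a
  proof -
    have A: "mi_size (mk_index i a) \<le> m" using that by simp
    show ?thesis
      using level_energy_estimate[OF A t] level_energy_bounds(1)[OF A tT(1)] level_energy_bounds(2)[OF A tT(2)]
      unfolding inc_mk_index by linarith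
  qed
  have "min (1/2) (c\<^sup>2) * ?E t \<le> ?sum (\<lambda>i a. 1/2 * ?P t (Suc i) a + c\<^sup>2 * (\<Sum>j\<in>UNIV. ?P t i (inc j a)))"
    unfolding energy_eq[OF tT(1)] by (rule weighted_layers_bounds(1)) auto
  also have "\<dots> \<le> ?sum (\<lambda>i a. (3/2 * ?P 0 (Suc i) a + c\<^sup>2 * (\<Sum>j\<in>UNIV. ?P 0 i (inc j a))) + 2 * ?I)"
    using step by (intro sum_mono mult_left_mono layer_weight_bounds) auto
  also have "\<dots> = ?sum (\<lambda>i a. 3/2 * ?P 0 (Suc i) a + c\<^sup>2 * (\<Sum>j\<in>UNIV. ?P 0 i (inc j a))) + ?sum (\<lambda>i a. 2 * ?I)"
    by (simp only: distrib_left sum.distrib)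
  also have "\<dots> \<le> (3/2 + c\<^sup>2) * ?E 0 + real ((m + 1) * card {a :: 'n multi_index. mi_size a \<le> m}) * (2 * ?I)"
  proof (rule add_mono)
    show "?sum (\<lambda>i a. 3/2 * ?P 0 (Suc i) a + c\<^sup>2 * (\<Sum>j\<in>UNIV. ?P 0 i (inc j a))) \<le> (3/2 + c\<^sup>2) * ?E 0"
      unfolding energy_eq[OF tT(2)] by (rule weighted_layers_bounds(2)) auto
    have "(\<Sum>a | mi_size a \<le> m - i. layer_weight i (a :: 'n multi_index) * (2 * ?I)) \<le>
        (\<Sum>a\<in>{a :: 'n multi_index. mi_size a \<le> m}. 2 * ?I)" for i
    proof -
      have "(\<Sum>a | mi_size a \<le> m - i. layer_weight i (a :: 'n multi_index) * (2 * ?I)) \<le> (\<Sum>a\<in>{a :: 'n multi_index. mi_size a \<le> m - i}. 2 * ?I)"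
        using I by (intro sum_mono mult_left_le_one_le layer_weight_bounds) auto
      also have "\<dots> \<le> (\<Sum>a\<in>{a :: 'n multi_index. mi_size a \<le> m}. 2 * ?I)"
        using I finite_mi_size_le[of m] by (intro sum_mono2) auto
      finally show ?thesis .
    qed
    then have "?sum (\<lambda>i a. 2 * ?I) \<le> (\<Sum>i\<le>m. \<Sum>a\<in>{a :: 'n multi_index. mi_size a \<le> m}. 2 * ?I)" by (rule sum_mono)
    also have "\<dots> = real ((m + 1) * card {a :: 'n multi_index. mi_size a \<le> m}) * (2 * ?I)"
      by (simp only: sum_constant card_atMost of_nat_mult Suc_eq_plus1 mult.assoc)
    finally show "?sum (\<lambda>i a. 2 * ?I) \<le> real ((m + 1) * card {a :: 'n multi_index. mi_size a \<le> m}) * (2 * ?I)" .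
  qed
  finally show ?thesis .
qed

text \<open>Both sides are continuous in \<open>t\<close>, so the inequality extends from
  \<open>t < T\<close> to the right endpoint.\<close>

lemma energy_estimate:
  assumes t: "t \<in> {0..T}"
  shows "min (1/2) (c\<^sup>2) * energy m {0..T} u t \<le> (3/2 + c\<^sup>2) * energy m {0..T} u 0 +
    real ((m + 1) * card {a :: 'n multi_index. mi_size a \<le> m}) *
      (2 * (rate_const * integral {0..t} (\<lambda>s. energy m {0..T} u s powr (3/2))))"
proof -
  let ?E = "energy m {0..T} u"
  let ?f = "\<lambda>t. (3/2 + c\<^sup>2) * ?E 0 + real ((m + 1) * card {a :: 'n multi_index. mi_size a \<le> m}) *
      (2 * (rate_const * integral {0..t} (\<lambda>s. ?E s powr (3/2)))) - min (1/2) (c\<^sup>2) * ?E t"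
  have cl: "closure {0..<T} = {0..T}" using T by simp
  have "continuous_on {0..T} (\<lambda>t. integral {0..t} (\<lambda>s. ?E s powr (3/2)))"
    by (intro indefinite_integral_continuous_1 integrable_continuous_interval energy_powr_continuous)
  then have "continuous_on (closure {0..<T}) ?f"
    unfolding cl by (intro continuous_intros E_continuous)
  from continuous_ge_on_closure[OF this, of t 0] show ?thesis
    using energy_estimate_half_open t cl by simp
qed

end

theorem proposition1:
  fixes m :: nat
  assumes "m \<ge> nat \<lfloor>real CARD('n::finite) / 2 + 2\<rfloor>"
  shows "\<exists>C :: real \<Rightarrow> real.
    (\<forall>c>0. C c > 0) \<and>
    (\<forall>c>0. \<forall>c'>0. min (1/2) (c\<^sup>2) \<noteq> c\<^sup>2 \<longrightarrow> min (1/2) (c'\<^sup>2) \<noteq> c'\<^sup>2 \<longrightarrow> C c = C c') \<and>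
    (\<forall>c \<alpha> \<beta> \<epsilon> M1 M2 T. \<forall>(u0 :: real ^ 'n \<Rightarrow> real) u1 (u :: real \<Rightarrow> real ^ 'n \<Rightarrow> real).
      c > 0 \<longrightarrow> \<alpha> > 0 \<longrightarrow> \<beta> > 0 \<longrightarrow> \<epsilon> > 0 \<longrightarrow> M1 > 0 \<longrightarrow> M2 > 0 \<longrightarrow> T > 0 \<longrightarrow>
      kuznetsov_solution c \<alpha> \<beta> \<epsilon> {0..T} u0 u1 u \<longrightarrow>
      (\<forall>r\<le>m. u \<in> C_sobolev r (m + 1 - r) {0..T}) \<longrightarrow>
      (\<forall>t\<in>{0..T}. Linf_norm (time_deriv {0..T} u t) < ereal (1 / (2 * \<alpha> * \<epsilon>)) \<and>
                  Linf_norm (u t) < ereal M1 \<and>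
                  Linf_norm (grad (u t)) < ereal M2) \<longrightarrow>
      (let B = (3 + 2 * c\<^sup>2) / min (1/2) (c\<^sup>2) in
        B > 0 \<and>
        (\<forall>t\<in>{0..T}. energy m {0..T} u t \<le>
           B * energy m {0..T} u 0 +
           C c * max \<alpha> \<beta> * \<epsilon> *
             integral {0..t} (\<lambda>\<tau>. energy m {0..T} u \<tau> powr (3/2)))))"
proof -
  have "\<lfloor>real CARD('n) / 2 + 2\<rfloor> \<le> int m" using assms by linarith
  \<comment> \<open>The floor condition gives \<open>n / 2 + 2 < m + 1\<close>, that is
    \<open>n + 2 < 2 * m\<close>.\<close>
  then have m_large: "CARD('n) + 3 \<le> 2 * m" by linarith
  obtain K where K: "0 \<le> K" and product: "\<forall>s1\<le>m+1. \<forall>s2\<le>m+1. CARD('n) + 1 \<le> 2 * (s1 + s2) \<longrightarrow>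
      (\<forall>(f :: real ^ 'n \<Rightarrow> real) g M N. sobolev_bound s1 M f \<longrightarrow> sobolev_bound s2 N g \<longrightarrow>
        (\<lambda>x. f x * g x) \<in> L2 \<and> L2_norm (\<lambda>x. f x * g x) \<le> K * M * N)"
    using sobolev_product_estimate[where 'n = 'n, of "m + 1"] by (elim exE conjE)
  define N where "N = real ((m + 1) * card {a :: 'n multi_index. mi_size a \<le> m})"
  \<comment> \<open>\<open>N\<close> counts the levels, 2 comes from doubling the level energies,
    and the rest is \<open>rate_const\<close> without \<open>max a b\<close>. \<open>K + 1\<close>
    in place of \<open>K\<close> makes the constant strictly positive.\<close>
  define D where "D = N * (2 * ((real CARD('n) + 1) * (2 + 2 ^ m) * (K + 1)))"
  have "(\<lambda>_. 0) \<in> {a :: 'n multi_index. mi_size a \<le> m}" by (simp add: mi_size_def)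
  then have "0 < card {a :: 'n multi_index. mi_size a \<le> m}"
    using finite_mi_size_le[of m] card_gt_0_iff by blast
  then have N: "0 < N" unfolding N_def of_nat_0_less_iff by (intro mult_pos_pos) auto
  then have D: "0 < D" unfolding D_def using K by (intro mult_pos_pos add_nonneg_pos) auto
  show ?thesis
  \<comment> \<open>\<open>c\<close> enters only through the minimum, so the constant is the same
    for all \<open>c\<close> with minimum 1/2.\<close>
  proof (intro exI[of _ "\<lambda>c. D / min (1/2) (c\<^sup>2)"] conjI allI impI)
    fix c :: real assume "0 < c"
    then show "0 < D / min (1/2) (c\<^sup>2)" using D by simp
  next
    fix c c' :: real assume "min (1/2) (c\<^sup>2) \<noteq> c\<^sup>2" "min (1/2) (c'\<^sup>2) \<noteq> c'\<^sup>2"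
    then show "D / min (1/2) (c\<^sup>2) = D / min (1/2) (c'\<^sup>2)" by (auto simp: min_def split: if_splits)
  next
    fix c \<alpha> \<beta> \<epsilon> M1 M2 T :: real and u0 u1 :: "real ^ 'n \<Rightarrow> real" and u
    assume positive: "0 < c" "0 < \<alpha>" "0 < \<beta>" "0 < \<epsilon>" "0 < T"
      and solution: "kuznetsov_solution c \<alpha> \<beta> \<epsilon> {0..T} u0 u1 u"
      and regular: "\<forall>r\<le>m. u \<in> C_sobolev r (m + 1 - r) {0..T}"
      and Linf: "\<forall>t\<in>{0..T}. Linf_norm (time_deriv {0..T} u t) < ereal (1 / (2 * \<alpha> * \<epsilon>)) \<and>
        Linf_norm (u t) < ereal M1 \<and> Linf_norm (grad (u t)) < ereal M2"
    interpret kuznetsov m T u c \<alpha> \<beta> \<epsilon> "K + 1" u0 u1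
    proof unfold_locales
      show "1 \<le> m" using m_large by simp
      show "(\<lambda>x. f x * g x) \<in> L2 \<and> L2_norm (\<lambda>x. f x * g x) \<le> (K + 1) * M * N"
        if "s1 \<le> m + 1" "s2 \<le> m + 1" "CARD('n) + 1 \<le> 2 * (s1 + s2)" "sobolev_bound s1 M f" "sobolev_bound s2 N g"
        for s1 s2 and f g :: "real ^ 'n \<Rightarrow> real" and M N
      proof -
        have "0 \<le> M" "0 \<le> N"
          using sobolev_bound_L2[OF that(4)] sobolev_bound_L2[OF that(5)] L2_norm_nonneg order_trans by blast+
        then have "K * M * N \<le> (K + 1) * M * N" using K by (intro mult_right_mono) auto
        then show ?thesis using product[rule_format, OF that] by (auto intro: order_trans)
      qed
    qed (use positive m_large K solution regular Linf in auto)
    let ?E = "energy m {0..T} u" and ?q = "min (1/2) (c\<^sup>2)"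
    have q: "0 < ?q" using positive by simp
    have rate: "N * (2 * (rate_const * y)) = D * max \<alpha> \<beta> * \<epsilon> * y" for y
    proof -
      have "max (\<alpha> * \<epsilon>) (\<beta> * \<epsilon>) = max \<alpha> \<beta> * \<epsilon>" using positive by (simp add: max_mult_distrib_right)
      then show ?thesis by (simp only: D_def rate_const_def mult_ac)
    qed
    have "?E t \<le> (3 + 2 * c\<^sup>2) / ?q * ?E 0 + D / ?q * max \<alpha> \<beta> * \<epsilon> * integral {0..t} (\<lambda>\<tau>. ?E \<tau> powr (3/2))"
      if t: "t \<in> {0..T}" for t
    proof -
      have "0 \<le> ?E 0" using E_nonneg[of 0] positive by simp
      \<comment> \<open>The argument yields half of the stated numerator of \<open>B\<close>;
        nonnegativity of the initial energy allows the larger one.\<close>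
      then have "(3/2 + c\<^sup>2) * ?E 0 \<le> (3 + 2 * c\<^sup>2) * ?E 0" by (intro mult_right_mono) auto
      then have "?q * ?E t \<le> (3 + 2 * c\<^sup>2) * ?E 0 + D * max \<alpha> \<beta> * \<epsilon> * integral {0..t} (\<lambda>\<tau>. ?E \<tau> powr (3/2))"
        using energy_estimate[OF t] unfolding N_def[symmetric] rate by linarith
      then have "?E t \<le> ((3 + 2 * c\<^sup>2) * ?E 0 + D * max \<alpha> \<beta> * \<epsilon> * integral {0..t} (\<lambda>\<tau>. ?E \<tau> powr (3/2))) / ?q"
        using q by (simp only: pos_le_divide_eq mult.commute)
      then show ?thesis by (simp only: add_divide_distrib[of "x * ?E 0" for x] times_divide_eq_left)
    qed
    moreover have "0 < (3 + 2 * c\<^sup>2) / ?q" using q by (intro divide_pos_pos add_pos_nonneg) auto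
    ultimately show "let B = (3 + 2 * c\<^sup>2) / ?q in B > 0 \<and> (\<forall>t\<in>{0..T}. ?E t \<le> B * ?E 0 +
        D / ?q * max \<alpha> \<beta> * \<epsilon> * integral {0..t} (\<lambda>\<tau>. ?E \<tau> powr (3/2)))"
      unfolding Let_def by blast
  qed
qed

end
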